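(* Let $M, M' \subset \mathbb{C}^N$ be smooth generic submanifolds of the same dimension through $p$ and $p'$ respectively, and let $H: (\mathbb{C}^N, p) \to (\mathbb{C}^N,p')$ be a germ of a holomorphic mapping such that $H(M) \subset M'$ (as germs at $p$ and $p'$) and $\operatorname{Jac} H \not\equiv 0$. If $M$ is of finite type and essentially finite at $p$, then $H$ is a finite map $(\mathbb{C}^N, p) \to (\mathbb{C}^N,p')$. If, in addition, $M$ is finitely nondegenerate at $p$, then $H$ is a local biholomorphism near $p$.
   Context: A smooth real submanifold $M\subset\mathbb{C}^N$ of real codimension $d$ is generic if near every point of $M$ it is defined by an equation $\rho(Z,\bar Z)=0$, where $\rho=(\rho_1,\dots,\rho_d)$ is a smooth $\mathbb{R}^d$-valued function with $\partial\rho_1\wedge\cdots\wedge\partial\rho_d\neq 0$. Its CR bundle is $T^{0,1}M=\mathbb{C}TM\cap T^{0,1}\mathbb{C}^N$, of rank $n=N-d$; its sections are called CR (or $(0,1)$) vector fields. $M$ is of finite type at $p\in M$ (in the sense of Kohn and Bloom--Graham) if the complex Lie algebra $\mathfrak{g}_M$ generated by all smooth CR vector fields on $M$ (near $p$) and their conjugates satisfies $\mathfrak{g}_M(p)=\mathbb{C}T_pM$. Essential finiteness: let $\rho(Z,\xi)$ denote the formal Taylor series of $\rho(Z,\bar Z)$ at $p$, with $\bar Z$ replaced by an independent variable $\xi$ (and $p$ translated to $0$). There is an invertible formal holomorphic change of coordinates $Z=\varphi(z,w)$, $z\in\mathbb{C}^n$, $w\in\mathbb{C}^d$, $\varphi(0)=0$,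 such that the ideal generated by the components of $\rho(\varphi(z,w),\bar\varphi(\chi,\tau))$ in $\mathbb{C}[[z,w,\chi,\tau]]$ equals the one generated by the components of $w-Q(z,\chi,\tau)$, where $Q$ is a $\mathbb{C}^d$-valued formal power series with $Q(z,0,\tau)\equiv Q(0,\chi,\tau)\equiv\tau$ (normal coordinates; $\bar\varphi$ is obtained from $\varphi$ by conjugating coefficients). Write $Q(z,\chi,0)=\sum_\alpha q_\alpha(\chi)z^\alpha$. $M$ is essentially finite at $p$ if the ideal in $\mathbb{C}[[\chi]]$ generated by all components of all the $q_\alpha$ has finite codimension in $\mathbb{C}[[\chi]]$ as a complex vector space. (This is independent of the choice of normal coordinates.) Finite nondegeneracy: let $L_1,\dots,L_n$ be a local basis of smooth CR vector fields on $M$ near $p$ and $\rho_{j,Z}=(\partial\rho_j/\partial Z_1,\dots,\partial\rho_j/\partial Z_N)$. $M$ is finitely nondegenerate at $p$ if the vectors $L^\alpha\rho_{j,Z}(p,\bar p)$, $1\le j\le d$, $\alpha\in\mathbb{Z}_{\ge 0}^n$, with $L^\alpha=L_1^{\alpha_1}\cdots L_n^{\alpha_n}$, span $\mathbb{C}^N$. $\operatorname{Jac}H$ denotes the (holomorphic) Jacobian determinant of $H$, and $\not\equiv0$ means not identically zero near $p$. $H$ is a finite map $(\mathbb{C}^N,p)\to(\mathbb{C}^N,p')$ if $H^{-1}(p')=\{p\}$ as germs of varieties at $p$. *)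

theory Defs
  imports
    "HOL-Analysis.Analysis"
    "HOL-Library.Multiset"
    "HOL-Combinatorics.Permutations"
begin

section \<open>Formal power series in several variables\<close>

text \<open>
  Monomials in variables indexed by a type \<open>'v\<close> are multisets over \<open>'v\<close>: the multiset \<open>\<alpha>\<close>
  stands for the product of the variables \<open>v\<close> to the power \<open>count \<alpha> v\<close>. A formal power
  series is an arbitrary family of complex coefficients indexed by monomials.
\<close>

typedef 'v mfps = "UNIV :: ('v multiset \<Rightarrow> complex) set"
  morphisms mcoeff Mfps ..

lemma mcoeff_Mfps [simp]: "mcoeff (Mfps f) = f"
  by (simp add: Mfps_inverse)

lemma mfps_eqI: "(\<And>\<alpha>. mcoeff f \<alpha> = mcoeff g \<alpha>) \<Longrightarrow> f = g"
  by (metis ext mcoeff_inject)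

lemma finite_submultisets [simp]: "finite {\<beta>. \<beta> \<subseteq># \<alpha>}"
proof (induction \<alpha>)
  case empty
  then show ?case by simp
next
  case (add x \<alpha>)
  have "{\<beta>. \<beta> \<subseteq># add_mset x \<alpha>} \<subseteq> {\<beta>. \<beta> \<subseteq># \<alpha>} \<union> add_mset x ` {\<beta>. \<beta> \<subseteq># \<alpha>}"
  proof
    fix \<beta> assume "\<beta> \<in> {\<beta>. \<beta> \<subseteq># add_mset x \<alpha>}"
    then have b: "\<beta> \<subseteq># add_mset x \<alpha>" by simp
    show "\<beta> \<in> {\<beta>. \<beta> \<subseteq># \<alpha>} \<union> add_mset x ` {\<beta>. \<beta> \<subseteq># \<alpha>}"
    proof (cases "x \<in># \<beta>")
      case True
      then obtain \<gamma> where "\<beta> = add_mset x \<gamma>" by (metis mset_add)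
      with b show ?thesis by auto
    next
      case False
      with b have "\<beta> \<subseteq># \<alpha>"
        by (metis diff_single_trivial subset_eq_diff_conv add_mset_add_single)
      then show ?thesis by simp
    qed
  qed
  then show ?case using add.IH finite_subset by blast
qed

lemma double_diff_mset: "\<beta> \<subseteq># \<alpha> \<Longrightarrow> \<alpha> - (\<alpha> - \<beta>) = (\<beta> :: 'v multiset)"
  by (intro multiset_eqI) (simp add: subseteq_mset_def)

instantiation mfps :: (type) comm_ring_1
begin

definition "0 = Mfps (\<lambda>_. 0)"
definition "1 = Mfps (\<lambda>\<alpha>. if \<alpha> = {#} then 1 else 0)"
definition "f + g = Mfps (\<lambda>\<alpha>. mcoeff f \<alpha> + mcoeff g \<alpha>)"
definition "- f = Mfps (\<lambda>\<alpha>. - mcoeff f \<alpha>)" for f :: "'a mfps"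
definition "f - g = Mfps (\<lambda>\<alpha>. mcoeff f \<alpha> - mcoeff g \<alpha>)"
definition "f * g = Mfps (\<lambda>\<alpha>. \<Sum>\<beta> | \<beta> \<subseteq># \<alpha>. mcoeff f \<beta> * mcoeff g (\<alpha> - \<beta>))"

instance
proof
  fix a b c :: "'a mfps"
  show "a * b * c = a * (b * c)"
  proof (rule mfps_eqI)
    fix \<alpha>
    have "mcoeff (a * b * c) \<alpha> = (\<Sum>(\<beta>, \<gamma>) \<in> (SIGMA \<beta>:{\<beta>. \<beta> \<subseteq># \<alpha>}. {\<gamma>. \<gamma> \<subseteq># \<beta>}).
        mcoeff a \<gamma> * mcoeff b (\<beta> - \<gamma>) * mcoeff c (\<alpha> - \<beta>))"
      by (simp add: times_mfps_def sum_distrib_right sum.Sigma)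
    also have "\<dots> = (\<Sum>(\<gamma>, \<delta>) \<in> (SIGMA \<gamma>:{\<gamma>. \<gamma> \<subseteq># \<alpha>}. {\<delta>. \<delta> \<subseteq># \<alpha> - \<gamma>}).
        mcoeff a \<gamma> * (mcoeff b \<delta> * mcoeff c (\<alpha> - \<gamma> - \<delta>)))"
    proof (rule sum.reindex_bij_witness
        [where i = "\<lambda>(\<gamma>, \<delta>). (\<gamma> + \<delta>, \<gamma>)" and j = "\<lambda>(\<beta>, \<gamma>). (\<gamma>, \<beta> - \<gamma>)"])
      fix p assume p: "p \<in> (SIGMA \<beta>:{\<beta>. \<beta> \<subseteq># \<alpha>}. {\<gamma>. \<gamma> \<subseteq># \<beta>})"
      obtain \<beta> \<gamma> where eq: "p = (\<beta>, \<gamma>)" by force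
      from p eq have sub: "\<beta> \<subseteq># \<alpha>" "\<gamma> \<subseteq># \<beta>" by auto
      then show "(\<lambda>(\<gamma>, \<delta>). (\<gamma> + \<delta>, \<gamma>)) ((\<lambda>(\<beta>, \<gamma>). (\<gamma>, \<beta> - \<gamma>)) p) = p"
        by (simp add: eq)
      show "(\<lambda>(\<beta>, \<gamma>). (\<gamma>, \<beta> - \<gamma>)) p \<in> (SIGMA \<gamma>:{\<gamma>. \<gamma> \<subseteq># \<alpha>}. {\<delta>. \<delta> \<subseteq># \<alpha> - \<gamma>})"
        using sub
        by (simp add: eq subseteq_mset_def) (meson diff_le_mono order.trans)
      have "\<alpha> - \<gamma> - (\<beta> - \<gamma>) = \<alpha> - \<beta>"
        using sub by (intro multiset_eqI) (simp add: subseteq_mset_def)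
      then show "(case (\<lambda>(\<beta>, \<gamma>). (\<gamma>, \<beta> - \<gamma>)) p of (\<gamma>, \<delta>) \<Rightarrow>
           mcoeff a \<gamma> * (mcoeff b \<delta> * mcoeff c (\<alpha> - \<gamma> - \<delta>))) =
          (case p of (\<beta>, \<gamma>) \<Rightarrow> mcoeff a \<gamma> * mcoeff b (\<beta> - \<gamma>) * mcoeff c (\<alpha> - \<beta>))"
        by (simp add: eq)
    next
      fix p assume p: "p \<in> (SIGMA \<gamma>:{\<gamma>. \<gamma> \<subseteq># \<alpha>}. {\<delta>. \<delta> \<subseteq># \<alpha> - \<gamma>})"
      obtain \<gamma> \<delta> where eq: "p = (\<gamma>, \<delta>)" by force
      from p eq have sub: "\<gamma> \<subseteq># \<alpha>" "\<delta> \<subseteq># \<alpha> - \<gamma>" by auto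
      then show "(\<lambda>(\<beta>, \<gamma>). (\<gamma>, \<beta> - \<gamma>)) ((\<lambda>(\<gamma>, \<delta>). (\<gamma> + \<delta>, \<gamma>)) p) = p"
        by (simp add: eq)
      have "count \<gamma> x + count \<delta> x \<le> count \<alpha> x" for x
        using sub[unfolded subseteq_mset_def, rule_format, of x] by simp
      then have "\<gamma> + \<delta> \<subseteq># \<alpha>"
        by (simp add: subseteq_mset_def)
      then show "(\<lambda>(\<gamma>, \<delta>). (\<gamma> + \<delta>, \<gamma>)) p \<in> (SIGMA \<beta>:{\<beta>. \<beta> \<subseteq># \<alpha>}. {\<gamma>. \<gamma> \<subseteq># \<beta>})"
        by (simp add: eq)
    qed
    also have "\<dots> = mcoeff (a * (b * c)) \<alpha>"
      by (simp add: times_mfps_def sum_distrib_left sum.Sigma)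
    finally show "mcoeff (a * b * c) \<alpha> = mcoeff (a * (b * c)) \<alpha>" .
  qed
  show "a * b = b * a"
  proof (rule mfps_eqI)
    fix \<alpha>
    show "mcoeff (a * b) \<alpha> = mcoeff (b * a) \<alpha>"
      unfolding times_mfps_def mcoeff_Mfps
      by (rule sum.reindex_bij_witness[where i = "\<lambda>\<beta>. \<alpha> - \<beta>" and j = "\<lambda>\<beta>. \<alpha> - \<beta>"])
        (auto simp: double_diff_mset mult.commute)
  qed
  show "1 * a = a"
  proof (rule mfps_eqI)
    fix \<alpha>
    have "mcoeff (1 * a) \<alpha> = (\<Sum>\<beta> | \<beta> \<subseteq># \<alpha>. if \<beta> = {#} then mcoeff a \<alpha> else 0)"
      unfolding times_mfps_def one_mfps_def mcoeff_Mfps by (rule sum.cong) auto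
    then show "mcoeff (1 * a) \<alpha> = mcoeff a \<alpha>" by simp
  qed
  show "(a + b) * c = a * c + b * c"
    by (rule mfps_eqI) (simp add: times_mfps_def plus_mfps_def distrib_right sum.distrib)
  show "(0 :: 'a mfps) \<noteq> 1"
  proof
    assume "(0 :: 'a mfps) = 1"
    then have "mcoeff (0 :: 'a mfps) {#} = mcoeff 1 {#}" by (rule arg_cong)
    then show False by (simp add: zero_mfps_def one_mfps_def)
  qed
qed (rule mfps_eqI; simp add: plus_mfps_def zero_mfps_def uminus_mfps_def minus_mfps_def add_ac)+

end

definition mvar :: "'v \<Rightarrow> 'v mfps" where
  "mvar v = Mfps (\<lambda>\<alpha>. if \<alpha> = {#v#} then 1 else 0)"

definition mconst :: "complex \<Rightarrow> 'v mfps" where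
  "mconst c = Mfps (\<lambda>\<alpha>. if \<alpha> = {#} then c else 0)"

definition mcnj :: "'v mfps \<Rightarrow> 'v mfps" where
  "mcnj f = Mfps (\<lambda>\<alpha>. cnj (mcoeff f \<alpha>))"

lemma finite_bounded_multisets: "finite {\<alpha> :: 'v::finite multiset. size \<alpha> \<le> n}"
proof -
  have "{\<alpha> :: 'v multiset. size \<alpha> \<le> n} \<subseteq> mset ` {xs. set xs \<subseteq> UNIV \<and> length xs \<le> n}"
  proof
    fix \<alpha> :: "'v multiset" assume "\<alpha> \<in> {\<alpha>. size \<alpha> \<le> n}"
    moreover obtain xs where "mset xs = \<alpha>" using ex_mset by blast
    ultimately show "\<alpha> \<in> mset ` {xs. set xs \<subseteq> UNIV \<and> length xs \<le> n}" by (auto simp: image_iff)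
  qed
  then show ?thesis by (rule finite_subset) (intro finite_imageI finite_lists_length_le finite)
qed

text \<open>
  Substitution of \<open>g v\<close> for each variable \<open>v\<close>, meaningful when all \<open>g v\<close> have zero constant
  term: then monomials of degree larger than \<open>size \<gamma>\<close> do not contribute to the coefficient at
  \<open>\<gamma>\<close>, and the sum below is finite.
\<close>
definition msubst :: "('v::finite \<Rightarrow> 'u mfps) \<Rightarrow> 'v mfps \<Rightarrow> 'u mfps" where
  "msubst g f = Mfps (\<lambda>\<gamma>. \<Sum>\<alpha> | size \<alpha> \<le> size \<gamma>. mcoeff f \<alpha> * mcoeff (\<Prod>v\<in>#\<alpha>. g v) \<gamma>)"

definition set_zero :: "'v::finite set \<Rightarrow> 'v mfps \<Rightarrow> 'v mfps" where
  "set_zero S = msubst (\<lambda>v. if v \<in> S then 0 else mvar v)"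

definition series_in :: "'v set \<Rightarrow> 'v mfps set" where
  "series_in V = {f. \<forall>\<alpha>. mcoeff f \<alpha> \<noteq> 0 \<longrightarrow> set_mset \<alpha> \<subseteq> V}"

definition ideal_gen :: "'a::comm_ring_1 set \<Rightarrow> 'a set \<Rightarrow> 'a set" where
  \<comment> \<open>the ideal of the subring \<open>A\<close> generated by the subset \<open>S\<close> of \<open>A\<close>\<close>
  "ideal_gen A S = {\<Sum>s\<in>F. a s * s | F a. finite F \<and> F \<subseteq> S \<and> a ` F \<subseteq> A}"

definition finite_codim :: "'v mfps set \<Rightarrow> 'v mfps set \<Rightarrow> bool" where
  \<comment> \<open>the complex vector space \<open>A / I\<close> is spanned by the classes of finitely many elements\<close>
  "finite_codim A I \<longleftrightarrow>
     (\<exists>B. finite B \<and> B \<subseteq> A \<and> (\<forall>f\<in>A. \<exists>c. f - (\<Sum>b\<in>B. mconst (c b) * b) \<in> I))"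


section \<open>Smooth functions and complex vector fields on complex Euclidean space\<close>

primrec times_differentiable_on ::
    "nat \<Rightarrow> 'a::real_normed_vector set \<Rightarrow> ('a \<Rightarrow> 'b::real_normed_vector) \<Rightarrow> bool" where
  "times_differentiable_on 0 U f \<longleftrightarrow> continuous_on U f"
| "times_differentiable_on (Suc k) U f \<longleftrightarrow>
     (\<forall>x\<in>U. f differentiable (at x)) \<and>
     (\<forall>v. times_differentiable_on k U (\<lambda>x. frechet_derivative f (at x) v))"

text \<open>Only used for open \<open>U\<close>; all derivatives are real derivatives.\<close>
definition smooth_on :: "'a::real_normed_vector set \<Rightarrow> ('a \<Rightarrow> 'b::real_normed_vector) \<Rightarrow> bool" where
  "smooth_on U f \<longleftrightarrow> (\<forall>k. times_differentiable_on k U f)"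

definition dZ :: "'N \<Rightarrow> (complex^'N::finite \<Rightarrow> complex) \<Rightarrow> complex^'N \<Rightarrow> complex" where
  "dZ k f Z = (frechet_derivative f (at Z) (axis k 1)
               - \<i> * frechet_derivative f (at Z) (axis k \<i>)) / 2"

definition dZbar :: "'N \<Rightarrow> (complex^'N::finite \<Rightarrow> complex) \<Rightarrow> complex^'N \<Rightarrow> complex" where
  "dZbar k f Z = (frechet_derivative f (at Z) (axis k 1)
                  + \<i> * frechet_derivative f (at Z) (axis k \<i>)) / 2"

text \<open>
  A complexified tangent vector of \<open>\<complex>\<^sup>N\<close> is a pair \<open>(a, b)\<close>, standing for the sum over \<open>k\<close> of
  \<open>a\<^sub>k \<partial>/\<partial>Z\<^sub>k + b\<^sub>k \<partial>/\<partial>Zbar\<^sub>k\<close>; the vectors of type (0,1) are those with \<open>a = 0\<close>.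
\<close>
type_synonym 'N cvec = "(complex^'N) \<times> (complex^'N)"

definition vact :: "'N::finite cvec \<Rightarrow> (complex^'N \<Rightarrow> complex) \<Rightarrow> complex^'N \<Rightarrow> complex" where
  "vact X f Z = (\<Sum>k\<in>UNIV. fst X $ k * dZ k f Z + snd X $ k * dZbar k f Z)"

definition vcnj :: "complex^'N \<Rightarrow> complex^'N" where
  "vcnj v = (\<chi> k. cnj (v $ k))"

definition lie_bracket ::
    "(complex^'N \<Rightarrow> 'N::finite cvec) \<Rightarrow> (complex^'N \<Rightarrow> 'N cvec) \<Rightarrow> complex^'N \<Rightarrow> 'N cvec" where
  "lie_bracket X Y Z =
     (\<chi> k. vact (X Z) (\<lambda>W. fst (Y W) $ k) Z - vact (Y Z) (\<lambda>W. fst (X W) $ k) Z,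
      \<chi> k. vact (X Z) (\<lambda>W. snd (Y W) $ k) Z - vact (Y Z) (\<lambda>W. snd (X W) $ k) Z)"

definition del :: "(complex^'N \<Rightarrow> complex) \<Rightarrow> complex^'N \<Rightarrow> 'N::finite cvec \<Rightarrow> complex" where
  \<comment> \<open>the (1,0)-form \<open>\<partial>f\<close> at \<open>Z\<close>\<close>
  "del f Z X = (\<Sum>k\<in>UNIV. dZ k f Z * fst X $ k)"

definition wedge :: "nat \<Rightarrow> (nat \<Rightarrow> 'a \<Rightarrow> complex) \<Rightarrow> (nat \<Rightarrow> 'a) \<Rightarrow> complex" where
  \<comment> \<open>the \<open>d\<close>-form \<open>\<theta>\<^sub>0 \<and> \<dots> \<and> \<theta>\<^bsub>d-1\<^esub>\<close> evaluated at \<open>X\<^sub>0, \<dots>, X\<^bsub>d-1\<^esub>\<close>\<close>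
  "wedge d \<theta> X = (\<Sum>\<sigma> | \<sigma> permutes {..<d}. of_int (sign \<sigma>) * (\<Prod>j<d. \<theta> j (X (\<sigma> j))))"


section \<open>Generic submanifolds\<close>

abbreviation cplx :: "('a \<Rightarrow> real) \<Rightarrow> 'a \<Rightarrow> complex" where
  "cplx f \<equiv> \<lambda>x. complex_of_real (f x)"

definition local_defining ::
    "nat \<Rightarrow> (complex^'N::finite) set \<Rightarrow> complex^'N \<Rightarrow> (complex^'N) set \<Rightarrow> (nat \<Rightarrow> complex^'N \<Rightarrow> real) \<Rightarrow> bool"
  where
  "local_defining d M p U \<rho> \<longleftrightarrow>
     open U \<and> p \<in> U \<and> (\<forall>j<d. smooth_on U (\<rho> j)) \<and>
     (\<forall>Z\<in>U. Z \<in> M \<longleftrightarrow> (\<forall>j<d. \<rho> j Z = 0)) \<and>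
     (\<forall>Z\<in>U. \<exists>X. wedge d (\<lambda>j. del (cplx (\<rho> j)) Z) X \<noteq> 0)"

definition generic_submanifold :: "nat \<Rightarrow> (complex^'N::finite) set \<Rightarrow> bool" where
  \<comment> \<open>of real codimension \<open>d\<close>\<close>
  "generic_submanifold d M \<longleftrightarrow> (\<forall>p\<in>M. \<exists>U \<rho>. local_defining d M p U \<rho>)"

definition CT :: "nat \<Rightarrow> (complex^'N::finite) set \<Rightarrow> complex^'N \<Rightarrow> 'N cvec set" where
  \<comment> \<open>complexified tangent space at \<open>Z\<close>; it does not depend on the defining function\<close>
  "CT d M Z = {X. \<exists>U \<rho>. local_defining d M Z U \<rho> \<and> (\<forall>j<d. vact X (cplx (\<rho> j)) Z = 0)}"

definition T01 :: "nat \<Rightarrow> (complex^'N::finite) set \<Rightarrow> complex^'N \<Rightarrow> (complex^'N) set" where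
  "T01 d M Z = {b. (0, b) \<in> CT d M Z}"

text \<open>
  Vector fields on \<open>M\<close> near \<open>p\<close> are given by smooth vector fields on a neighbourhood of \<open>p\<close> in
  the ambient space that are tangent to \<open>M\<close> along \<open>M\<close>. The values along \<open>M\<close> of brackets, and of
  iterated derivatives of functions, do not depend on the extension.
\<close>
definition CR_field :: "nat \<Rightarrow> (complex^'N::finite) set \<Rightarrow> complex^'N \<Rightarrow> (complex^'N \<Rightarrow> complex^'N) \<Rightarrow> bool" where
  "CR_field d M p L \<longleftrightarrow>
     (\<exists>U. open U \<and> p \<in> U \<and> smooth_on U L \<and> (\<forall>Z\<in>M \<inter> U. L Z \<in> T01 d M Z))"


section \<open>Finite type\<close>

inductive_set CR_lie_algebra ::
    "nat \<Rightarrow> (complex^'N::finite) set \<Rightarrow> complex^'N \<Rightarrow> (complex^'N \<Rightarrow> 'N cvec) set"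
  for d M p where
  CR: "CR_field d M p L \<Longrightarrow> (\<lambda>Z. (0, L Z)) \<in> CR_lie_algebra d M p"
| CR_conj: "CR_field d M p L \<Longrightarrow> (\<lambda>Z. (vcnj (L Z), 0)) \<in> CR_lie_algebra d M p"
| add: "X \<in> CR_lie_algebra d M p \<Longrightarrow> Y \<in> CR_lie_algebra d M p
    \<Longrightarrow> (\<lambda>Z. X Z + Y Z) \<in> CR_lie_algebra d M p"
| scale: "X \<in> CR_lie_algebra d M p \<Longrightarrow> (\<lambda>Z. (c *s fst (X Z), c *s snd (X Z))) \<in> CR_lie_algebra d M p"
| bracket: "X \<in> CR_lie_algebra d M p \<Longrightarrow> Y \<in> CR_lie_algebra d M p
    \<Longrightarrow> lie_bracket X Y \<in> CR_lie_algebra d M p"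

definition finite_type :: "nat \<Rightarrow> (complex^'N::finite) set \<Rightarrow> complex^'N \<Rightarrow> bool" where
  "finite_type d M p \<longleftrightarrow> {X p | X. X \<in> CR_lie_algebra d M p} = CT d M p"


section \<open>Essential finiteness\<close>

text \<open>
  Series in \<open>(Z, \<xi>)\<close>, and in \<open>((z, w), (\<chi>, \<tau>))\<close>, have variables indexed by \<open>'N + 'N\<close>: \<open>Inl\<close>
  for the holomorphic group \<open>Z\<close> resp. \<open>(z, w)\<close> and \<open>Inr\<close> for the conjugate group \<open>\<xi>\<close> resp.
  \<open>(\<chi>, \<tau>)\<close>. Within each group, a set \<open>D\<close> of \<open>d\<close> indices marks the \<open>w\<close> (resp. \<open>\<tau>\<close>)
  variables, the remaining \<open>n\<close> indices being those of \<open>z\<close> (resp. \<open>\<chi>\<close>).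
\<close>

primrec wirtinger :: "'N + 'N \<Rightarrow> (complex^'N::finite \<Rightarrow> complex) \<Rightarrow> complex^'N \<Rightarrow> complex" where
  "wirtinger (Inl k) f = dZ k f"
| "wirtinger (Inr k) f = dZbar k f"

text \<open>
  Taylor series at \<open>p\<close>, with \<open>p\<close> translated to the origin. The derivatives of a smooth function
  commute, so the order in which the variables of a monomial are listed is immaterial.
\<close>
definition taylor :: "complex^'N::finite \<Rightarrow> (complex^'N \<Rightarrow> complex) \<Rightarrow> ('N + 'N) mfps" where
  "taylor p f = Mfps (\<lambda>\<alpha>. foldr wirtinger (SOME vs. mset vs = \<alpha>) f p
                           / of_nat (\<Prod>v\<in>set_mset \<alpha>. fact (count \<alpha> v)))"

definition formal_coordinates :: "('N::finite \<Rightarrow> 'N mfps) \<Rightarrow> bool" where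
  "formal_coordinates \<phi> \<longleftrightarrow> (\<forall>k. mcoeff (\<phi> k) {#} = 0) \<and>
     (\<exists>\<psi>. (\<forall>k. mcoeff (\<psi> k) {#} = 0) \<and>
          (\<forall>k. msubst \<phi> (\<psi> k) = mvar k) \<and> (\<forall>k. msubst \<psi> (\<phi> k) = mvar k))"

text \<open>The substitution \<open>Z = \<phi>(z, w)\<close>, \<open>\<xi> = \<phi>bar(\<chi>, \<tau>)\<close>.\<close>
definition polarized :: "('N::finite \<Rightarrow> 'N mfps) \<Rightarrow> 'N + 'N \<Rightarrow> ('N + 'N) mfps" where
  "polarized \<phi> v = (case v of
      Inl k \<Rightarrow> msubst (\<lambda>i. mvar (Inl i)) (\<phi> k)
    | Inr k \<Rightarrow> msubst (\<lambda>i. mvar (Inr i)) (mcnj (\<phi> k)))"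

definition normal_coordinates ::
    "nat \<Rightarrow> (nat \<Rightarrow> ('N + 'N) mfps) \<Rightarrow> ('N::finite \<Rightarrow> 'N mfps) \<Rightarrow> 'N set \<Rightarrow> ('N \<Rightarrow> ('N + 'N) mfps) \<Rightarrow> bool"
  where
  "normal_coordinates d r \<phi> D Q \<longleftrightarrow>
     formal_coordinates \<phi> \<and> card D = d \<and>
     (\<forall>j\<in>D. Q j \<in> series_in (- (Inl ` D))) \<and>
     (\<forall>j\<in>D. set_zero (Inr ` (- D)) (Q j) = mvar (Inr j)) \<and>
     (\<forall>j\<in>D. set_zero (Inl ` (- D)) (Q j) = mvar (Inr j)) \<and>
     ideal_gen UNIV {msubst (polarized \<phi>) (r j) | j. j < d} =
     ideal_gen UNIV {mvar (Inl j) - Q j | j. j \<in> D}"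

text \<open>The coefficient of \<open>z\<^sup>\<alpha>\<close> in \<open>q(z, \<chi>, 0)\<close>, as a series in \<open>\<chi>\<close>.\<close>
definition q_coeff :: "'N::finite set \<Rightarrow> ('N + 'N) mfps \<Rightarrow> 'N multiset \<Rightarrow> 'N mfps" where
  "q_coeff D q \<alpha> =
     Mfps (\<lambda>\<beta>. mcoeff (set_zero (Inr ` D) q) (image_mset Inl \<alpha> + image_mset Inr \<beta>))"

definition essentially_finite :: "nat \<Rightarrow> (complex^'N::finite) set \<Rightarrow> complex^'N \<Rightarrow> bool" where
  "essentially_finite d M p \<longleftrightarrow>
     (\<exists>U \<rho> \<phi> D Q. local_defining d M p U \<rho> \<and>
        normal_coordinates d (\<lambda>j. taylor p (cplx (\<rho> j))) \<phi> D Q \<and>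
        finite_codim (series_in (- D))
          (ideal_gen (series_in (- D))
             {q_coeff D (Q j) \<alpha> | j \<alpha>. j \<in> D \<and> set_mset \<alpha> \<subseteq> - D}))"


section \<open>Finite nondegeneracy\<close>

definition CR_basis :: "nat \<Rightarrow> (complex^'N::finite) set \<Rightarrow> complex^'N \<Rightarrow> (nat \<Rightarrow> complex^'N \<Rightarrow> complex^'N) \<Rightarrow> bool" where
  "CR_basis d M p L \<longleftrightarrow>
     (\<forall>i < CARD('N) - d. CR_field d M p (L i)) \<and>
     (\<forall>\<^sub>F Z in nhds p. Z \<in> M \<longrightarrow>
        inj_on (\<lambda>i. L i Z) {..<CARD('N) - d} \<and>
        vec.independent ((\<lambda>i. L i Z) ` {..<CARD('N) - d}) \<and>
        vec.span ((\<lambda>i. L i Z) ` {..<CARD('N) - d}) = T01 d M Z)"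

definition apply_CR :: "(complex^'N \<Rightarrow> complex^'N) \<Rightarrow> (complex^'N::finite \<Rightarrow> complex) \<Rightarrow> complex^'N \<Rightarrow> complex" where
  "apply_CR L f Z = vact (0, L Z) f Z"

definition CR_power ::
    "nat \<Rightarrow> (nat \<Rightarrow> complex^'N \<Rightarrow> complex^'N) \<Rightarrow> (nat \<Rightarrow> nat) \<Rightarrow>
     (complex^'N::finite \<Rightarrow> complex) \<Rightarrow> complex^'N \<Rightarrow> complex" where
  \<comment> \<open>\<open>L\<^sub>0\<close> to the power \<open>\<alpha> 0\<close> is applied last\<close>
  "CR_power n L \<alpha> f = foldr (\<lambda>i. apply_CR (L i) ^^ \<alpha> i) [0..<n] f"

definition finitely_nondegenerate :: "nat \<Rightarrow> (complex^'N::finite) set \<Rightarrow> complex^'N \<Rightarrow> bool" where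
  "finitely_nondegenerate d M p \<longleftrightarrow>
     (\<exists>U \<rho> L. local_defining d M p U \<rho> \<and> CR_basis d M p L \<and>
        vec.span {(\<chi> k. CR_power (CARD('N) - d) L \<alpha> (dZ k (cplx (\<rho> j))) p) | j \<alpha>. j < d} = UNIV)"


section \<open>Holomorphic mappings\<close>

definition holomorphic_map_on :: "(complex^'N) set \<Rightarrow> (complex^'N::finite \<Rightarrow> complex^'N) \<Rightarrow> bool" where
  "holomorphic_map_on U H \<longleftrightarrow> (\<forall>Z\<in>U. \<exists>A :: complex^'N^'N. (H has_derivative (\<lambda>v. A *v v)) (at Z))"

definition Jac :: "(complex^'N::finite \<Rightarrow> complex^'N) \<Rightarrow> complex^'N \<Rightarrow> complex" where
  "Jac H Z = det (matrix (frechet_derivative H (at Z)))"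

definition holomorphic_germ :: "(complex^'N::finite \<Rightarrow> complex^'N) \<Rightarrow> complex^'N \<Rightarrow> complex^'N \<Rightarrow> bool" where
  "holomorphic_germ H p p' \<longleftrightarrow> (\<exists>U. open U \<and> p \<in> U \<and> holomorphic_map_on U H) \<and> H p = p'"

definition finite_map_at :: "(complex^'N::finite \<Rightarrow> complex^'N) \<Rightarrow> complex^'N \<Rightarrow> complex^'N \<Rightarrow> bool" where
  "finite_map_at H p p' \<longleftrightarrow> (\<forall>\<^sub>F Z in nhds p. H Z = p' \<longleftrightarrow> Z = p)"

definition local_biholomorphism :: "(complex^'N::finite \<Rightarrow> complex^'N) \<Rightarrow> complex^'N \<Rightarrow> bool" where
  "local_biholomorphism H p \<longleftrightarrow>
     (\<exists>U V G. open U \<and> p \<in> U \<and> open V \<and> holomorphic_map_on U H \<and> holomorphic_map_on V G \<and>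
        H ` U = V \<and> (\<forall>Z\<in>U. G (H Z) = Z) \<and> (\<forall>W\<in>V. H (G W) = W))"

end

theory Submission
  imports Defs "HOL-Complex_Analysis.Conformal_Mappings"
begin

text \<open>
  The crucial point is the transversality of \<open>H\<close>. Since \<open>H\<close> maps \<open>M\<close> into \<open>M'\<close>, the Taylor series
  satisfy \<open>\<rho>'(H(Z), Hbar(\<xi>)) = a(Z, \<xi>) \<rho>(Z, \<xi>)\<close>. Differentiating in \<open>Z\<close> and in \<open>\<xi>\<close> shows that
  \<open>det a\<close> divides \<open>Jac H(Z)\<close> and its conjugate in \<open>\<xi>\<close> up to units, modulo the ideal of \<open>M\<close>.
  The \<open>(0,1)\<close> fields annihilate \<open>Jac H(Z)\<close> and the \<open>(1,0)\<close> fields its conjugate. Suppose that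
  \<open>det a\<close> is not a unit. Comparing orders of vanishing along the prime ideals obtained from the
  maximal one by passing to the largest subideals stable under one field after another, one finds
  that all words in CR fields and their conjugates map \<open>det a\<close> into the maximal ideal. By finite
  type \<open>det a\<close> then lies in the ideal of \<open>M\<close>, and so does \<open>Jac H\<close>, which is a contradiction.

  Hence \<open>a\<close> is invertible. Setting \<open>\<xi> = 0\<close> puts \<open>w\<close> into the ideal generated by the components of
  \<open>H\<close>, while restricting to the points of \<open>M\<close> with \<open>\<tau> = 0\<close> puts \<open>Q(z, \<chi>, 0)\<close> into the ideal generated
  by those of \<open>Hbar\<close>; essential finiteness thus makes the components of \<open>H\<close> generate an ideal of finite
  codimension. Finally, modulo the ideal of \<open>M\<close> the gradient \<open>\<rho>\<^sub>Z\<close> is a combination of the rows of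
  the derivative of \<open>H\<close>, with coefficients that alone are affected by CR fields, so finite
  nondegeneracy forces the derivative of \<open>H\<close> at \<open>p\<close> to be invertible.
\<close>

section \<open>Formal power series: coefficients and order of vanishing\<close>

text \<open>\<open>M\<close> and \<open>M'\<close> are only smooth, so their Taylor series need not
  converge, and the geometry is moved into formal power series. The bridge is that a smooth function
  vanishing on \<open>M\<close> has its Taylor series in the formal ideal of \<open>M\<close>. It
  rests on leading forms: one that does not vanish on the complexified tangent space is nonzero at a
  real tangent vector, hence along a curve in \<open>M\<close>.

  The obstacle to transversality is that the fields do not annihilate \<open>det a\<close> itself
  but only multiples of it, and the derivative of a product says little about one factor. Prime
  ideals repair this: a factor outside a prime can be cancelled without changing the order of
  vanishing there. The (0,1) fields and their conjugates need different multiples, so the primes are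
  built one letter at a time along a word; in characteristic zero each stays prime because binomial
  coefficients avoid it. Finite type enters twice: it makes the order of vanishing of
  \<open>Jac H\<close> finite, and it turns the vanishing of all words into membership in the
  ideal.\<close>

lemma mcoeff_0 [simp]: "mcoeff 0 \<alpha> = 0"
  by (simp add: zero_mfps_def)

lemma mcoeff_1 [simp]: "mcoeff 1 \<alpha> = (if \<alpha> = {#} then 1 else 0)"
  by (simp add: one_mfps_def)

lemma mcoeff_add [simp]: "mcoeff (f + g) \<alpha> = mcoeff f \<alpha> + mcoeff g \<alpha>"
  by (simp add: plus_mfps_def)

lemma mcoeff_uminus [simp]: "mcoeff (- f) \<alpha> = - mcoeff f \<alpha>"
  by (simp add: uminus_mfps_def)

lemma mcoeff_diff [simp]: "mcoeff (f - g) \<alpha> = mcoeff f \<alpha> - mcoeff g \<alpha>"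
  by (simp add: minus_mfps_def)

lemma mcoeff_sum [simp]: "mcoeff (sum f A) \<alpha> = (\<Sum>x\<in>A. mcoeff (f x) \<alpha>)"
  by (induction A rule: infinite_finite_induct) auto

lemma mcoeff_mult: "mcoeff (f * g) \<alpha> = (\<Sum>\<beta> | \<beta> \<subseteq># \<alpha>. mcoeff f \<beta> * mcoeff g (\<alpha> - \<beta>))"
  by (simp add: times_mfps_def)

lemma mcoeff_mvar [simp]: "mcoeff (mvar v) \<alpha> = (if \<alpha> = {#v#} then 1 else 0)"
  by (simp add: mvar_def)

lemma mcoeff_mconst [simp]: "mcoeff (mconst c) \<alpha> = (if \<alpha> = {#} then c else 0)"
  by (simp add: mconst_def)

lemma mcoeff_mcnj [simp]: "mcoeff (mcnj f) \<alpha> = cnj (mcoeff f \<alpha>)"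
  by (simp add: mcnj_def)

lemma mcoeff_mult_empty [simp]: "mcoeff (f * g) {#} = mcoeff f {#} * mcoeff g {#}"
  by (simp add: mcoeff_mult)

lemma mcoeff_mult_single:
  "mcoeff (f * g) {#v#} = mcoeff f {#} * mcoeff g {#v#} + mcoeff f {#v#} * mcoeff g {#}"
proof -
  have "{\<beta>. \<beta> \<subseteq># {#v#}} = {{#}, {#v#}}"
  proof -
    have "\<beta> = {#} \<or> \<beta> = {#v#}" if "\<beta> \<subseteq># {#v#}" for \<beta>
    proof (cases "v \<in># \<beta>")
      case True
      then obtain \<gamma> where "\<beta> = add_mset v \<gamma>" by (metis mset_add)
      with that show ?thesis by auto
    next
      case False
      have "set_mset \<beta> \<subseteq> {v}" using set_mset_mono[OF that] by simp
      with False have "set_mset \<beta> = {}" by auto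
      then show ?thesis by simp
    qed
    then show ?thesis by auto
  qed
  then show ?thesis by (simp add: mcoeff_mult)
qed

lemma mcoeff_mconst_mult [simp]: "mcoeff (mconst c * f) \<alpha> = c * mcoeff f \<alpha>"
proof -
  have "mcoeff (mconst c * f) \<alpha> = (\<Sum>\<beta> | \<beta> \<subseteq># \<alpha>. if \<beta> = {#} then c * mcoeff f \<alpha> else 0)"
    unfolding mcoeff_mult by (rule sum.cong) auto
  then show ?thesis by simp
qed

lemma mcoeff_mvar_mult:
  "mcoeff (mvar v * f) \<alpha> = (if v \<in># \<alpha> then mcoeff f (\<alpha> - {#v#}) else 0)"
proof -
  have "mcoeff (mvar v * f) \<alpha> = (\<Sum>\<beta> | \<beta> \<subseteq># \<alpha>. if \<beta> = {#v#} then mcoeff f (\<alpha> - {#v#}) else 0)"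
    unfolding mcoeff_mult by (rule sum.cong) auto
  then show ?thesis by simp
qed

lemma mconst_0 [simp]: "mconst 0 = 0" and mconst_1 [simp]: "mconst 1 = 1"
  and mconst_add: "mconst (a + b) = mconst a + mconst b"
  and mconst_mult: "mconst (a * b) = mconst a * mconst b"
  and mconst_uminus: "mconst (- a) = - mconst a"
  by (auto intro!: mfps_eqI)

lemma of_nat_mconst: "of_nat n = mconst (of_nat n)"
  by (induction n) (auto simp: mconst_add)

lemma mconst_sum: "mconst (sum f A) = (\<Sum>x\<in>A. mconst (f x))"
  by (rule mfps_eqI) simp

section \<open>Monomials, powers of the maximal ideal, truncation\<close>

definition mon :: "'v multiset \<Rightarrow> 'v mfps" where
  "mon \<alpha> = (\<Prod>v\<in>#\<alpha>. mvar v)"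

lemma mon_empty [simp]: "mon {#} = 1" and mon_add_mset: "mon (add_mset v \<alpha>) = mvar v * mon \<alpha>"
  and mon_add: "mon (\<alpha> + \<beta>) = mon \<alpha> * mon \<beta>"
  by (auto simp: mon_def)

lemma mcoeff_mon [simp]: "mcoeff (mon \<alpha>) \<gamma> = (if \<gamma> = \<alpha> then 1 else 0)"
proof (induction \<alpha> arbitrary: \<gamma>)
  case (add v \<alpha>)
  show ?case
    by (auto simp: mon_add_mset mcoeff_mvar_mult add)
qed auto

definition mpow :: "nat \<Rightarrow> 'v mfps set" where
  \<comment> \<open>the powers of the maximal ideal\<close>
  "mpow k = {f. \<forall>\<alpha>. size \<alpha> < k \<longrightarrow> mcoeff f \<alpha> = 0}"

lemma mpowD: "f \<in> mpow k \<Longrightarrow> size \<alpha> < k \<Longrightarrow> mcoeff f \<alpha> = 0"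
  by (simp add: mpow_def)

lemma mpow_0 [simp]: "mpow 0 = UNIV"
  by (auto simp: mpow_def)

lemma mpow_1_iff: "f \<in> mpow (Suc 0) \<longleftrightarrow> mcoeff f {#} = 0"
  by (auto simp: mpow_def)

lemma mpow_antimono: "k \<le> l \<Longrightarrow> mpow l \<subseteq> mpow k"
  by (auto simp: mpow_def)

lemma zero_in_mpow [simp]: "0 \<in> mpow k"
  by (simp add: mpow_def)

lemma mpow_add: "f \<in> mpow k \<Longrightarrow> g \<in> mpow k \<Longrightarrow> f + g \<in> mpow k"
  and mpow_diff: "f \<in> mpow k \<Longrightarrow> g \<in> mpow k \<Longrightarrow> f - g \<in> mpow k"
  by (auto simp: mpow_def)

lemma mpow_sum: "(\<And>x. x \<in> A \<Longrightarrow> f x \<in> mpow k) \<Longrightarrow> sum f A \<in> mpow k"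
  by (induction A rule: infinite_finite_induct) (auto intro: mpow_add)

lemma mpow_mult:
  assumes "f \<in> mpow k" "g \<in> mpow l"
  shows "f * g \<in> mpow (k + l)"
  unfolding mpow_def mem_Collect_eq
proof (intro allI impI)
  fix \<alpha> :: "'a multiset" assume s: "size \<alpha> < k + l"
  show "mcoeff (f * g) \<alpha> = 0"
    unfolding mcoeff_mult
  proof (rule sum.neutral, safe)
    fix \<beta> assume "\<beta> \<subseteq># \<alpha>"
    then have "size \<beta> + size (\<alpha> - \<beta>) = size \<alpha>"
      by (metis size_union subset_mset.add_diff_inverse)
    with s have "size \<beta> < k \<or> size (\<alpha> - \<beta>) < l" by linarith
    then show "mcoeff f \<beta> * mcoeff g (\<alpha> - \<beta>) = 0"
      using assms by (auto simp: mpow_def)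
  qed
qed

lemma mpow_mult_left: "g \<in> mpow k \<Longrightarrow> f * g \<in> mpow k"
  using mpow_mult[of f 0 g k] by simp

lemma mpow_mult_right: "g \<in> mpow k \<Longrightarrow> g * f \<in> mpow k"
  using mpow_mult_left[of g k f] by (simp add: mult.commute)

lemma mpow_prod_mset: "(\<And>v. v \<in># \<alpha> \<Longrightarrow> g v \<in> mpow 1) \<Longrightarrow> (\<Prod>v\<in>#\<alpha>. g v) \<in> mpow (size \<alpha>)"
proof (induction \<alpha>)
  case (add x \<alpha>)
  then show ?case using mpow_mult[of "g x" 1 "\<Prod>v\<in>#\<alpha>. g v" "size \<alpha>"] by simp
qed simp

lemma mon_in_mpow: "mon \<alpha> \<in> mpow (size \<alpha>)"
  by (auto simp: mpow_def)

lemma mfps_eqI_mpow: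
  assumes "\<And>n. f - g \<in> mpow n" shows "f = g"
proof (rule mfps_eqI)
  fix \<alpha> show "mcoeff f \<alpha> = mcoeff g \<alpha>"
    using mpowD[OF assms[of "Suc (size \<alpha>)"], of \<alpha>] by simp
qed

definition mtrunc :: "nat \<Rightarrow> 'v::finite mfps \<Rightarrow> 'v mfps" where
  "mtrunc k f = (\<Sum>\<alpha> | size \<alpha> \<le> k. mconst (mcoeff f \<alpha>) * mon \<alpha>)"

lemma mcoeff_mtrunc: "mcoeff (mtrunc k f) \<gamma> = (if size \<gamma> \<le> k then mcoeff f \<gamma> else 0)"
proof -
  have "mcoeff (mtrunc k f) \<gamma> = (\<Sum>\<alpha> | size \<alpha> \<le> k. if \<alpha> = \<gamma> then mcoeff f \<gamma> else 0)"
    unfolding mtrunc_def by (auto intro!: sum.cong)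
  then show ?thesis by (simp add: finite_bounded_multisets)
qed

lemma diff_mtrunc_in_mpow: "f - mtrunc k f \<in> mpow (Suc k)"
  by (auto simp: mpow_def mcoeff_mtrunc)

subsection \<open>Continuous additive operators\<close>

text \<open>Continuity at 0 for the topology in which the powers of the maximal ideal are the
  neighbourhoods of 0.\<close>

definition mcontinuous :: "('v mfps \<Rightarrow> 'u mfps) \<Rightarrow> bool" where
  "mcontinuous T \<longleftrightarrow> (\<forall>n. \<exists>k. \<forall>h\<in>mpow k. T h \<in> mpow n)"

lemma additiveI: "(\<And>f g. T (f + g) = T f + T g) \<Longrightarrow> Modules.additive T"
  by unfold_locales

text \<open>Polynomials are dense, so identities between continuous operators need only be checked
  on single terms. The scalar \<open>c\<close> belongs to the term because the operators are
  additive but not assumed linear. Product rule, chain rule and composition of substitutions are all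
  reduced to monomials in this way.\<close>

lemma mcontinuous_eqI:
  fixes S T :: "'v::finite mfps \<Rightarrow> 'u mfps"
  assumes "Modules.additive S" "Modules.additive T" "mcontinuous S" "mcontinuous T"
    and eq: "\<And>c \<alpha>. S (mconst c * mon \<alpha>) = T (mconst c * mon \<alpha>)"
  shows "S f = T f"
proof (rule mfps_eqI_mpow)
  fix n
  interpret S: Modules.additive S by fact
  interpret T: Modules.additive T by fact
  obtain k l where k: "\<forall>h\<in>mpow k. S h \<in> mpow n" and l: "\<forall>h\<in>mpow l. T h \<in> mpow n"
    using assms unfolding mcontinuous_def by meson
  define t where "t = mtrunc (max k l) f"
  have "f - t \<in> mpow k" "f - t \<in> mpow l"
    using diff_mtrunc_in_mpow[of f "max k l"]
      mpow_antimono[of k "Suc (max k l)", OF le_SucI[OF max.cobounded1]]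
      mpow_antimono[of l "Suc (max k l)", OF le_SucI[OF max.cobounded2]] by (auto simp: t_def)
  then have "S (f - t) - T (f - t) \<in> mpow n"
    using k l by (auto intro: mpow_diff)
  moreover have "S t = T t"
    by (simp add: t_def mtrunc_def S.sum T.sum eq)
  ultimately show "S f - T f \<in> mpow n"
    by (simp add: S.diff T.diff)
qed

lemma mcontinuous_add: "mcontinuous S \<Longrightarrow> mcontinuous T \<Longrightarrow> mcontinuous (\<lambda>f. S f + T f)"
  unfolding mcontinuous_def
proof
  fix n assume "\<forall>n. \<exists>k. \<forall>h\<in>mpow k. S h \<in> mpow n" "\<forall>n. \<exists>k. \<forall>h\<in>mpow k. T h \<in> mpow n"
  then obtain k l where "\<forall>h\<in>mpow k. S h \<in> mpow n" "\<forall>h\<in>mpow l. T h \<in> mpow n" by meson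
  then have "\<forall>h\<in>mpow (max k l). S h + T h \<in> mpow n"
    using mpow_antimono[of k "max k l"] mpow_antimono[of l "max k l"]
    by (auto intro!: mpow_add)
  then show "\<exists>k. \<forall>h\<in>mpow k. S h + T h \<in> mpow n" by blast
qed

lemma mcontinuous_mult_left: "mcontinuous S \<Longrightarrow> mcontinuous (\<lambda>f. c * S f)"
  unfolding mcontinuous_def by (meson mpow_mult_left)

lemma mcontinuous_mult_right: "mcontinuous S \<Longrightarrow> mcontinuous (\<lambda>f. S f * c)"
  unfolding mcontinuous_def by (meson mpow_mult_right)

lemma mcontinuous_sum:
  assumes "finite A" "\<And>x. x \<in> A \<Longrightarrow> mcontinuous (S x)"
  shows "mcontinuous (\<lambda>f. \<Sum>x\<in>A. S x f)"
  using assms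
proof (induction A rule: finite_induct)
  case empty then show ?case by (simp add: mcontinuous_def)
next
  case (insert x A) then show ?case by (simp add: mcontinuous_add)
qed

lemma mcontinuous_compose: "mcontinuous S \<Longrightarrow> mcontinuous T \<Longrightarrow> mcontinuous (\<lambda>f. S (T f))"
  unfolding mcontinuous_def by meson

lemma mcontinuous_id: "mcontinuous (\<lambda>f. f)"
  unfolding mcontinuous_def by blast

subsection \<open>Substitution\<close>

lemma mcoeff_msubst: "mcoeff (msubst g f) \<gamma> =
    (\<Sum>\<alpha> | size \<alpha> \<le> size \<gamma>. mcoeff f \<alpha> * mcoeff (\<Prod>v\<in>#\<alpha>. g v) \<gamma>)"
  by (simp add: msubst_def)

text \<open>Monomials of degree above \<open>size \<gamma>\<close> contribute nothing once every
  \<open>g v\<close> has zero constant term. A bound \<open>n\<close> common to many \<gamma> allows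
  comparison with one polynomial in the \<open>g v\<close>.\<close>

lemma mcoeff_msubst_bound:
  assumes g: "\<And>v. g v \<in> mpow 1" and n: "size \<gamma> \<le> n"
  shows "mcoeff (msubst g f) \<gamma> = (\<Sum>\<alpha> | size \<alpha> \<le> n. mcoeff f \<alpha> * mcoeff (\<Prod>v\<in>#\<alpha>. g v) \<gamma>)"
  unfolding mcoeff_msubst
proof (rule sum.mono_neutral_left)
  show "\<forall>\<alpha>\<in>{\<alpha>. size \<alpha> \<le> n} - {\<alpha>. size \<alpha> \<le> size \<gamma>}. mcoeff f \<alpha> * mcoeff (\<Prod>v\<in>#\<alpha>. g v) \<gamma> = 0"
    using mpowD[OF mpow_prod_mset[of _ g]] g by force
qed (use n in \<open>auto simp: finite_bounded_multisets\<close>)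

lemma additive_msubst: "Modules.additive (msubst g)"
  by unfold_locales (auto intro!: mfps_eqI simp: mcoeff_msubst sum.distrib ring_distribs)

lemmas msubst_add = Modules.additive.add[OF additive_msubst]
  and msubst_diff = Modules.additive.diff[OF additive_msubst]
  and msubst_sum = Modules.additive.sum[OF additive_msubst]
  and msubst_0 [simp] = Modules.additive.zero[OF additive_msubst]

lemma msubst_in_mpow: "f \<in> mpow k \<Longrightarrow> (\<And>v. g v \<in> mpow 1) \<Longrightarrow> msubst g f \<in> mpow k"
  by (auto simp: mpow_def mcoeff_msubst intro!: sum.neutral)

lemma mcontinuous_msubst: "(\<And>v. g v \<in> mpow 1) \<Longrightarrow> mcontinuous (msubst g)"
  unfolding mcontinuous_def using msubst_in_mpow by blast

lemma mcoeff_msubst_empty [simp]: "mcoeff (msubst g f) {#} = mcoeff f {#}"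
proof -
  have "{\<alpha> :: 'b multiset. size \<alpha> \<le> size ({#} :: 'a multiset)} = {{#}}" by auto
  then show ?thesis by (simp add: mcoeff_msubst)
qed

lemma msubst_term:
  assumes "\<And>v. g v \<in> mpow 1"
  shows "msubst g (mconst c * mon \<alpha>) = mconst c * (\<Prod>v\<in>#\<alpha>. g v)"
proof (rule mfps_eqI)
  fix \<gamma>
  have "mcoeff (msubst g (mconst c * mon \<alpha>)) \<gamma> = (\<Sum>\<beta> | size \<beta> \<le> max (size \<gamma>) (size \<alpha>).
      mcoeff (mconst c * mon \<alpha>) \<beta> * mcoeff (\<Prod>v\<in>#\<beta>. g v) \<gamma>)"
    by (rule mcoeff_msubst_bound) (use assms in auto)
  also have "\<dots> = (\<Sum>\<beta> | size \<beta> \<le> max (size \<gamma>) (size \<alpha>).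
      if \<beta> = \<alpha> then c * mcoeff (\<Prod>v\<in>#\<alpha>. g v) \<gamma> else 0)"
    by (rule sum.cong) auto
  finally show "mcoeff (msubst g (mconst c * mon \<alpha>)) \<gamma> = mcoeff (mconst c * (\<Prod>v\<in>#\<alpha>. g v)) \<gamma>"
    by (simp add: finite_bounded_multisets)
qed

lemma msubst_mult:
  fixes f h :: "'v::finite mfps"
  assumes g: "\<And>v. g v \<in> mpow 1"
  shows "msubst g (f * h) = msubst g f * msubst g h"
proof -
  note ct = mcontinuous_msubst[OF g]
  \<comment> \<open>Multiplicativity first for a single term as left factor, by density in
    \<open>h\<close>; density in \<open>f\<close> then gives the general left factor.\<close>
  have 1: "msubst g (mconst c * mon \<alpha> * h) = msubst g (mconst c * mon \<alpha>) * msubst g h"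
    for c and \<alpha> :: "'v multiset" and h
  proof (rule mcontinuous_eqI[where f = h])
    fix b \<beta>
    have "msubst g (mconst c * mon \<alpha> * (mconst b * mon \<beta>)) = msubst g (mconst (c * b) * mon (\<alpha> + \<beta>))"
      by (simp add: mconst_mult mon_add mult_ac)
    then show "msubst g (mconst c * mon \<alpha> * (mconst b * mon \<beta>))
        = msubst g (mconst c * mon \<alpha>) * msubst g (mconst b * mon \<beta>)"
      unfolding msubst_term[OF g] by (simp add: mconst_mult mult_ac)
  qed (rule additiveI, simp add: distrib_left msubst_add, rule additiveI,
      simp add: distrib_left msubst_add,
      rule mcontinuous_compose[OF ct mcontinuous_mult_left[OF mcontinuous_id]],
      rule mcontinuous_mult_left[OF ct])
  show ?thesis
  proof (rule mcontinuous_eqI[where f = f])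
    show "msubst g (mconst c * mon \<alpha> * h) = msubst g (mconst c * mon \<alpha>) * msubst g h" for c \<alpha>
      by (rule 1)
  qed (rule additiveI, simp add: distrib_right msubst_add, rule additiveI,
      simp add: distrib_right msubst_add,
      rule mcontinuous_compose[OF ct mcontinuous_mult_right[OF mcontinuous_id]],
      rule mcontinuous_mult_right[OF ct])
qed

lemma msubst_mconst [simp]:
  fixes g :: "'v::finite \<Rightarrow> 'u mfps"
  shows "msubst g (mconst c) = mconst c"
proof (rule mfps_eqI)
  fix \<gamma>
  have "mcoeff (msubst g (mconst c)) \<gamma> =
      (\<Sum>\<beta> :: 'v multiset | size \<beta> \<le> size \<gamma>. if \<beta> = {#} then mcoeff (mconst c) \<gamma> else 0)"
    unfolding mcoeff_msubst by (rule sum.cong) auto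
  then show "mcoeff (msubst g (mconst c)) \<gamma> = mcoeff (mconst c) \<gamma>"
    by (simp add: finite_bounded_multisets)
qed

lemma msubst_1 [simp]: "msubst g 1 = 1"
  using msubst_mconst[of g 1] by simp

lemma msubst_mvar:
  assumes "\<And>v. g v \<in> mpow 1" shows "msubst g (mvar v) = g v"
  using msubst_term[OF assms, where c = 1 and \<alpha> = "{#v#}"] by (simp add: mon_add_mset)

lemma msubst_prod_mset:
  assumes "\<And>v. g v \<in> mpow 1" shows "msubst g (\<Prod>x\<in>#\<alpha>. f x) = (\<Prod>x\<in>#\<alpha>. msubst g (f x))"
  by (induction \<alpha>) (auto simp: msubst_mult[OF assms])

lemma msubst_power:
  assumes "\<And>v. g v \<in> mpow 1" shows "msubst g (f ^ n) = msubst g f ^ n"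
  by (induction n) (auto simp: msubst_mult[OF assms])

lemma msubst_msubst:
  fixes f :: "'v::finite mfps" and h :: "'v \<Rightarrow> 'u::finite mfps"
  assumes g: "\<And>v. g v \<in> mpow 1" and h: "\<And>v. h v \<in> mpow 1"
  shows "msubst g (msubst h f) = msubst (\<lambda>v. msubst g (h v)) f"
proof (rule mcontinuous_eqI[where f = f])
  have gh: "msubst g (h v) \<in> mpow 1" for v
    by (rule msubst_in_mpow) (use g h in auto)
  then show "mcontinuous (msubst (\<lambda>v. msubst g (h v)))"
    by (rule mcontinuous_msubst)
  show "mcontinuous (\<lambda>f. msubst g (msubst h f))"
    using mcontinuous_compose[OF mcontinuous_msubst[OF g] mcontinuous_msubst[OF h]] .
  show "msubst g (msubst h (mconst c * mon \<alpha>)) = msubst (\<lambda>v. msubst g (h v)) (mconst c * mon \<alpha>)" for c \<alpha>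
    by (simp add: msubst_term[OF h] msubst_term[OF gh] msubst_mult[OF g] msubst_prod_mset[OF g])
qed (rule additiveI, simp add: msubst_add, rule additiveI, simp add: msubst_add)

lemma mvar_in_mpow [simp]: "mvar v \<in> mpow (Suc 0)"
  by (simp add: mpow_1_iff)

lemma msubst_mvar_id: "msubst mvar f = (f :: 'v::finite mfps)"
proof (rule mcontinuous_eqI[where f = f])
  show "msubst mvar (mconst c * mon \<alpha>) = mconst c * mon \<alpha>" for c and \<alpha> :: "'v multiset"
    by (subst msubst_term) (auto simp: mon_def)
qed (rule additiveI, simp add: msubst_add, rule additiveI, simp, rule mcontinuous_msubst, simp,
  rule mcontinuous_id)

lemma mcoeff_msubst_single:
  assumes "\<And>v. g v \<in> mpow 1"
  shows "mcoeff (msubst g f) {#u#} = (\<Sum>v\<in>UNIV. mcoeff f {#v#} * mcoeff (g v) {#u#})"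
proof -
  have *: "{\<alpha>. size \<alpha> \<le> size {#u#}} = insert {#} ((\<lambda>v. {#v#}) ` UNIV)"
    by (auto simp: le_Suc_eq dest!: size_1_singleton_mset[unfolded One_nat_def])
  show ?thesis
    unfolding mcoeff_msubst * by (subst sum.insert) (auto simp: sum.reindex inj_on_def)
qed

subsection \<open>Conjugation\<close>

lemma mcnj_mult: "mcnj (f * g) = mcnj f * mcnj g"
  by (rule mfps_eqI) (simp add: mcoeff_mult)

lemma mcnj_add: "mcnj (f + g) = mcnj f + mcnj g"
  and mcnj_1 [simp]: "mcnj 1 = 1" and mcnj_0 [simp]: "mcnj 0 = 0"
  and mcnj_mvar [simp]: "mcnj (mvar v) = mvar v" and mcnj_mcnj [simp]: "mcnj (mcnj f) = f"
  by (auto intro!: mfps_eqI)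

lemma mcnj_sum: "mcnj (sum f A) = (\<Sum>x\<in>A. mcnj (f x))"
  by (rule mfps_eqI) simp

lemma mcnj_power: "mcnj (f ^ n) = mcnj f ^ n"
  by (induction n) (auto simp: mcnj_mult)

lemma mcnj_prod_mset: "mcnj (\<Prod>v\<in>#\<alpha>. g v) = (\<Prod>v\<in>#\<alpha>. mcnj (g v))"
  by (induction \<alpha>) (auto simp: mcnj_mult)

lemma mcnj_msubst: "mcnj (msubst g f) = msubst (\<lambda>v. mcnj (g v)) (mcnj f)"
  by (rule mfps_eqI) (simp add: mcoeff_msubst flip: mcnj_prod_mset)

lemma mcnj_in_mpow [simp]: "mcnj f \<in> mpow k \<longleftrightarrow> f \<in> mpow k"
  by (simp add: mpow_def)

subsection \<open>Units\<close>

text \<open>Geometric series: \<open>e\<close> is the expansion of 1/(1 + t) in one variable,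
  indexed by \<open>unit\<close>, and t is replaced by \<open>h\<close>, the deviation of
  \<open>f\<close> divided by its constant term from 1.\<close>

lemma mfps_unit:
  fixes f :: "'v mfps"
  assumes "mcoeff f {#} \<noteq> 0"
  obtains g where "f * g = 1"
proof -
  define c where "c = mcoeff f {#}"
  define h where "h = mconst (inverse c) * f - 1"
  define e :: "unit mfps" where "e = Mfps (\<lambda>\<alpha>. (-1) ^ size \<alpha>)"
  have c0: "c \<noteq> 0" using assms by (simp add: c_def)
  have hm: "h \<in> mpow 1" by (simp add: mpow_1_iff h_def c0 flip: c_def)
  have "(1 + mvar ()) * e = 1"
  proof (rule mfps_eqI)
    fix \<alpha> :: "unit multiset"
    have "() \<in># \<alpha>" if "\<alpha> \<noteq> {#}" using that by (metis (full_types) multiset_nonemptyE old.unit.exhaust)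
    then obtain \<beta> where "\<alpha> = {#} \<or> \<alpha> = add_mset () \<beta>" by (metis mset_add)
    then show "mcoeff ((1 + mvar ()) * e) \<alpha> = mcoeff 1 \<alpha>"
      by (auto simp: distrib_right mcoeff_mvar_mult) (auto simp: e_def)
  qed
  then have "msubst (\<lambda>_. h) ((1 + mvar ()) * e) = 1" by simp
  then have "(1 + h) * msubst (\<lambda>_. h) e = 1"
    by (simp add: msubst_mult[OF hm] msubst_add msubst_mvar[OF hm])
  then have "f * (mconst (inverse c) * msubst (\<lambda>_. h) e) = 1"
    by (simp add: h_def mult_ac)
  then show ?thesis by (rule that)
qed

subsection \<open>Partial derivatives\<close>

definition pder :: "'v \<Rightarrow> 'v mfps \<Rightarrow> 'v mfps" where
  "pder v f = Mfps (\<lambda>\<alpha>. of_nat (Suc (count \<alpha> v)) * mcoeff f (add_mset v \<alpha>))"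

lemma mcoeff_pder: "mcoeff (pder v f) \<alpha> = of_nat (Suc (count \<alpha> v)) * mcoeff f (add_mset v \<alpha>)"
  by (simp add: pder_def)

lemma additive_pder: "Modules.additive (pder v)"
  by unfold_locales (auto intro!: mfps_eqI simp: mcoeff_pder ring_distribs)

lemmas pder_add = Modules.additive.add[OF additive_pder]
  and pder_diff = Modules.additive.diff[OF additive_pder]
  and pder_sum = Modules.additive.sum[OF additive_pder]

lemma pder_in_mpow: "f \<in> mpow (Suc k) \<Longrightarrow> pder v f \<in> mpow k"
  by (auto simp: mpow_def mcoeff_pder)

lemma mcontinuous_pder: "mcontinuous (pder v)"
  unfolding mcontinuous_def by (meson pder_in_mpow)

lemma pder_mconst [simp]: "pder v (mconst c) = 0"
  by (rule mfps_eqI) (simp add: mcoeff_pder)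

lemma pder_1 [simp]: "pder v 1 = 0"
  using pder_mconst[of v 1] by simp

lemma pder_mvar: "pder v (mvar u) = (if u = v then 1 else 0)"
  by (rule mfps_eqI) (auto simp: mcoeff_pder)

lemma pder_mvar_mult: "pder v (mvar u * f) = pder v (mvar u) * f + mvar u * pder v f"
proof (rule mfps_eqI)
  fix \<alpha> show "mcoeff (pder v (mvar u * f)) \<alpha> = mcoeff (pder v (mvar u) * f + mvar u * pder v f) \<alpha>"
  proof (cases "u \<in># \<alpha>")
    case True
    then obtain \<beta> where "\<alpha> = add_mset u \<beta>" by (metis mset_add)
    then show ?thesis
      by (auto simp: mcoeff_pder mcoeff_mvar_mult pder_mvar ring_distribs add_mset_commute)
  next
    case False
    then have "count \<alpha> u = 0" by (simp add: not_in_iff)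
    with False show ?thesis
      by (auto simp: mcoeff_pder mcoeff_mvar_mult pder_mvar simp del: count_eq_zero_iff)
  qed
qed

lemma pder_mconst_mult: "pder v (mconst c * f) = mconst c * pder v f"
  by (rule mfps_eqI) (simp add: mcoeff_pder)

lemma pder_mult:
  fixes f g :: "'v::finite mfps"
  shows "pder v (f * g) = pder v f * g + f * pder v g"
proof (rule mcontinuous_eqI[where f = f])
  have "pder v (mon \<alpha> * g) = pder v (mon \<alpha>) * g + mon \<alpha> * pder v g" for \<alpha>
    by (induction \<alpha>) (auto simp: mon_add_mset mult.assoc pder_mvar_mult ring_distribs)
  then show "pder v (mconst c * mon \<alpha> * g) = pder v (mconst c * mon \<alpha>) * g + mconst c * mon \<alpha> * pder v g"
    for c \<alpha> by (simp add: mult.assoc pder_mconst_mult ring_distribs)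
  show "Modules.additive (\<lambda>f. pder v (f * g))"
    by (rule additiveI) (simp add: distrib_right pder_add)
  show "Modules.additive (\<lambda>f. pder v f * g + f * pder v g)"
    by (rule additiveI) (simp add: distrib_right pder_add add_ac)
  show "mcontinuous (\<lambda>f. pder v (f * g))"
    using mcontinuous_compose[OF mcontinuous_pder[of v] mcontinuous_mult_right[OF mcontinuous_id, of g]] .
  show "mcontinuous (\<lambda>f. pder v f * g + f * pder v g)"
    using mcontinuous_add[OF mcontinuous_mult_right[OF mcontinuous_pder[of v], of g]
        mcontinuous_mult_right[OF mcontinuous_id, of "pder v g"]] .
qed

lemma pder_commute: "pder u (pder v f) = pder v (pder u f)"
  by (rule mfps_eqI) (auto simp: mcoeff_pder add_mset_commute)

lemma pder_msubst:
  fixes f :: "'v::finite mfps" and g :: "'v \<Rightarrow> 'u::finite mfps"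
  assumes g: "\<And>v. g v \<in> mpow 1"
  shows "pder w (msubst g f) = (\<Sum>v\<in>UNIV. msubst g (pder v f) * pder w (g v))"
proof (rule mcontinuous_eqI[where f = f])
  have *: "pder w (msubst g (mon \<alpha>)) = (\<Sum>v\<in>UNIV. msubst g (pder v (mon \<alpha>)) * pder w (g v))" for \<alpha>
  proof (induction \<alpha>)
    case (add u \<alpha>)
    have "(\<Sum>v\<in>UNIV. msubst g (pder v (mon (add_mset u \<alpha>))) * pder w (g v))
       = (\<Sum>v\<in>UNIV. if v = u then msubst g (mon \<alpha>) * pder w (g v) else 0)
         + (\<Sum>v\<in>UNIV. g u * (msubst g (pder v (mon \<alpha>)) * pder w (g v)))"
      unfolding sum.distrib[symmetric]
      by (rule sum.cong) (auto simp: mon_add_mset pder_mult pder_mvar msubst_add msubst_mult[OF g]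
          msubst_mvar[OF g] ring_distribs mult_ac)
    then show ?case
      by (simp add: mon_add_mset pder_mult msubst_mult[OF g] msubst_mvar[OF g] add
          flip: sum_distrib_left)
  qed simp
  show "pder w (msubst g (mconst c * mon \<alpha>))
      = (\<Sum>v\<in>UNIV. msubst g (pder v (mconst c * mon \<alpha>)) * pder w (g v))" for c \<alpha>
    by (simp add: msubst_mult[OF g] pder_mconst_mult * sum_distrib_left mult.assoc)
  show "Modules.additive (\<lambda>f. pder w (msubst g f))"
    by (rule additiveI) (simp add: msubst_add pder_add)
  show "Modules.additive (\<lambda>f. \<Sum>v\<in>UNIV. msubst g (pder v f) * pder w (g v))"
    by (rule additiveI) (simp add: msubst_add pder_add distrib_right sum.distrib)
  show "mcontinuous (\<lambda>f. pder w (msubst g f))"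
    using mcontinuous_compose[OF mcontinuous_pder[of w] mcontinuous_msubst[OF g]] .
  have "mcontinuous (\<lambda>f. msubst g (pder v f) * pder w (g v))" for v
    using mcontinuous_mult_right[OF mcontinuous_compose[OF mcontinuous_msubst[OF g] mcontinuous_pder[of v]]] .
  then show "mcontinuous (\<lambda>f. \<Sum>v\<in>UNIV. msubst g (pder v f) * pder w (g v))"
    by (rule mcontinuous_sum[OF finite])
qed

subsection \<open>Ideals\<close>

definition isideal :: "'a::comm_ring_1 set \<Rightarrow> bool" where
  "isideal J \<longleftrightarrow> 0 \<in> J \<and> (\<forall>a\<in>J. \<forall>b\<in>J. a + b \<in> J) \<and> (\<forall>c. \<forall>a\<in>J. c * a \<in> J)"

lemma isidealI:
  "0 \<in> J \<Longrightarrow> (\<And>a b. a \<in> J \<Longrightarrow> b \<in> J \<Longrightarrow> a + b \<in> J) \<Longrightarrow> (\<And>c a. a \<in> J \<Longrightarrow> c * a \<in> J) \<Longrightarrow> isideal J"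
  by (simp add: isideal_def)

lemma isideal_0: "isideal J \<Longrightarrow> 0 \<in> J"
  and isideal_add: "isideal J \<Longrightarrow> a \<in> J \<Longrightarrow> b \<in> J \<Longrightarrow> a + b \<in> J"
  and isideal_mult: "isideal J \<Longrightarrow> a \<in> J \<Longrightarrow> c * a \<in> J"
  by (simp_all add: isideal_def)

lemma isideal_mult_right: "isideal J \<Longrightarrow> a \<in> J \<Longrightarrow> a * c \<in> J"
  using isideal_mult[of J a c] by (simp add: mult.commute)

lemma isideal_uminus: "isideal J \<Longrightarrow> a \<in> J \<Longrightarrow> - a \<in> J"
  using isideal_mult[of J a "-1"] by simp

lemma isideal_diff: "isideal J \<Longrightarrow> a \<in> J \<Longrightarrow> b \<in> J \<Longrightarrow> a - b \<in> J"
  using isideal_add[of J a "- b"] isideal_uminus[of J b] by simp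

lemma isideal_sum: "isideal J \<Longrightarrow> (\<And>x. x \<in> A \<Longrightarrow> f x \<in> J) \<Longrightarrow> sum f A \<in> J"
  by (induction A rule: infinite_finite_induct) (auto intro: isideal_0 isideal_add)

lemma isideal_diff_cong: "isideal J \<Longrightarrow> a - b \<in> J \<Longrightarrow> a \<in> J \<longleftrightarrow> b \<in> J"
  using isideal_add[of J "a - b" b] isideal_diff[of J a "a - b"] by auto

lemma isideal_ideal_gen: "isideal (ideal_gen UNIV S)"
proof (rule isidealI)
  show "0 \<in> ideal_gen UNIV S"
    unfolding ideal_gen_def by (auto intro!: exI[of _ "{}"])
next
  fix x y assume "x \<in> ideal_gen UNIV S" "y \<in> ideal_gen UNIV S"
  then obtain F a G b where F: "x = (\<Sum>s\<in>F. a s * s)" "finite F" "F \<subseteq> S"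
    and G: "y = (\<Sum>s\<in>G. b s * s)" "finite G" "G \<subseteq> S"
    unfolding ideal_gen_def by blast
  define c where "c s = (if s \<in> F then a s else 0) + (if s \<in> G then b s else 0)" for s
  have "x = (\<Sum>s\<in>F \<union> G. (if s \<in> F then a s else 0) * s)"
    unfolding F(1) by (rule sum.mono_neutral_cong_left) (use F G in auto)
  moreover have "y = (\<Sum>s\<in>F \<union> G. (if s \<in> G then b s else 0) * s)"
    unfolding G(1) by (rule sum.mono_neutral_cong_left) (use F G in auto)
  ultimately have "x + y = (\<Sum>s\<in>F \<union> G. c s * s)"
    by (simp add: c_def distrib_right sum.distrib)
  then show "x + y \<in> ideal_gen UNIV S"
    unfolding ideal_gen_def using F G by (intro CollectI exI[of _ "F \<union> G"] exI[of _ c]) auto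
next
  fix c x assume "x \<in> ideal_gen UNIV S"
  then obtain F a where F: "x = (\<Sum>s\<in>F. a s * s)" "finite F" "F \<subseteq> S"
    unfolding ideal_gen_def by blast
  then have "c * x = (\<Sum>s\<in>F. (c * a s) * s)" by (simp add: sum_distrib_left mult.assoc)
  then show "c * x \<in> ideal_gen UNIV S"
    unfolding ideal_gen_def using F by (intro CollectI exI[of _ F] exI[of _ "\<lambda>s. c * a s"]) auto
qed

lemma ideal_gen_superset: "S \<subseteq> ideal_gen UNIV S"
proof
  fix s assume "s \<in> S"
  then show "s \<in> ideal_gen UNIV S"
    unfolding ideal_gen_def by (intro CollectI exI[of _ "{s}"] exI[of _ "\<lambda>_. 1"]) auto
qed

lemma ideal_gen_least: "isideal J \<Longrightarrow> S \<subseteq> J \<Longrightarrow> ideal_gen A S \<subseteq> J"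
  unfolding ideal_gen_def by (force intro!: isideal_sum isideal_mult)

lemma isideal_vimage:
  assumes "isideal J" "Modules.additive T" "\<And>f g. T (f * g) = T f * T g"
  shows "isideal {f. T f \<in> J}"
  using assms Modules.additive.zero[OF assms(2)] Modules.additive.add[OF assms(2)]
  by (auto simp: isideal_def)

text \<open>\<open>ideal_gen\<close> sums over a set of generators, while the family
  \<open>h\<close> may take the same value at several indices; the proof therefore compares ideals
  instead of rewriting sums.\<close>

lemma ideal_gen_indexed:
  assumes "finite K"
  shows "f \<in> ideal_gen UNIV {h j |j. j \<in> K} \<longleftrightarrow> (\<exists>c. f = (\<Sum>j\<in>K. c j * h j))"
proof
  have "isideal {f. \<exists>c. f = (\<Sum>j\<in>K. c j * h j)}"
  proof (rule isidealI)
    show "0 \<in> {f. \<exists>c. f = (\<Sum>j\<in>K. c j * h j)}" by (auto intro!: exI[of _ "\<lambda>_. 0"])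
  next
    fix a b assume "a \<in> {f. \<exists>c. f = (\<Sum>j\<in>K. c j * h j)}" "b \<in> {f. \<exists>c. f = (\<Sum>j\<in>K. c j * h j)}"
    then obtain c d where "a = (\<Sum>j\<in>K. c j * h j)" "b = (\<Sum>j\<in>K. d j * h j)" by auto
    then show "a + b \<in> {f. \<exists>c. f = (\<Sum>j\<in>K. c j * h j)}"
      by (auto intro!: exI[of _ "\<lambda>j. c j + d j"] simp: distrib_right sum.distrib)
  next
    fix e a assume "a \<in> {f. \<exists>c. f = (\<Sum>j\<in>K. c j * h j)}"
    then obtain c where "a = (\<Sum>j\<in>K. c j * h j)" by auto
    then show "e * a \<in> {f. \<exists>c. f = (\<Sum>j\<in>K. c j * h j)}"
      by (auto intro!: exI[of _ "\<lambda>j. e * c j"] simp: sum_distrib_left mult.assoc)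
  qed
  moreover have "h j \<in> {f. \<exists>c. f = (\<Sum>j\<in>K. c j * h j)}" if "j \<in> K" for j
  proof -
    have "h j = (\<Sum>i\<in>K. (if i = j then 1 else 0) * h i)"
      using that assms by (simp add: if_distrib[of "\<lambda>x. x * _"] cong: if_cong)
    then show ?thesis by (intro CollectI exI[of _ "\<lambda>i. if i = j then 1 else 0"])
  qed
  ultimately have "ideal_gen UNIV {h j |j. j \<in> K} \<subseteq> {f. \<exists>c. f = (\<Sum>j\<in>K. c j * h j)}"
    by (intro ideal_gen_least) auto
  then show "f \<in> ideal_gen UNIV {h j |j. j \<in> K} \<Longrightarrow> \<exists>c. f = (\<Sum>j\<in>K. c j * h j)" by auto
next
  assume "\<exists>c. f = (\<Sum>j\<in>K. c j * h j)"
  then show "f \<in> ideal_gen UNIV {h j |j. j \<in> K}"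
    using ideal_gen_superset[of "{h j |j. j \<in> K}"]
    by (auto intro!: isideal_sum isideal_mult isideal_ideal_gen)
qed

definition prime_ideal :: "'a::comm_ring_1 set \<Rightarrow> bool" where
  "prime_ideal P \<longleftrightarrow> isideal P \<and> 1 \<notin> P \<and> (\<forall>a b. a * b \<in> P \<longrightarrow> a \<in> P \<or> b \<in> P)"

subsection \<open>Derivations and differential powers of prime ideals\<close>

definition derivation :: "('a::comm_ring_1 \<Rightarrow> 'a) \<Rightarrow> bool" where
  "derivation X \<longleftrightarrow> (\<forall>a b. X (a + b) = X a + X b) \<and> (\<forall>a b. X (a * b) = X a * b + a * X b)"

lemma derivation_add: "derivation X \<Longrightarrow> X (a + b) = X a + X b"
  and derivation_mult: "derivation X \<Longrightarrow> X (a * b) = X a * b + a * X b"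
  by (simp_all add: derivation_def)

lemma derivation_additive: "derivation X \<Longrightarrow> Modules.additive X"
  by (rule additiveI) (simp add: derivation_add)

lemmas derivation_0 = Modules.additive.zero[OF derivation_additive]
  and derivation_sum = Modules.additive.sum[OF derivation_additive]

lemma derivation_commutator:
  assumes X: "derivation X" and Y: "derivation Y"
  shows "derivation (\<lambda>f. X (Y f) - Y (X f))"
  unfolding derivation_def
  by (simp add: derivation_add[OF X] derivation_add[OF Y] derivation_mult[OF X]
      derivation_mult[OF Y] algebra_simps)

lemma additive_funpow:
  fixes X :: "'a::ab_group_add \<Rightarrow> 'a"
  assumes "Modules.additive X" shows "Modules.additive (X ^^ n)"
proof (rule additiveI)
  show "(X ^^ n) (f + g) = (X ^^ n) f + (X ^^ n) g" for f g
    by (induction n) (simp_all add: Modules.additive.add[OF assms])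
qed

lemmas derivation_funpow_additive = additive_funpow[OF derivation_additive]

lemma derivation_funpow_mult:
  assumes X: "derivation X"
  shows "(X ^^ n) (f * g) = (\<Sum>i\<le>n. of_nat (n choose i) * ((X ^^ i) f * (X ^^ (n - i)) g))"
proof (induction n)
  case (Suc n)
  have of_nat: "X (of_nat k * a) = of_nat k * X a" for k a
    by (induction k) (simp_all add: derivation_0[OF X] derivation_add[OF X] distrib_right)
  define t where "t i j = (X ^^ i) f * (X ^^ j) g" for i j
  have Xt: "X (t i j) = t (Suc i) j + t i (Suc j)" for i j
    by (simp add: t_def derivation_mult[OF X])
  have "(X ^^ Suc n) (f * g) = (\<Sum>i\<le>n. of_nat (n choose i) * (t (Suc i) (n - i) + t i (Suc (n - i))))"
    by (simp add: Suc derivation_sum[OF X] of_nat Xt flip: t_def)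
  also have "\<dots> = (\<Sum>i\<le>n. of_nat (n choose i) * t (Suc i) (Suc n - Suc i))
      + (\<Sum>i\<le>n. of_nat (n choose i) * t i (Suc n - i))"
    unfolding sum.distrib[symmetric] by (rule sum.cong) (auto simp: distrib_left Suc_diff_le)
  also have "(\<Sum>i\<le>n. of_nat (n choose i) * t i (Suc n - i))
      = (\<Sum>i\<le>Suc n. of_nat (n choose i) * t i (Suc n - i))"
    by (simp add: binomial_eq_0)
  also have "\<dots> = t 0 (Suc n) + (\<Sum>i\<le>n. of_nat (n choose Suc i) * t (Suc i) (Suc n - Suc i))"
    by (subst sum.atMost_Suc_shift) simp
  also have "(\<Sum>i\<le>n. of_nat (n choose i) * t (Suc i) (Suc n - Suc i)) +
      (t 0 (Suc n) + (\<Sum>i\<le>n. of_nat (n choose Suc i) * t (Suc i) (Suc n - Suc i)))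
      = t 0 (Suc n) + (\<Sum>i\<le>n. of_nat (Suc n choose Suc i) * t (Suc i) (Suc n - Suc i))"
    by (simp add: distrib_right sum.distrib del: diff_Suc_Suc)
  also have "\<dots> = (\<Sum>i\<le>Suc n. of_nat (Suc n choose i) * t i (Suc n - i))"
    by (subst sum.atMost_Suc_shift) simp
  finally show ?case by (simp add: t_def)
qed simp

text \<open>The set is the largest \<open>X\<close>-stable ideal inside \<open>P\<close>. If the
  first iterates leaving \<open>P\<close> are the \<open>i\<close>-th for \<open>a\<close> and the
  \<open>j\<close>-th for \<open>b\<close>, then in the Leibniz expansion of order
  \<open>i + j\<close> of \<open>a * b\<close> every term but the one at \<open>i\<close> lies in
  \<open>P\<close>; its binomial coefficient is a positive integer, which \<open>nat\<close> keeps
  outside \<open>P\<close>.\<close>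

lemma prime_ideal_stable_core:
  assumes X: "derivation X" and P: "prime_ideal P" and nat: "\<And>n. of_nat (Suc n) \<notin> P"
  shows "prime_ideal {f. \<forall>i. (X ^^ i) f \<in> P}"
proof -
  let ?Q = "{f. \<forall>i. (X ^^ i) f \<in> P}"
  have P': "isideal P" "1 \<notin> P" and prime: "\<And>a b. a * b \<in> P \<Longrightarrow> a \<in> P \<or> b \<in> P"
    using P by (auto simp: prime_ideal_def)
  have add: "(X ^^ i) (a + b) = (X ^^ i) a + (X ^^ i) b" and zero: "(X ^^ i) 0 = 0" for i a b
    using Modules.additive.add[OF derivation_funpow_additive[OF X]]
      Modules.additive.zero[OF derivation_funpow_additive[OF X]] by auto
  have "isideal ?Q"
  proof (rule isidealI)
    fix c a assume "a \<in> ?Q"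
    then show "c * a \<in> ?Q"
      by (auto simp: derivation_funpow_mult[OF X] intro!: isideal_sum isideal_mult P')
  qed (auto simp: add zero intro: isideal_add isideal_0 P')
  moreover have "1 \<notin> ?Q" using P' by (auto intro!: exI[of _ 0])
  moreover have "a \<in> ?Q \<or> b \<in> ?Q" if ab: "a * b \<in> ?Q" for a b
  proof (rule ccontr)
    assume "\<not> (a \<in> ?Q \<or> b \<in> ?Q)"
    then have ex: "\<exists>i. (X ^^ i) a \<notin> P" "\<exists>i. (X ^^ i) b \<notin> P" by auto
    define i where "i = (LEAST i. (X ^^ i) a \<notin> P)"
    define j where "j = (LEAST i. (X ^^ i) b \<notin> P)"
    have i: "(X ^^ i) a \<notin> P" "\<And>k. k < i \<Longrightarrow> (X ^^ k) a \<in> P"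
      unfolding i_def using LeastI_ex[OF ex(1)] not_less_Least by blast+
    have j: "(X ^^ j) b \<notin> P" "\<And>k. k < j \<Longrightarrow> (X ^^ k) b \<in> P"
      unfolding j_def using LeastI_ex[OF ex(2)] not_less_Least by blast+
    let ?t = "\<lambda>k. of_nat (i + j choose k) * ((X ^^ k) a * (X ^^ (i + j - k)) b)"
    have "(\<Sum>k\<in>{..i+j} - {i}. ?t k) \<in> P"
    proof (rule isideal_sum[OF P'(1)], rule isideal_mult[OF P'(1)])
      fix k assume k: "k \<in> {..i+j} - {i}"
      show "(X ^^ k) a * (X ^^ (i + j - k)) b \<in> P"
      proof (cases "k < i")
        case True then show ?thesis by (intro isideal_mult_right P' i)
      next
        case False
        with k have "i + j - k < j" by auto
        then show ?thesis by (intro isideal_mult P' j)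
      qed
    qed
    moreover have "(\<Sum>k\<le>i+j. ?t k) \<in> P"
      using ab by (simp flip: derivation_funpow_mult[OF X])
    moreover have "(\<Sum>k\<le>i+j. ?t k) = ?t i + (\<Sum>k\<in>{..i+j} - {i}. ?t k)"
      by (rule sum.remove) auto
    ultimately have "?t i \<in> P"
      using isideal_diff[OF P'(1), of "\<Sum>k\<le>i+j. ?t k" "\<Sum>k\<in>{..i+j} - {i}. ?t k"]
      by (simp only: add_diff_cancel_right')
    moreover have "of_nat (i + j choose i) \<notin> P"
    proof -
      have "i + j choose i \<noteq> 0" by simp
      then obtain n where "(i + j choose i) = Suc n" by (metis not0_implies_Suc)
      then show ?thesis using nat by metis
    qed
    ultimately have "(X ^^ i) a * (X ^^ j) b \<in> P" using prime by auto
    then show False using prime i j by blast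
  qed
  ultimately show ?thesis unfolding prime_ideal_def by blast
qed

text \<open>Vanishing to order \<open>n\<close> along \<open>P\<close>, as tested by the operators
  in \<open>\<D>\<close>. Differential powers behave like symbolic powers: for a prime
  \<open>P\<close>, factors outside \<open>P\<close> can be cancelled.\<close>

primrec dpow :: "('a::comm_ring_1 \<Rightarrow> 'a) set \<Rightarrow> 'a set \<Rightarrow> nat \<Rightarrow> 'a set" where
  "dpow \<D> P 0 = UNIV"
| "dpow \<D> P (Suc n) = {f \<in> P. \<forall>X\<in>\<D>. X f \<in> dpow \<D> P n}"

context
  fixes \<D> :: "('a::comm_ring_1 \<Rightarrow> 'a) set" and I :: "'a set"
  assumes der: "\<And>X. X \<in> \<D> \<Longrightarrow> derivation X"
    and ideal: "isideal I"
    and pres: "\<And>X f. X \<in> \<D> \<Longrightarrow> f \<in> I \<Longrightarrow> X f \<in> I"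
    and comm: "\<And>X Y. X \<in> \<D> \<Longrightarrow> Y \<in> \<D> \<Longrightarrow> (\<lambda>f. X (Y f) - Y (X f)) \<in> \<D>"
begin

lemma dpow_Suc_subset: "dpow \<D> P (Suc n) \<subseteq> dpow \<D> P n"
  by (induction n) auto

lemma dpow_add:
  assumes P: "isideal P" shows "f \<in> dpow \<D> P n \<Longrightarrow> g \<in> dpow \<D> P n \<Longrightarrow> f + g \<in> dpow \<D> P n"
  by (induction n arbitrary: f g) (auto simp: derivation_add[OF der] intro: isideal_add[OF P])

lemma dpow_mult:
  assumes P: "isideal P" shows "f \<in> dpow \<D> P n \<Longrightarrow> g * f \<in> dpow \<D> P n"
proof (induction n arbitrary: f g)
  case (Suc n)
  have "X (g * f) \<in> dpow \<D> P n" if "X \<in> \<D>" for X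
    using that Suc dpow_Suc_subset[of P n]
    by (auto simp: derivation_mult[OF der] intro!: dpow_add[OF P])
  with Suc.prems show ?case by (auto intro: isideal_mult[OF P])
qed simp

lemma isideal_dpow:
  assumes P: "isideal P" shows "isideal (dpow \<D> P n)"
proof (rule isidealI)
  have "0 \<in> dpow \<D> P n" if "f \<in> dpow \<D> P n" for f
    using dpow_mult[OF P that, of 0] by simp
  show "0 \<in> dpow \<D> P n"
    by (induction n) (auto simp: isideal_0[OF P] derivation_0[OF der])
qed (auto intro: dpow_add[OF P] dpow_mult[OF P])

lemma dpow_ideal_subset: "I \<subseteq> P \<Longrightarrow> f \<in> I \<Longrightarrow> f \<in> dpow \<D> P n"
  by (induction n arbitrary: f) (auto intro: pres)

lemma dpow_mono: "P \<subseteq> Q \<Longrightarrow> dpow \<D> P n \<subseteq> dpow \<D> Q n"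
  by (induction n) auto

lemma dpow_mult_prime:
  assumes P: "isideal P" shows "f \<in> P \<Longrightarrow> g \<in> dpow \<D> P n \<Longrightarrow> f * g \<in> dpow \<D> P (Suc n)"
proof (induction n arbitrary: g)
  case 0 then show ?case by (auto intro: isideal_mult_right[OF P])
next
  case (Suc n)
  have "X (f * g) \<in> dpow \<D> P (Suc n)" if "X \<in> \<D>" for X
    unfolding derivation_mult[OF der[OF that]]
    by (intro dpow_add[OF P] dpow_mult[OF P] Suc) (use Suc that in auto)
  then show ?case using Suc.prems by (auto intro: isideal_mult_right[OF P])
qed

text \<open>Induction on the order: \<open>h * X f\<close> is \<open>X (h * f) - X h * f\<close>,
  and both terms vanish to the lower order.\<close>

lemma dpow_cancel:
  assumes P: "prime_ideal P" and h: "h \<notin> P"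
  shows "h * f \<in> dpow \<D> P n \<Longrightarrow> f \<in> dpow \<D> P n"
proof (induction n arbitrary: f)
  case (Suc n)
  have P': "isideal P" using P by (simp add: prime_ideal_def)
  have "f \<in> P" using P h Suc.prems by (auto simp: prime_ideal_def)
  moreover have "X f \<in> dpow \<D> P n" if X: "X \<in> \<D>" for X
  proof (rule Suc.IH)
    have "f \<in> dpow \<D> P n" using Suc dpow_Suc_subset[of P n] by blast
    moreover have "X (h * f) \<in> dpow \<D> P n" using Suc.prems X by auto
    ultimately have "X (h * f) - X h * f \<in> dpow \<D> P n"
      by (intro isideal_diff[OF isideal_dpow[OF P']] dpow_mult[OF P'])
    then show "h * X f \<in> dpow \<D> P n" by (simp add: derivation_mult[OF der[OF X]])
  qed
  ultimately show ?case by auto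
qed simp

text \<open>An element whose iterates under \<open>X\<close> all vanish to order \<open>n\<close> at
  \<open>P\<close> vanishes to that order at the smaller ideal as well. This applies to elements
  that \<open>X\<close> kills modulo \<open>I\<close>, and is the reason why such elements do not
  distinguish \<open>P\<close> from its stable core.\<close>

lemma dpow_stable_core:
  assumes P: "isideal P" and X: "X \<in> \<D>"
  shows "(\<And>i. (X ^^ i) f \<in> dpow \<D> P n) \<Longrightarrow> f \<in> dpow \<D> {f. \<forall>i. (X ^^ i) f \<in> P} n"
proof (induction n arbitrary: f)
  case (Suc n)
  \<comment> \<open>The field \<open>Y\<close> is kept general: moving \<open>X\<close> past
    \<open>Y\<close> produces the commutator, which is again in \<open>\<D>\<close> and meets one
    iterate of \<open>X\<close> fewer.\<close>
  have *: "(X ^^ i) (Y f) \<in> dpow \<D> P n" if "Y \<in> \<D>" "\<And>i. (X ^^ i) f \<in> dpow \<D> P (Suc n)" for Y i f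
    using that
  proof (induction i arbitrary: Y f)
    case 0
    from 0(2)[of 0] 0(1) show ?case by auto
  next
    case (Suc i)
    have "(X ^^ i) (Y (X f)) \<in> dpow \<D> P n"
    proof (rule Suc.IH[OF Suc.prems(1)])
      show "(X ^^ j) (X f) \<in> dpow \<D> P (Suc n)" for j
        using Suc.prems(2)[of "Suc j"] by (simp only: funpow_Suc_right o_apply)
    qed
    moreover have "(X ^^ i) (X (Y f) - Y (X f)) \<in> dpow \<D> P n"
      by (rule Suc.IH[OF comm[OF X Suc.prems(1)] Suc.prems(2)])
    ultimately have "(X ^^ i) (Y (X f) + (X (Y f) - Y (X f))) \<in> dpow \<D> P n"
      unfolding Modules.additive.add[OF derivation_funpow_additive[OF der[OF X]]]
      by (rule dpow_add[OF P])
    then show ?case by (simp add: funpow_swap1)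
  qed
  have "(X ^^ i) f \<in> P" for i using Suc.prems[of i] by auto
  moreover have "Y f \<in> dpow \<D> {f. \<forall>i. (X ^^ i) f \<in> P} n" if "Y \<in> \<D>" for Y
    by (rule Suc.IH) (rule *[OF that Suc.prems])
  ultimately show ?case by auto
qed simp

text \<open>
  If \<open>A * B\<close> is a unit multiple of an \<open>X\<close>-constant, then \<open>A\<close> cannot lie in \<open>P\<close> but outside the
  largest \<open>X\<close>-stable subideal \<open>Q\<close>: since \<open>A * B\<close> vanishes at \<open>P\<close> one order more than \<open>B\<close>, and an
  \<open>X\<close>-constant vanishes at \<open>Q\<close> to the same order as at \<open>P\<close>, \<open>B\<close> would vanish at \<open>Q\<close> to infinite order.
\<close>
lemma divisor_in_stable_core:
  assumes P: "prime_ideal P" and IP: "I \<subseteq> P" and nat: "\<And>n. of_nat (Suc n) \<notin> P"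
    and X: "X \<in> \<D>" and A: "A \<in> P" and AB: "A * B - u * J \<in> I" and u: "u \<notin> P"
    and XJ: "X J \<in> I" and J: "J \<notin> dpow \<D> P N"
  shows "A \<in> {f. \<forall>i. (X ^^ i) f \<in> P}" (is "A \<in> ?Q")
proof (rule ccontr)
  assume AQ: "A \<notin> ?Q"
  have P': "isideal P" using P by (simp add: prime_ideal_def)
  have Q: "prime_ideal ?Q"
    by (rule prime_ideal_stable_core[OF der[OF X] P nat])
  then have Q': "isideal ?Q" by (simp add: prime_ideal_def)
  have X0: "(X ^^ i) f \<in> I" if "f \<in> I" for i f
    by (induction i) (auto simp: that pres[OF X])
  have IQ: "I \<subseteq> ?Q" using X0 IP by auto
  have QP: "?Q \<subseteq> P" by (auto dest: spec[of _ 0])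
  have cong: "A * B \<in> dpow \<D> R n \<longleftrightarrow> u * J \<in> dpow \<D> R n" if "isideal R" "I \<subseteq> R" for R n
    by (rule isideal_diff_cong[OF isideal_dpow[OF that(1)] dpow_ideal_subset[OF that(2) AB]])
  have B: "B \<in> dpow \<D> ?Q n" for n
  proof (induction n)
    case (Suc n)
    then have "B \<in> dpow \<D> P n" using dpow_mono[OF QP] by blast
    then have "A * B \<in> dpow \<D> P (Suc n)" by (rule dpow_mult_prime[OF P' A])
    then have J: "J \<in> dpow \<D> P (Suc n)"
      using cong[OF P' IP] dpow_cancel[OF P u] by blast
    have "(X ^^ i) J \<in> dpow \<D> P (Suc n)" for i
    proof (cases i)
      case (Suc i')
      have "(X ^^ i') (X J) \<in> I" by (rule X0[OF XJ])
      then show ?thesis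
        unfolding Suc funpow_Suc_right o_apply by (rule dpow_ideal_subset[OF IP])
    qed (use J in simp)
    then have "J \<in> dpow \<D> ?Q (Suc n)" by (rule dpow_stable_core[OF P' X])
    then have "A * B \<in> dpow \<D> ?Q (Suc n)"
      using cong[OF Q' IQ] dpow_mult[OF Q'] by blast
    then show ?case by (rule dpow_cancel[OF Q AQ])
  qed simp
  have "u * J \<in> dpow \<D> P N"
    using cong[OF P' IP] dpow_mult[OF P' subsetD[OF dpow_mono[OF QP] B], of A] by blast
  then show False using dpow_cancel[OF P u] J by blast
qed

text \<open>Along the word a decreasing chain of primes containing \<open>A\<close> is built,
  starting from \<open>m\<close>. In \<open>foldr\<close> the appended letter \<open>X\<close> acts
  first, so it suffices that \<open>X\<close> maps the new prime, the stable core of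
  \<open>P\<close>, into \<open>P\<close>. The witness \<open>J\<close> may change from letter to
  letter. Its finite order is assumed only at \<open>m\<close>, which passes to every smaller prime
  by monotonicity of \<open>dpow\<close>.\<close>

lemma divisor_in_word_kernel:
  assumes m: "prime_ideal m" and Im: "I \<subseteq> m" and nat: "\<And>n. of_nat (Suc n) \<notin> m"
    and A: "A \<in> m" and \<L>: "\<L> \<subseteq> \<D>"
    and AB: "\<And>X. X \<in> \<L> \<Longrightarrow> \<exists>B u J n. A * B - u * J \<in> I \<and> u \<notin> m \<and> X J \<in> I \<and> J \<notin> dpow \<D> m n"
    and ws: "set ws \<subseteq> \<L>"
  shows "foldr (\<lambda>X. X) ws A \<in> m"
proof -
  have "\<exists>P. prime_ideal P \<and> I \<subseteq> P \<and> P \<subseteq> m \<and> A \<in> P \<and> (\<forall>f\<in>P. foldr (\<lambda>X. X) ws f \<in> m)"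
    using ws
  proof (induction ws rule: rev_induct)
    case Nil then show ?case using m Im A by auto
  next
    case (snoc X ws)
    then obtain P where P: "prime_ideal P" "I \<subseteq> P" "P \<subseteq> m" "A \<in> P"
      and w: "\<And>f. f \<in> P \<Longrightarrow> foldr (\<lambda>X. X) ws f \<in> m" by auto
    have X: "X \<in> \<L>" "X \<in> \<D>" using snoc.prems \<L> by auto
    let ?Q = "{f. \<forall>i. (X ^^ i) f \<in> P}"
    have natP: "of_nat (Suc n) \<notin> P" for n using nat P by blast
    obtain B u J n where B: "A * B - u * J \<in> I" "u \<notin> P" "X J \<in> I" "J \<notin> dpow \<D> P n"
      using AB[OF X(1)] P dpow_mono[OF P(3)] by blast
    have "prime_ideal ?Q"
      by (rule prime_ideal_stable_core[OF der[OF X(2)] P(1) natP])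
    moreover have "A \<in> ?Q"
      by (rule divisor_in_stable_core[OF P(1,2) natP X(2) P(4) B])
    moreover have "(X ^^ i) f \<in> P" if "f \<in> I" for i f
    proof -
      have "(X ^^ i) f \<in> I" by (induction i) (auto simp: that pres[OF X(2)])
      then show ?thesis using P by blast
    qed
    moreover have "?Q \<subseteq> m" using P by (auto dest: spec[of _ 0])
    moreover have "foldr (\<lambda>X. X) (ws @ [X]) f \<in> m" if "f \<in> ?Q" for f
      using that w[of "X f"] by (auto dest: spec[of _ 1])
    ultimately show ?case by (intro exI[of _ ?Q]) auto
  qed
  then show ?thesis by blast
qed

end

subsection \<open>Divisibility by variables\<close>

lemma mcoeff_set_zero:
  fixes f :: "'v::finite mfps"
  shows "mcoeff (set_zero S f) \<alpha> = (if set_mset \<alpha> \<inter> S = {} then mcoeff f \<alpha> else 0)"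
proof -
  let ?g = "\<lambda>v. if v \<in> S then 0 else mvar v :: 'v mfps"
  have "(\<Prod>v\<in>#\<beta>. ?g v) = (if set_mset \<beta> \<inter> S = {} then mon \<beta> else 0)" for \<beta>
    by (induction \<beta>) (auto simp: mon_add_mset)
  then have "mcoeff (set_zero S f) \<alpha> = (\<Sum>\<beta> | size \<beta> \<le> size \<alpha>.
      if \<beta> = \<alpha> then (if set_mset \<alpha> \<inter> S = {} then mcoeff f \<alpha> else 0) else 0)"
    unfolding set_zero_def mcoeff_msubst by (intro sum.cong) auto
  then show ?thesis by (simp add: finite_bounded_multisets)
qed

lemma mfps_decompose:
  fixes F :: "'v::finite mfps"
  assumes F: "\<And>\<alpha>. mcoeff F \<alpha> \<noteq> 0 \<Longrightarrow> \<exists>v\<in>T. v \<in># \<alpha>"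
  obtains G where "F = (\<Sum>v\<in>T. mvar v * G v)" "\<And>v k. F \<in> mpow (Suc k) \<Longrightarrow> G v \<in> mpow k"
proof -
  \<comment> \<open>A monomial may be divisible by several variables of \<open>T\<close>;
    \<open>pick\<close> assigns it to exactly one of them, so that no coefficient is counted
    twice.\<close>
  define pick where "pick \<beta> = (SOME v. v \<in> T \<and> v \<in># \<beta>)" for \<beta>
  define G where "G v = Mfps (\<lambda>\<alpha>. if v = pick (add_mset v \<alpha>) then mcoeff F (add_mset v \<alpha>) else 0)" for v
  have pick: "pick \<alpha> \<in> T \<and> pick \<alpha> \<in># \<alpha>" if "mcoeff F \<alpha> \<noteq> 0" for \<alpha>
    unfolding pick_def by (rule someI_ex) (use F[OF that] in auto)
  have "F = (\<Sum>v\<in>T. mvar v * G v)"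
  proof (rule mfps_eqI)
    fix \<alpha>
    have "mcoeff (\<Sum>v\<in>T. mvar v * G v) \<alpha> = (\<Sum>v\<in>T. if v = pick \<alpha> then mcoeff F \<alpha> else 0)"
      unfolding mcoeff_sum
    proof (rule sum.cong)
      fix v assume "v \<in> T"
      show "mcoeff (mvar v * G v) \<alpha> = (if v = pick \<alpha> then mcoeff F \<alpha> else 0)"
        using pick[of \<alpha>] by (auto simp: mcoeff_mvar_mult G_def)
    qed simp
    then show "mcoeff F \<alpha> = mcoeff (\<Sum>v\<in>T. mvar v * G v) \<alpha>"
      using pick[of \<alpha>] by auto
  qed
  moreover have "G v \<in> mpow k" if "F \<in> mpow (Suc k)" for v k
    using that by (auto simp: mpow_def G_def)
  ultimately show ?thesis using that by blast
qed

lemma mpow_Suc_decompose: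
  fixes F :: "'v::finite mfps"
  assumes "F \<in> mpow (Suc k)"
  obtains G where "F = (\<Sum>v\<in>UNIV. mvar v * G v)" "\<And>v. G v \<in> mpow k"
proof (rule mfps_decompose[of F UNIV])
  fix \<alpha> assume "mcoeff F \<alpha> \<noteq> 0"
  then have "\<alpha> \<noteq> {#}" using assms by (auto simp: mpow_def)
  then show "\<exists>v\<in>UNIV. v \<in># \<alpha>" by (auto simp: multiset_nonemptyE)
qed (use assms that in blast)

text \<open>The universal case is \<open>f(x + y) - f(x)\<close> in doubled variables: it vanishes
  at \<open>y = 0\<close> and is therefore a combination of the \<open>y\<close> variables.
  Substituting \<open>g'\<close> for x and \<open>g - g'\<close> for y gives the general
  case.\<close>

lemma msubst_diff_decompose:
  fixes g g' :: "'v::finite \<Rightarrow> 'u::finite mfps"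
  assumes g: "\<And>v. g v \<in> mpow 1" and g': "\<And>v. g' v \<in> mpow 1"
  obtains c where "msubst g f - msubst g' f = (\<Sum>v\<in>UNIV. (g v - g' v) * c v)"
proof -
  let ?a = "\<lambda>v. mvar (Inl v) + mvar (Inr v) :: ('v + 'v) mfps" and ?b = "\<lambda>v. mvar (Inl v) :: ('v + 'v) mfps"
  let ?z = "\<lambda>v. if v \<in> range Inr then 0 else mvar v :: ('v + 'v) mfps"
  let ?t = "\<lambda>w. case w of Inl v \<Rightarrow> g' v | Inr v \<Rightarrow> g v - g' v"
  have a: "?a v \<in> mpow 1" and b: "?b v \<in> mpow 1" for v by (auto simp: mpow_1_iff)
  have z: "?z v \<in> mpow 1" for v by (auto simp: mpow_1_iff)
  have t: "?t w \<in> mpow 1" for w using g g' by (auto split: sum.split intro: mpow_diff)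
  define F where "F = msubst ?a f - msubst ?b f"
  have "set_zero (range Inr) F = 0"
    unfolding F_def set_zero_def by (auto simp: msubst_diff msubst_msubst[OF z a] msubst_msubst[OF z b]
      msubst_add msubst_mvar[OF z])
  then have "mcoeff F \<alpha> = 0" if "set_mset \<alpha> \<inter> range Inr = {}" for \<alpha>
    using mcoeff_set_zero[of "range Inr" F \<alpha>] that by simp
  then have "mcoeff F \<alpha> \<noteq> 0 \<Longrightarrow> \<exists>v\<in>range Inr. v \<in># \<alpha>" for \<alpha> by blast
  then obtain G where G: "F = (\<Sum>v\<in>range Inr. mvar v * G v)"
    using mfps_decompose[of F "range Inr"] by metis
  have "msubst g f - msubst g' f = msubst ?t F"
    unfolding F_def by (simp add: msubst_diff msubst_msubst[OF t a] msubst_msubst[OF t b] msubst_add msubst_mvar[OF t])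
  also have "\<dots> = (\<Sum>v\<in>range Inr. ?t v * msubst ?t (G v))"
    unfolding G by (simp add: msubst_sum msubst_mult[OF t] msubst_mvar[OF t])
  also have "\<dots> = (\<Sum>v\<in>UNIV. (g v - g' v) * msubst ?t (G (Inr v)))"
    by (subst sum.reindex) auto
  finally show ?thesis by (rule that)
qed

lemma msubst_diff_in_ideal:
  fixes g g' :: "'v::finite \<Rightarrow> 'u::finite mfps"
  assumes g: "\<And>v. g v \<in> mpow 1" and g': "\<And>v. g' v \<in> mpow 1" and J: "isideal J"
    and d: "\<And>v. g v - g' v \<in> J"
  shows "msubst g f - msubst g' f \<in> J"
proof -
  obtain c where "msubst g f - msubst g' f = (\<Sum>v\<in>UNIV. (g v - g' v) * c v)"
    using msubst_diff_decompose[OF g g'] .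
  then show ?thesis using d by (auto intro!: isideal_sum[OF J] isideal_mult_right[OF J])
qed

subsection \<open>Leading forms\<close>

definition lform :: "nat \<Rightarrow> 'v::finite mfps \<Rightarrow> ('v \<Rightarrow> complex) \<Rightarrow> complex" where
  "lform k f x = (\<Sum>\<alpha> | size \<alpha> = k. mcoeff f \<alpha> * (\<Prod>v\<in>#\<alpha>. x v))"

lemma finite_size_eq [simp]: "finite {\<alpha> :: 'v::finite multiset. size \<alpha> = k}"
  by (rule finite_subset[OF _ finite_bounded_multisets[of k]]) auto

text \<open>Continuity of \<open>X\<close> is a consequence here, not a hypothesis: a series of
  order \<open>k + 1\<close> is a combination of variables with cofactors of order \<open>k\<close>,
  to which the product rule applies.\<close>

lemma derivation_mpow:
  fixes f :: "'v::finite mfps"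
  assumes X: "derivation X"
  shows "f \<in> mpow (Suc k) \<Longrightarrow> X f \<in> mpow k"
proof (induction k arbitrary: f)
  case (Suc k)
  obtain G where G: "f = (\<Sum>v\<in>UNIV. mvar v * G v)" "\<And>v. G v \<in> mpow (Suc k)"
    using mpow_Suc_decompose[OF Suc.prems] by metis
  have "X (mvar v * G v) \<in> mpow (Suc k)" for v
    unfolding derivation_mult[OF X] using G(2)[of v] Suc.IH[OF G(2), of v]
      mpow_mult[of "mvar v" 1 "X (G v)" k] by (auto intro!: mpow_add mpow_mult_left)
  then show ?case unfolding G(1) derivation_sum[OF X] by (intro mpow_sum)
qed simp

lemma derivation_funpow_mpow:
  fixes f :: "'v::finite mfps"
  assumes X: "derivation X" shows "f \<in> mpow (i + k) \<Longrightarrow> (X ^^ i) f \<in> mpow k"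
  by (induction i arbitrary: k) (auto intro!: derivation_mpow[OF X])

text \<open>A form of degree \<open>k\<close> survives \<open>k\<close> differentiations at the
  origin only if each of its factors is differentiated exactly once, so only the value of
  \<open>X\<close> at the origin enters. Iterating one field therefore evaluates the leading form at
  the vector of that field.\<close>

lemma derivation_funpow_lform:
  fixes f :: "'v::finite mfps"
  assumes X: "derivation X" and c: "\<And>c. X (mconst c) = 0" and f: "f \<in> mpow k"
  shows "mcoeff ((X ^^ k) f) {#} = fact k * lform k f (\<lambda>v. mcoeff (X (mvar v)) {#})"
proof -
  let ?x = "\<lambda>v. mcoeff (X (mvar v)) {#}"
  define e where "e n f = mcoeff ((X ^^ n) f) {#}" for n f
  have e_add: "e n (f + g) = e n f + e n g" for n f g
    by (simp add: e_def Modules.additive.add[OF derivation_funpow_additive[OF X]])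
  have e_sum: "e n (sum f A) = (\<Sum>x\<in>A. e n (f x))" for n and f :: "'b \<Rightarrow> 'v mfps" and A
    by (simp add: e_def Modules.additive.sum[OF derivation_funpow_additive[OF X]])
  have e_mult: "e n (f * g) = (\<Sum>i\<le>n. of_nat (n choose i) * (e i f * e (n - i) g))" for n f g
    unfolding e_def derivation_funpow_mult[OF X] mcoeff_sum by (simp add: of_nat_mconst)
  have e_small: "e n f = 0" if "f \<in> mpow (Suc n)" for n f
    using derivation_funpow_mpow[OF X, of f n 1] that by (simp add: e_def mpow_1_iff)
  have e_const: "e n (mconst b * g) = b * e n g" for n b g
  proof -
    have "(X ^^ n) (mconst b * g) = mconst b * (X ^^ n) g" for g
      by (induction n) (auto simp: derivation_mult[OF X] c)
    then show ?thesis by (simp add: e_def)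
  qed
  have e_mon: "e (size \<alpha>) (mon \<alpha>) = fact (size \<alpha>) * (\<Prod>v\<in>#\<alpha>. ?x v)" for \<alpha>
  proof (induction \<alpha>)
    case empty then show ?case by (simp add: e_def)
  next
    case (add v \<alpha>)
    let ?n = "Suc (size \<alpha>)"
    \<comment> \<open>For \<open>i = 0\<close> the variable is left undifferentiated and vanishes at
      the origin; for \<open>i \<ge> 2\<close> too few derivatives remain for
      \<open>mon \<alpha>\<close>.\<close>
    have "e ?n (mvar v * mon \<alpha>) = (\<Sum>i\<le>?n. if i = 1 then of_nat ?n * (?x v * e (size \<alpha>) (mon \<alpha>)) else 0)"
      unfolding e_mult
    proof (rule sum.cong)
      fix i assume i: "i \<in> {..?n}"
      have "i = 0 \<or> i = 1 \<or> i \<ge> 2" by auto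
      then show "of_nat (?n choose i) * (e i (mvar v) * e (?n - i) (mon \<alpha>))
          = (if i = 1 then of_nat ?n * (?x v * e (size \<alpha>) (mon \<alpha>)) else 0)"
      proof (elim disjE)
        assume "i \<ge> 2"
        then have "Suc (?n - i) \<le> size \<alpha>" using i unfolding atMost_iff by linarith
        then have "mon \<alpha> \<in> mpow (Suc (?n - i))"
          using mon_in_mpow[of \<alpha>] mpow_antimono[of "Suc (?n - i)" "size \<alpha>"] i by auto
        then show ?thesis using \<open>i \<ge> 2\<close> e_small by auto
      qed (auto simp: e_def)
    qed simp
    then show ?case by (simp add: mon_add_mset add del: sum.atMost_Suc)
  qed
  have "e k f = e k (mtrunc k f)"
    using e_add[of k "mtrunc k f" "f - mtrunc k f"] e_small[OF diff_mtrunc_in_mpow[of f k]] by simp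
  also have "\<dots> = (\<Sum>\<alpha> | size \<alpha> \<le> k. mcoeff f \<alpha> * e k (mon \<alpha>))"
    by (simp add: mtrunc_def e_sum e_const)
  also have "\<dots> = (\<Sum>\<alpha> | size \<alpha> = k. mcoeff f \<alpha> * e k (mon \<alpha>))"
    by (rule sum.mono_neutral_right) (use f in \<open>auto simp: finite_bounded_multisets mpow_def\<close>)
  also have "\<dots> = fact k * lform k f ?x"
    unfolding lform_def sum_distrib_left by (rule sum.cong) (auto simp: e_mon)
  finally show ?thesis by (simp add: e_def)
qed

subsection \<open>Vanishing polynomial functions\<close>

text \<open>Induction on the set of variables: with the other values fixed, the sum is a polynomial
  in \<open>v\<close> that vanishes identically, so each of its coefficients does. The injective
  index map \<mu> keeps the shape of the claim when one variable is stripped off.\<close>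

lemma monomials_independent:
  fixes \<mu> :: "'i \<Rightarrow> 'v multiset"
  assumes "finite F"
  shows "finite A \<Longrightarrow> inj_on \<mu> A \<Longrightarrow> (\<And>a. a \<in> A \<Longrightarrow> set_mset (\<mu> a) \<subseteq> F) \<Longrightarrow>
    (\<And>x :: 'v \<Rightarrow> complex. (\<Sum>a\<in>A. c a * (\<Prod>v\<in>#\<mu> a. x v)) = 0) \<Longrightarrow> a \<in> A \<Longrightarrow> c a = 0"
  using assms
proof (induction F arbitrary: A \<mu> a rule: finite_induct)
  case empty
  then have "\<mu> b = {#}" if "b \<in> A" for b using that by auto
  then have "A = {a}" using empty.prems(2,5) by (auto simp: inj_on_def)
  with empty.prems(4)[of undefined] empty.prems(3)[of a] show ?case by simp
next
  case (insert v F)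
  define \<nu> where "\<nu> b = filter_mset (\<lambda>u. u \<noteq> v) (\<mu> b)" for b
  define n where "n b = count (\<mu> b) v" for b
  have mu: "\<mu> b = \<nu> b + replicate_mset (n b) v" for b
    unfolding \<nu>_def n_def by (rule multiset_eqI) auto
  \<comment> \<open>Only monomials with the same exponent of \<open>v\<close> as \<open>a\<close>
    enter the coefficient at \<open>n a\<close>, and on these the remaining part \<nu> is still
    injective.\<close>
  let ?A = "{b \<in> A. n b = n a}"
  show ?case
  proof (rule insert.IH[of ?A \<nu> a])
    show "inj_on \<nu> ?A"
      using insert.prems(2) by (auto simp: inj_on_def mu[abs_def])
    show "set_mset (\<nu> b) \<subseteq> F" if "b \<in> ?A" for b
      using insert.prems(3)[of b] that by (auto simp: \<nu>_def)
    fix x :: "'v \<Rightarrow> complex"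
    define q where "q = (\<Sum>b\<in>A. monom (c b * (\<Prod>u\<in>#\<nu> b. x u)) (n b))"
    have "poly q t = 0" for t
    proof -
      have "(\<Prod>u\<in>#\<mu> b. (x(v := t)) u) = (\<Prod>u\<in>#\<nu> b. x u) * t ^ n b" for b
      proof -
        have "(\<Prod>u\<in>#\<nu> b. (x(v := t)) u) = (\<Prod>u\<in>#\<nu> b. x u)"
          by (rule arg_cong[of _ _ prod_mset], rule image_mset_cong) (auto simp: \<nu>_def)
        then show ?thesis by (subst mu) (simp del: fun_upd_apply, simp)
      qed
      then show ?thesis using insert.prems(4)[of "x(v := t)"]
        by (simp add: q_def poly_sum poly_monom mult.assoc)
    qed
    then have "q = 0" using poly_all_0_iff_0 by blast
    then have "coeff q (n a) = 0" by simp
    then have "(\<Sum>b\<in>A. if n b = n a then c b * (\<Prod>u\<in>#\<nu> b. x u) else 0) = 0"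
      by (simp add: q_def coeff_sum)
    then show "(\<Sum>b\<in>?A. c b * (\<Prod>u\<in>#\<nu> b. x u)) = 0"
      using insert.prems(1) by (simp add: sum.inter_filter)
  qed (use insert.prems in auto)
qed

lemma lform_eq_0D:
  assumes "\<And>x. lform k f x = 0" "size \<alpha> = k" shows "mcoeff f \<alpha> = 0"
  by (rule monomials_independent[where F = UNIV and A = "{\<alpha>. size \<alpha> = k}" and \<mu> = "\<lambda>\<alpha>. \<alpha>"])
    (use assms in \<open>auto simp: lform_def\<close>)

lemma poly_of_real_eq_0:
  assumes "\<And>t :: real. poly q (complex_of_real t) = 0" shows "q = 0"
proof (rule ccontr)
  assume "q \<noteq> 0"
  then have "finite {x. poly q x = 0}" by (rule poly_roots_finite)
  then have "finite (range complex_of_real)"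
    by (rule rev_finite_subset) (use assms in auto)
  then show False
    using finite_imageD[of complex_of_real UNIV] infinite_UNIV_char_0 by (auto simp: inj_on_def)
qed

text \<open>On the complex line through \<open>x\<close> in direction \<open>y\<close> the form is a
  polynomial in one variable, and infinitely many real zeros make it zero. With
  \<open>s = \<i>\<close> this carries vanishing from a real subspace to its
  complexification.\<close>

lemma lform_real_combination:
  assumes "\<And>t :: real. lform k f (\<lambda>v. x v + complex_of_real t * y v) = 0"
  shows "lform k f (\<lambda>v. x v + s * y v) = 0"
proof -
  define q where "q = (\<Sum>\<alpha> | size \<alpha> = k. smult (mcoeff f \<alpha>) (\<Prod>v\<in>#\<alpha>. [:x v, y v:]))"
  have *: "poly (\<Prod>v\<in>#\<alpha>. [:x v, y v:]) t = (\<Prod>v\<in>#\<alpha>. x v + t * y v)" for \<alpha> t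
    by (induction \<alpha>) (auto simp: algebra_simps)
  have "poly q t = lform k f (\<lambda>v. x v + t * y v)" for t
    by (simp add: q_def lform_def poly_sum *)
  then show ?thesis using poly_of_real_eq_0[of q] assms by (metis poly_0)
qed

text \<open>Cramer's rule: entry (i, j) of the adjugate is the determinant of \<open>A\<close> with
  column i replaced by the j-th unit vector. The columns are written as rows, so linearity in a row
  and equality of rows can be used.\<close>

lemma adjugate_exists:
  fixes A :: "'a::comm_ring_1^'n^'n"
  obtains B where "B ** A = mat (det A)"
proof -
  define B where "B = (\<chi> i j. det (\<chi> r. if r = i then axis j 1 else column r A))"
  have "(B ** A) $ i $ l = mat (det A) $ i $ l" for i l
  proof -
    have "(B ** A) $ i $ l = (\<Sum>j\<in>UNIV. A $ j $ l * det (\<chi> r. if r = i then axis j 1 else column r A))"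
      by (simp add: matrix_matrix_mult_def B_def mult.commute)
    also have "\<dots> = (\<Sum>j\<in>UNIV. det (\<chi> r. if r = i then A $ j $ l *s axis j 1 else column r A))"
      by (simp add: det_row_mul[symmetric])
    also have "\<dots> = det (\<chi> r. if r = i then (\<Sum>j\<in>UNIV. A $ j $ l *s axis j 1) else column r A)"
      by (rule det_linear_row_sum[symmetric]) simp
    also have "(\<Sum>j\<in>UNIV. A $ j $ l *s axis j 1) = column l A"
      by (simp add: vec_eq_iff column_def axis_def if_distrib[of "\<lambda>x. _ * x"] cong: if_cong)
    also have "det (\<chi> r. if r = i then column l A else column r A) = (if i = l then det A else 0)"
    proof (cases "i = l")
      case True
      then have "(\<chi> r. if r = i then column l A else column r A) = transpose A"
        by (simp add: vec_eq_iff column_def transpose_def)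
      then show ?thesis using True by (simp add: det_transpose)
    next
      case False
      then show ?thesis
        by (auto intro!: det_identical_rows[of i l] simp: row_def)
    qed
    finally show ?thesis by (simp add: mat_def)
  qed
  then show ?thesis by (intro that[of B]) (simp add: vec_eq_iff)
qed

section \<open>Formal normal coordinates\<close>

abbreviation hol :: "'N \<Rightarrow> ('N + 'N) mfps" where "hol i \<equiv> mvar (Inl i)"
abbreviation anti :: "'N \<Rightarrow> ('N + 'N) mfps" where "anti i \<equiv> mvar (Inr i)"

lemma hol_mpow: "hol i \<in> mpow 1" and anti_mpow: "anti i \<in> mpow 1"
  by simp_all

definition lift_hol :: "'N::finite mfps \<Rightarrow> ('N + 'N) mfps" where "lift_hol = msubst hol"
definition lift_anti :: "'N::finite mfps \<Rightarrow> ('N + 'N) mfps" where "lift_anti = msubst anti"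

lemma polarized_simps:
  "polarized \<phi> (Inl k) = lift_hol (\<phi> k)" "polarized \<phi> (Inr k) = lift_anti (mcnj (\<phi> k))"
  by (simp_all add: polarized_def lift_hol_def lift_anti_def)

lemma polarized_mpow:
  assumes "\<And>k. \<phi> k \<in> mpow 1" shows "polarized \<phi> v \<in> mpow 1"
  by (cases v) (use assms in \<open>auto simp: polarized_simps lift_hol_def lift_anti_def mpow_1_iff\<close>)

lemma msubst_lift_hol:
  assumes "\<And>v. g v \<in> mpow 1"
  shows "msubst g (lift_hol f) = msubst (\<lambda>i. g (Inl i)) f"
  unfolding lift_hol_def by (simp add: msubst_msubst[OF assms hol_mpow] msubst_mvar[OF assms])

lemma msubst_lift_anti:
  assumes "\<And>v. g v \<in> mpow 1"
  shows "msubst g (lift_anti f) = msubst (\<lambda>i. g (Inr i)) f"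
  unfolding lift_anti_def by (simp add: msubst_msubst[OF assms anti_mpow] msubst_mvar[OF assms])

lemma msubst_polarized_inverse:
  assumes \<phi>: "\<And>k. \<phi> k \<in> mpow 1" and \<psi>: "\<And>k. \<psi> k \<in> mpow 1"
    and inv: "\<And>k. msubst \<phi> (\<psi> k) = mvar k"
  shows "msubst (polarized \<phi>) (msubst (polarized \<psi>) f) = f"
proof -
  note p = polarized_mpow[of \<phi>, OF \<phi>] and q = polarized_mpow[of \<psi>, OF \<psi>]
  have cn: "mcnj (\<phi> k) \<in> mpow 1" for k using \<phi> by simp
  have "msubst (polarized \<phi>) (polarized \<psi> v) = mvar v" for v
  proof (cases v)
    case (Inl k)
    have "msubst (polarized \<phi>) (polarized \<psi> v) = msubst (\<lambda>i. msubst hol (\<phi> i)) (\<psi> k)"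
      by (simp add: Inl polarized_simps msubst_lift_hol[OF p]) (simp add: lift_hol_def)
    also have "\<dots> = msubst hol (msubst \<phi> (\<psi> k))"
      by (rule msubst_msubst[OF hol_mpow \<phi>, symmetric])
    finally show ?thesis by (simp add: inv msubst_mvar Inl)
  next
    case (Inr k)
    have "msubst (polarized \<phi>) (polarized \<psi> v) = msubst (\<lambda>i. msubst anti (mcnj (\<phi> i))) (mcnj (\<psi> k))"
      by (simp add: Inr polarized_simps msubst_lift_anti[OF p]) (simp add: lift_anti_def)
    also have "\<dots> = msubst anti (msubst (\<lambda>i. mcnj (\<phi> i)) (mcnj (\<psi> k)))"
      by (rule msubst_msubst[OF anti_mpow cn, symmetric])
    also have "msubst (\<lambda>i. mcnj (\<phi> i)) (mcnj (\<psi> k)) = mvar k"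
      by (simp add: inv flip: mcnj_msubst)
    finally show ?thesis by (simp add: msubst_mvar Inr)
  qed
  then show ?thesis by (simp add: msubst_msubst[OF p q] msubst_mvar_id)
qed

locale formal_normal_coordinates =
  fixes d :: nat and r :: "nat \<Rightarrow> ('N::finite + 'N) mfps" and \<phi> :: "'N \<Rightarrow> 'N mfps"
    and D :: "'N set" and Q :: "'N \<Rightarrow> ('N + 'N) mfps"
  assumes nc: "normal_coordinates d r \<phi> D Q"
begin

lemma formal_coords: "formal_coordinates \<phi>"
  and card_D: "card D = d"
  and Q_series: "j \<in> D \<Longrightarrow> Q j \<in> series_in (- (Inl ` D))"
  and Q_chi_zero: "j \<in> D \<Longrightarrow> set_zero (Inr ` (- D)) (Q j) = anti j"
  and Q_z_zero: "j \<in> D \<Longrightarrow> set_zero (Inl ` (- D)) (Q j) = anti j"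
  and ideal_eq: "ideal_gen UNIV {msubst (polarized \<phi>) (r j) | j. j < d} =
     ideal_gen UNIV {hol j - Q j | j. j \<in> D}"
  using nc unfolding normal_coordinates_def by blast+

definition \<psi> :: "'N \<Rightarrow> 'N mfps" where
  "\<psi> = (SOME \<psi>. (\<forall>k. mcoeff (\<psi> k) {#} = 0) \<and>
          (\<forall>k. msubst \<phi> (\<psi> k) = mvar k) \<and> (\<forall>k. msubst \<psi> (\<phi> k) = mvar k))"

lemma psi: "\<psi> k \<in> mpow 1" "msubst \<phi> (\<psi> k) = mvar k" "msubst \<psi> (\<phi> k) = mvar k"
proof -
  have "\<exists>\<psi>. (\<forall>k. mcoeff (\<psi> k) {#} = 0) \<and>
          (\<forall>k. msubst \<phi> (\<psi> k) = mvar k) \<and> (\<forall>k. msubst \<psi> (\<phi> k) = mvar k)"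
    using formal_coords by (simp add: formal_coordinates_def)
  from someI_ex[OF this, folded \<psi>_def]
  show "\<psi> k \<in> mpow 1" "msubst \<phi> (\<psi> k) = mvar k" "msubst \<psi> (\<phi> k) = mvar k"
    by (auto simp: mpow_1_iff)
qed

lemma phi: "\<phi> k \<in> mpow 1"
  using formal_coords by (auto simp: formal_coordinates_def mpow_1_iff)

definition pol where "pol = msubst (polarized \<phi>)"
definition ipol where "ipol = msubst (polarized \<psi>)"

lemmas pol_mpow1 = polarized_mpow[of \<phi>, OF phi]
  and ipol_mpow1 = polarized_mpow[of \<psi>, OF psi(1)]

lemma pol_ipol [simp]: "pol (ipol f) = f"
  unfolding pol_def ipol_def by (rule msubst_polarized_inverse[OF phi psi(1,2)])

lemma ipol_pol [simp]: "ipol (pol f) = f"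
  unfolding pol_def ipol_def by (rule msubst_polarized_inverse[OF psi(1) phi psi(3)])

lemma pol_ring: "pol (f + g) = pol f + pol g" "pol (f - g) = pol f - pol g"
    "pol (f * g) = pol f * pol g" "pol (sum h A) = (\<Sum>x\<in>A. pol (h x))"
  unfolding pol_def by (simp_all only: msubst_add msubst_diff msubst_mult[OF pol_mpow1] msubst_sum)

lemma ipol_ring: "ipol (f + g) = ipol f + ipol g" "ipol (f - g) = ipol f - ipol g"
    "ipol (f * g) = ipol f * ipol g" "ipol (sum h A) = (\<Sum>x\<in>A. ipol (h x))"
  unfolding ipol_def by (simp_all only: msubst_add msubst_diff msubst_mult[OF ipol_mpow1] msubst_sum)

definition II :: "('N + 'N) mfps set" where
  "II = ideal_gen UNIV {r j | j. j < d}"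

lemma isideal_II: "isideal II"
  by (simp add: II_def isideal_ideal_gen)

definition II' :: "('N + 'N) mfps set" where
  "II' = ideal_gen UNIV {hol j - Q j | j. j \<in> D}"

lemma isideal_II': "isideal II'"
  by (simp add: II'_def isideal_ideal_gen)

lemma pol_in_II': "f \<in> II \<Longrightarrow> pol f \<in> II'"
proof -
  have "isideal {f. pol f \<in> II'}"
    by (rule isideal_vimage[OF isideal_II']) (auto intro!: additiveI simp: pol_ring)
  moreover have "{r j | j. j < d} \<subseteq> {f. pol f \<in> II'}"
    using ideal_gen_superset[of "{msubst (polarized \<phi>) (r j) | j. j < d}"]
    unfolding II'_def ideal_eq pol_def by auto
  ultimately have "II \<subseteq> {f. pol f \<in> II'}"
    unfolding II_def by (rule ideal_gen_least)
  then show "f \<in> II \<Longrightarrow> pol f \<in> II'" by auto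
qed

lemma ipol_in_II: "f \<in> II' \<Longrightarrow> ipol f \<in> II"
proof -
  have "isideal {f. ipol f \<in> II}"
    by (rule isideal_vimage[OF isideal_II]) (auto intro!: additiveI simp: ipol_ring)
  moreover have "ipol (msubst (polarized \<phi>) (r j)) \<in> II" if "j < d" for j
    using ideal_gen_superset[of "{r j | j. j < d}"] that
    by (auto simp: II_def simp flip: pol_def)
  ultimately have "II' \<subseteq> {f. ipol f \<in> II}"
    unfolding II'_def ideal_eq[symmetric] by (intro ideal_gen_least) auto
  then show "f \<in> II' \<Longrightarrow> ipol f \<in> II" by auto
qed

lemma II_iff_pol: "f \<in> II \<longleftrightarrow> pol f \<in> II'"
  using pol_in_II' ipol_in_II[of "pol f"] by auto

text \<open>The equations of the normal form written in the original variables. Unlike the given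
  \<open>r j\<close>, they have an explicit image under \<open>pol\<close> and are indexed by
  \<open>D\<close>.\<close>

definition s :: "'N \<Rightarrow> ('N + 'N) mfps" where
  "s j = ipol (hol j - Q j)"

lemma pol_s: "pol (s j) = hol j - Q j"
  by (simp add: s_def)

lemma II_iff_s: "f \<in> II \<longleftrightarrow> (\<exists>a. f = (\<Sum>j\<in>D. a j * s j))"
proof
  assume "f \<in> II"
  then have "pol f \<in> II'" by (rule pol_in_II')
  then obtain c where "pol f = (\<Sum>j\<in>D. c j * (hol j - Q j))"
    unfolding II'_def ideal_gen_indexed[OF finite] by blast
  then have "ipol (pol f) = (\<Sum>j\<in>D. ipol (c j) * s j)"
    by (simp add: ipol_ring s_def)
  then show "\<exists>a. f = (\<Sum>j\<in>D. a j * s j)" by auto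
next
  assume "\<exists>a. f = (\<Sum>j\<in>D. a j * s j)"
  then obtain a where "f = (\<Sum>j\<in>D. a j * s j)" by blast
  then have "pol f = (\<Sum>j\<in>D. pol (a j) * (hol j - Q j))"
    by (simp add: pol_ring pol_s)
  then show "f \<in> II"
    unfolding II_iff_pol II'_def ideal_gen_indexed[OF finite]
    by (intro exI[of _ "\<lambda>j. pol (a j)"])
qed

lemma s_in_II: "j \<in> D \<Longrightarrow> s j \<in> II"
  unfolding II_iff_pol pol_s II'_def using ideal_gen_superset[of "{hol j - Q j | j. j \<in> D}"] by auto

lemma Q_mpow: "j \<in> D \<Longrightarrow> Q j \<in> mpow 1"
  using arg_cong[OF Q_chi_zero[of j], of "\<lambda>f. mcoeff f {#}"]
  by (simp add: mpow_1_iff mcoeff_set_zero)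

text \<open>A linear monomial cannot involve both a z and a \<chi> variable, so it survives one of
  the two normalizations, and each of them leaves exactly \<tau>.\<close>

lemma Q_linear: "j \<in> D \<Longrightarrow> mcoeff (Q j) {#v#} = (if v = Inr j then 1 else 0)"
proof -
  assume j: "j \<in> D"
  have a: "mcoeff (set_zero (Inr ` (- D)) (Q j)) {#v#} = mcoeff (anti j) {#v#}"
    and b: "mcoeff (set_zero (Inl ` (- D)) (Q j)) {#v#} = mcoeff (anti j) {#v#}"
    by (simp_all add: Q_chi_zero Q_z_zero j)
  show ?thesis
  proof (cases "v \<in> Inr ` (- D)")
    case True
    then have "v \<notin> Inl ` (- D)" by auto
    then show ?thesis using b by (auto simp: mcoeff_set_zero)
  next
    case False
    then show ?thesis using a by (auto simp: mcoeff_set_zero)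
  qed
qed

text \<open>The points of the complexified \<open>M\<close> in normal coordinates, parametrized by
  (z, \<chi>, \<tau>); \<open>Psi\<close> below is restriction to them.\<close>

definition graph :: "'N + 'N \<Rightarrow> ('N + 'N) mfps" where
  "graph v = (case v of Inl j \<Rightarrow> if j \<in> D then Q j else hol j | Inr j \<Rightarrow> anti j)"

lemma graph_mpow: "graph v \<in> mpow 1"
  by (cases v) (auto simp: graph_def intro: Q_mpow[unfolded One_nat_def])

lemma series_in_subst_cong:
  fixes f :: "'v::finite mfps" and g h :: "'v \<Rightarrow> 'u::finite mfps"
  assumes "f \<in> series_in V" "\<And>v. v \<in> V \<Longrightarrow> g v = h v"
  shows "msubst g f = msubst h f"
proof (rule mfps_eqI)
  fix \<gamma>
  show "mcoeff (msubst g f) \<gamma> = mcoeff (msubst h f) \<gamma>"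
    unfolding mcoeff_msubst
  proof (rule sum.cong)
    fix \<alpha>
    show "mcoeff f \<alpha> * mcoeff (\<Prod>v\<in>#\<alpha>. g v) \<gamma> = mcoeff f \<alpha> * mcoeff (\<Prod>v\<in>#\<alpha>. h v) \<gamma>"
    proof (cases "mcoeff f \<alpha> = 0")
      case False
      with assms(1) have "set_mset \<alpha> \<subseteq> V" by (auto simp: series_in_def)
      then have "image_mset g \<alpha> = image_mset h \<alpha>" using assms(2) by (auto intro!: image_mset_cong)
      then show ?thesis by simp
    qed simp
  qed simp
qed

lemma graph_Q: "j \<in> D \<Longrightarrow> msubst graph (Q j) = Q j"
proof -
  assume "j \<in> D"
  then have "msubst graph (Q j) = msubst mvar (Q j)"
    by (intro series_in_subst_cong[OF Q_series]) (auto simp: graph_def split: sum.splits)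
  then show ?thesis by (simp add: msubst_mvar_id)
qed

definition Psi :: "('N + 'N) mfps \<Rightarrow> ('N + 'N) mfps" where
  "Psi f = msubst graph (pol f)"

text \<open>Substituting \<open>w = Q\<close> kills the generators, since \<open>Q\<close> contains
  no w. Conversely a series changes under that substitution only by a combination of the
  \<open>w - Q\<close>.\<close>

lemma II_iff_Psi: "f \<in> II \<longleftrightarrow> Psi f = 0"
proof
  assume "f \<in> II"
  then obtain a where "f = (\<Sum>j\<in>D. a j * s j)" unfolding II_iff_s by blast
  then show "Psi f = 0"
    by (simp add: Psi_def pol_ring pol_s msubst_sum msubst_mult[OF graph_mpow] msubst_diff
        msubst_mvar[OF graph_mpow] graph_Q) (simp add: graph_def)
next
  have "msubst mvar (pol f) - msubst graph (pol f) \<in> II'"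
  proof (rule msubst_diff_in_ideal[OF _ graph_mpow isideal_II'])
    show "mvar v - graph v \<in> II'" for v
      using ideal_gen_superset[of "{hol j - Q j | j. j \<in> D}"] isideal_0[OF isideal_II']
      by (cases v) (auto simp: graph_def II'_def)
  qed simp
  moreover assume "Psi f = 0"
  ultimately show "f \<in> II" by (simp add: Psi_def msubst_mvar_id II_iff_pol)
qed

text \<open>\<open>Q\<close> is free of w, so substituting \<open>graph\<close> twice is the same as
  once; pulling back the restriction gives a representative modulo \<open>II\<close>.\<close>

lemma diff_ipol_Psi_in_II: "f - ipol (Psi f) \<in> II"
proof -
  have "msubst graph (graph v) = graph v" for v
    by (cases v) (auto simp: graph_def graph_Q msubst_mvar[OF graph_mpow])
  then have "msubst graph (msubst graph g) = msubst graph g" for g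
    by (simp add: msubst_msubst[OF graph_mpow graph_mpow])
  then show ?thesis by (simp add: II_iff_Psi Psi_def pol_ring msubst_diff)
qed

text \<open>At \<chi> = 0 the normalization gives \<open>w = \<tau>\<close>, so the holomorphic
  coordinates of points of the complexified \<open>M\<close> are arbitrary there; \<open>?k\<close>
  is this restriction, with \<tau> renamed to w.\<close>

lemma lift_hol_in_II: assumes "lift_hol J \<in> II" shows "J = 0"
proof -
  let ?k = "\<lambda>v. case v of Inl i \<Rightarrow> if i \<in> D then 0 else mvar i | Inr j \<Rightarrow> if j \<in> D then mvar j else 0"
  let ?z = "\<lambda>v. if v \<in> Inr ` (- D) then 0 else (mvar v :: ('N + 'N) mfps)"
  have k: "?k v \<in> mpow 1" for v by (auto split: sum.split)
  have z: "?z v \<in> mpow 1" for v by auto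
  have kz: "msubst ?k (?z v) = ?k v" for v
    by (cases v) (auto simp: msubst_mvar[OF k])
  have Q: "msubst ?k (Q j) = mvar j" if "j \<in> D" for j
  proof -
    have "msubst ?k (set_zero (Inr ` (- D)) (Q j)) = msubst ?k (Q j)"
      unfolding set_zero_def msubst_msubst[OF k z] kz ..
    then show ?thesis by (simp add: Q_chi_zero that msubst_mvar[OF k])
  qed
  have g: "msubst ?k (graph (Inl i)) = mvar i" for i
    by (auto simp: graph_def Q msubst_mvar[OF k])
  have "msubst graph (msubst (polarized \<phi>) (lift_hol J)) = 0"
    using assms by (simp add: II_iff_Psi Psi_def pol_def)
  moreover have "msubst (polarized \<phi>) (lift_hol J) = lift_hol (msubst \<phi> J)"
    unfolding msubst_lift_hol[OF pol_mpow1] polarized_simps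
    by (simp add: lift_hol_def msubst_msubst[OF hol_mpow phi])
  ultimately have "msubst (\<lambda>i. graph (Inl i)) (msubst \<phi> J) = 0"
    by (simp add: msubst_lift_hol[OF graph_mpow])
  then have "msubst ?k (msubst (\<lambda>i. graph (Inl i)) (msubst \<phi> J)) = 0" by simp
  then have "msubst \<phi> J = 0"
    by (simp add: msubst_msubst[OF k graph_mpow] g msubst_mvar_id)
  then have "msubst \<psi> (msubst \<phi> J) = 0" by simp
  then show ?thesis by (simp add: msubst_msubst[OF psi(1) phi] psi msubst_mvar_id)
qed

text \<open>The variables \<chi>, \<tau> are themselves parameters of the graph, so a series in them
  alone restricts to itself.\<close>

lemma lift_anti_in_II: assumes "lift_anti J \<in> II" shows "J = 0"
proof -
  let ?k = "\<lambda>v. case v of Inl i \<Rightarrow> 0 | Inr j \<Rightarrow> (mvar j :: 'N mfps)"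
  have k: "?k v \<in> mpow 1" for v by (auto split: sum.split)
  have cphi: "mcnj (\<phi> i) \<in> mpow 1" and cpsi: "mcnj (\<psi> i) \<in> mpow 1" for i using phi psi by simp_all
  have "msubst graph (msubst (polarized \<phi>) (lift_anti J)) = 0"
    using assms by (simp add: II_iff_Psi Psi_def pol_def)
  moreover have "msubst (polarized \<phi>) (lift_anti J) = lift_anti (msubst (\<lambda>i. mcnj (\<phi> i)) J)"
    unfolding msubst_lift_anti[OF pol_mpow1] polarized_simps
    by (simp add: lift_anti_def msubst_msubst[OF anti_mpow cphi])
  ultimately have "msubst anti (msubst (\<lambda>i. mcnj (\<phi> i)) J) = 0"
    by (simp add: msubst_lift_anti[OF graph_mpow]) (simp add: graph_def)
  then have "msubst ?k (msubst anti (msubst (\<lambda>i. mcnj (\<phi> i)) J)) = 0" by simp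
  then have "msubst (\<lambda>i. mcnj (\<phi> i)) J = 0"
    by (simp add: msubst_msubst[OF k anti_mpow] msubst_mvar[OF k] msubst_mvar_id)
  then have "msubst (\<lambda>i. mcnj (\<psi> i)) (msubst (\<lambda>i. mcnj (\<phi> i)) J) = 0" by simp
  then show ?thesis
    by (simp add: msubst_msubst[OF cpsi cphi] psi msubst_mvar_id flip: mcnj_msubst)
qed

subsection \<open>Leading forms on the complexified tangent space\<close>

text \<open>By \<open>Q_linear\<close> the equations have linear part \<open>w - \<tau>\<close>, so
  this is the complexified tangent space in normal coordinates. The differential \<open>dpol\<close>
  of the coordinate change carries it to the original ones.\<close>

definition tangent :: "('N + 'N \<Rightarrow> complex) \<Rightarrow> bool" where
  "tangent y \<longleftrightarrow> (\<forall>j\<in>D. y (Inl j) = y (Inr j))"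

definition dpol :: "('N + 'N \<Rightarrow> complex) \<Rightarrow> 'N + 'N \<Rightarrow> complex" where
  "dpol y u = (\<Sum>v\<in>UNIV. mcoeff (polarized \<phi> u) {#v#} * y v)"

lemma II_linear:
  assumes "f \<in> II" "tangent y"
  shows "(\<Sum>u\<in>UNIV. mcoeff f {#u#} * dpol y u) = 0"
proof -
  obtain a where a: "f = (\<Sum>j\<in>D. a j * s j)" using assms(1) unfolding II_iff_s by blast
  have "(\<Sum>u\<in>UNIV. mcoeff f {#u#} * dpol y u)
      = (\<Sum>v\<in>UNIV. (\<Sum>u\<in>UNIV. mcoeff f {#u#} * mcoeff (polarized \<phi> u) {#v#}) * y v)"
    unfolding dpol_def sum_distrib_left sum_distrib_right by (subst sum.swap) (simp add: mult.assoc)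
  also have "\<dots> = (\<Sum>v\<in>UNIV. mcoeff (pol f) {#v#} * y v)"
    unfolding pol_def mcoeff_msubst_single[OF pol_mpow1] ..
  also have "\<dots> = (\<Sum>v\<in>UNIV. \<Sum>j\<in>D. mcoeff (pol (a j)) {#} * mcoeff (hol j - Q j) {#v#} * y v)"
    using Q_mpow by (simp add: a pol_ring pol_s mcoeff_mult_single mpow_1_iff sum_distrib_right)
  also have "\<dots> = (\<Sum>j\<in>D. \<Sum>v\<in>UNIV. mcoeff (pol (a j)) {#} * mcoeff (hol j - Q j) {#v#} * y v)"
    by (rule sum.swap)
  also have "\<dots> = (\<Sum>j\<in>D. mcoeff (pol (a j)) {#} * (y (Inl j) - y (Inr j)))"
  proof (rule sum.cong)
    fix j assume j: "j \<in> D"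
    have "(\<Sum>v\<in>UNIV. mcoeff (pol (a j)) {#} * mcoeff (hol j - Q j) {#v#} * y v)
       = (\<Sum>v\<in>UNIV. (if v = Inl j then mcoeff (pol (a j)) {#} * y v else 0)
            - (if v = Inr j then mcoeff (pol (a j)) {#} * y v else 0))"
      by (rule sum.cong) (auto simp: Q_linear[OF j])
    then show "(\<Sum>v\<in>UNIV. mcoeff (pol (a j)) {#} * mcoeff (hol j - Q j) {#v#} * y v)
        = mcoeff (pol (a j)) {#} * (y (Inl j) - y (Inr j))"
      by (simp add: sum_subtractf right_diff_distrib)
  qed simp
  finally show ?thesis using assms(2) by (simp add: tangent_def)
qed

text \<open>Both leading forms are evaluated by iterating a derivation: \<open>X\<close> is the
  constant field \<open>dpol y\<close>, and \<open>Y\<close> is the same field seen in normal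
  coordinates, whose value at the origin is \<open>y\<close>.\<close>

lemma lform_ipol:
  assumes g: "g \<in> mpow k" shows "lform k (ipol g) (dpol y) = lform k g y"
proof -
  let ?x = "dpol y"
  define X where "X f = (\<Sum>u\<in>UNIV. mconst (?x u) * pder u f)" for f :: "('N + 'N) mfps"
  have X: "derivation X"
    by (auto simp: derivation_def X_def pder_add pder_mult ring_distribs sum.distrib
        sum_distrib_left sum_distrib_right mult_ac)
  have Xc: "X (mconst c) = 0" for c by (simp add: X_def)
  have Xv: "mcoeff (X f) {#} = (\<Sum>u\<in>UNIV. mcoeff f {#u#} * ?x u)" for f
    by (simp add: X_def mcoeff_pder mult.commute)
  define Y where "Y f = pol (X (ipol f))" for f
  have Y: "derivation Y"
    unfolding derivation_def
    by (simp add: Y_def ipol_ring derivation_add[OF X] derivation_mult[OF X] pol_ring)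
  have Yc: "Y (mconst c) = 0" for c by (simp add: Y_def ipol_def Xc) (simp add: pol_def)
  have Yn: "(Y ^^ n) f = pol ((X ^^ n) (ipol f))" for n f
    by (induction n) (auto simp: Y_def)
  have ig: "ipol g \<in> mpow k"
    unfolding ipol_def by (rule msubst_in_mpow[OF g ipol_mpow1])
  have "mcoeff (Y (mvar v)) {#} = y v" for v
  proof -
    have "mcoeff (Y (mvar v)) {#} = (\<Sum>u\<in>UNIV. mcoeff (polarized \<psi> v) {#u#} * ?x u)"
      by (simp add: Y_def pol_def ipol_def msubst_mvar[OF ipol_mpow1] Xv)
    also have "\<dots> = (\<Sum>w\<in>UNIV. (\<Sum>u\<in>UNIV. mcoeff (polarized \<psi> v) {#u#} * mcoeff (polarized \<phi> u) {#w#}) * y w)"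
      unfolding dpol_def sum_distrib_left sum_distrib_right by (subst sum.swap) (simp add: mult.assoc)
    also have "\<dots> = (\<Sum>w\<in>UNIV. mcoeff (pol (polarized \<psi> v)) {#w#} * y w)"
      unfolding pol_def mcoeff_msubst_single[OF pol_mpow1] ..
    also have "pol (polarized \<psi> v) = mvar v"
      using pol_ipol[of "mvar v"] by (simp add: ipol_def msubst_mvar[OF ipol_mpow1])
    finally show ?thesis by (simp add: if_distrib[of "\<lambda>x. x * _"] cong: if_cong)
  qed
  then have "fact k * lform k g y = mcoeff ((Y ^^ k) g) {#}"
    by (simp add: derivation_funpow_lform[OF Y Yc g])
  also have "\<dots> = mcoeff ((X ^^ k) (ipol g)) {#}"
    by (simp add: Yn pol_def)
  also have "\<dots> = fact k * lform k (ipol g) (\<lambda>u. mcoeff (X (mvar u)) {#})"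
    by (rule derivation_funpow_lform[OF X Xc ig])
  also have "(\<lambda>u. mcoeff (X (mvar u)) {#}) = ?x"
    by (auto simp: Xv if_distrib[of "\<lambda>x. x * _"] cong: if_cong)
  finally show ?thesis by simp
qed

text \<open>
  The lowest order part of a function not in the ideal is nonzero somewhere on the real tangent
  space, whose points are those with \<open>\<chi> = cnj z\<close> and \<open>w = \<tau>\<close> real: a polynomial function that
  vanishes on a real subspace vanishes on its complexification.
\<close>
lemma leading_form_not_in_II:
  assumes "F \<notin> II"
  obtains k f y where "F - f \<in> II" "f \<in> mpow k" "tangent y" "\<And>i. y (Inr i) = cnj (y (Inl i))"
    "lform k f (dpol y) \<noteq> 0"
proof -
  define R where "R = Psi F"
  have "R \<noteq> 0" using assms by (simp add: R_def II_iff_Psi)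
  then have ex: "\<exists>k. \<exists>\<alpha>. size \<alpha> = k \<and> mcoeff R \<alpha> \<noteq> 0" by (metis mfps_eqI mcoeff_0)
  define k where "k = (LEAST k. \<exists>\<alpha>. size \<alpha> = k \<and> mcoeff R \<alpha> \<noteq> 0)"
  obtain \<alpha> where \<alpha>: "size \<alpha> = k" "mcoeff R \<alpha> \<noteq> 0"
    using LeastI_ex[OF ex] unfolding k_def by blast
  have R: "R \<in> mpow k"
    unfolding mpow_def k_def using not_less_Least by blast
  \<comment> \<open>Every value of \<open>graph\<close> is free of w, hence so is anything
    substituted from it.\<close>
  have Rs: "R \<in> series_in (- (Inl ` D))"
  proof -
    have "set_zero (Inl ` D) R = R"
    proof -
      have z: "(if v \<in> Inl ` D then 0 else (mvar v :: ('N + 'N) mfps)) \<in> mpow 1" for v by simp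
      have "set_zero (Inl ` D) (graph v) = graph v" for v
      proof (cases "v \<in> Inl ` D")
        case True
        then obtain j where "v = Inl j" "j \<in> D" by blast
        then have "set_zero (Inl ` D) (graph v) = msubst mvar (Q j)"
          unfolding set_zero_def using Q_series[of j] by (auto simp: graph_def intro!: series_in_subst_cong)
        then show ?thesis using \<open>v = Inl j\<close> \<open>j \<in> D\<close> by (simp add: msubst_mvar_id graph_def)
      next
        case False
        then show ?thesis
          unfolding set_zero_def by (cases v) (auto simp: graph_def msubst_mvar[OF z])
      qed
      then show ?thesis
        unfolding R_def Psi_def set_zero_def by (simp add: msubst_msubst[OF z graph_mpow])
    qed
    then have "set_mset \<alpha> \<inter> Inl ` D = {}" if "mcoeff R \<alpha> \<noteq> 0" for \<alpha>
      using mcoeff_set_zero[of "Inl ` D" R \<alpha>] that by (simp split: if_splits)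
    then show ?thesis unfolding series_in_def by blast
  qed
  have "\<exists>y. tangent y \<and> (\<forall>i. y (Inr i) = cnj (y (Inl i))) \<and> lform k R y \<noteq> 0"
  proof (rule ccontr)
    assume "\<not> ?thesis"
    then have real: "lform k R y = 0" if "tangent y" "\<And>i. y (Inr i) = cnj (y (Inl i))" for y
      using that by blast
    have tangent0: "lform k R y = 0" if t: "tangent y" for y
    proof -
      define a where "a v = (case v of Inl i \<Rightarrow> (y (Inl i) + cnj (y (Inr i))) / 2
         | Inr i \<Rightarrow> (cnj (y (Inl i)) + y (Inr i)) / 2)" for v
      define b where "b v = (case v of Inl i \<Rightarrow> (y (Inl i) - cnj (y (Inr i))) / (2 * \<i>)
         | Inr i \<Rightarrow> (y (Inr i) - cnj (y (Inl i))) / (2 * \<i>))" for v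
      have "lform k R (\<lambda>v. a v + \<i> * b v) = 0"
      proof (rule lform_real_combination, rule real)
        fix t :: real
        show "tangent (\<lambda>v. a v + complex_of_real t * b v)"
          using t by (auto simp: tangent_def a_def b_def add.commute)
        show "a (Inr i) + complex_of_real t * b (Inr i) = cnj (a (Inl i) + complex_of_real t * b (Inl i))" for i
          by (simp add: a_def b_def field_simps)
      qed
      moreover have "a v + \<i> * b v = y v" for v
        by (cases v) (simp_all add: a_def b_def field_simps)
      ultimately show ?thesis by simp
    qed
    have "lform k R x = 0" for x
    proof -
      \<comment> \<open>The form does not involve w, so those coordinates may be reset to \<tau>,
        which makes the vector tangent.\<close>
      define y where "y v = (case v of Inl i \<Rightarrow> if i \<in> D then x (Inr i) else x (Inl i) | Inr i \<Rightarrow> x (Inr i))" for v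
      have "lform k R x = lform k R y"
        unfolding lform_def
      proof (rule sum.cong)
        fix \<beta>
        show "mcoeff R \<beta> * (\<Prod>v\<in>#\<beta>. x v) = mcoeff R \<beta> * (\<Prod>v\<in>#\<beta>. y v)"
        proof (cases "mcoeff R \<beta> = 0")
          case False
          then have "set_mset \<beta> \<subseteq> - (Inl ` D)" using Rs by (auto simp: series_in_def)
          then have "image_mset x \<beta> = image_mset y \<beta>"
            by (intro image_mset_cong) (auto simp: y_def split: sum.splits)
          then show ?thesis by simp
        qed simp
      qed simp
      also have "\<dots> = 0" by (rule tangent0) (simp add: tangent_def y_def)
      finally show ?thesis .
    qed
    then show False using lform_eq_0D[OF _ \<alpha>(1)] \<alpha>(2) by blast
  qed
  then obtain y where y: "tangent y" "\<And>i. y (Inr i) = cnj (y (Inl i))" "lform k R y \<noteq> 0" by blast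
  show ?thesis
  proof (rule that[of "ipol R" k y])
    show "F - ipol R \<in> II" unfolding R_def by (rule diff_ipol_Psi_in_II)
    show "ipol R \<in> mpow k" unfolding ipol_def by (rule msubst_in_mpow[OF R ipol_mpow1])
    show "lform k (ipol R) (dpol y) \<noteq> 0" using y by (simp add: lform_ipol[OF R])
  qed (use y in auto)
qed

text \<open>Modulo \<open>II\<close>, a series outside the ideal has a representative whose leading
  form, of some degree \<open>k\<close>, is nonzero at a complexified tangent vector. The derivation
  with that value detects it in its \<open>k\<close>-th iterate, while the part in \<open>II\<close>
  stays in \<open>II\<close> and vanishes at the origin.\<close>

lemma words_separate:
  assumes \<G>: "\<And>X. X \<in> \<G> \<Longrightarrow> derivation X" "\<And>X c. X \<in> \<G> \<Longrightarrow> X (mconst c) = 0"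
    "\<And>X f. X \<in> \<G> \<Longrightarrow> f \<in> II \<Longrightarrow> X f \<in> II"
    and span: "\<And>y. tangent y \<Longrightarrow> \<exists>X\<in>\<G>. \<forall>u. mcoeff (X (mvar u)) {#} = dpol y u"
    and II0: "II \<subseteq> mpow 1"
    and F: "\<And>X k. X \<in> \<G> \<Longrightarrow> mcoeff ((X ^^ k) F) {#} = 0"
  shows "F \<in> II"
proof (rule ccontr)
  assume "F \<notin> II"
  then obtain k f y where f: "F - f \<in> II" "f \<in> mpow k" "tangent y" "lform k f (dpol y) \<noteq> 0"
    using leading_form_not_in_II by metis
  obtain X where X: "X \<in> \<G>" "\<And>u. mcoeff (X (mvar u)) {#} = dpol y u" using span[OF f(3)] by blast
  have "(X ^^ k) (F - f) \<in> II" by (induction k) (use f(1) \<G>(3)[OF X(1)] in auto)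
  then have "mcoeff ((X ^^ k) (F - f)) {#} = 0" using II0 by (auto simp: mpow_1_iff)
  then have "mcoeff ((X ^^ k) f) {#} = 0"
    using F[OF X(1), of k] by (simp add: Modules.additive.diff[OF derivation_funpow_additive[OF \<G>(1)[OF X(1)]]])
  moreover have "mcoeff ((X ^^ k) f) {#} = fact k * lform k f (dpol y)"
    using derivation_funpow_lform[OF \<G>(1)[OF X(1)] \<G>(2)[OF X(1)] f(2)] X(2) by simp
  ultimately show False using f(4) by simp
qed

lemma II_mpow: "II \<subseteq> mpow 1"
proof
  fix f assume "f \<in> II"
  then obtain a where "f = (\<Sum>j\<in>D. a j * s j)" unfolding II_iff_s by blast
  moreover have "s j \<in> mpow 1" if "j \<in> D" for j
    unfolding s_def ipol_def
    by (rule msubst_in_mpow[OF mpow_diff[OF hol_mpow Q_mpow[OF that]] ipol_mpow1])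
  ultimately show "f \<in> mpow 1" by (auto intro!: mpow_sum mpow_mult_left)
qed

end

section \<open>Smooth functions\<close>

abbreviation dder :: "('a::real_normed_vector \<Rightarrow> 'b::real_normed_vector) \<Rightarrow> 'a \<Rightarrow> 'a \<Rightarrow> 'b" where
  "dder f v \<equiv> \<lambda>x. frechet_derivative f (at x) v"

lemma times_differentiable_on_subset:
  "times_differentiable_on k U f \<Longrightarrow> V \<subseteq> U \<Longrightarrow> times_differentiable_on k V f"
  by (induction k arbitrary: f) (auto intro: continuous_on_subset)

lemma smooth_on_subset: "smooth_on U f \<Longrightarrow> V \<subseteq> U \<Longrightarrow> smooth_on V f"
  unfolding smooth_on_def by (blast intro: times_differentiable_on_subset)

lemma smooth_on_differentiable: "smooth_on U f \<Longrightarrow> x \<in> U \<Longrightarrow> f differentiable (at x)"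
  unfolding smooth_on_def using times_differentiable_on.simps(2)[of 0 U f] by blast

lemma smooth_on_dder: "smooth_on U f \<Longrightarrow> smooth_on U (dder f v)"
  unfolding smooth_on_def using times_differentiable_on.simps(2) by blast

lemma smooth_on_continuous: "smooth_on U f \<Longrightarrow> continuous_on U f"
  unfolding smooth_on_def using times_differentiable_on.simps(1)[of U f] by blast

lemma smooth_on_has_derivative:
  "smooth_on U f \<Longrightarrow> x \<in> U \<Longrightarrow> (f has_derivative frechet_derivative f (at x)) (at x)"
  using smooth_on_differentiable frechet_derivative_works by blast

text \<open>Smoothness as a greatest fixed point: a class of differentiable functions closed under
  directional derivatives consists of smooth functions.\<close>

lemma smooth_on_coinduct:
  assumes "P f" and step: "\<And>f. P f \<Longrightarrow> (\<forall>x\<in>U. f differentiable (at x)) \<and> (\<forall>v. P (dder f v))"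
  shows "smooth_on U f"
proof -
  have "times_differentiable_on k U f" if "P f" for k f
    using that
  proof (induction k arbitrary: f)
    case 0
    then show ?case using step[OF 0]
      by (auto intro!: continuous_at_imp_continuous_on differentiable_imp_continuous_within)
  next
    case (Suc k)
    then show ?case using step[OF Suc.prems] by auto
  qed
  then show ?thesis using assms(1) unfolding smooth_on_def by blast
qed

lemma dder_eqI: "(f has_derivative f') (at x) \<Longrightarrow> dder f v x = f' v"
  using frechet_derivative_at[of f f' x] by simp

text \<open>
  The derivatives of a product are sums of products, so the induction on the order of differentiability
  needs the whole algebra generated by the smooth functions, which is closed under derivatives.
\<close>
inductive smooth_alg :: "'a::real_normed_vector set \<Rightarrow> ('a \<Rightarrow> 'b::real_normed_algebra_1) \<Rightarrow> bool" for U where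
  base: "smooth_on U f \<Longrightarrow> smooth_alg U f"
| const: "smooth_alg U (\<lambda>_. c)"
| add: "smooth_alg U f \<Longrightarrow> smooth_alg U g \<Longrightarrow> smooth_alg U (\<lambda>x. f x + g x)"
| mult: "smooth_alg U f \<Longrightarrow> smooth_alg U g \<Longrightarrow> smooth_alg U (\<lambda>x. f x * g x)"
| cong: "smooth_alg U f \<Longrightarrow> (\<And>x. x \<in> U \<Longrightarrow> g x = f x) \<Longrightarrow> smooth_alg U g"

lemma smooth_alg_step:
  assumes U: "open U"
  shows "smooth_alg U f \<Longrightarrow> (\<forall>x\<in>U. f differentiable (at x)) \<and> (\<forall>v. smooth_alg U (dder f v))"
proof (induction rule: smooth_alg.induct)
  case (base f)
  then show ?case by (auto intro: smooth_alg.base smooth_on_dder smooth_on_differentiable)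
next
  case (const c)
  then show ?case by (auto intro: smooth_alg.const)
next
  case (add f g)
  have "dder (\<lambda>x. f x + g x) v x = dder f v x + dder g v x" if "x \<in> U" for v x
    using add that by (intro dder_eqI has_derivative_add) (auto simp: frechet_derivative_works)
  then have "smooth_alg U (dder (\<lambda>x. f x + g x) v)" for v
    by (rule smooth_alg.cong[OF smooth_alg.add[of U "dder f v" "dder g v"], rotated 2]) (use add in blast)+
  then show ?case using add by auto
next
  case (mult f g)
  have "dder (\<lambda>x. f x * g x) v x = f x * dder g v x + dder f v x * g x" if "x \<in> U" for v x
    using mult that by (intro dder_eqI has_derivative_mult) (auto simp: frechet_derivative_works)
  then have "smooth_alg U (dder (\<lambda>x. f x * g x) v)" for v
    by (rule smooth_alg.cong[OF smooth_alg.add[OF smooth_alg.mult[of U f "dder g v"]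
            smooth_alg.mult[of U "dder f v" g]], rotated 4]) (use mult in blast)+
  then show ?case using mult by auto
next
  case (cong f g)
  have *: "(g has_derivative frechet_derivative f (at x)) (at x)" if "x \<in> U" for x
    by (rule has_derivative_transform_within_open[OF _ U that])
      (use cong that in \<open>auto simp: frechet_derivative_works\<close>)
  have "smooth_alg U (dder g v)" for v
    by (rule smooth_alg.cong[of U "dder f v"]) (use cong dder_eqI[OF *] in blast)+
  moreover have "g differentiable (at x)" if "x \<in> U" for x
    using *[OF that] by (auto simp: differentiable_def)
  ultimately show ?case by blast
qed

lemma smooth_alg_imp_smooth: "open U \<Longrightarrow> smooth_alg U f \<Longrightarrow> smooth_on U f"
  by (erule smooth_on_coinduct) (rule smooth_alg_step)

context
  fixes U :: "'a::real_normed_vector set" assumes U: "open U"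
begin

lemma smooth_on_const: "smooth_on U (\<lambda>_. c :: 'b::real_normed_algebra_1)"
  by (rule smooth_alg_imp_smooth[OF U smooth_alg.const])

lemma smooth_on_add:
  fixes f g :: "'a \<Rightarrow> 'b::real_normed_algebra_1"
  shows "smooth_on U f \<Longrightarrow> smooth_on U g \<Longrightarrow> smooth_on U (\<lambda>x. f x + g x)"
  by (rule smooth_alg_imp_smooth[OF U]) (blast intro: smooth_alg.intros)

lemma smooth_on_mult:
  fixes f g :: "'a \<Rightarrow> 'b::real_normed_algebra_1"
  shows "smooth_on U f \<Longrightarrow> smooth_on U g \<Longrightarrow> smooth_on U (\<lambda>x. f x * g x)"
  by (rule smooth_alg_imp_smooth[OF U]) (blast intro: smooth_alg.intros)

lemma smooth_on_cong:
  fixes f g :: "'a \<Rightarrow> 'b::real_normed_algebra_1"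
  shows "smooth_on U f \<Longrightarrow> (\<And>x. x \<in> U \<Longrightarrow> g x = f x) \<Longrightarrow> smooth_on U g"
  by (rule smooth_alg_imp_smooth[OF U]) (blast intro: smooth_alg.intros)

lemma smooth_on_diff:
  fixes f g :: "'a \<Rightarrow> 'b::real_normed_algebra_1"
  assumes "smooth_on U f" "smooth_on U g" shows "smooth_on U (\<lambda>x. f x - g x)"
  using smooth_on_add[OF assms(1) smooth_on_mult[OF smooth_on_const[of "-1"] assms(2)]] by simp

end

lemma dder_bounded_linear:
  assumes "bounded_linear L" "f differentiable (at x)"
  shows "((\<lambda>x. L (f x)) has_derivative (\<lambda>v. L (dder f v x))) (at x)"
  using bounded_linear.has_derivative[OF assms(1)] assms(2) by (simp add: frechet_derivative_works)

lemma smooth_on_bounded_linear: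
  assumes U: "open U" and L: "bounded_linear L" and f: "smooth_on U f"
  shows "smooth_on U (\<lambda>x. L (f x))"
proof (rule smooth_on_coinduct[where P = "\<lambda>g. \<exists>f. smooth_on U f \<and> (\<forall>x\<in>U. g x = L (f x))"])
  fix g assume "\<exists>f. smooth_on U f \<and> (\<forall>x\<in>U. g x = L (f x))"
  then obtain f where f: "smooth_on U f" "\<forall>x\<in>U. g x = L (f x)" by blast
  have *: "(g has_derivative (\<lambda>v. L (dder f v x))) (at x)" if "x \<in> U" for x
    by (rule has_derivative_transform_within_open[OF
          dder_bounded_linear[OF L smooth_on_differentiable[OF f(1) that]] U that]) (use f in simp)
  show "(\<forall>x\<in>U. g differentiable (at x)) \<and> (\<forall>v. \<exists>f. smooth_on U f \<and> (\<forall>x\<in>U. dder g v x = L (f x)))"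
  proof (intro conjI ballI allI)
    show "g differentiable (at x)" if "x \<in> U" for x using *[OF that] by (auto simp: differentiable_def)
    show "\<exists>f. smooth_on U f \<and> (\<forall>x\<in>U. dder g v x = L (f x))" for v
      using smooth_on_dder[OF f(1)] dder_eqI[OF *] by blast
  qed
qed (use f in auto)

subsection \<open>Symmetry of second derivatives\<close>

text \<open>The mean value theorem is applied twice: in direction \<open>v\<close> to the difference
  \<open>h\<close> in direction \<open>w\<close>, then in direction \<open>w\<close> to the
  derivative obtained. The left-hand side is symmetric in \<open>v\<close> and \<open>w\<close>,
  which yields equality of mixed derivatives in the limit.\<close>

lemma second_difference_mvt:
  fixes g :: "'a::real_normed_vector \<Rightarrow> real"
  assumes t: "0 < t" and ball: "\<And>s s'. 0 \<le> s \<Longrightarrow> s \<le> t \<Longrightarrow> 0 \<le> s' \<Longrightarrow> s' \<le> t \<Longrightarrow> x + s *\<^sub>R v + s' *\<^sub>R w \<in> U"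
    and g: "\<And>y. y \<in> U \<Longrightarrow> g differentiable (at y)" and gv: "\<And>y. y \<in> U \<Longrightarrow> dder g v differentiable (at y)"
  obtains s s' where "0 < s" "s < t" "0 < s'" "s' < t"
    "g (x + t *\<^sub>R v + t *\<^sub>R w) - g (x + t *\<^sub>R v) - g (x + t *\<^sub>R w) + g x = t\<^sup>2 * dder (dder g v) w (x + s *\<^sub>R v + s' *\<^sub>R w)"
proof -
  have line: "((\<lambda>s. h (y + s *\<^sub>R z)) has_real_derivative dder h z (y + s *\<^sub>R z)) (at s)"
    if "h differentiable (at (y + s *\<^sub>R z))" for h :: "'a \<Rightarrow> real" and y z s
  proof -
    have "((\<lambda>s. y + s *\<^sub>R z) has_derivative (\<lambda>s. s *\<^sub>R z)) (at s)"
      by (auto intro!: derivative_eq_intros)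
    from has_derivative_compose[OF this that[unfolded frechet_derivative_works]]
    have "((\<lambda>s. h (y + s *\<^sub>R z)) has_derivative (\<lambda>r. dder h (r *\<^sub>R z) (y + s *\<^sub>R z))) (at s)" .
    moreover have "dder h (r *\<^sub>R z) (y + s *\<^sub>R z) = dder h z (y + s *\<^sub>R z) * r" for r
      using linear_scale[OF linear_frechet_derivative[OF that]] by simp
    ultimately show ?thesis by (simp add: has_field_derivative_def)
  qed
  define h where "h s = g (x + t *\<^sub>R w + s *\<^sub>R v) - g (x + s *\<^sub>R v)" for s
  have "\<exists>s>0. s < t \<and> h t - h 0 = (t - 0) * (dder g v (x + t *\<^sub>R w + s *\<^sub>R v) - dder g v (x + s *\<^sub>R v))"
  proof (rule MVT2[OF t])
    fix s assume s: "0 \<le> s" "s \<le> t"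
    have "x + t *\<^sub>R w + s *\<^sub>R v \<in> U" "x + s *\<^sub>R v \<in> U"
      using ball[OF s, of t] ball[OF s, of 0] t by (simp_all add: algebra_simps)
    then show "(h has_real_derivative dder g v (x + t *\<^sub>R w + s *\<^sub>R v) - dder g v (x + s *\<^sub>R v)) (at s)"
      unfolding h_def by (intro DERIV_diff line g)
  qed
  then obtain s where s: "0 < s" "s < t"
    and h: "h t - h 0 = t * (dder g v (x + s *\<^sub>R v + t *\<^sub>R w) - dder g v (x + s *\<^sub>R v))"
    by (auto simp: add_ac)
  have "\<exists>s'>0. s' < t \<and> dder g v (x + s *\<^sub>R v + t *\<^sub>R w) - dder g v (x + s *\<^sub>R v + 0 *\<^sub>R w)
      = (t - 0) * dder (dder g v) w (x + s *\<^sub>R v + s' *\<^sub>R w)"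
    by (rule MVT2[OF t]) (intro line gv ball, use s in auto)
  then obtain s' where s': "0 < s'" "s' < t"
    "dder g v (x + s *\<^sub>R v + t *\<^sub>R w) - dder g v (x + s *\<^sub>R v) = t * dder (dder g v) w (x + s *\<^sub>R v + s' *\<^sub>R w)"
    by auto
  have "g (x + t *\<^sub>R v + t *\<^sub>R w) - g (x + t *\<^sub>R v) - g (x + t *\<^sub>R w) + g x = h t - h 0"
    by (simp add: h_def algebra_simps)
  then show ?thesis using h s s' by (intro that[of s s']) (auto simp: power2_eq_square)
qed

lemma dder_commute_real:
  fixes g :: "'a::real_normed_vector \<Rightarrow> real"
  assumes U: "open U" and x: "x \<in> U" and g: "smooth_on U g"
  shows "dder (dder g v) w x = dder (dder g w) v x"
proof -
  let ?a = "dder (dder g v) w" and ?b = "dder (dder g w) v"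
  obtain e where e: "e > 0" "ball x e \<subseteq> U" using U x openE by blast
  have cont: "isCont ?a x" "isCont ?b x"
    using smooth_on_continuous[OF smooth_on_dder[OF smooth_on_dder[OF g]]] U x
    by (auto simp: continuous_on_eq_continuous_at)
  have "\<bar>?a x - ?b x\<bar> \<le> \<epsilon>" if \<epsilon>: "\<epsilon> > 0" for \<epsilon>
  proof -
    have "\<epsilon> / 2 > 0" using \<epsilon> by simp
    then obtain d1 d2 where d: "d1 > 0" "\<And>y. dist y x < d1 \<Longrightarrow> dist (?a y) (?a x) < \<epsilon> / 2"
      "d2 > 0" "\<And>y. dist y x < d2 \<Longrightarrow> dist (?b y) (?b x) < \<epsilon> / 2"
      using cont unfolding continuous_at_eps_delta by metis
    define m where "m = min e (min d1 d2)"
    \<comment> \<open>So small that the whole parallelogram stays within \<open>m\<close> of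
      \<open>x\<close>; the summand 1 keeps the denominator positive when \<open>v\<close> and
      \<open>w\<close> are both zero.\<close>
    define t where "t = m / (2 * (norm v + norm w + 1))"
    have m: "m > 0" using e d by (simp add: m_def)
    have pos: "norm v + norm w + 1 > 0" by (simp add: add_nonneg_pos)
    have t: "t > 0" using m pos by (simp add: t_def)
    have near: "dist (x + s *\<^sub>R v + s' *\<^sub>R w) x < m" if "0 \<le> s" "s \<le> t" "0 \<le> s'" "s' \<le> t" for s s'
    proof -
      have "norm (s *\<^sub>R v + s' *\<^sub>R w) \<le> s * norm v + s' * norm w"
        using that norm_triangle_ineq[of "s *\<^sub>R v" "s' *\<^sub>R w"] by simp
      also have "\<dots> \<le> t * norm v + t * norm w"
        using that by (intro add_mono mult_right_mono) auto
      also have "\<dots> \<le> t * (norm v + norm w + 1)" using t by (simp add: algebra_simps)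
      also have "\<dots> = m / 2" using pos by (simp add: t_def del: distrib_left_numeral)
      also have "\<dots> < m" using m by simp
      finally show ?thesis by (simp add: dist_norm)
    qed
    have inU: "x + s *\<^sub>R v + s' *\<^sub>R w \<in> U" if "0 \<le> s" "s \<le> t" "0 \<le> s'" "s' \<le> t" for s s'
      using near[OF that] e by (auto simp: m_def dist_commute)
    have inU': "x + s *\<^sub>R w + s' *\<^sub>R v \<in> U" if "0 \<le> s" "s \<le> t" "0 \<le> s'" "s' \<le> t" for s s'
      using inU[of s' s] that by (simp add: algebra_simps)
    note diff = smooth_on_differentiable[OF g] smooth_on_differentiable[OF smooth_on_dder[OF g]]
    obtain s s' where s: "0 < s" "s < t" "0 < s'" "s' < t"
      "g (x + t *\<^sub>R v + t *\<^sub>R w) - g (x + t *\<^sub>R v) - g (x + t *\<^sub>R w) + g x = t\<^sup>2 * ?a (x + s *\<^sub>R v + s' *\<^sub>R w)"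
      by (rule second_difference_mvt[OF t inU diff]) auto
    obtain r r' where r: "0 < r" "r < t" "0 < r'" "r' < t"
      "g (x + t *\<^sub>R w + t *\<^sub>R v) - g (x + t *\<^sub>R w) - g (x + t *\<^sub>R v) + g x = t\<^sup>2 * ?b (x + r *\<^sub>R w + r' *\<^sub>R v)"
      by (rule second_difference_mvt[OF t inU' diff]) auto
    have "g (x + t *\<^sub>R v + t *\<^sub>R w) = g (x + t *\<^sub>R w + t *\<^sub>R v)" by (simp add: add_ac)
    then have "t\<^sup>2 * ?a (x + s *\<^sub>R v + s' *\<^sub>R w) = t\<^sup>2 * ?b (x + r *\<^sub>R w + r' *\<^sub>R v)"
      using s(5) r(5) by linarith
    then have "?a (x + s *\<^sub>R v + s' *\<^sub>R w) = ?b (x + r *\<^sub>R w + r' *\<^sub>R v)"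
      using t by simp
    moreover have "dist (?a (x + s *\<^sub>R v + s' *\<^sub>R w)) (?a x) < \<epsilon> / 2"
      by (rule d(2)) (use near[of s s'] s in \<open>auto simp: m_def\<close>)
    moreover have "dist (?b (x + r *\<^sub>R w + r' *\<^sub>R v)) (?b x) < \<epsilon> / 2"
      by (rule d(4)) (use near[of r' r] r in \<open>auto simp: m_def add_ac\<close>)
    ultimately show ?thesis unfolding dist_real_def by linarith
  qed
  then have "\<bar>?a x - ?b x\<bar> \<le> 0"
    using field_le_epsilon[of "\<bar>?a x - ?b x\<bar>" 0] by simp
  then show ?thesis by simp
qed

lemma dder_commute:
  fixes f :: "'a::real_normed_vector \<Rightarrow> complex"
  assumes U: "open U" and x: "x \<in> U" and f: "smooth_on U f"
  shows "dder (dder f v) w x = dder (dder f w) v x"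
proof -
  have *: "L (dder (dder f v) w x) = L (dder (dder f w) v x)" if L: "bounded_linear L" for L :: "complex \<Rightarrow> real"
  proof -
    define g where "g x = L (f x)" for x
    have g: "smooth_on U g" unfolding g_def by (rule smooth_on_bounded_linear[OF U L f])
    have 1: "dder g v y = L (dder f v y)" if "y \<in> U" for v y
      unfolding g_def by (rule dder_eqI[OF dder_bounded_linear[OF L smooth_on_differentiable[OF f that]]])
    have "dder (dder g v) w x = L (dder (dder f v) w x)" for v w
    proof (rule dder_eqI)
      have "((\<lambda>y. L (dder f v y)) has_derivative (\<lambda>w. L (dder (dder f v) w x))) (at x)"
        by (rule dder_bounded_linear[OF L smooth_on_differentiable[OF smooth_on_dder[OF f] x]])
      then show "(dder g v has_derivative (\<lambda>w. L (dder (dder f v) w x))) (at x)"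
        by (rule has_derivative_transform_within_open[OF _ U x]) (simp add: 1)
    qed
    then show ?thesis using dder_commute_real[OF U x g, of v w] by simp
  qed
  show ?thesis
    using *[OF bounded_linear_Re] *[OF bounded_linear_Im] by (simp add: complex_eq_iff)
qed

subsection \<open>Wirtinger derivatives\<close>

text \<open>Two real directions and the coefficient of the second, so that both kinds of Wirtinger
  derivative are one formula and are treated together.\<close>

definition wdir :: "'N + 'N \<Rightarrow> (complex^'N::finite) \<times> (complex^'N) \<times> complex" where
  "wdir u = (case u of Inl k \<Rightarrow> (axis k 1, axis k \<i>, - \<i>) | Inr k \<Rightarrow> (axis k 1, axis k \<i>, \<i>))"

lemma wirtinger_eq:
  "wirtinger u f x = (dder f (fst (wdir u)) x + snd (snd (wdir u)) * dder f (fst (snd (wdir u))) x) / 2"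
  by (cases u) (auto simp: wdir_def dZ_def dZbar_def)

lemma smooth_on_wirtinger:
  assumes "open U" "smooth_on U f" shows "smooth_on U (wirtinger u f)"
proof -
  have "smooth_on U (\<lambda>x. (1/2) * (dder f (fst (wdir u)) x + snd (snd (wdir u)) * dder f (fst (snd (wdir u))) x))"
    by (intro smooth_on_mult smooth_on_add smooth_on_const smooth_on_dder assms)
  then show ?thesis by (rule smooth_on_cong[OF assms(1)]) (simp add: wirtinger_eq)
qed

lemma wirtinger_cong:
  assumes "open U" "x \<in> U" "\<And>y. y \<in> U \<Longrightarrow> f y = g y" "f differentiable (at x)"
  shows "wirtinger u f x = wirtinger u g x"
proof -
  have "(g has_derivative frechet_derivative f (at x)) (at x)"
    by (rule has_derivative_transform_within_open[OF _ assms(1,2,3)])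
      (use assms(4) in \<open>simp_all add: frechet_derivative_works\<close>)
  then have "frechet_derivative g (at x) = frechet_derivative f (at x)"
    by (rule frechet_derivative_at[symmetric])
  then show ?thesis by (simp add: wirtinger_eq)
qed

lemma dder_wirtinger:
  assumes f: "smooth_on U f" and x: "x \<in> U"
  shows "dder (wirtinger u f) v x
    = (dder (dder f (fst (wdir u))) v x + snd (snd (wdir u)) * dder (dder f (fst (snd (wdir u)))) v x) / 2"
proof (rule dder_eqI)
  let ?c = "snd (snd (wdir u))"
  have "((\<lambda>x. (dder f (fst (wdir u)) x + ?c * dder f (fst (snd (wdir u))) x) * (1 / 2)) has_derivative
      (\<lambda>v. (dder (dder f (fst (wdir u))) v x + ?c * dder (dder f (fst (snd (wdir u)))) v x) * (1 / 2))) (at x)"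
    by (intro has_derivative_mult_left has_derivative_add has_derivative_mult_right
        smooth_on_has_derivative[OF smooth_on_dder[OF f] x])
  then show "(wirtinger u f has_derivative
      (\<lambda>v. (dder (dder f (fst (wdir u))) v x + ?c * dder (dder f (fst (snd (wdir u)))) v x) / 2)) (at x)"
    by (simp add: wirtinger_eq[abs_def])
qed

lemma wirtinger_commute:
  assumes U: "open U" and x: "x \<in> U" and f: "smooth_on U f"
  shows "wirtinger u (wirtinger v f) x = wirtinger v (wirtinger u f) x"
  unfolding wirtinger_eq[of u "wirtinger v f"] wirtinger_eq[of v "wirtinger u f"]
    dder_wirtinger[OF f x]
  by (simp add: dder_commute[OF U x f, of "fst (wdir v)" "fst (wdir u)"]
      dder_commute[OF U x f, of "fst (snd (wdir v))" "fst (wdir u)"]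
      dder_commute[OF U x f, of "fst (wdir v)" "fst (snd (wdir u))"]
      dder_commute[OF U x f, of "fst (snd (wdir v))" "fst (snd (wdir u))"] field_simps)

lemma smooth_on_foldr_wirtinger:
  "open U \<Longrightarrow> smooth_on U f \<Longrightarrow> smooth_on U (foldr wirtinger vs f)"
  by (induction vs) (auto intro: smooth_on_wirtinger)

lemma foldr_wirtinger_move:
  assumes U: "open U" and f: "smooth_on U f"
  shows "x \<in> U \<Longrightarrow> foldr wirtinger (ys @ a # zs) f x = foldr wirtinger (a # ys @ zs) f x"
proof (induction ys arbitrary: x)
  case (Cons y ys)
  have sm: "smooth_on U (foldr wirtinger (ys @ a # zs) f)" "smooth_on U (foldr wirtinger (ys @ zs) f)"
    by (rule smooth_on_foldr_wirtinger[OF U f])+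
  have "wirtinger y (foldr wirtinger (ys @ a # zs) f) x = wirtinger y (wirtinger a (foldr wirtinger (ys @ zs) f)) x"
    by (rule wirtinger_cong[OF U Cons.prems]) (use Cons.IH sm smooth_on_differentiable[OF _ Cons.prems] in auto)
  also have "\<dots> = wirtinger a (wirtinger y (foldr wirtinger (ys @ zs) f)) x"
    by (rule wirtinger_commute[OF U Cons.prems sm(2)])
  finally show ?case by simp
qed simp

text \<open>This makes the Taylor coefficients independent of the list chosen by \<open>SOME\<close>
  in \<open>taylor\<close>.\<close>

lemma foldr_wirtinger_mset:
  assumes U: "open U" and f: "smooth_on U f"
  shows "mset vs = mset ws \<Longrightarrow> x \<in> U \<Longrightarrow> foldr wirtinger vs f x = foldr wirtinger ws f x"
proof (induction vs arbitrary: ws x)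
  case (Cons a vs)
  then have "a \<in> set ws" by (metis list.set_intros(1) set_mset_mset)
  then obtain ys zs where ws: "ws = ys @ a # zs" by (meson split_list)
  then have ms: "mset vs = mset (ys @ zs)" using Cons.prems by simp
  have "foldr wirtinger (a # vs) f x = wirtinger a (foldr wirtinger (ys @ zs) f) x"
    unfolding foldr.simps o_apply
    by (rule wirtinger_cong[OF U Cons.prems(2)])
      (use Cons.IH[OF ms] smooth_on_foldr_wirtinger[OF U f] smooth_on_differentiable[OF _ Cons.prems(2)] in auto)
  then show ?case using foldr_wirtinger_move[OF U f Cons.prems(2)] by (simp add: ws)
qed simp

lemma mcoeff_taylor:
  assumes "open U" "p \<in> U" "smooth_on U f"
  shows "mcoeff (taylor p f) (mset vs)
    = foldr wirtinger vs f p / of_nat (\<Prod>v\<in>set vs. fact (count (mset vs) v))"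
proof -
  have *: "mset (SOME ws. mset ws = mset vs) = mset vs"
    by (rule someI_ex) auto
  show ?thesis
    unfolding taylor_def mcoeff_Mfps foldr_wirtinger_mset[OF assms(1,3) _ assms(2), OF *]
    by simp
qed

lemma taylor_wirtinger:
  assumes "open U" "p \<in> U" "smooth_on U f"
  shows "taylor p (wirtinger u f) = pder u (taylor p f)"
proof (rule mfps_eqI)
  fix \<alpha> :: "('a + 'a) multiset"
  obtain vs where vs: "mset vs = \<alpha>" using ex_mset by blast
  let ?P = "\<lambda>\<beta>. \<Prod>v\<in>set_mset \<beta>. fact (count \<beta> v) :: nat"
  have "?P (add_mset u \<alpha>) = fact (Suc (count \<alpha> u)) * (\<Prod>v\<in>set_mset \<alpha> - {u}. fact (count \<alpha> v))"
    by (simp add: prod.insert_remove del: fact_Suc) (intro disjI2 prod.cong, auto)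
  also have "\<dots> = Suc (count \<alpha> u) * (fact (count \<alpha> u) * (\<Prod>v\<in>set_mset \<alpha> - {u}. fact (count \<alpha> v)))"
    by (simp add: algebra_simps)
  also have "fact (count \<alpha> u) * (\<Prod>v\<in>set_mset \<alpha> - {u}. fact (count \<alpha> v)) = ?P \<alpha>"
  proof (cases "u \<in># \<alpha>")
    case True then show ?thesis by (simp add: prod.remove[of "set_mset \<alpha>" u])
  next
    case False then show ?thesis by (simp add: not_in_iff)
  qed
  finally have P: "?P (add_mset u \<alpha>) = Suc (count \<alpha> u) * ?P \<alpha>" .
  have P0: "complex_of_nat (Suc (count \<alpha> u)) \<noteq> 0" by (simp del: of_nat_Suc)
  \<comment> \<open>The extra \<open>u\<close> is put at the end of the list because
    \<open>foldr\<close> applies the last entry first.\<close>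
  have "mcoeff (pder u (taylor p f)) \<alpha>
      = of_nat (Suc (count \<alpha> u)) * mcoeff (taylor p f) (mset (vs @ [u]))"
    by (simp add: mcoeff_pder vs)
  also have "\<dots> = of_nat (Suc (count \<alpha> u)) * (foldr wirtinger (vs @ [u]) f p / of_nat (?P (add_mset u \<alpha>)))"
    unfolding mcoeff_taylor[OF assms] by (simp add: vs flip: set_mset_mset)
  also have "\<dots> = foldr wirtinger vs (wirtinger u f) p / of_nat (?P \<alpha>)"
    unfolding P of_nat_mult using P0 by simp
  also have "\<dots> = mcoeff (taylor p (wirtinger u f)) \<alpha>"
    using mcoeff_taylor[OF assms(1,2) smooth_on_wirtinger[OF assms(1,3), of u], of vs]
    by (simp add: vs flip: set_mset_mset)
  finally show "mcoeff (taylor p (wirtinger u f)) \<alpha> = mcoeff (pder u (taylor p f)) \<alpha>" ..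
qed

lemma mcoeff_taylor_empty [simp]: "mcoeff (taylor p f) {#} = f p"
  by (simp add: taylor_def)

section \<open>Asymptotic expansions\<close>

text \<open>The filter \<open>nhds 0\<close> includes the point 0 itself, so for
  \<open>n > 0\<close> a flat function vanishes there; expansions thereby determine the value at
  \<open>p\<close>.\<close>

definition flat :: "nat \<Rightarrow> ('a::real_normed_vector \<Rightarrow> complex) \<Rightarrow> bool" where
  "flat n g \<longleftrightarrow> (\<exists>C. \<forall>\<^sub>F v in nhds 0. norm (g v) \<le> C * norm v ^ n)"

lemma flatE:
  assumes "flat n g" obtains C where "C \<ge> 0" "\<forall>\<^sub>F v in nhds 0. norm (g v) \<le> C * norm v ^ n"
proof -
  obtain C where C: "\<forall>\<^sub>F v in nhds 0. norm (g v) \<le> C * norm v ^ n" using assms by (auto simp: flat_def)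
  have "\<forall>\<^sub>F v in nhds 0. norm (g v) \<le> \<bar>C\<bar> * norm v ^ n"
    using C by eventually_elim (metis abs_ge_self mult_right_mono norm_ge_zero order_trans zero_le_power)
  then show ?thesis using that[of "\<bar>C\<bar>"] by simp
qed

lemma flat_cong: "flat n g \<Longrightarrow> \<forall>\<^sub>F v in nhds 0. f v = g v \<Longrightarrow> flat n f"
  unfolding flat_def by (force elim: eventually_elim2)

lemma flat_add: assumes "flat n f" "flat n g" shows "flat n (\<lambda>v. f v + g v)"
proof -
  obtain C D where "\<forall>\<^sub>F v in nhds 0. norm (f v) \<le> C * norm v ^ n" "\<forall>\<^sub>F v in nhds 0. norm (g v) \<le> D * norm v ^ n"
    using assms by (auto simp: flat_def)
  then have "\<forall>\<^sub>F v in nhds 0. norm (f v + g v) \<le> (C + D) * norm v ^ n"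
  proof eventually_elim
    case (elim v)
    then show ?case using norm_triangle_ineq[of "f v" "g v"] by (simp add: distrib_right)
  qed
  then show ?thesis by (auto simp: flat_def)
qed

lemma flat_mult: assumes "flat n f" "flat m g" shows "flat (n + m) (\<lambda>v. f v * g v)"
proof -
  obtain C where C: "C \<ge> 0" "\<forall>\<^sub>F v in nhds 0. norm (f v) \<le> C * norm v ^ n" using flatE[OF assms(1)] .
  obtain D where D: "D \<ge> 0" "\<forall>\<^sub>F v in nhds 0. norm (g v) \<le> D * norm v ^ m" using flatE[OF assms(2)] .
  have "\<forall>\<^sub>F v in nhds 0. norm (f v * g v) \<le> (C * D) * norm v ^ (n + m)"
    using C(2) D(2)
  proof eventually_elim
    case (elim v)
    have "norm (f v * g v) \<le> (C * norm v ^ n) * (D * norm v ^ m)"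
      unfolding norm_mult using elim C(1) by (intro mult_mono) auto
    then show ?case by (simp add: power_add mult_ac)
  qed
  then show ?thesis by (auto simp: flat_def)
qed

lemma flat_mono: assumes "flat n f" "m \<le> n" shows "flat m f"
proof -
  obtain C where C: "C \<ge> 0" "\<forall>\<^sub>F v in nhds 0. norm (f v) \<le> C * norm v ^ n" using flatE[OF assms(1)] .
  have "\<forall>\<^sub>F v::'a in nhds 0. norm v < 1"
    using eventually_nhds_ball[of 1 "0::'a"] by (simp add: dist_norm)
  then have "\<forall>\<^sub>F v in nhds 0. norm (f v) \<le> C * norm v ^ m"
    using C(2)
  proof eventually_elim
    case (elim v)
    then have "norm v ^ n \<le> norm v ^ m" using assms(2) by (intro power_decreasing) auto
    then show ?case using elim C(1) by (meson mult_left_mono order_trans)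
  qed
  then show ?thesis by (auto simp: flat_def)
qed

lemma flat_const: "flat 0 (\<lambda>_. c)"
  by (auto simp: flat_def intro!: exI[of _ "norm c"])

lemma flat_zero [simp]: "flat n (\<lambda>_. 0)"
  by (auto simp: flat_def intro!: exI[of _ 0])

lemma flat_cmult: "flat n f \<Longrightarrow> flat n (\<lambda>v. c * f v)"
  using flat_mult[OF flat_const[of c], of n f] by simp

lemma flat_uminus: "flat n f \<Longrightarrow> flat n (\<lambda>v. - f v)"
  by (simp add: flat_def)

lemma flat_diff: "flat n f \<Longrightarrow> flat n g \<Longrightarrow> flat n (\<lambda>v. f v - g v)"
  using flat_add[OF _ flat_uminus, of n f g] by simp

lemma flat_sum: "(\<And>i. i \<in> A \<Longrightarrow> flat n (f i)) \<Longrightarrow> flat n (\<lambda>v. \<Sum>i\<in>A. f i v)"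
  by (induction A rule: infinite_finite_induct) (auto intro: flat_add)

lemma flat_compose:
  fixes w :: "'a::real_normed_vector \<Rightarrow> 'b::real_normed_vector"
  assumes f: "flat n f" and w: "\<forall>\<^sub>F v in nhds 0. norm (w v) \<le> K * norm v"
  shows "flat n (\<lambda>v. f (w v))"
proof -
  obtain C where C: "C \<ge> 0" "\<forall>\<^sub>F v in nhds 0. norm (f v) \<le> C * norm v ^ n" using flatE[OF f] .
  have w': "\<forall>\<^sub>F v in nhds 0. norm (w v) \<le> \<bar>K\<bar> * norm v"
    using w by eventually_elim (metis abs_ge_self mult_right_mono norm_ge_zero order_trans)
  have "((\<lambda>v. \<bar>K\<bar> * norm v) \<longlongrightarrow> \<bar>K\<bar> * norm (0::'a)) (nhds (0::'a))"
    by (rule tendsto_mult[OF tendsto_const tendsto_norm[OF filterlim_ident]])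
  then have "((\<lambda>v. \<bar>K\<bar> * norm v) \<longlongrightarrow> 0) (nhds (0::'a))" by simp
  from Lim_null_comparison[OF w' this] have "(w \<longlongrightarrow> 0) (nhds 0)" .
  then have "\<forall>\<^sub>F v in nhds 0. norm (f (w v)) \<le> C * norm (w v) ^ n"
    using C(2) by (auto simp: filterlim_iff)
  then have "\<forall>\<^sub>F v in nhds 0. norm (f (w v)) \<le> (C * \<bar>K\<bar> ^ n) * norm v ^ n"
    using w'
  proof eventually_elim
    case (elim v)
    have "norm (w v) ^ n \<le> (\<bar>K\<bar> * norm v) ^ n" using elim by (intro power_mono) auto
    then have "C * norm (w v) ^ n \<le> C * (\<bar>K\<bar> * norm v) ^ n" using C(1) by (rule mult_left_mono)
    then show ?case using elim by (simp add: power_mult_distrib mult_ac)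
  qed
  then show ?thesis by (auto simp: flat_def)
qed

section \<open>Truncated series on the real points, and asymptotic expansions\<close>

definition cc :: "complex^'N \<Rightarrow> 'N + 'N \<Rightarrow> complex" where
  "cc v u = (case u of Inl k \<Rightarrow> v $ k | Inr k \<Rightarrow> cnj (v $ k))"

lemma cc_simps [simp]: "cc v (Inl k) = v $ k" "cc v (Inr k) = cnj (v $ k)"
  by (simp_all add: cc_def)

lemma norm_cc: "norm (cc (v :: complex^'N::finite) u) \<le> norm v"
  by (cases u) (auto simp: component_le_norm_cart norm_bound_component_le_cart Finite_Cartesian_Product.norm_nth_le)

lemma norm_prod_cc: "norm (\<Prod>u\<in>#\<alpha>. cc (v :: complex^'N::finite) u) \<le> norm v ^ size \<alpha>"
proof (induction \<alpha>)
  case (add u \<alpha>)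
  have "norm (cc v u) * norm (\<Prod>u\<in>#\<alpha>. cc v u) \<le> norm v * norm v ^ size \<alpha>"
    by (intro mult_mono norm_cc add) auto
  then show ?case by (simp add: norm_mult)
qed simp

text \<open>The part of degree below \<open>n\<close>, evaluated where the conjugate variables are
  the conjugates of the holomorphic ones.\<close>

definition pev :: "nat \<Rightarrow> ('N::finite + 'N) mfps \<Rightarrow> complex^'N \<Rightarrow> complex" where
  "pev n F v = (\<Sum>\<alpha> | size \<alpha> < n. mcoeff F \<alpha> * (\<Prod>u\<in>#\<alpha>. cc v u))"

lemma finite_size_less [simp]: "finite {\<alpha> :: 'v::finite multiset. size \<alpha> < n}"
  by (rule finite_subset[OF _ finite_bounded_multisets[of n]]) auto

lemma flat_monomial: "size \<alpha> \<ge> n \<Longrightarrow> flat n (\<lambda>v. c * (\<Prod>u\<in>#\<alpha>. cc v u))"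
proof (rule flat_cmult, rule flat_mono)
  show "flat (size \<alpha>) (\<lambda>v. \<Prod>u\<in>#\<alpha>. cc v u)"
    unfolding flat_def by (intro exI[of _ 1]) (simp add: norm_prod_cc)
qed

lemma flat_pev: "F \<in> mpow k \<Longrightarrow> flat k (pev n F)"
  unfolding pev_def[abs_def]
proof (rule flat_sum)
  fix \<alpha> assume "F \<in> mpow k"
  then show "flat k (\<lambda>v. mcoeff F \<alpha> * (\<Prod>u\<in>#\<alpha>. cc v u))"
    by (cases "size \<alpha> < k") (auto simp: mpow_def intro: flat_monomial)
qed

lemma pev_add: "pev n (F + G) v = pev n F v + pev n G v"
  and pev_diff: "pev n (F - G) v = pev n F v - pev n G v"
  by (simp_all add: pev_def sum.distrib sum_subtractf sum_distrib_left ring_distribs mult.assoc)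

text \<open>The product of the truncations and the truncation of the product share all terms of
  degree below \<open>n\<close>; the remaining pairs of monomials have total degree at least
  \<open>n\<close>.\<close>

lemma pev_mult: "flat n (\<lambda>v. pev n F v * pev n G v - pev n (F * G) v)"
proof -
  let ?B = "{\<alpha> :: ('a + 'a) multiset. size \<alpha> < n}"
  let ?m = "\<lambda>\<alpha> v. \<Prod>u\<in>#\<alpha>. cc v u"
  let ?t = "\<lambda>v (\<beta>, \<gamma>). mcoeff F \<beta> * mcoeff G \<gamma> * ?m (\<beta> + \<gamma>) v"
  let ?S = "{(\<beta>, \<gamma>). size \<beta> + size \<gamma> < n} :: (('a + 'a) multiset \<times> _) set"
  have S: "?S \<subseteq> ?B \<times> ?B" by auto
  have 1: "pev n F v * pev n G v = (\<Sum>p\<in>?B \<times> ?B. ?t v p)" for v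
    by (simp add: pev_def sum_product sum.cartesian_product case_prod_unfold mult_ac)
  have 2: "pev n (F * G) v = (\<Sum>p\<in>?S. ?t v p)" for v
  proof -
    have "pev n (F * G) v = (\<Sum>(\<alpha>, \<beta>)\<in>(SIGMA \<alpha>:?B. {\<beta>. \<beta> \<subseteq># \<alpha>}). mcoeff F \<beta> * mcoeff G (\<alpha> - \<beta>) * ?m \<alpha> v)"
      by (simp add: pev_def mcoeff_mult sum_distrib_right sum.Sigma)
    also have "\<dots> = (\<Sum>p\<in>?S. ?t v p)"
      by (rule sum.reindex_bij_witness[where i = "\<lambda>(\<beta>, \<gamma>). (\<beta> + \<gamma>, \<beta>)" and j = "\<lambda>(\<alpha>, \<beta>). (\<beta>, \<alpha> - \<beta>)"])
        (auto simp: size_Diff_submset size_mset_mono simp del: image_mset_union)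
    finally show ?thesis .
  qed
  have "pev n F v * pev n G v - pev n (F * G) v = (\<Sum>p\<in>?B \<times> ?B - ?S. ?t v p)" for v
    unfolding 1 2 by (rule sum_diff[symmetric]) (use S in \<open>auto intro: finite_cartesian_product\<close>)
  moreover have "flat n (\<lambda>v. \<Sum>p\<in>?B \<times> ?B - ?S. ?t v p)"
    by (rule flat_sum) (auto simp del: image_mset_union intro!: flat_monomial)
  ultimately show ?thesis by simp
qed

text \<open>Expansions are additive and multiplicative and pass through composition by mere
  estimates. Together with uniqueness this computes Taylor series of composites without formulas for
  higher derivatives.\<close>

definition has_exp :: "(complex^'N::finite \<Rightarrow> complex) \<Rightarrow> complex^'N \<Rightarrow> ('N + 'N) mfps \<Rightarrow> bool" where
  "has_exp f p F \<longleftrightarrow> (\<forall>n. flat n (\<lambda>v. f (p + v) - pev n F v))"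

lemma has_expD: "has_exp f p F \<Longrightarrow> flat n (\<lambda>v. f (p + v) - pev n F v)"
  by (simp add: has_exp_def)

lemma eventually_nhds_0_shift:
  fixes p :: "'a::real_normed_vector"
  assumes "\<forall>\<^sub>F x in nhds p. P x" shows "\<forall>\<^sub>F v in nhds 0. P (p + v)"
proof -
  have "((\<lambda>v. p + v) \<longlongrightarrow> p + 0) (nhds 0)" by (intro tendsto_intros filterlim_ident)
  then show ?thesis using assms by (simp add: filterlim_iff)
qed

lemma has_exp_cong: "has_exp f p F \<Longrightarrow> \<forall>\<^sub>F x in nhds p. g x = f x \<Longrightarrow> has_exp g p F"
  unfolding has_exp_def
proof
  fix n assume "\<forall>n. flat n (\<lambda>v. f (p + v) - pev n F v)" and ev: "\<forall>\<^sub>F x in nhds p. g x = f x"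
  then have "flat n (\<lambda>v. f (p + v) - pev n F v)" by blast
  then show "flat n (\<lambda>v. g (p + v) - pev n F v)"
    by (rule flat_cong) (rule eventually_mono[OF eventually_nhds_0_shift[OF ev]], simp)
qed

lemma has_exp_const:
  fixes p :: "complex^'N::finite"
  shows "has_exp (\<lambda>_. c) p (mconst c)"
  unfolding has_exp_def
proof
  fix n show "flat n (\<lambda>v :: complex^'N. c - pev n (mconst c) v)"
  proof (cases n)
    case 0
    then show ?thesis by (simp add: pev_def flat_const)
  next
    case (Suc m)
    have "pev n (mconst c) v = (\<Sum>\<alpha> :: ('N + 'N) multiset | size \<alpha> < n. if \<alpha> = {#} then c else 0)" for v :: "complex^'N"
      unfolding pev_def by (rule sum.cong) auto
    then show ?thesis by (simp add: Suc)
  qed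
qed

lemma has_exp_add: assumes "has_exp f p F" "has_exp g p G" shows "has_exp (\<lambda>x. f x + g x) p (F + G)"
  unfolding has_exp_def
proof
  fix n show "flat n (\<lambda>v. f (p + v) + g (p + v) - pev n (F + G) v)"
    using flat_add[OF has_expD[OF assms(1)] has_expD[OF assms(2)], of n] by (simp add: pev_add algebra_simps)
qed

lemma flat_0_exp: assumes "has_exp f p F" shows "flat 0 (\<lambda>v. f (p + v))"
  using has_expD[OF assms, of 0] by (simp add: pev_def)

lemma has_exp_mult: assumes "has_exp f p F" "has_exp g p G" shows "has_exp (\<lambda>x. f x * g x) p (F * G)"
  unfolding has_exp_def
proof
  fix n
  have 1: "flat n (\<lambda>v. (f (p + v) - pev n F v) * g (p + v))"
    using flat_mult[OF has_expD[OF assms(1)] flat_0_exp[OF assms(2)]] by simp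
  have 2: "flat n (\<lambda>v. pev n F v * (g (p + v) - pev n G v))"
    using flat_mult[OF flat_pev[of F 0] has_expD[OF assms(2)]] by simp
  show "flat n (\<lambda>v. f (p + v) * g (p + v) - pev n (F * G) v)"
    using flat_add[OF 1 flat_add[OF 2 pev_mult[of n F G]]] by (simp add: algebra_simps)
qed

lemma has_exp_cmult: "has_exp f p F \<Longrightarrow> has_exp (\<lambda>x. c * f x) p (mconst c * F)"
  by (rule has_exp_mult[OF has_exp_const])

lemma has_exp_diff: assumes "has_exp f p F" "has_exp g p G" shows "has_exp (\<lambda>x. f x - g x) p (F - G)"
  using has_exp_add[OF assms(1) has_exp_cmult[OF assms(2), of "-1"]] by (simp add: mconst_uminus)

lemma has_exp_sum: "(\<And>i. i \<in> A \<Longrightarrow> has_exp (f i) p (F i)) \<Longrightarrow> has_exp (\<lambda>x. \<Sum>i\<in>A. f i x) p (\<Sum>i\<in>A. F i)"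
  by (induction A rule: infinite_finite_induct) (auto intro: has_exp_add has_exp_const[of 0, simplified])

lemma has_exp_prod: "(\<And>i. i \<in> A \<Longrightarrow> has_exp (f i) p (F i)) \<Longrightarrow> has_exp (\<lambda>x. \<Prod>i\<in>A. f i x) p (\<Prod>i\<in>A. F i)"
  by (induction A rule: infinite_finite_induct) (auto intro: has_exp_mult has_exp_const[of 1, simplified])

lemma has_exp_prod_mset: "(\<And>i. has_exp (f i) p (F i)) \<Longrightarrow> has_exp (\<lambda>x. \<Prod>i\<in>#\<alpha>. f i x) p (\<Prod>i\<in>#\<alpha>. F i)"
  by (induction \<alpha>) (auto intro: has_exp_mult has_exp_const[of 1, simplified])

lemma has_exp_det:
  fixes A :: "complex^'N::finite \<Rightarrow> complex^'n^'n"
  assumes "\<And>i j. has_exp (\<lambda>x. A x $ i $ j) p (B $ i $ j)"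
  shows "has_exp (\<lambda>x. det (A x)) p (det B)"
  unfolding det_def
proof (rule has_exp_sum)
  fix \<sigma> :: "'n \<Rightarrow> 'n"
  have P: "has_exp (\<lambda>x. \<Prod>i\<in>UNIV. A x $ i $ \<sigma> i) p (\<Prod>i\<in>UNIV. B $ i $ \<sigma> i)"
    by (rule has_exp_prod[OF assms])
  show "has_exp (\<lambda>x. of_int (sign \<sigma>) * (\<Prod>i\<in>UNIV. A x $ i $ \<sigma> i)) p
      (of_int (sign \<sigma>) * (\<Prod>i\<in>UNIV. B $ i $ \<sigma> i))"
  proof (cases "evenperm \<sigma>")
    case True then show ?thesis using P by (simp add: sign_def)
  next
    case False then show ?thesis using has_exp_cmult[OF P, of "-1"] by (simp add: sign_def mconst_uminus)
  qed
qed

lemma has_exp_value: assumes "has_exp f p F" shows "mcoeff F {#} = f p"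
proof -
  obtain C where "\<forall>\<^sub>F v in nhds 0. norm (f (p + v) - pev 1 F v) \<le> C * norm v ^ 1"
    using has_expD[OF assms, of 1] by (auto simp: flat_def)
  then have "norm (f (p + 0) - pev 1 F 0) \<le> C * norm (0::complex^'a) ^ 1"
    by (rule eventually_nhds_x_imp_x)
  then show ?thesis by (simp add: pev_def)
qed

subsection \<open>Uniqueness\<close>

lemma pev_Suc_lform: "F \<in> mpow k \<Longrightarrow> pev (Suc k) F v = lform k F (cc v)"
  unfolding pev_def lform_def
  by (rule sum.mono_neutral_right) (auto simp: mpow_def less_Suc_eq_le le_less)

lemma lform_scale: "lform k F (cc (t *\<^sub>R v)) = of_real t ^ k * lform k F (cc v)"
proof -
  have "(\<Prod>u\<in>#\<alpha>. cc (t *\<^sub>R v) u) = of_real t ^ size \<alpha> * (\<Prod>u\<in>#\<alpha>. cc v u)" for \<alpha>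
  proof (induction \<alpha>)
    case (add u \<alpha>)
    have "cc (t *\<^sub>R v) u = of_real t * cc v u"
      by (cases u) (simp_all add: scaleR_conv_of_real[where x = "_ :: complex"])
    then show ?case using add by simp
  qed simp
  then show ?thesis by (simp add: lform_def sum_distrib_left mult_ac)
qed

lemma continuous_lform: "continuous_on UNIV (\<lambda>v. lform k F (cc v))"
proof -
  have "continuous_on UNIV (\<lambda>v. cc v u)" for u :: "'a + 'a"
    by (cases u) (auto intro!: continuous_intros)
  then have "continuous_on UNIV (\<lambda>v. \<Prod>u\<in>#\<alpha>. cc v u)" for \<alpha> :: "('a + 'a) multiset"
    by (induction \<alpha>) (auto intro: continuous_on_mult)
  then show ?thesis unfolding lform_def by (intro continuous_intros)
qed

text \<open>Blow-up along the curve: \<open>h t\<close> tends to \<open>w\<close>, and by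
  homogeneity the bound at \<open>\<gamma> t\<close> says that the form at \<open>h t\<close> is
  O(t). The limit is taken from the right so that \<open>t ^ k\<close> is positive and cancels. The
  set \<open>A\<close> is the whole space for uniqueness of expansions, and the shifted
  \<open>M\<close> for functions vanishing on \<open>M\<close>.\<close>

lemma lform_eq_0_curve:
  assumes C: "\<forall>\<^sub>F v in nhds 0. v \<in> A \<longrightarrow> norm (lform k F (cc v)) \<le> C * norm v ^ Suc k"
    and \<gamma>: "(\<gamma> has_vector_derivative w) (at 0)" "\<gamma> 0 = 0" and A: "\<forall>\<^sub>F t in nhds (0::real). \<gamma> t \<in> A"
  shows "lform k F (cc w) = 0"
proof -
  define h where "h t = (1 / t) *\<^sub>R \<gamma> t" for t
  have h: "(h \<longlongrightarrow> w) (at_right 0)"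
  proof -
    have "((\<lambda>t. norm (\<gamma> t - t *\<^sub>R w) / norm t) \<longlongrightarrow> 0) (at 0)"
      using \<gamma> by (simp add: has_vector_derivative_def has_derivative_at)
    moreover have "\<forall>\<^sub>F t in at 0. norm (\<gamma> t - t *\<^sub>R w) / norm t = norm (h t - w)"
      unfolding eventually_at_filter
    proof (rule always_eventually, intro allI impI)
      fix t :: real assume t: "t \<noteq> 0"
      then have "h t - w = (1 / t) *\<^sub>R (\<gamma> t - t *\<^sub>R w)" by (simp add: h_def algebra_simps)
      then show "norm (\<gamma> t - t *\<^sub>R w) / norm t = norm (h t - w)" by simp
    qed
    ultimately have "((\<lambda>t. norm (h t - w)) \<longlongrightarrow> 0) (at 0)" by (rule Lim_transform_eventually)
    then have "(h \<longlongrightarrow> w) (at 0)" by (rule LIM_zero_cancel[OF tendsto_norm_zero_cancel])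
    then show ?thesis by (simp add: filterlim_at_split)
  qed
  have "continuous (at 0) \<gamma>" using \<gamma>(1) has_vector_derivative_continuous by blast
  then have "(\<gamma> \<longlongrightarrow> 0) (nhds 0)" using \<gamma>(2) tendsto_at_iff_tendsto_nhds[of \<gamma> 0] by (simp add: continuous_at)
  then have "\<forall>\<^sub>F t in nhds 0. \<gamma> t \<in> A \<longrightarrow> norm (lform k F (cc (\<gamma> t))) \<le> C * norm (\<gamma> t) ^ Suc k"
    using C by (auto simp: filterlim_iff)
  then have "\<forall>\<^sub>F t in nhds 0. norm (lform k F (cc (\<gamma> t))) \<le> C * norm (\<gamma> t) ^ Suc k"
    using A by eventually_elim auto
  then have "\<forall>\<^sub>F t in at_right 0. norm (lform k F (cc (\<gamma> t))) \<le> C * norm (\<gamma> t) ^ Suc k"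
    by (simp add: eventually_nhds_conv_at eventually_at_split)
  moreover have "\<forall>\<^sub>F t in at_right 0. (0::real) < t" by (simp add: eventually_at_right_less)
  ultimately have "\<forall>\<^sub>F t in at_right 0. norm (lform k F (cc (h t))) \<le> C * norm (h t) ^ Suc k * t"
  proof eventually_elim
    case (elim t)
    have g: "\<gamma> t = t *\<^sub>R h t" using elim by (simp add: h_def)
    have "t ^ k * norm (lform k F (cc (h t))) \<le> t ^ k * (C * norm (h t) ^ Suc k * t)"
      using elim(1) elim(2) unfolding g lform_scale by (simp add: norm_mult norm_power power_mult_distrib mult_ac)
    then show ?case using elim by simp
  qed
  moreover have "((\<lambda>t. C * norm (h t) ^ Suc k * t) \<longlongrightarrow> C * norm w ^ Suc k * 0) (at_right 0)"
    by (intro tendsto_intros h)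
  moreover have "((\<lambda>t. norm (lform k F (cc (h t)))) \<longlongrightarrow> norm (lform k F (cc w))) (at_right 0)"
    using continuous_lform[of k F] by (intro tendsto_norm isCont_tendsto_compose[OF _ h]) (simp add: continuous_on_eq_continuous_at)
  ultimately have "norm (lform k F (cc w)) \<le> C * norm w ^ Suc k * 0"
    by (intro tendsto_le[of "at_right (0::real)"]) auto
  then show ?thesis by simp
qed

text \<open>Induction on the order: if all terms of degree below \<open>k\<close> vanish, the form
  of degree \<open>k\<close> vanishes at real points along straight lines, hence everywhere by
  complexification.\<close>

lemma has_exp_0_unique: assumes "has_exp (\<lambda>_. 0) p F" shows "F = 0"
proof -
  have "F \<in> mpow k" for k
  proof (induction k)
    case (Suc k)
    obtain C where "\<forall>\<^sub>F v in nhds 0. norm (0 - pev (Suc k) F v) \<le> C * norm v ^ Suc k"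
      using has_expD[OF assms, of "Suc k"] by (auto simp: flat_def)
    then have C: "\<forall>\<^sub>F v in nhds 0. v \<in> UNIV \<longrightarrow> norm (lform k F (cc v)) \<le> C * norm v ^ Suc k"
      by (simp add: pev_Suc_lform[OF Suc])
    have real: "lform k F (cc w) = 0" for w
      by (rule lform_eq_0_curve[OF C, of "\<lambda>t. t *\<^sub>R w"]) (auto intro!: derivative_eq_intros)
    have "lform k F x = 0" for x
    proof -
      define a where "a = (\<chi> i. (x (Inl i) + cnj (x (Inr i))) / 2)"
      define b where "b = (\<chi> i. (x (Inl i) - cnj (x (Inr i))) / (2 * \<i>))"
      have "lform k F (\<lambda>v. cc a v + \<i> * cc b v) = 0"
      proof (rule lform_real_combination)
        fix t :: real
        have "(\<lambda>v. cc a v + complex_of_real t * cc b v) = cc (a + t *\<^sub>R b)"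
        proof
          fix v show "cc a v + complex_of_real t * cc b v = cc (a + t *\<^sub>R b) v"
            by (cases v) (simp_all add: scaleR_conv_of_real[where x = "_ :: complex"])
        qed
        then show "lform k F (\<lambda>v. cc a v + complex_of_real t * cc b v) = 0" using real by simp
      qed
      moreover have "cc a v + \<i> * cc b v = x v" for v
        by (cases v) (simp_all add: a_def b_def field_simps)
      ultimately show ?thesis by simp
    qed
    then have "mcoeff F \<alpha> = 0" if "size \<alpha> = k" for \<alpha> using lform_eq_0D that by blast
    then show ?case using Suc by (auto simp: mpow_def less_Suc_eq)
  qed simp
  then show ?thesis by (intro mfps_eqI_mpow) simp
qed

lemma has_exp_unique: assumes "has_exp f p F" "has_exp f p G" shows "F = G"
  using has_exp_0_unique[of p "F - G"] has_exp_diff[OF assms] by simp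

subsection \<open>Taylor expansions\<close>

lemma has_derivative_cc: "((\<lambda>v. cc v u) has_derivative (\<lambda>w. cc w u)) (at (v :: complex^'N::finite))"
proof -
  have "bounded_linear (\<lambda>v :: complex^'N. cc v u)"
    by (cases u) (auto intro!: bounded_linear_intros bounded_linear_vec_nth bounded_linear_compose[OF bounded_linear_cnj])
  then show ?thesis by (rule bounded_linear_imp_has_derivative)
qed

lemma has_derivative_monomial:
  fixes v :: "complex^'N::finite"
  shows "((\<lambda>v. \<Prod>u\<in>#\<alpha>. cc v u) has_derivative
    (\<lambda>w. \<Sum>u\<in>UNIV. of_nat (count \<alpha> u) * (\<Prod>x\<in>#(\<alpha> - {#u#}). cc v x) * cc w u)) (at v)"
proof (induction \<alpha>)
  case (add a \<alpha>)
  have *: "cc v a * (\<Sum>u\<in>UNIV. of_nat (count \<alpha> u) * (\<Prod>x\<in>#(\<alpha> - {#u#}). cc v x) * cc w u) + cc w a * (\<Prod>u\<in>#\<alpha>. cc v u)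
    = (\<Sum>u\<in>UNIV. of_nat (count (add_mset a \<alpha>) u) * (\<Prod>x\<in>#(add_mset a \<alpha> - {#u#}). cc v x) * cc w u)" for w
  proof -
    have "(\<Sum>u\<in>UNIV. of_nat (count (add_mset a \<alpha>) u) * (\<Prod>x\<in>#(add_mset a \<alpha> - {#u#}). cc v x) * cc w u)
       = (\<Sum>u\<in>UNIV. cc v a * (of_nat (count \<alpha> u) * (\<Prod>x\<in>#(\<alpha> - {#u#}). cc v x) * cc w u)
          + (if u = a then cc w a * (\<Prod>u\<in>#\<alpha>. cc v u) else 0))"
    proof (rule sum.cong)
      fix u
      show "of_nat (count (add_mset a \<alpha>) u) * (\<Prod>x\<in>#(add_mset a \<alpha> - {#u#}). cc v x) * cc w u
        = cc v a * (of_nat (count \<alpha> u) * (\<Prod>x\<in>#(\<alpha> - {#u#}). cc v x) * cc w u)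
          + (if u = a then cc w a * (\<Prod>u\<in>#\<alpha>. cc v u) else 0)"
      proof (cases "u \<in># \<alpha>")
        case True
        then obtain \<beta> where b: "\<alpha> = add_mset u \<beta>" by (metis mset_add)
        then show ?thesis by (cases "u = a") (simp_all add: algebra_simps add_mset_commute)
      next
        case False
        then show ?thesis by (auto simp: not_in_iff)
      qed
    qed simp
    then show ?thesis by (simp add: sum.distrib sum_distrib_left)
  qed
  show ?case
    using has_derivative_mult[OF has_derivative_cc[of a v] add] by (simp add: *)
qed simp

lemma has_derivative_pev:
  "(pev (Suc n) F has_derivative (\<lambda>w. \<Sum>u\<in>UNIV. pev n (pder u F) v * cc w u)) (at v)"
proof -
  have "(\<Sum>\<alpha> | size \<alpha> < Suc n. mcoeff F \<alpha> * (\<Sum>u\<in>UNIV. of_nat (count \<alpha> u) * (\<Prod>x\<in>#(\<alpha> - {#u#}). cc v x) * cc w u))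
     = (\<Sum>u\<in>UNIV. pev n (pder u F) v * cc w u)" for w
  proof -
    have "(\<Sum>\<alpha> | size \<alpha> < Suc n. mcoeff F \<alpha> * (of_nat (count \<alpha> u) * (\<Prod>x\<in>#(\<alpha> - {#u#}). cc v x)))
       = pev n (pder u F) v" for u
    proof -
      have "(\<Sum>\<alpha> | size \<alpha> < Suc n. mcoeff F \<alpha> * (of_nat (count \<alpha> u) * (\<Prod>x\<in>#(\<alpha> - {#u#}). cc v x)))
         = (\<Sum>\<alpha>\<in>add_mset u ` {\<beta>. size \<beta> < n}. mcoeff F \<alpha> * (of_nat (count \<alpha> u) * (\<Prod>x\<in>#(\<alpha> - {#u#}). cc v x)))"
      proof (rule sum.mono_neutral_right)
        show "\<forall>\<alpha>\<in>{\<alpha>. size \<alpha> < Suc n} - add_mset u ` {\<beta>. size \<beta> < n}.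
            mcoeff F \<alpha> * (of_nat (count \<alpha> u) * (\<Prod>x\<in>#(\<alpha> - {#u#}). cc v x)) = 0"
        proof
          fix \<alpha> assume a: "\<alpha> \<in> {\<alpha>. size \<alpha> < Suc n} - add_mset u ` {\<beta>. size \<beta> < n}"
          have "u \<notin># \<alpha>"
          proof
            assume "u \<in># \<alpha>"
            then obtain \<beta> where "\<alpha> = add_mset u \<beta>" by (metis mset_add)
            with a show False by auto
          qed
          then show "mcoeff F \<alpha> * (of_nat (count \<alpha> u) * (\<Prod>x\<in>#(\<alpha> - {#u#}). cc v x)) = 0"
            by (simp add: not_in_iff)
        qed
      qed auto
      also have "\<dots> = pev n (pder u F) v"
        unfolding pev_def by (subst sum.reindex) (auto simp: mcoeff_pder inj_on_def mult_ac)
      finally show ?thesis .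
    qed
    then have "(\<Sum>u\<in>UNIV. pev n (pder u F) v * cc w u) = (\<Sum>u\<in>UNIV. \<Sum>\<alpha> | size \<alpha> < Suc n.
        mcoeff F \<alpha> * (of_nat (count \<alpha> u) * (\<Prod>x\<in>#(\<alpha> - {#u#}). cc v x)) * cc w u)"
      by (simp flip: sum_distrib_right)
    also have "\<dots> = (\<Sum>\<alpha> | size \<alpha> < Suc n. \<Sum>u\<in>UNIV.
        mcoeff F \<alpha> * (of_nat (count \<alpha> u) * (\<Prod>x\<in>#(\<alpha> - {#u#}). cc v x)) * cc w u)"
      by (rule sum.swap)
    finally show ?thesis by (simp add: sum_distrib_left mult.assoc)
  qed
  moreover have "((\<lambda>v. \<Sum>\<alpha> | size \<alpha> < Suc n. mcoeff F \<alpha> * (\<Prod>u\<in>#\<alpha>. cc v u)) has_derivative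
     (\<lambda>w. \<Sum>\<alpha> | size \<alpha> < Suc n. mcoeff F \<alpha> * (\<Sum>u\<in>UNIV. of_nat (count \<alpha> u) * (\<Prod>x\<in>#(\<alpha> - {#u#}). cc v x) * cc w u))) (at v)"
    by (intro has_derivative_sum has_derivative_mult_right has_derivative_monomial)
  ultimately show ?thesis unfolding pev_def[abs_def] by simp
qed

lemma derivative_wirtinger:
  fixes f :: "complex^'N::finite \<Rightarrow> complex"
  assumes "f differentiable (at x)"
  shows "frechet_derivative f (at x) w = (\<Sum>u\<in>UNIV. wirtinger u f x * cc w u)"
proof -
  let ?L = "frechet_derivative f (at x)"
  interpret L: linear ?L by (rule linear_frechet_derivative[OF assms])
  have "w = (\<Sum>k\<in>UNIV. Re (w $ k) *\<^sub>R axis k 1 + Im (w $ k) *\<^sub>R axis k \<i>)"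
  proof -
    have "(\<Sum>k\<in>UNIV. Re (w $ k) *\<^sub>R axis k 1 + Im (w $ k) *\<^sub>R axis k \<i>) $ i = w $ i" for i
    proof -
      have "(\<Sum>k\<in>UNIV. Re (w $ k) *\<^sub>R axis k 1 + Im (w $ k) *\<^sub>R axis k \<i>) $ i
        = (\<Sum>k\<in>UNIV. if k = i then w $ i else 0)"
        unfolding sum_component by (rule sum.cong) (auto simp: axis_def complex_eq_iff)
      then show ?thesis by simp
    qed
    then show ?thesis by (simp add: vec_eq_iff)
  qed
  then have "?L w = (\<Sum>k\<in>UNIV. Re (w $ k) *\<^sub>R ?L (axis k 1) + Im (w $ k) *\<^sub>R ?L (axis k \<i>))"
    by (metis (no_types, lifting) L.sum L.add L.scale sum.cong)
  also have "\<dots> = (\<Sum>k\<in>UNIV. dZ k f x * w $ k + dZbar k f x * cnj (w $ k))"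
  proof (rule sum.cong)
    fix k
    obtain a b where ab: "w $ k = Complex a b" by (metis complex_surj)
    show "Re (w $ k) *\<^sub>R ?L (axis k 1) + Im (w $ k) *\<^sub>R ?L (axis k \<i>)
      = dZ k f x * w $ k + dZbar k f x * cnj (w $ k)"
      unfolding ab by (simp add: dZ_def dZbar_def complex_eq_iff field_simps)
  qed simp
  also have "\<dots> = (\<Sum>u\<in>UNIV. wirtinger u f x * cc w u)"
    using sum.Plus[of UNIV UNIV "\<lambda>u. wirtinger u f x * cc w u"] by (simp add: sum.distrib)
  finally show ?thesis .
qed

text \<open>Induction on \<open>n\<close> with \<open>f\<close> general: the derivative of the
  remainder has the remainders of the Wirtinger derivatives as coefficients, each O(norm v ^ n), and
  the mean value inequality on a ball gains one power.\<close>

lemma has_exp_taylor: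
  fixes f :: "complex^'N::finite \<Rightarrow> complex"
  assumes U: "open U" and p: "p \<in> U" and f: "smooth_on U f"
  shows "has_exp f p (taylor p f)"
  unfolding has_exp_def
proof
  fix n
  have ev: "\<forall>\<^sub>F v in nhds 0. p + v \<in> U"
    by (rule eventually_nhds_0_shift) (use U p in \<open>rule eventually_nhds_in_open\<close>)
  show "flat n (\<lambda>v. f (p + v) - pev n (taylor p f) v)"
    using f
  proof (induction n arbitrary: f)
    \<comment> \<open>At order 0 the truncation is an empty sum, so the claim is only that
      \<open>f\<close> is bounded near \<open>p\<close>.\<close>
    case 0
    have "isCont f p" using smooth_on_continuous[OF 0] U p by (simp add: continuous_on_eq_continuous_at)
    then have "\<forall>\<^sub>F x in nhds p. dist (f x) (f p) < 1"
      by (auto simp: continuous_at tendsto_at_iff_tendsto_nhds dest: tendstoD[of _ _ _ 1])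
    then have "\<forall>\<^sub>F v in nhds 0. norm (f (p + v)) \<le> (norm (f p) + 1) * norm v ^ 0"
      by (rule eventually_mono[OF eventually_nhds_0_shift]) (simp add: dist_norm, smt (verit) norm_triangle_sub)
    then show ?case by (auto simp: flat_def pev_def)
  next
    case (Suc n)
    let ?F = "taylor p f"
    define g where "g v = f (p + v) - pev (Suc n) ?F v" for v
    let ?r = "\<lambda>u v. wirtinger u f (p + v) - pev n (pder u ?F) v"
    have "\<exists>C. C \<ge> 0 \<and> (\<forall>\<^sub>F v in nhds 0. norm (?r u v) \<le> C * norm v ^ n)" for u
    proof -
      have "flat n (?r u)"
        using Suc.IH[OF smooth_on_wirtinger[OF U Suc.prems, of u]]
        unfolding taylor_wirtinger[OF U p Suc.prems] .
      from flatE[OF this] show ?thesis by blast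
    qed
    then have "\<exists>C. \<forall>u. C u \<ge> 0 \<and> (\<forall>\<^sub>F v in nhds 0. norm (?r u v) \<le> C u * norm v ^ n)"
      by (intro choice allI)
    then obtain C where C: "\<And>u. C u \<ge> 0"
      "\<And>u. \<forall>\<^sub>F v in nhds 0. norm (wirtinger u f (p + v) - pev n (pder u ?F) v) \<le> C u * norm v ^ n"
      by blast
    have "\<forall>\<^sub>F v in nhds 0. p + v \<in> U \<and> (\<forall>u. norm (wirtinger u f (p + v) - pev n (pder u ?F) v) \<le> C u * norm v ^ n)"
      using ev C(2) by (simp add: eventually_conj_iff eventually_all_finite)
    then obtain e where e: "e > 0" "\<And>v. norm v < e \<Longrightarrow> p + v \<in> U"
      "\<And>v u. norm v < e \<Longrightarrow> norm (wirtinger u f (p + v) - pev n (pder u ?F) v) \<le> C u * norm v ^ n"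
      unfolding eventually_nhds_metric by (auto simp: dist_norm)
    have der: "(g has_derivative (\<lambda>w. \<Sum>u\<in>UNIV. (wirtinger u f (p + v) - pev n (pder u ?F) v) * cc w u)) (at v)"
      if "norm v < e" for v
    proof -
      have d: "f differentiable (at (p + v))" by (rule smooth_on_differentiable[OF Suc.prems e(2)[OF that]])
      have "((\<lambda>v. p + v) has_derivative (\<lambda>w. w)) (at v)" by (auto intro!: derivative_eq_intros)
      from has_derivative_compose[OF this d[unfolded frechet_derivative_works]]
      have "((\<lambda>v. f (p + v)) has_derivative (\<lambda>w. \<Sum>u\<in>UNIV. wirtinger u f (p + v) * cc w u)) (at v)"
        by (simp add: derivative_wirtinger[OF d])
      from has_derivative_diff[OF this has_derivative_pev]
      show ?thesis by (simp add: g_def[abs_def] sum_subtractf left_diff_distrib)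
    qed
    define K where "K = (\<Sum>u\<in>UNIV. C u)"
    have "norm (g v) \<le> K * norm v ^ Suc n" if v: "norm v < e" for v
    proof -
      have "norm (g v - g 0) \<le> (K * norm v ^ n) * norm (v - 0)"
      proof (rule differentiable_bound)
        show "convex (cball (0 :: complex^'N) (norm v))" by simp
        fix x :: "complex^'N" assume x: "x \<in> cball 0 (norm v)"
        then have x': "norm x \<le> norm v" "norm x < e" using v by auto
        show "(g has_derivative (\<lambda>w. \<Sum>u\<in>UNIV. (wirtinger u f (p + x) - pev n (pder u ?F) x) * cc w u)) (at x within cball 0 (norm v))"
          by (rule has_derivative_at_withinI[OF der[OF x'(2)]])
        show "onorm (\<lambda>w. \<Sum>u\<in>UNIV. (wirtinger u f (p + x) - pev n (pder u ?F) x) * cc w u) \<le> K * norm v ^ n"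
        proof (rule onorm_le)
          fix w
          have "norm (\<Sum>u\<in>UNIV. (wirtinger u f (p + x) - pev n (pder u ?F) x) * cc w u)
             \<le> (\<Sum>u\<in>UNIV. (C u * norm v ^ n) * norm w)"
          proof (rule sum_norm_le)
            fix u
            have "norm (wirtinger u f (p + x) - pev n (pder u ?F) x) \<le> C u * norm x ^ n" by (rule e(3)[OF x'(2)])
            also have "\<dots> \<le> C u * norm v ^ n" using x' C(1) by (intro mult_left_mono power_mono) auto
            finally show "norm ((wirtinger u f (p + x) - pev n (pder u ?F) x) * cc w u) \<le> (C u * norm v ^ n) * norm w"
              unfolding norm_mult using norm_cc by (intro mult_mono) (auto simp: C(1))
          qed
          then show "norm (\<Sum>u\<in>UNIV. (wirtinger u f (p + x) - pev n (pder u ?F) x) * cc w u) \<le> K * norm v ^ n * norm w"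
            by (simp add: K_def sum_distrib_right)
        qed
      qed auto
      moreover have "g 0 = 0"
      proof -
        have "pev (Suc n) ?F 0 = (\<Sum>\<alpha> :: ('N + 'N) multiset | size \<alpha> < Suc n. if \<alpha> = {#} then f p else 0)"
          unfolding pev_def
        proof (rule sum.cong)
          fix \<alpha> :: "('N + 'N) multiset"
          have "(\<Prod>u\<in>#\<alpha>. cc 0 u) = 0" if "\<alpha> \<noteq> {#}"
          proof -
            obtain u \<beta> where "\<alpha> = add_mset u \<beta>" using \<open>\<alpha> \<noteq> {#}\<close> by (metis multiset_cases)
            then show ?thesis by (cases u) auto
          qed
          then show "mcoeff ?F \<alpha> * (\<Prod>u\<in>#\<alpha>. cc 0 u) = (if \<alpha> = {#} then f p else 0)" by auto
        qed simp
        then show ?thesis by (simp add: g_def)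
      qed
      ultimately show ?thesis by (simp add: mult_ac)
    qed
    then have "\<forall>\<^sub>F v in nhds 0. norm (g v) \<le> K * norm v ^ Suc n"
      using e(1) unfolding eventually_nhds_metric by (auto simp: dist_norm)
    then show ?case by (auto simp: flat_def g_def)
  qed
qed

subsection \<open>Composition\<close>

text \<open>Truncating \<open>G\<close> first reduces the claim to a polynomial \<open>K\<close> in
  the expansions \<open>A u\<close>, for which sums and products suffice. Since the
  \<open>A u\<close> have no constant term, \<open>K\<close> and \<open>msubst A G\<close> agree in
  degrees below \<open>n\<close>.\<close>

lemma has_exp_compose:
  fixes H :: "complex^'N::finite \<Rightarrow> complex^'N"
  assumes f: "has_exp f (H p) G"
    and A: "\<And>u. has_exp (\<lambda>x. cc (H x - H p) u) p (A u)"
  shows "has_exp (\<lambda>x. f (H x)) p (msubst A G)"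
  unfolding has_exp_def
proof
  fix n
  have A1: "A u \<in> mpow 1" for u
    using has_exp_value[OF A[of u]] by (cases u) (simp_all add: mpow_1_iff)
  let ?w = "\<lambda>v. H (p + v) - H p"
  have "flat 1 (\<lambda>v. ?w v $ k)" for k
    using flat_add[OF has_expD[OF A, of 1 "Inl k"] flat_pev[OF A1, of 1 "Inl k"]] by simp
  then have "\<exists>C. \<forall>k. \<forall>\<^sub>F v in nhds 0. norm (?w v $ k) \<le> C k * norm v ^ 1"
    unfolding flat_def by (intro choice allI)
  then obtain C where C: "\<And>k. \<forall>\<^sub>F v in nhds 0. norm (?w v $ k) \<le> C k * norm v ^ 1"
    by blast
  then have "\<forall>\<^sub>F v in nhds 0. \<forall>k. norm (?w v $ k) \<le> C k * norm v" by (simp add: eventually_all_finite)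
  then have w: "\<forall>\<^sub>F v in nhds 0. norm (?w v) \<le> (\<Sum>k\<in>UNIV. C k) * norm v"
  proof eventually_elim
    case (elim v)
    have "norm (?w v) \<le> (\<Sum>k\<in>UNIV. norm (?w v $ k))" unfolding norm_vec_def by (rule L2_set_le_sum) simp
    also have "\<dots> \<le> (\<Sum>k\<in>UNIV. C k * norm v)" using elim by (intro sum_mono) auto
    finally show ?case by (simp add: sum_distrib_right)
  qed
  have 1: "flat n (\<lambda>v. f (H (p + v)) - pev n G (?w v))"
    using flat_compose[OF has_expD[OF f, of n] w] by simp
  define K where "K = (\<Sum>\<alpha> | size \<alpha> < n. mconst (mcoeff G \<alpha>) * (\<Prod>u\<in>#\<alpha>. A u))"
  have "has_exp (\<lambda>x. \<Sum>\<alpha> | size \<alpha> < n. mcoeff G \<alpha> * (\<Prod>u\<in>#\<alpha>. cc (H x - H p) u)) p K"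
    unfolding K_def by (intro has_exp_sum has_exp_cmult has_exp_prod_mset A)
  then have 2: "flat n (\<lambda>v. pev n G (?w v) - pev n K v)"
    using has_expD[of _ p K n] by (simp add: pev_def[of n G])
  have "pev n K v = pev n (msubst A G) v" for v
    unfolding pev_def
  proof (rule sum.cong)
    fix \<gamma> :: "('N + 'N) multiset" assume "\<gamma> \<in> {\<gamma>. size \<gamma> < n}"
    then have \<gamma>: "size \<gamma> \<le> n - 1" "n \<ge> 1" by auto
    then have "{\<alpha> :: ('N + 'N) multiset. size \<alpha> \<le> n - 1} = {\<alpha>. size \<alpha> < n}" by auto
    then have "mcoeff K \<gamma> = mcoeff (msubst A G) \<gamma>"
      using mcoeff_msubst_bound[OF A1 \<gamma>(1), where f = G] by (simp add: K_def)
    then show "mcoeff K \<gamma> * (\<Prod>u\<in>#\<gamma>. cc v u) = mcoeff (msubst A G) \<gamma> * (\<Prod>u\<in>#\<gamma>. cc v u)" by simp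
  qed simp
  then show "flat n (\<lambda>v. f (H (p + v)) - pev n (msubst A G) v)"
    using flat_add[OF 1 2] by simp
qed

section \<open>Holomorphic functions of several variables\<close>

text \<open>Complex differentiability expressed through the real derivative, which only has to
  commute with multiplication by \<open>\<i>\<close>.\<close>

definition cdiff_on :: "(complex^'N::finite) set \<Rightarrow> (complex^'N \<Rightarrow> complex) \<Rightarrow> bool" where
  "cdiff_on U h \<longleftrightarrow> (\<forall>Z\<in>U. h differentiable (at Z) \<and> (\<forall>v. dder h (\<i> *s v) Z = \<i> * dder h v Z))"

lemma cdiff_onD: "cdiff_on U h \<Longrightarrow> Z \<in> U \<Longrightarrow> h differentiable (at Z)"
  by (simp add: cdiff_on_def)

lemma cdiff_on_scale:
  assumes "cdiff_on U h" "Z \<in> U" shows "dder h (c *s v) Z = c * dder h v Z"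
proof -
  interpret linear "frechet_derivative h (at Z)"
    by (rule linear_frechet_derivative[OF cdiff_onD[OF assms]])
  have "c *s v = Re c *\<^sub>R v + Im c *\<^sub>R (\<i> *s v)"
    by (simp add: vec_eq_iff complex_eq_iff)
  then have "dder h (c *s v) Z = Re c *\<^sub>R dder h v Z + Im c *\<^sub>R (\<i> * dder h v Z)"
    using assms by (simp add: add scale cdiff_on_def)
  then show ?thesis by (simp add: complex_eq_iff)
qed

lemma bounded_linear_scale_vec: "bounded_linear (\<lambda>\<mu>. \<mu> *s (w :: complex^'N::finite))"
  by (rule linear_conv_bounded_linear[THEN iffD1], rule linearI)
    (simp_all add: vec_eq_iff algebra_simps)

lemma cdiff_on_line:
  assumes "cdiff_on U h" "Z + \<zeta> *s w \<in> U"
  shows "((\<lambda>\<zeta>. h (Z + \<zeta> *s w)) has_field_derivative dder h w (Z + \<zeta> *s w)) (at \<zeta>)"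
proof -
  have "((\<lambda>\<zeta>. Z + \<zeta> *s w) has_derivative (\<lambda>\<mu>. \<mu> *s w)) (at \<zeta>)"
    using has_derivative_add[OF has_derivative_const bounded_linear_imp_has_derivative[OF bounded_linear_scale_vec]] by simp
  from has_derivative_compose[OF this cdiff_onD[OF assms, unfolded frechet_derivative_works]]
  have "((\<lambda>\<zeta>. h (Z + \<zeta> *s w)) has_derivative (\<lambda>\<mu>. dder h (\<mu> *s w) (Z + \<zeta> *s w))) (at \<zeta>)" .
  then show ?thesis
    by (simp add: cdiff_on_scale[OF assms] has_field_derivative_def mult.commute[of _ "dder h w _"])
qed

lemma norm_scale_vec: "norm (c *s (v :: complex^'N::finite)) = norm c * norm v"
  by (simp add: norm_vec_def norm_mult L2_set_right_distrib)

lemma continuous_scale_vec [continuous_intros]: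
  "continuous_on S f \<Longrightarrow> continuous_on S (\<lambda>x. f x *s (w :: complex^'N::finite))"
  by (rule continuous_on_compose2[OF linear_continuous_on[OF bounded_linear_scale_vec], of _ f]) auto

definition circ :: "real \<Rightarrow> real \<Rightarrow> complex" where
  "circ r t = of_real r * exp (2 * of_real pi * \<i> * of_real t)"

lemma norm_circ: "r \<ge> 0 \<Longrightarrow> norm (circ r t) = r"
proof -
  assume "r \<ge> 0"
  have "norm (exp (\<i> * of_real (2 * pi * t))) = 1" by (rule norm_exp_i_times)
  then show ?thesis using \<open>r \<ge> 0\<close> by (simp add: circ_def norm_mult mult_ac)
qed

lemma continuous_circ [continuous_intros]: "continuous_on S (\<lambda>x. f x) \<Longrightarrow> continuous_on S (\<lambda>x. circ r (f x))"
  unfolding circ_def by (intro continuous_intros)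

text \<open>Cauchy's formula on the complex line through \<open>Z\<close> in direction
  \<open>w\<close>. A derivative becomes an integral of \<open>h\<close> itself, so its regularity
  follows by differentiating under the integral sign. One power of the denominator cancels against
  the velocity of the circle.\<close>

lemma dder_integral:
  assumes h: "cdiff_on U h" and r: "r > 0" and sub: "\<And>\<zeta>. norm \<zeta> \<le> r \<Longrightarrow> Z + \<zeta> *s w \<in> U"
  shows "dder h w Z = integral (cbox 0 1) (\<lambda>t. h (Z + circ r t *s w) / circ r t)"
proof -
  let ?g = "\<lambda>\<zeta>. h (Z + \<zeta> *s w)"
  have der: "(?g has_field_derivative dder h w (Z + \<zeta> *s w)) (at \<zeta>)" if "norm \<zeta> \<le> r" for \<zeta>
    by (rule cdiff_on_line[OF h sub[OF that]])
  have "continuous_on (cball 0 r) ?g"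
    by (intro continuous_at_imp_continuous_on ballI) (auto intro: DERIV_isCont[OF der])
  moreover have "?g holomorphic_on ball 0 r"
    unfolding holomorphic_on_def field_differentiable_def
    using der by (metis has_field_derivative_at_within less_imp_le mem_ball_0)
  ultimately have "contour_integral (circlepath 0 r) (\<lambda>u. ?g u / (u - 0)^2) = (2 * complex_of_real pi * \<i>) * deriv ?g 0"
    using r Cauchy_contour_integral_circlepath_2[of 0 r ?g 0] by simp
  moreover have "deriv ?g 0 = dder h w Z" using DERIV_imp_deriv[OF der[of 0]] r by simp
  ultimately have "(2 * complex_of_real pi * \<i>) * dder h w Z
      = integral {0..1} (\<lambda>x. ?g (circlepath 0 r x) / (circlepath 0 r x)^2 * vector_derivative (circlepath 0 r) (at x))"
    by (simp add: contour_integral_integral)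
  also have "\<dots> = integral {0..1} (\<lambda>t. (2 * complex_of_real pi * \<i>) * (h (Z + circ r t *s w) / circ r t))"
  proof (rule integral_cong)
    fix x :: real
    have c: "circlepath 0 r x = circ r x" by (simp add: circlepath circ_def)
    have "vector_derivative (circlepath 0 r) (at x) = 2 * complex_of_real pi * \<i> * circ r x"
      by (simp add: vector_derivative_circlepath circ_def)
    moreover have "circ r x \<noteq> 0" using norm_circ[of r x] r by auto
    ultimately show "?g (circlepath 0 r x) / (circlepath 0 r x)^2 * vector_derivative (circlepath 0 r) (at x)
        = (2 * complex_of_real pi * \<i>) * (h (Z + circ r x *s w) / circ r x)"
      by (simp add: c power2_eq_square)
  qed
  also have "\<dots> = (2 * complex_of_real pi * \<i>) * integral {0..1} (\<lambda>t. h (Z + circ r t *s w) / circ r t)"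
    by (rule integral_mult_right)
  finally show ?thesis by simp
qed

lemma cdiff_on_imp_continuous: "cdiff_on U h \<Longrightarrow> continuous_on U h"
  by (auto intro!: continuous_at_imp_continuous_on differentiable_imp_continuous_within simp: cdiff_on_def)

lemma small_circle:
  assumes U: "open U" and Z: "Z \<in> U"
  obtains r where "r > 0" "ball Z r \<subseteq> U" "\<And>Y \<zeta>. Y \<in> ball Z r \<Longrightarrow> norm \<zeta> \<le> r \<Longrightarrow> Y + \<zeta> *s w \<in> (U :: (complex^'N::finite) set)"
proof -
  obtain e where e: "e > 0" "ball Z e \<subseteq> U" using U Z openE by blast
  define r where "r = e / (2 + norm w)"
  have pos: "2 + norm w > 0" by (simp add: add_pos_nonneg)
  then have r: "r > 0" using e by (simp add: r_def)
  have re: "r * (2 + norm w) = e" using pos by (simp add: r_def)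
  have *: "Y + \<zeta> *s w \<in> U" if "Y \<in> ball Z r" "norm \<zeta> \<le> r" for Y \<zeta>
  proof -
    have "dist Z (Y + \<zeta> *s w) \<le> dist Z Y + norm (\<zeta> *s w)"
      by (metis add_diff_cancel_left' dist_norm dist_triangle norm_minus_commute)
    also have "\<dots> < r + r * norm w"
      using that by (intro add_less_le_mono) (auto simp: norm_scale_vec intro: mult_right_mono)
    also have "\<dots> \<le> e" using r unfolding re[symmetric] by (simp add: algebra_simps)
    finally show ?thesis using e by auto
  qed
  moreover have "ball Z r \<subseteq> U"
    using *[of _ 0] r by auto
  ultimately show ?thesis using that[OF r] by blast
qed

lemma continuous_on_dder:
  assumes U: "open U" and h: "cdiff_on U h"
  shows "continuous_on U (dder h w)"
proof (rule continuous_at_imp_continuous_on, rule ballI)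
  fix Z assume Z: "Z \<in> U"
  obtain r where r: "r > 0" "ball Z r \<subseteq> U" "\<And>Y \<zeta>. Y \<in> ball Z r \<Longrightarrow> norm \<zeta> \<le> r \<Longrightarrow> Y + \<zeta> *s w \<in> U"
    using small_circle[OF U Z, of w] by metis
  have nz: "circ r t \<noteq> 0" for t using norm_circ[of r t] r by auto
  have "continuous_on (ball Z r \<times> cbox (0::real) 1) (\<lambda>(Y, t). h (Y + circ r t *s w) / circ r t)"
    unfolding case_prod_unfold
    by (intro continuous_on_divide continuous_on_compose2[OF cdiff_on_imp_continuous[OF h]] continuous_intros)
      (use r nz in \<open>auto simp: norm_circ\<close>)
  then have "continuous_on (ball Z r) (\<lambda>Y. integral (cbox 0 1) (\<lambda>t. h (Y + circ r t *s w) / circ r t))"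
    by (rule integral_continuous_on_param)
  then have "continuous_on (ball Z r) (dder h w)"
    by (rule continuous_on_eq) (use dder_integral[OF h r(1) r(3)] in simp)
  then show "isCont (dder h w) Z"
    using r by (simp add: continuous_on_eq_continuous_at)
qed

text \<open>The total derivative as a bounded linear operator, the form in which both the
  differentiation of parameter integrals and the inverse function theorem take it.\<close>

definition fder :: "('a::real_normed_vector \<Rightarrow> 'b::real_normed_vector) \<Rightarrow> 'a \<Rightarrow> ('a \<Rightarrow>\<^sub>L 'b)" where
  "fder f x = Blinfun (frechet_derivative f (at x))"

lemma fder_apply: "f differentiable (at x) \<Longrightarrow> blinfun_apply (fder f x) v = dder f v x"
  unfolding fder_def
  by (subst bounded_linear_Blinfun_apply)
    (auto simp: frechet_derivative_works intro: has_derivative_bounded_linear)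

lemma fder_apply': "f differentiable (at x) \<Longrightarrow> blinfun_apply (fder f x) = frechet_derivative f (at x)"
  by (rule ext) (rule fder_apply)

lemma continuous_on_fder:
  fixes f :: "'a::euclidean_space \<Rightarrow> 'b::real_normed_vector"
  assumes "\<And>x. x \<in> U \<Longrightarrow> f differentiable (at x)" "\<And>v. continuous_on U (dder f v)"
  shows "continuous_on U (fder f)"
proof (rule continuous_on_blinfun_componentwise)
  fix i :: 'a
  show "continuous_on U (\<lambda>x. blinfun_apply (fder f x) i)"
    by (rule continuous_on_eq[OF assms(2)[of i]]) (simp add: fder_apply assms(1))
qed

text \<open>Differentiation under the integral in \<open>dder_integral\<close>; the joint continuity
  of the integrand's derivative comes from \<open>continuous_on_dder\<close>. Linearity over
  \<open>\<i>\<close> passes through the integral.\<close>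

lemma cdiff_on_dder:
  assumes U: "open U" and h: "cdiff_on U h"
  shows "cdiff_on U (dder h w)"
  unfolding cdiff_on_def
proof
  fix Z assume Z: "Z \<in> U"
  obtain r where r: "r > 0" "ball Z r \<subseteq> U" "\<And>Y \<zeta>. Y \<in> ball Z r \<Longrightarrow> norm \<zeta> \<le> r \<Longrightarrow> Y + \<zeta> *s w \<in> U"
    using small_circle[OF U Z, of w] by metis
  have nz: "circ r t \<noteq> 0" for t using norm_circ[of r t] r by auto
  have inU: "Y + circ r t *s w \<in> U" if "Y \<in> ball Z r" for Y t using r that by (auto simp: norm_circ)
  let ?F = "\<lambda>Y t. h (Y + circ r t *s w) / circ r t"
  let ?f = "\<lambda>Y t. blinfun_compose (blinfun_mult_right (1 / circ r t)) (fder h (Y + circ r t *s w))"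
  have apply_f: "blinfun_apply (?f Y t) v = dder h v (Y + circ r t *s w) / circ r t" if "Y \<in> ball Z r" for Y t v
    using fder_apply[OF cdiff_onD[OF h inU[OF that]]] by simp
  have cont_fder: "continuous_on U (fder h)"
    by (rule continuous_on_fder[OF cdiff_onD[OF h] continuous_on_dder[OF U h]])
  have cont: "continuous_on (ball Z r \<times> cbox (0::real) 1) (\<lambda>(Y, t). ?f Y t)"
    unfolding case_prod_unfold
    by (intro continuous_intros continuous_on_compose2[OF cont_fder]) (use inU nz in auto)
  have contF: "continuous_on (cbox (0::real) 1) (?F Y)" if "Y \<in> ball Z r" for Y
    by (intro continuous_on_divide continuous_on_compose2[OF cdiff_on_imp_continuous[OF h]] continuous_intros)
      (use inU[OF that] nz in auto)
  have "((\<lambda>Y. integral (cbox 0 1) (?F Y)) has_derivative integral (cbox 0 1) (?f Z)) (at Z within ball Z r)"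
  proof (rule leibniz_rule[OF _ _ cont])
    fix Y and t :: real assume Y: "Y \<in> ball Z r"
    have "((\<lambda>Y. Y + circ r t *s w) has_derivative (\<lambda>v. v)) (at Y)" by (auto intro!: derivative_eq_intros)
    from has_derivative_compose[OF this cdiff_onD[OF h inU[OF Y], unfolded frechet_derivative_works]]
    have "((\<lambda>Y. h (Y + circ r t *s w) * (1 / circ r t)) has_derivative (\<lambda>v. dder h v (Y + circ r t *s w) * (1 / circ r t))) (at Y)"
      by (rule has_derivative_mult_left)
    then have "((\<lambda>Y. ?F Y t) has_derivative (\<lambda>v. dder h v (Y + circ r t *s w) / circ r t)) (at Y)"
      by simp
    moreover have "blinfun_apply (?f Y t) = (\<lambda>v. dder h v (Y + circ r t *s w) / circ r t)"
      by (rule ext) (rule apply_f[OF Y])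
    ultimately show "((\<lambda>Y. ?F Y t) has_derivative blinfun_apply (?f Y t)) (at Y within ball Z r)"
      by (metis (no_types) has_derivative_at_withinI)
  next
    show "?F Y integrable_on cbox 0 1" if "Y \<in> ball Z r" for Y
      by (rule integrable_continuous[OF contF[OF that]])
  qed (use r in auto)
  then have "((\<lambda>Y. integral (cbox 0 1) (?F Y)) has_derivative integral (cbox 0 1) (?f Z)) (at Z)"
    using r at_within_open[of Z "ball Z r"] by simp
  then have D: "(dder h w has_derivative integral (cbox 0 1) (?f Z)) (at Z)"
    by (rule has_derivative_transform_within_open[OF _ open_ball centre_in_ball[THEN iffD2, OF r(1)]])
      (rule dder_integral[OF h r(1) r(3), symmetric], assumption+)
  have int: "?f Z integrable_on cbox 0 1"
    by (rule integrable_continuous, rule continuous_on_compose2[OF cont, of _ "\<lambda>t. (Z, t)", simplified])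
      (use r in \<open>auto intro!: continuous_intros\<close>)
  have app: "dder (dder h w) v Z = integral (cbox 0 1) (\<lambda>t. dder h v (Z + circ r t *s w) / circ r t)" for v
  proof -
    have "dder (dder h w) v Z = integral (cbox 0 1) (\<lambda>t. blinfun_apply (?f Z t) v)"
      unfolding dder_eqI[OF D] by (rule blinfun_apply_integral[OF int])
    also have "\<dots> = integral (cbox 0 1) (\<lambda>t. dder h v (Z + circ r t *s w) / circ r t)"
      by (rule integral_cong, rule apply_f) (use r in simp)
    finally show ?thesis .
  qed
  have "dder (dder h w) (\<i> *s v) Z = \<i> * dder (dder h w) v Z" for v
  proof -
    have "dder (dder h w) (\<i> *s v) Z = integral (cbox 0 1) (\<lambda>t. \<i> * (dder h v (Z + circ r t *s w) / circ r t))"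
      unfolding app by (rule integral_cong) (use inU[of Z] r cdiff_on_scale[OF h] in auto)
    also have "\<dots> = \<i> * integral (cbox 0 1) (\<lambda>t. dder h v (Z + circ r t *s w) / circ r t)"
      by (rule integral_mult_right)
    finally show ?thesis by (simp add: app)
  qed
  then show "dder h w differentiable at Z \<and> (\<forall>v. dder (dder h w) (\<i> *s v) Z = \<i> * dder (dder h w) v Z)"
    using D by (auto simp: differentiable_def)
qed

lemma cdiff_on_smooth:
  assumes "open U" "cdiff_on U h" shows "smooth_on U h"
  by (rule smooth_on_coinduct[where P = "cdiff_on U"])
    (use assms cdiff_on_dder cdiff_onD in blast)+

lemma axis_i: "axis k \<i> = \<i> *s axis k 1"
  by (simp add: vec_eq_iff axis_def)

lemma cdiff_on_dZ: "cdiff_on U h \<Longrightarrow> Z \<in> U \<Longrightarrow> dZ k h Z = dder h (axis k 1) Z"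
  and cdiff_on_dZbar: "cdiff_on U h \<Longrightarrow> Z \<in> U \<Longrightarrow> dZbar k h Z = 0"
  by (simp_all add: dZ_def dZbar_def axis_i cdiff_on_scale)

lemma has_derivative_vecI:
  fixes f :: "'a::real_normed_vector \<Rightarrow> ('b::real_normed_vector)^'n::finite"
  assumes "\<And>i. ((\<lambda>x. f x $ i) has_derivative (\<lambda>v. f' v $ i)) F" "bounded_linear f'"
  shows "(f has_derivative f') F"
  using assms unfolding has_derivative_def by (auto intro!: vec_tendstoI)

lemma bounded_linear_matrix_vector: "bounded_linear (\<lambda>v. (A :: complex^'n^'m) *v v)"
  by (rule linear_conv_bounded_linear[THEN iffD1], rule linearI)
    (simp_all add: matrix_vector_mult_def vec_eq_iff sum.distrib scaleR_sum_right algebra_simps)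

lemma holomorphic_map_on_iff: "holomorphic_map_on U H \<longleftrightarrow> (\<forall>k. cdiff_on U (\<lambda>Z. H Z $ k))"
proof
  assume H: "holomorphic_map_on U H"
  show "\<forall>k. cdiff_on U (\<lambda>Z. H Z $ k)"
    unfolding cdiff_on_def
  proof (intro allI ballI)
    fix k Z assume "Z \<in> U"
    then obtain A :: "complex^'a^'a" where "(H has_derivative (\<lambda>v. A *v v)) (at Z)"
      using H by (auto simp: holomorphic_map_on_def)
    then have D: "((\<lambda>Z. H Z $ k) has_derivative (\<lambda>v. (A *v v) $ k)) (at Z)"
      by (rule bounded_linear.has_derivative[OF bounded_linear_vec_nth])
    show "(\<lambda>Z. H Z $ k) differentiable at Z \<and>
        (\<forall>v. dder (\<lambda>Z. H Z $ k) (\<i> *s v) Z = \<i> * dder (\<lambda>Z. H Z $ k) v Z)"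
      using D by (auto simp: differentiable_def dder_eqI[OF D] vec.scale)
  qed
next
  assume H: "\<forall>k. cdiff_on U (\<lambda>Z. H Z $ k)"
  show "holomorphic_map_on U H"
    unfolding holomorphic_map_on_def
  proof
    fix Z assume Z: "Z \<in> U"
    define A :: "complex^'a^'a" where "A = (\<chi> i j. dder (\<lambda>Z. H Z $ i) (axis j 1) Z)"
    have "(H has_derivative (\<lambda>v. A *v v)) (at Z)"
    proof (rule has_derivative_vecI[OF _ bounded_linear_matrix_vector])
      fix i
      have h: "cdiff_on U (\<lambda>Z. H Z $ i)" using H by blast
      interpret linear "frechet_derivative (\<lambda>Z. H Z $ i) (at Z)"
        by (rule linear_frechet_derivative[OF cdiff_onD[OF h Z]])
      have "dder (\<lambda>Z. H Z $ i) v Z = (A *v v) $ i" for v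
      proof -
        have "v = (\<Sum>j\<in>UNIV. v $ j *s axis j 1)" by (simp add: basis_expansion)
        then have "dder (\<lambda>Z. H Z $ i) v Z = (\<Sum>j\<in>UNIV. dder (\<lambda>Z. H Z $ i) (v $ j *s axis j 1) Z)"
          by (metis (no_types, lifting) sum sum.cong)
        then show ?thesis
          by (simp add: cdiff_on_scale[OF h Z] A_def matrix_vector_mult_def mult.commute)
      qed
      then have eq: "frechet_derivative (\<lambda>Z. H Z $ i) (at Z) = (\<lambda>v. (A *v v) $ i)" by (rule ext)
      show "((\<lambda>Z. H Z $ i) has_derivative (\<lambda>v. (A *v v) $ i)) (at Z)"
        using cdiff_onD[OF h Z] unfolding frechet_derivative_works eq .
    qed
    then show "\<exists>A::complex^'a^'a. (H has_derivative (*v) A) (at Z)" by auto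
  qed
qed

subsection \<open>Expansions of holomorphic functions\<close>

lemma msubst_rename_coeff:
  fixes A :: "'v::finite mfps" and j :: "'v \<Rightarrow> 'u::finite"
  assumes j: "inj j"
  shows "mcoeff (msubst (\<lambda>i. mvar (j i)) A) (image_mset j \<alpha>) = mcoeff A \<alpha>"
    and "mcoeff (msubst (\<lambda>i. mvar (j i)) A) \<gamma> \<noteq> 0 \<Longrightarrow> \<exists>\<alpha>. \<gamma> = image_mset j \<alpha>"
proof -
  have mon: "(\<Prod>v\<in>#\<beta>. mvar (j v)) = mon (image_mset j \<beta>)" for \<beta>
    by (simp add: mon_def image_mset.compositionality o_def)
  have "mcoeff (msubst (\<lambda>i. mvar (j i)) A) (image_mset j \<alpha>)
      = (\<Sum>\<beta> | size \<beta> \<le> size \<alpha>. if \<beta> = \<alpha> then mcoeff A \<alpha> else 0)"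
    unfolding mcoeff_msubst mon
    by (rule sum.cong) (auto simp: inj_eq[OF multiset.inj_map[OF j]] dest!: multiset.inj_map[OF j, THEN injD])
  then show "mcoeff (msubst (\<lambda>i. mvar (j i)) A) (image_mset j \<alpha>) = mcoeff A \<alpha>"
    by (simp add: finite_bounded_multisets)
  show "\<exists>\<alpha>. \<gamma> = image_mset j \<alpha>" if "mcoeff (msubst (\<lambda>i. mvar (j i)) A) \<gamma> \<noteq> 0"
  proof (rule ccontr)
    assume "\<nexists>\<alpha>. \<gamma> = image_mset j \<alpha>"
    then show False using that unfolding mcoeff_msubst mon by (auto simp: sum.neutral)
  qed
qed

lemma pev_rename:
  fixes A :: "'N::finite mfps" and j :: "'N \<Rightarrow> 'N + 'N"
  assumes j: "inj j"
  shows "pev n (msubst (\<lambda>i. mvar (j i)) A) v = (\<Sum>\<beta> | size \<beta> < n. mcoeff A \<beta> * (\<Prod>k\<in>#\<beta>. cc v (j k)))"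
proof -
  let ?F = "msubst (\<lambda>i. mvar (j i)) A"
  have "pev n ?F v = (\<Sum>\<gamma>\<in>image_mset j ` {\<beta>. size \<beta> < n}. mcoeff ?F \<gamma> * (\<Prod>u\<in>#\<gamma>. cc v u))"
    unfolding pev_def
  proof (rule sum.mono_neutral_right)
    show "\<forall>\<gamma>\<in>{\<gamma>. size \<gamma> < n} - image_mset j ` {\<beta>. size \<beta> < n}. mcoeff ?F \<gamma> * (\<Prod>u\<in>#\<gamma>. cc v u) = 0"
    proof
      fix \<gamma> assume g: "\<gamma> \<in> {\<gamma>. size \<gamma> < n} - image_mset j ` {\<beta>. size \<beta> < n}"
      have "mcoeff ?F \<gamma> = 0"
      proof (rule ccontr)
        assume "mcoeff ?F \<gamma> \<noteq> 0"
        from msubst_rename_coeff(2)[OF j this] obtain \<alpha> where "\<gamma> = image_mset j \<alpha>" by blast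
        with g show False by auto
      qed
      then show "mcoeff ?F \<gamma> * (\<Prod>u\<in>#\<gamma>. cc v u) = 0" by simp
    qed
  qed auto
  also have "\<dots> = (\<Sum>\<beta> | size \<beta> < n. mcoeff A \<beta> * (\<Prod>k\<in>#\<beta>. cc v (j k)))"
    using multiset.inj_map[OF j]
    by (subst sum.reindex) (auto simp: inj_on_def msubst_rename_coeff(1)[OF j] image_mset.compositionality o_def)
  finally show ?thesis .
qed

lemma cnj_prod_mset: "cnj (\<Prod>k\<in>#\<beta>. f k) = (\<Prod>k\<in>#\<beta>. cnj (f k))"
  by (induction \<beta>) auto

lemma has_exp_cnj_hol: assumes "has_exp h p (lift_hol A)" shows "has_exp (\<lambda>x. cnj (h x)) p (lift_anti (mcnj A))"
  unfolding has_exp_def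
proof
  fix n
  have "cnj (pev n (lift_hol A) v) = pev n (lift_anti (mcnj A)) v" for v
    by (simp add: lift_hol_def lift_anti_def pev_rename cnj_prod_mset)
  then have "norm (cnj (h (p + v)) - pev n (lift_anti (mcnj A)) v) = norm (h (p + v) - pev n (lift_hol A) v)" for v
    by (metis complex_cnj_diff complex_mod_cnj)
  then show "flat n (\<lambda>v. cnj (h (p + v)) - pev n (lift_anti (mcnj A)) v)"
    using has_expD[OF assms, of n] by (simp add: flat_def)
qed

lemma series_in_hol_lift:
  assumes "F \<in> series_in (range Inl)" obtains A where "lift_hol A = F"
proof
  let ?A = "Mfps (\<lambda>\<alpha>. mcoeff F (image_mset Inl \<alpha>))"
  show "lift_hol ?A = F"
  proof (rule mfps_eqI)
    fix \<gamma>
    show "mcoeff (lift_hol ?A) \<gamma> = mcoeff F \<gamma>"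
    proof (cases "set_mset \<gamma> \<subseteq> range Inl")
      case True
      then have "\<gamma> = image_mset Inl (image_mset projl \<gamma>)"
        by (auto simp: image_mset.compositionality intro!: image_mset_cong[of \<gamma> "\<lambda>x. x", simplified])
      then obtain \<alpha> where "\<gamma> = image_mset Inl \<alpha>" by blast
      then show ?thesis unfolding lift_hol_def using msubst_rename_coeff(1)[of Inl ?A \<alpha>] by simp
    next
      case False
      have "mcoeff (lift_hol ?A) \<gamma> = 0"
        using False msubst_rename_coeff(2)[of Inl ?A \<gamma>] unfolding lift_hol_def by auto
      moreover have "mcoeff F \<gamma> = 0" using False assms by (auto simp: series_in_def)
      ultimately show ?thesis by simp
    qed
  qed
qed

text \<open>The formal derivative in a conjugate variable is the expansion of
  \<open>dZbar k h\<close>, which is zero near \<open>p\<close>; as the integer factors in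
  \<open>pder\<close> are nonzero, no monomial contains a conjugate variable.\<close>

lemma cdiff_on_has_exp:
  assumes U: "open U" and p: "p \<in> U" and h: "cdiff_on U h"
  obtains A where "has_exp h p (lift_hol A)"
proof -
  note sm = cdiff_on_smooth[OF U h]
  let ?F = "taylor p h"
  have "pder (Inr k) ?F = 0" for k
  proof -
    have "has_exp (dZbar k h) p (pder (Inr k) ?F)"
      using has_exp_taylor[OF U p smooth_on_wirtinger[OF U sm], of "Inr k"]
      unfolding taylor_wirtinger[OF U p sm] by simp
    then have "has_exp (\<lambda>_. 0) p (pder (Inr k) ?F)"
      by (rule has_exp_cong) (use cdiff_on_dZbar[OF h] eventually_nhds_in_open[OF U p] in \<open>auto elim: eventually_mono\<close>)
    then show ?thesis by (rule has_exp_0_unique)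
  qed
  then have "mcoeff ?F (add_mset (Inr k) \<alpha>) = 0" for k \<alpha>
    using mcoeff_pder[of "Inr k" ?F \<alpha>] by (metis mcoeff_0 mult_eq_0_iff of_nat_neq_0)
  then have "?F \<in> series_in (range Inl)"
    unfolding series_in_def
  proof (intro CollectI allI impI subsetI)
    fix \<alpha> x assume z: "\<And>k \<alpha>. mcoeff ?F (add_mset (Inr k) \<alpha>) = 0" and a: "mcoeff ?F \<alpha> \<noteq> 0" and x: "x \<in># \<alpha>"
    show "x \<in> range Inl"
    proof (cases x)
      case (Inr k)
      then obtain \<beta> where "\<alpha> = add_mset (Inr k) \<beta>" using x by (metis mset_add)
      with z a show ?thesis by auto
    qed auto
  qed
  then obtain A where "lift_hol A = ?F" by (rule series_in_hol_lift)
  then show ?thesis using that has_exp_taylor[OF U p sm] by metis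
qed

lemma pder_lift_hol: "pder (Inl k) (lift_hol A) = lift_hol (pder k A)"
  unfolding lift_hol_def pder_msubst[OF hol_mpow]
  by (simp add: pder_mvar if_distrib[of "\<lambda>x. _ * x"] cong: if_cong)

lemma pder_lift_anti: "pder (Inr k) (lift_anti A) = lift_anti (pder k A)"
  unfolding lift_anti_def pder_msubst[OF anti_mpow]
  by (simp add: pder_mvar if_distrib[of "\<lambda>x. _ * x"] cong: if_cong)

lemma pder_lift_other: "pder (Inr k) (lift_hol A) = 0" "pder (Inl k) (lift_anti A) = 0"
  unfolding lift_hol_def lift_anti_def pder_msubst[OF hol_mpow] pder_msubst[OF anti_mpow]
  by (simp_all add: pder_mvar)

lemma lift_hol_mult: "lift_hol (f * g) = lift_hol f * lift_hol g"
  and lift_anti_mult: "lift_anti (f * g) = lift_anti f * lift_anti g"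
  by (simp_all add: lift_hol_def lift_anti_def msubst_mult)

lemma cdiff_on_has_exp_dder:
  assumes U: "open U" and p: "p \<in> U" and h: "cdiff_on U h" and A: "has_exp h p (lift_hol A)"
  shows "has_exp (dder h (axis k 1)) p (lift_hol (pder k A))"
proof -
  note sm = cdiff_on_smooth[OF U h]
  have T: "taylor p h = lift_hol A" by (rule has_exp_unique[OF has_exp_taylor[OF U p sm] A])
  have "has_exp (dZ k h) p (pder (Inl k) (taylor p h))"
    using has_exp_taylor[OF U p smooth_on_wirtinger[OF U sm], of "Inl k"]
    unfolding taylor_wirtinger[OF U p sm] by simp
  then have "has_exp (dZ k h) p (lift_hol (pder k A))" by (simp add: T pder_lift_hol)
  then show ?thesis
    by (rule has_exp_cong)
      (rule eventually_mono[OF eventually_nhds_in_open[OF U p]], simp add: cdiff_on_dZ[OF h])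
qed

lemma has_exp_coordinate: "has_exp (\<lambda>x. cc (x - p) u) p (mvar u)"
  unfolding has_exp_def
proof
  fix n
  have pev: "pev n (mvar u) v = (if n \<ge> 2 then cc v u else 0)" for v :: "complex^'a"
  proof -
    have "pev n (mvar u) v = (\<Sum>\<alpha> | size \<alpha> < n. if \<alpha> = {#u#} then cc v u else 0)"
      unfolding pev_def by (rule sum.cong) auto
    then show ?thesis by auto
  qed
  have "flat 1 (\<lambda>v. cc v u)" by (auto simp: flat_def norm_cc intro!: exI[of _ 1])
  then show "flat n (\<lambda>v. cc (p + v - p) u - pev n (mvar u) v)"
    by (cases "n \<ge> 2") (auto simp: pev not_le intro: flat_mono)
qed

lemma cdiff_on_add: "open U \<Longrightarrow> cdiff_on U f \<Longrightarrow> cdiff_on U g \<Longrightarrow> cdiff_on U (\<lambda>x. f x + g x)"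
  unfolding cdiff_on_def
proof
  fix Z assume *: "\<forall>Z\<in>U. f differentiable at Z \<and> (\<forall>v. dder f (\<i> *s v) Z = \<i> * dder f v Z)"
    "\<forall>Z\<in>U. g differentiable at Z \<and> (\<forall>v. dder g (\<i> *s v) Z = \<i> * dder g v Z)" and "Z \<in> U"
  then have "((\<lambda>x. f x + g x) has_derivative (\<lambda>v. dder f v Z + dder g v Z)) (at Z)"
    by (auto intro!: has_derivative_add simp: frechet_derivative_works)
  from dder_eqI[OF this] * \<open>Z \<in> U\<close>
  show "(\<lambda>x. f x + g x) differentiable at Z \<and>
     (\<forall>v. dder (\<lambda>x. f x + g x) (\<i> *s v) Z = \<i> * dder (\<lambda>x. f x + g x) v Z)"
    by (auto simp: distrib_left intro: differentiable_add)
qed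

lemma cdiff_on_mult: "open U \<Longrightarrow> cdiff_on U f \<Longrightarrow> cdiff_on U g \<Longrightarrow> cdiff_on U (\<lambda>x. f x * g x)"
  unfolding cdiff_on_def
proof
  fix Z assume *: "\<forall>Z\<in>U. f differentiable at Z \<and> (\<forall>v. dder f (\<i> *s v) Z = \<i> * dder f v Z)"
    "\<forall>Z\<in>U. g differentiable at Z \<and> (\<forall>v. dder g (\<i> *s v) Z = \<i> * dder g v Z)" and "Z \<in> U"
  then have "((\<lambda>x. f x * g x) has_derivative (\<lambda>v. f Z * dder g v Z + dder f v Z * g Z)) (at Z)"
    by (auto intro!: has_derivative_mult simp: frechet_derivative_works)
  from dder_eqI[OF this] * \<open>Z \<in> U\<close>
  show "(\<lambda>x. f x * g x) differentiable at Z \<and>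
     (\<forall>v. dder (\<lambda>x. f x * g x) (\<i> *s v) Z = \<i> * dder (\<lambda>x. f x * g x) v Z)"
    by (auto simp: algebra_simps intro: differentiable_mult)
qed

lemma cdiff_on_const: "cdiff_on U (\<lambda>_. c)"
  by (simp add: cdiff_on_def)

lemma cdiff_on_det:
  fixes A :: "complex^'N::finite \<Rightarrow> complex^'n^'n"
  assumes U: "open U" and A: "\<And>i j. cdiff_on U (\<lambda>x. A x $ i $ j)"
  shows "cdiff_on U (\<lambda>x. det (A x))"
proof -
  have sum: "cdiff_on U (\<lambda>x. \<Sum>i\<in>S. f i x)" if "\<And>i. cdiff_on U (f i)" for S and f :: "'i \<Rightarrow> complex^'N \<Rightarrow> complex"
    using that by (induction S rule: infinite_finite_induct) (auto intro: cdiff_on_const cdiff_on_add[OF U])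
  have prod: "cdiff_on U (\<lambda>x. \<Prod>i\<in>S. f i x)" if "\<And>i. cdiff_on U (f i)" for S and f :: "'i \<Rightarrow> complex^'N \<Rightarrow> complex"
    using that by (induction S rule: infinite_finite_induct) (auto intro: cdiff_on_const cdiff_on_mult[OF U])
  show ?thesis
    unfolding det_def by (intro sum prod cdiff_on_mult[OF U] cdiff_on_const A)
qed

text \<open>On each complex line through \<open>p\<close> a nonconstant restriction would be
  \<open>\<zeta> ^ n\<close> times a nonvanishing function, against flatness of order
  \<open>n + 1\<close>.\<close>

lemma cdiff_on_identity:
  assumes U: "open U" and p: "p \<in> U" and g: "cdiff_on U g" and exp: "has_exp g p 0"
  shows "\<forall>\<^sub>F Z in nhds p. g Z = 0"
proof -
  obtain e where e: "e > 0" "ball p e \<subseteq> U" using U p openE by blast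
  have "g (p + w) = 0" if w: "norm w < e" for w
  proof (cases "w = 0")
    case True
    then show ?thesis using has_exp_value[OF exp] by simp
  next
    case False
    \<comment> \<open>Radius of the disc in the parameter of the line that stays in the ball; it
      exceeds 1, so the disc contains the parameter 1 of the point \<open>p + w\<close>.\<close>
    define R where "R = e / norm w"
    have R: "R > 1" using False w by (simp add: R_def)
    have inU: "p + \<zeta> *s w \<in> U" if "\<zeta> \<in> ball 0 R" for \<zeta>
    proof -
      have "norm (\<zeta> *s w) < e" using that False by (simp add: norm_scale_vec R_def field_simps)
      then show ?thesis using e by (auto simp: dist_norm)
    qed
    define f where "f \<zeta> = g (p + \<zeta> *s w)" for \<zeta>
    have hol: "f holomorphic_on ball 0 R"
      unfolding f_def holomorphic_on_def field_differentiable_def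
      using cdiff_on_line[OF g inU] by (metis has_field_derivative_at_within)
    have f0: "f 0 = 0" using has_exp_value[OF exp] by (simp add: f_def)
    have "f constant_on ball 0 R"
    proof (rule ccontr)
      assume "\<not> f constant_on ball 0 R"
      then obtain q r n where q: "0 < n" "0 < r" "ball (0::complex) r \<subseteq> ball 0 R" "q holomorphic_on ball 0 r"
        "\<And>\<zeta>. \<zeta> \<in> ball 0 r \<Longrightarrow> f \<zeta> = (\<zeta> - 0) ^ n * q \<zeta>" "\<And>\<zeta>. \<zeta> \<in> ball 0 r \<Longrightarrow> q \<zeta> \<noteq> 0"
      proof (rule holomorphic_factor_zero_nonconstant[OF hol open_ball convex_connected[OF convex_ball] _ f0, rotated])
        fix g r n assume a: "0 < n" "0 < r" "ball (0::complex) r \<subseteq> ball 0 R" "g holomorphic_on ball 0 r"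
          "\<And>w. w \<in> ball 0 r \<Longrightarrow> f w = (w - 0) ^ n * g w" "\<And>w. w \<in> ball 0 r \<Longrightarrow> g w \<noteq> 0"
        show thesis by (rule that[of n r g]) (use a in blast)+
      qed (use R in auto)
      have "flat (Suc n) (\<lambda>v. g (p + v))" using has_expD[OF exp, of "Suc n"] by (simp add: pev_def)
      then have "flat (Suc n) f"
        unfolding f_def using flat_compose[of "Suc n" "\<lambda>v. g (p + v)" "\<lambda>\<zeta>. \<zeta> *s w" "norm w"]
        by (simp add: norm_scale_vec mult.commute)
      then obtain C where C: "\<forall>\<^sub>F \<zeta> in nhds 0. norm (f \<zeta>) \<le> C * norm \<zeta> ^ Suc n" by (auto simp: flat_def)
      have "\<forall>\<^sub>F \<zeta> in at 0. norm (q \<zeta>) \<le> C * norm \<zeta>"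
      proof -
        have "\<forall>\<^sub>F \<zeta> in at 0. \<zeta> \<in> ball 0 r" using q(2) by (intro eventually_at_in_open') auto
        moreover have "\<forall>\<^sub>F \<zeta> in at (0::complex). \<zeta> \<noteq> 0" by (simp add: eventually_at_filter)
        moreover have "\<forall>\<^sub>F \<zeta> in at 0. norm (f \<zeta>) \<le> C * norm \<zeta> ^ Suc n"
          using C by (simp add: eventually_nhds_conv_at)
        ultimately show ?thesis
        proof eventually_elim
          case (elim \<zeta>)
          then have "norm \<zeta> ^ n * norm (q \<zeta>) \<le> norm \<zeta> ^ n * (C * norm \<zeta>)"
            using q(5)[of \<zeta>] by (simp add: norm_mult norm_power mult_ac)
          then show ?case using elim by (simp add: mult_le_cancel_left_pos)
        qed
      qed
      moreover have "((\<lambda>\<zeta>. norm (q \<zeta>)) \<longlongrightarrow> norm (q 0)) (at 0)"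
        using holomorphic_on_imp_continuous_on[OF q(4)] q(2)
        by (intro tendsto_norm) (simp add: continuous_on_eq_continuous_at continuous_at)
      moreover have "((\<lambda>\<zeta>. C * norm \<zeta>) \<longlongrightarrow> C * norm (0::complex)) (at (0::complex))"
        by (rule tendsto_mult[OF tendsto_const tendsto_norm[OF tendsto_ident_at]])
      ultimately have "norm (q 0) \<le> C * norm (0::complex)" by (intro tendsto_le[of "at (0::complex)"]) auto
      then show False using q(2) q(6)[of 0] by simp
    qed
    then have "f 1 = f 0" using R unfolding constant_on_def by auto
    then show ?thesis using f0 by (simp add: f_def)
  qed
  then have "\<forall>Z. dist Z p < e \<longrightarrow> g Z = 0"
    by (metis add_diff_cancel_left' diff_add_cancel dist_norm add.commute)
  then show ?thesis using e(1) by (auto simp: eventually_nhds_metric)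
qed

section \<open>The Jacobian, local inverses and isolated common zeros\<close>

lemma Jac_eq:
  assumes "holomorphic_map_on U H" "Z \<in> U"
  shows "Jac H Z = det (\<chi> i j. dder (\<lambda>Z. H Z $ i) (axis j 1) Z)"
proof -
  obtain A :: "complex^'a^'a" where A: "(H has_derivative (\<lambda>v. A *v v)) (at Z)"
    using assms by (auto simp: holomorphic_map_on_def)
  have "dder H v Z $ i = dder (\<lambda>Z. H Z $ i) v Z" for v i
    using dder_eqI[OF bounded_linear.has_derivative[OF bounded_linear_vec_nth A]] dder_eqI[OF A] by simp
  then show ?thesis by (simp add: Jac_def matrix_def)
qed

text \<open>The real inverse function theorem supplies \<open>G\<close>; its derivative is the
  inverse of a complex matrix, so \<open>G\<close> is holomorphic.\<close>

lemma local_biholomorphismI: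
  assumes U: "open U" and p: "p \<in> U" and H: "holomorphic_map_on U H" and J: "Jac H p \<noteq> 0"
  shows "local_biholomorphism H p"
proof -
  have hk: "cdiff_on U (\<lambda>Z. H Z $ k)" for k using H by (simp add: holomorphic_map_on_iff)
  have d: "H differentiable (at Z)" if "Z \<in> U" for Z
    using H that by (auto simp: holomorphic_map_on_def differentiable_def)
  have comp: "dder H v Z $ i = dder (\<lambda>Z. H Z $ i) v Z" if "Z \<in> U" for v i Z
    using dder_eqI[OF bounded_linear.has_derivative[OF bounded_linear_vec_nth d[OF that, unfolded frechet_derivative_works]]] by simp
  have cont: "continuous_on U (fder H)"
  proof (rule continuous_on_fder[OF d])
    fix v
    have "continuous_on U (\<lambda>Z. \<chi> i. dder (\<lambda>Z. H Z $ i) v Z)"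
      by (intro continuous_on_vec_lambda continuous_on_dder[OF U hk])
    then show "continuous_on U (dder H v)"
      by (rule continuous_on_eq) (simp add: comp vec_eq_iff)
  qed
  have mat: "\<exists>A. frechet_derivative H (at Z) = (\<lambda>v. A *v v)" if Z: "Z \<in> U" for Z
  proof -
    obtain A :: "complex^'a^'a" where "(H has_derivative (\<lambda>v. A *v v)) (at Z)"
      using H Z by (auto simp: holomorphic_map_on_def)
    then show ?thesis using frechet_derivative_at by metis
  qed
  define A where "A = matrix (frechet_derivative H (at p))"
  have A: "frechet_derivative H (at p) = (\<lambda>v. A *v v)"
    using mat[OF p] unfolding A_def by (metis matrix_of_matrix_vector_mul)
  have "invertible A" using J by (simp add: invertible_det_nz A_def Jac_def)
  then obtain B where B: "B ** A = mat 1" by (auto simp: invertible_def)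
  have inv: "Blinfun (\<lambda>v. B *v v) o\<^sub>L fder H p = id_blinfun"
    by (rule blinfun_eqI)
      (simp add: fder_apply[OF d[OF p]] A bounded_linear_Blinfun_apply[OF bounded_linear_matrix_vector] matrix_vector_mul_assoc B)
  have der: "(H has_derivative blinfun_apply (fder H Z)) (at Z)" if "Z \<in> U" for Z
    using d[OF that] by (simp add: fder_apply' frechet_derivative_works)
  obtain U' V G G' where G: "open U'" "U' \<subseteq> U" "p \<in> U'" "open V" "homeomorphism U' V H G"
    "\<And>y. y \<in> V \<Longrightarrow> (G has_derivative (G' y)) (at y)"
    "\<And>y. y \<in> V \<Longrightarrow> G' y = inv (blinfun_apply (fder H (G y)))"
    "\<And>y. y \<in> V \<Longrightarrow> bij (blinfun_apply (fder H (G y)))"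
    using inverse_function_theorem[OF U der cont p inv] by metis
  have "holomorphic_map_on V G"
    unfolding holomorphic_map_on_def
  proof
    fix y assume y: "y \<in> V"
    have Gy: "G y \<in> U" using G(2,5) y by (auto simp: homeomorphism_def)
    obtain A where A: "blinfun_apply (fder H (G y)) = (\<lambda>v. A *v v)"
      using mat[OF Gy] by (auto simp: fder_apply'[OF d[OF Gy]])
    have bij: "bij (\<lambda>v. A *v v)" using G(8)[OF y] by (simp add: A)
    then obtain B where B: "B ** A = mat 1"
      using matrix_left_invertible_injective[of A] by (auto simp: bij_def)
    have "G' y = (\<lambda>v. B *v v)"
    proof
      fix v
      obtain u where u: "v = A *v u" using bij by (metis bij_pointE)
      have "G' y v = u" unfolding G(7)[OF y] A u by (rule inv_f_f) (use bij in \<open>simp add: bij_def\<close>)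
      then show "G' y v = B *v v" by (simp add: u matrix_vector_mul_assoc B)
    qed
    then show "\<exists>A::complex^'a^'a. (G has_derivative (*v) A) (at y)" using G(6)[OF y] by auto
  qed
  moreover have "holomorphic_map_on U' H" using H G(2) by (auto simp: holomorphic_map_on_def)
  ultimately show ?thesis
    unfolding local_biholomorphism_def using G(1-5)
    by (intro exI[of _ U'] exI[of _ V] exI[of _ G]) (auto simp: homeomorphism_def)
qed

text \<open>The cofactors in the ideal relation are only formal, so they are truncated: at a common
  zero the relation for \<open>mvar k ^ K\<close> leaves an error O(norm v ^ (K + 1)) for
  \<open>norm (v $ k) ^ K\<close>. Near the origin this is impossible for the largest coordinate of
  a nonzero vector.\<close>

lemma common_zero_isolated:
  fixes A :: "'N::finite \<Rightarrow> 'N mfps"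
  assumes h: "\<And>l. has_exp (h l) p (lift_hol (A l))"
    and nil: "\<And>k. mvar k ^ K \<in> ideal_gen UNIV {A l | l. l \<in> UNIV}"
  shows "\<forall>\<^sub>F Z in nhds p. (\<forall>l. h l Z = 0) \<longrightarrow> Z = p"
proof -
  have "\<exists>C. \<forall>\<^sub>F v in nhds 0. (\<forall>l. h l (p + v) = 0) \<longrightarrow> norm (v $ k) ^ K \<le> C * norm v ^ Suc K" for k
  proof -
    obtain g where g: "mvar k ^ K = (\<Sum>l\<in>UNIV. g l * A l)"
      using nil[of k] unfolding ideal_gen_indexed[OF finite] by blast
    have "hol k ^ K = lift_hol (mvar k ^ K)"
      by (simp add: lift_hol_def msubst_power msubst_mvar)
    then have gl: "hol k ^ K = (\<Sum>l\<in>UNIV. lift_hol (g l) * lift_hol (A l))"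
      by (simp add: g lift_hol_def msubst_sum msubst_mult)
    have "has_exp (\<lambda>x. \<Prod>i<K. cc (x - p) (Inl k)) p (\<Prod>i<K. hol k)"
      by (rule has_exp_prod[OF has_exp_coordinate])
    then have 1: "flat (Suc K) (\<lambda>v. (v $ k) ^ K - pev (Suc K) (hol k ^ K) v)"
      using has_expD[of _ p _ "Suc K"] by fastforce
    have 2: "flat (Suc K) (\<lambda>v. pev (Suc K) (lift_hol (g l) * lift_hol (A l)) v - pev (Suc K) (lift_hol (g l)) v * h l (p + v))" for l
    proof -
      have a: "flat (Suc K) (\<lambda>v. pev (Suc K) (lift_hol (g l)) v * (h l (p + v) - pev (Suc K) (lift_hol (A l)) v))"
        using flat_mult[OF flat_pev[of _ 0] has_expD[OF h]] by simp
      show ?thesis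
        using flat_uminus[OF flat_add[OF a pev_mult[of "Suc K" "lift_hol (g l)" "lift_hol (A l)"]]] by (simp add: algebra_simps)
    qed
    have psum: "pev n (sum f S) v = (\<Sum>l\<in>S. pev n (f l) v)" for n and f :: "'N \<Rightarrow> ('N + 'N) mfps" and S v
      by (induction S rule: infinite_finite_induct) (auto simp: pev_add, auto simp: pev_def)
    have "flat (Suc K) (\<lambda>v. pev (Suc K) (hol k ^ K) v - (\<Sum>l\<in>UNIV. pev (Suc K) (lift_hol (g l)) v * h l (p + v)))"
      unfolding gl psum sum_subtractf[symmetric] by (rule flat_sum[OF 2])
    from flat_add[OF 1 this]
    have "flat (Suc K) (\<lambda>v. (v $ k) ^ K - (\<Sum>l\<in>UNIV. pev (Suc K) (lift_hol (g l)) v * h l (p + v)))" by simp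
    then obtain C where "\<forall>\<^sub>F v in nhds 0. norm ((v $ k) ^ K - (\<Sum>l\<in>UNIV. pev (Suc K) (lift_hol (g l)) v * h l (p + v))) \<le> C * norm v ^ Suc K"
      by (auto simp: flat_def)
    then have "\<forall>\<^sub>F v in nhds 0. (\<forall>l. h l (p + v) = 0) \<longrightarrow> norm (v $ k) ^ K \<le> C * norm v ^ Suc K"
      by eventually_elim (auto simp: norm_power)
    then show ?thesis by blast
  qed
  then have "\<exists>C. \<forall>k. \<forall>\<^sub>F v in nhds 0. (\<forall>l. h l (p + v) = 0) \<longrightarrow> norm (v $ k) ^ K \<le> C k * norm v ^ Suc K"
    by (intro choice allI)
  then obtain C where C: "\<And>k. \<forall>\<^sub>F v in nhds 0. (\<forall>l. h l (p + v) = 0) \<longrightarrow> norm (v $ k) ^ K \<le> C k * norm v ^ Suc K"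
    by blast
  define B where "B = (\<Sum>k\<in>UNIV. \<bar>C k\<bar>)"
  define N where "N = real CARD('N)"
  have CB: "C k \<le> B" for k
  proof -
    have "\<bar>C k\<bar> \<le> B" unfolding B_def by (rule member_le_sum) auto
    then show ?thesis by simp
  qed
  have B0: "B \<ge> 0" unfolding B_def by (rule sum_nonneg) simp
  have N0: "N > 0" by (simp add: N_def)
  \<comment> \<open>\<open>N ^ K\<close> is the loss in comparing \<open>norm v\<close> with its
    largest coordinate and \<open>B\<close> bounds all constants \<open>C k\<close>; adding 1 avoids
    a zero denominator.\<close>
  define e where "e = 1 / (N ^ K * B + 1)"
  have NB: "N ^ K * B + 1 > 0" using B0 N0 by (intro add_nonneg_pos) auto
  have "\<forall>\<^sub>F v in nhds 0. \<forall>k. (\<forall>l. h l (p + v) = 0) \<longrightarrow> norm (v $ k) ^ K \<le> C k * norm v ^ Suc K"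
    by (rule eventually_all_finite[OF C])
  moreover have "\<forall>\<^sub>F v::complex^'N in nhds 0. norm v < e"
    using eventually_nhds_ball[of e "0::complex^'N"] NB by (simp add: dist_norm e_def)
  ultimately have ev: "\<forall>\<^sub>F v in nhds 0. (\<forall>l. h l (p + v) = 0) \<longrightarrow> v = 0"
  proof eventually_elim
    case (elim v)
    show ?case
    proof (intro impI)
      assume z: "\<forall>l. h l (p + v) = 0"
      have "Max (range (\<lambda>k. norm (v $ k))) \<in> range (\<lambda>k. norm (v $ k))" by (rule Max_in) auto
      then obtain k where k: "Max (range (\<lambda>k. norm (v $ k))) = norm (v $ k)" by (elim rangeE)
      have "norm v \<le> (\<Sum>i\<in>UNIV. norm (v $ i))" unfolding norm_vec_def by (rule L2_set_le_sum) simp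
      also have "\<dots> \<le> (\<Sum>i\<in>(UNIV :: 'N set). norm (v $ k))" unfolding k[symmetric] by (intro sum_mono Max_ge) auto
      finally have le: "norm v \<le> N * norm (v $ k)" by (simp add: N_def)
      show "v = 0"
      proof (rule ccontr)
        assume v: "v \<noteq> 0"
        have "norm v ^ K \<le> (N * norm (v $ k)) ^ K" by (rule power_mono[OF le]) simp
        also have "\<dots> = N ^ K * norm (v $ k) ^ K" by (rule power_mult_distrib)
        also have "\<dots> \<le> N ^ K * (C k * norm v ^ Suc K)" using elim(1) z N0 by (intro mult_left_mono) auto
        also have "\<dots> \<le> N ^ K * (B * norm v ^ Suc K)" using CB N0 by (intro mult_left_mono mult_right_mono) auto
        finally have "norm v ^ K * 1 \<le> norm v ^ K * (N ^ K * B * norm v)" by (simp add: mult_ac)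
        then have "1 \<le> N ^ K * B * norm v" using v by (simp add: mult_le_cancel_left_pos)
        also have "\<dots> \<le> (N ^ K * B + 1) * norm v" by (simp add: distrib_right)
        also have "\<dots> < (N ^ K * B + 1) * e" using elim(2) NB by (rule mult_strict_left_mono)
        also have "\<dots> = 1" using NB by (simp add: e_def)
        finally show False by simp
      qed
    qed
  qed
  have "((\<lambda>Z. Z - p) \<longlongrightarrow> p - p) (nhds p)" by (intro tendsto_intros filterlim_ident)
  then have "filterlim (\<lambda>Z. Z - p) (nhds 0) (nhds p)" by simp
  from eventually_compose_filterlim[OF ev this] show ?thesis by simp
qed

section \<open>Generic submanifolds\<close>

lemma wedge_repeat:
  assumes ab: "a < d" "b < d" "a \<noteq> b" and eq: "\<theta> a = \<theta> b"
  shows "wedge d \<theta> X = 0"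
proof -
  let ?t = "Transposition.transpose a b"
  let ?P = "{\<sigma>. \<sigma> permutes {..<d}}"
  let ?f = "\<lambda>\<sigma>. of_int (sign \<sigma>) * (\<Prod>j<d. \<theta> j (X (\<sigma> j)))"
  have t: "?t permutes {..<d}" using ab by (intro permutes_swap_id) auto
  have th: "\<theta> (?t j) = \<theta> j" for j using eq by (auto simp: Transposition.transpose_def)
  have "?f (\<sigma> \<circ> ?t) = - ?f \<sigma>" if s: "\<sigma> \<in> ?P" for \<sigma>
  proof -
    have "permutation \<sigma>" using s by (auto intro: permutes_imp_permutation[OF finite_lessThan])
    moreover have "permutation ?t" by (rule permutation_swap_id)
    ultimately have "sign (\<sigma> \<circ> ?t) = - sign \<sigma>" using ab(3) by (simp add: sign_compose sign_swap_id)
    moreover have "(\<Prod>j<d. \<theta> j (X ((\<sigma> \<circ> ?t) j))) = (\<Prod>j<d. \<theta> j (X (\<sigma> j)))"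
    proof -
      have "(\<Prod>j<d. \<theta> j (X (\<sigma> j))) = (\<Prod>j<d. \<theta> (?t j) (X (\<sigma> (?t j))))"
        using prod.permute[OF t, of "\<lambda>j. \<theta> j (X (\<sigma> j))"] by (simp add: o_def)
      then show ?thesis by (simp add: th)
    qed
    ultimately show ?thesis by simp
  qed
  then have "wedge d \<theta> X = - wedge d \<theta> X"
    unfolding wedge_def
    by (subst sum_permutations_compose_right[OF t]) (simp add: sum_negf)
  then show ?thesis by simp
qed

lemma wedge_dependent:
  assumes i: "i < d" and dep: "\<And>x. \<theta> i x = (\<Sum>k\<in>{..<d} - {i}. c k * \<theta> k x)"
  shows "wedge d \<theta> X = 0"
proof -
  let ?K = "{..<d} - {i}"
  have "(\<Prod>j<d. \<theta> j (X (\<sigma> j))) = (\<Sum>k\<in>?K. c k * (\<Prod>j<d. (\<theta>(i := \<theta> k)) j (X (\<sigma> j))))" for \<sigma>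
  proof -
    have "(\<Prod>j<d. (\<theta>(i := h)) j (X (\<sigma> j))) = h (X (\<sigma> i)) * (\<Prod>j\<in>?K. \<theta> j (X (\<sigma> j)))" for h
      using i by (subst prod.remove[of _ i]) auto
    from this[of "\<theta> i"] this show ?thesis
      by (simp add: dep sum_distrib_right sum_distrib_left mult.assoc)
  qed
  then have "wedge d \<theta> X = (\<Sum>k\<in>?K. c k * wedge d (\<theta>(i := \<theta> k)) X)"
    unfolding wedge_def
    by (simp add: sum_distrib_left mult.left_commute) (rule sum.swap)
  moreover have "wedge d (\<theta>(i := \<theta> k)) X = 0" if "k \<in> ?K" for k
    by (rule wedge_repeat[of i d k]) (use i that in auto)
  ultimately show ?thesis by simp
qed

lemma local_definingD:
  assumes "local_defining d M p U \<rho>"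
  shows "open U" "p \<in> U" "j < d \<Longrightarrow> smooth_on U (\<rho> j)"
    "Z \<in> U \<Longrightarrow> Z \<in> M \<longleftrightarrow> (\<forall>j<d. \<rho> j Z = 0)"
  using assms by (auto simp: local_defining_def)

lemma smooth_on_cplx: "open U \<Longrightarrow> smooth_on U f \<Longrightarrow> smooth_on U (cplx f)"
  by (rule smooth_on_bounded_linear[OF _ bounded_linear_of_real])

lemma dder_cplx: "f differentiable (at x) \<Longrightarrow> dder (cplx f) v x = of_real (dder f v x)"
  by (rule dder_eqI[OF dder_bounded_linear[OF bounded_linear_of_real]])

lemma local_defining_independent:
  assumes ld: "local_defining d M p U \<rho>" and Z: "Z \<in> U"
    and c: "\<And>k. (\<Sum>j<d. c j * dZ k (cplx (\<rho> j)) Z) = 0" and i: "i < d"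
  shows "c i = 0"
proof (rule ccontr)
  assume ci: "c i \<noteq> 0"
  obtain X where X: "wedge d (\<lambda>j. del (cplx (\<rho> j)) Z) X \<noteq> 0"
    using ld Z by (auto simp: local_defining_def)
  have "wedge d (\<lambda>j. del (cplx (\<rho> j)) Z) X = 0"
  proof (rule wedge_dependent[OF i, where c = "\<lambda>k. - c k / c i"])
    fix x :: "'a cvec"
    have "(\<Sum>j<d. c j * del (cplx (\<rho> j)) Z x) = (\<Sum>k\<in>UNIV. (\<Sum>j<d. c j * dZ k (cplx (\<rho> j)) Z) * fst x $ k)"
      unfolding del_def sum_distrib_left sum_distrib_right by (subst sum.swap) (simp add: mult.assoc)
    then have "(\<Sum>j<d. c j * del (cplx (\<rho> j)) Z x) = 0" by (simp add: c)
    moreover have "(\<Sum>j<d. c j * del (cplx (\<rho> j)) Z x)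
        = c i * del (cplx (\<rho> i)) Z x + (\<Sum>j\<in>{..<d} - {i}. c j * del (cplx (\<rho> j)) Z x)"
      using i by (intro sum.remove) auto
    ultimately have "del (cplx (\<rho> i)) Z x = - (\<Sum>j\<in>{..<d} - {i}. c j * del (cplx (\<rho> j)) Z x) / c i"
      using ci by (simp add: field_simps add_eq_0_iff)
    also have "\<dots> = (\<Sum>k\<in>{..<d} - {i}. - c k / c i * del (cplx (\<rho> k)) Z x)"
      by (simp add: sum_divide_distrib flip: sum_negf)
    finally show "del (cplx (\<rho> i)) Z x = (\<Sum>k\<in>{..<d} - {i}. - c k / c i * del (cplx (\<rho> k)) Z x)" .
  qed
  with X show False by contradiction
qed

text \<open>With \<open>g j\<close> representing \<open>L j\<close> by the inner product,
  \<open>b i\<close> is the component of \<open>g i\<close> orthogonal to the span of the others,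
  rescaled; independence makes this component nonzero.\<close>

lemma dual_vectors:
  fixes L :: "nat \<Rightarrow> 'a::euclidean_space \<Rightarrow> real"
  assumes lin: "\<And>j. j < d \<Longrightarrow> linear (L j)"
    and indep: "\<And>c i. (\<And>v. (\<Sum>j<d. c j * L j v) = 0) \<Longrightarrow> i < d \<Longrightarrow> c i = 0"
  obtains b where "\<And>i j. i < d \<Longrightarrow> j < d \<Longrightarrow> L j (b i) = (if i = j then 1 else 0)"
proof -
  define g where "g j = (\<Sum>e\<in>Basis. L j e *\<^sub>R e)" for j
  have g: "g j \<bullet> v = L j v" if "j < d" for j v
  proof -
    interpret linear "L j" by (rule lin[OF that])
    have "L j v = L j (\<Sum>e\<in>Basis. (v \<bullet> e) *\<^sub>R e)" by (simp add: euclidean_representation)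
    also have "\<dots> = (\<Sum>e\<in>Basis. (v \<bullet> e) * L j e)" by (simp add: sum scale)
    also have "\<dots> = g j \<bullet> v" by (simp add: g_def inner_sum_left inner_commute[of v] mult.commute)
    finally show ?thesis ..
  qed
  have "\<exists>b. \<forall>j<d. L j b = (if i = j then 1 else 0)" if i: "i < d" for i
  proof -
    define S where "S = {v. \<exists>c. v = (\<Sum>j\<in>{..<d} - {i}. c j *\<^sub>R g j)}"
    have sub: "subspace S"
      unfolding subspace_def
    proof (intro conjI ballI allI)
      show "0 \<in> S" by (auto simp: S_def intro!: exI[of _ "\<lambda>_. 0"])
      show "x + y \<in> S" if xy: "x \<in> S" "y \<in> S" for x y
      proof -
        obtain c e where "x = (\<Sum>j\<in>{..<d} - {i}. c j *\<^sub>R g j)" "y = (\<Sum>j\<in>{..<d} - {i}. e j *\<^sub>R g j)"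
          using xy by (auto simp: S_def)
        then show ?thesis
          by (auto simp: S_def scaleR_add_left sum.distrib intro!: exI[of _ "\<lambda>j. c j + e j"])
      qed
      show "a *\<^sub>R x \<in> S" if x: "x \<in> S" for a x
      proof -
        obtain c where "x = (\<Sum>j\<in>{..<d} - {i}. c j *\<^sub>R g j)" using x by (auto simp: S_def)
        then show ?thesis by (auto simp: S_def scaleR_sum_right intro!: exI[of _ "\<lambda>j. a * c j"])
      qed
    qed
    then have span: "span S = S" by (simp add: span_eq_iff)
    obtain y z where yz: "y \<in> span S" "\<And>w. w \<in> span S \<Longrightarrow> orthogonal z w" "g i = y + z"
      using orthogonal_subspace_decomp_exists by metis
    have gj: "g j \<in> S" if "j < d" "j \<noteq> i" for j
    proof -
      have "g j = (\<Sum>k\<in>{..<d} - {i}. (if k = j then 1 else 0) *\<^sub>R g k)"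
        using that by (simp add: if_distrib[of "\<lambda>x. x *\<^sub>R _"] cong: if_cong)
      then show ?thesis unfolding S_def by (intro CollectI exI[of _ "\<lambda>k. if k = j then 1 else 0"])
    qed
    have "z \<noteq> 0"
    proof
      assume "z = 0"
      then have "g i \<in> S" using yz(1,3) unfolding span by simp
      then obtain c where c: "g i = (\<Sum>j\<in>{..<d} - {i}. c j *\<^sub>R g j)" by (auto simp: S_def)
      define c' where "c' = c(i := -1)"
      have "c' i = 0"
      proof (rule indep[OF _ i])
        fix v
        have "(\<Sum>j<d. c' j * L j v) = c' i * L i v + (\<Sum>j\<in>{..<d} - {i}. c' j * L j v)"
          using i by (intro sum.remove) auto
        also have "(\<Sum>j\<in>{..<d} - {i}. c' j * L j v) = (\<Sum>j\<in>{..<d} - {i}. c j *\<^sub>R g j) \<bullet> v"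
          unfolding inner_sum_left by (rule sum.cong) (auto simp: c'_def g)
        finally show "(\<Sum>j<d. c' j * L j v) = 0" using c g[OF i, of v] by (simp add: c'_def)
      qed
      then show False by (simp add: c'_def)
    qed
    define b where "b = z /\<^sub>R (z \<bullet> z)"
    have "L j b = (if i = j then 1 else 0)" if j: "j < d" for j
    proof (cases "i = j")
      case True
      have "g i \<bullet> z = z \<bullet> z"
        using yz(2)[OF yz(1)] by (simp add: yz(3) inner_add_left orthogonal_def inner_commute[of y])
      then show ?thesis using \<open>z \<noteq> 0\<close> True g[OF i, of b] by (simp add: b_def)
    next
      case False
      then have "orthogonal z (g j)" using yz(2) gj[OF j] span by auto
      then show ?thesis using False g[OF j, of b] by (simp add: b_def orthogonal_def inner_commute)
    qed
    then show ?thesis by blast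
  qed
  then have "\<exists>b. \<forall>i. i < d \<longrightarrow> (\<forall>j<d. L j (b i) = (if i = j then 1 else 0))" by (intro choice) blast
  then show ?thesis using that by blast
qed

text \<open>
  A right inverse \<open>b\<close> of the differential of \<open>\<rho>\<close> turns \<open>x + (\<rho> x - D\<rho> x) b\<close> into a local
  diffeomorphism that straightens \<open>M\<close> to its tangent space.
\<close>
lemma tangent_curve:
  fixes M :: "(complex^'N::finite) set"
  assumes ld: "local_defining d M q U \<rho>" and q: "q \<in> M"
    and w: "\<And>j. j < d \<Longrightarrow> dder (\<rho> j) w q = 0"
  obtains \<gamma> where "\<gamma> 0 = 0" "(\<gamma> has_vector_derivative w) (at 0)" "\<forall>\<^sub>F t in nhds (0::real). q + \<gamma> t \<in> M"
proof -
  note U = local_definingD(1)[OF ld] and qU = local_definingD(2)[OF ld] and sm = local_definingD(3)[OF ld]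
  define L where "L j v = dder (\<rho> j) v q" for j v
  have diff: "\<rho> j differentiable (at x)" if "j < d" "x \<in> U" for j x
    by (rule smooth_on_differentiable[OF sm[OF that(1)] that(2)])
  have lin: "linear (L j)" if "j < d" for j
    unfolding L_def by (rule linear_frechet_derivative[OF diff[OF that qU]])
  have indep: "c i = 0" if c: "\<And>v. (\<Sum>j<d. c j * L j v) = 0" and i: "i < d" for c i
  proof -
    \<comment> \<open>The wedge condition gives independence of the (1,0) gradients over the complex
      numbers; a real relation between the differentials is such a relation.\<close>
    have "(\<Sum>j<d. of_real (c j) * dZ k (cplx (\<rho> j)) q) = 0" for k
    proof -
      have "(\<Sum>j<d. of_real (c j) * dZ k (cplx (\<rho> j)) q)
        = (\<Sum>j<d. (of_real (c j * L j (axis k 1)) - \<i> * of_real (c j * L j (axis k \<i>))) / 2)"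
        by (rule sum.cong) (auto simp: dZ_def dder_cplx[OF diff[OF _ qU]] L_def field_simps)
      also have "\<dots> = (of_real (\<Sum>j<d. c j * L j (axis k 1)) - \<i> * of_real (\<Sum>j<d. c j * L j (axis k \<i>))) / 2"
        by (simp add: sum_subtractf sum_distrib_left flip: sum_divide_distrib)
      finally show ?thesis by (simp add: c)
    qed
    from local_defining_independent[OF ld qU this i] show ?thesis by simp
  qed
  obtain b where b: "\<And>i j. i < d \<Longrightarrow> j < d \<Longrightarrow> L j (b i) = (if i = j then 1 else 0)"
  proof (rule dual_vectors[of d L])
    show "linear (L j)" if "j < d" for j by (rule lin[OF that])
    show "c i = 0" if "\<And>v. (\<Sum>j<d. c j * L j v) = 0" "i < d" for c i by (rule indep[OF that])
  qed blast
  define \<Phi> where "\<Phi> x = x + (\<Sum>i<d. (\<rho> i (q + x) - L i x) *\<^sub>R b i)" for x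
  define V where "V = (\<lambda>x. q + x) -` U"
  have V: "open V" unfolding V_def by (intro open_vimage U continuous_intros)
  have V0: "0 \<in> V" using qU by (simp add: V_def)
  have der: "(\<Phi> has_derivative (\<lambda>v. v + (\<Sum>i<d. (dder (\<rho> i) v (q + x) - L i v) *\<^sub>R b i))) (at x)" if x: "x \<in> V" for x
  proof -
    have "((\<lambda>x. \<rho> i (q + x)) has_derivative (\<lambda>v. dder (\<rho> i) v (q + x))) (at x)" if i: "i < d" for i
    proof -
      have "((\<lambda>x. q + x) has_derivative (\<lambda>v. v)) (at x)" by (auto intro!: derivative_eq_intros)
      from has_derivative_compose[OF this diff[OF i, of "q + x", unfolded frechet_derivative_works]] x
      show ?thesis by (simp add: V_def)
    qed
    moreover have "(L i has_derivative L i) (at x)" if "i < d" for i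
      by (rule linear_imp_has_derivative[OF lin[OF that]])
    ultimately show ?thesis
      unfolding \<Phi>_def
      by (intro has_derivative_add has_derivative_ident has_derivative_sum has_derivative_scaleR_left has_derivative_diff) auto
  qed
  have dd: "\<Phi> differentiable (at x)" if "x \<in> V" for x using der[OF that] by (auto simp: differentiable_def)
  have cont: "continuous_on V (fder \<Phi>)"
  proof (rule continuous_on_fder[OF dd])
    fix v
    have "continuous_on V (\<lambda>x. dder (\<rho> i) v (q + x))" if "i < d" for i
      by (rule continuous_on_compose2[OF smooth_on_continuous[OF smooth_on_dder[OF sm[OF that], of v]]])
        (auto simp: V_def intro!: continuous_intros)
    then have "continuous_on V (\<lambda>x. v + (\<Sum>i<d. (dder (\<rho> i) v (q + x) - L i v) *\<^sub>R b i))"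
      by (intro continuous_intros) auto
    then show "continuous_on V (dder \<Phi> v)"
      by (rule continuous_on_eq) (simp add: dder_eqI[OF der])
  qed
  have derf: "(\<Phi> has_derivative blinfun_apply (fder \<Phi> x)) (at x)" if "x \<in> V" for x
    using dd[OF that] by (simp add: fder_apply' frechet_derivative_works)
  have id: "blinfun_apply (fder \<Phi> 0) v = v" for v
    by (simp add: fder_apply[OF dd[OF V0]] dder_eqI[OF der[OF V0]] L_def)
  have "id_blinfun o\<^sub>L fder \<Phi> 0 = id_blinfun" by (rule blinfun_eqI) (simp add: id)
  then obtain U' V' G G' where G: "open U'" "U' \<subseteq> V" "0 \<in> U'" "open V'" "\<Phi> 0 \<in> V'" "homeomorphism U' V' \<Phi> G"
    "\<And>y. y \<in> V' \<Longrightarrow> (G has_derivative (G' y)) (at y)"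
    "\<And>y. y \<in> V' \<Longrightarrow> G' y = inv (blinfun_apply (fder \<Phi> (G y)))"
    using inverse_function_theorem[OF V derf cont V0] by metis
  have rho0: "\<rho> j q = 0" if "j < d" for j using local_definingD(4)[OF ld qU] q that by blast
  have \<Phi>0: "\<Phi> 0 = 0" using rho0 by (simp add: \<Phi>_def L_def linear_0[OF linear_frechet_derivative[OF diff[OF _ qU]]])
  have G0: "G 0 = 0" using G(3,6) \<Phi>0 by (metis homeomorphism_def)
  have V'0: "0 \<in> V'" using G(5) \<Phi>0 by simp
  have "G' 0 = id"
    unfolding G(8)[OF V'0] G0 using id by (auto simp: fun_eq_iff inv_def intro!: some_equality)
  then have dG: "(G has_derivative (\<lambda>v. v)) (at 0)" using G(7)[OF V'0] by (simp add: id_def)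
  define \<gamma> where "\<gamma> t = G (t *\<^sub>R w)" for t
  have "((\<lambda>t. t *\<^sub>R w) has_derivative (\<lambda>t. t *\<^sub>R w)) (at 0)" by (auto intro!: derivative_eq_intros)
  from has_derivative_compose[OF this, of G "\<lambda>v. v"] dG
  have 1: "(\<gamma> has_vector_derivative w) (at 0)"
    by (simp add: \<gamma>_def[abs_def] has_vector_derivative_def)
  have "((\<lambda>t. t *\<^sub>R w) \<longlongrightarrow> 0 *\<^sub>R w) (nhds (0::real))" by (intro tendsto_scaleR filterlim_ident tendsto_const)
  then have "filterlim (\<lambda>t. t *\<^sub>R w) (nhds 0) (nhds (0::real))" by simp
  from eventually_compose_filterlim[OF eventually_nhds_in_open[OF G(4) V'0] this]
  have ev: "\<forall>\<^sub>F t in nhds (0::real). t *\<^sub>R w \<in> V'" .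
  have 2: "\<forall>\<^sub>F t in nhds (0::real). q + \<gamma> t \<in> M"
    using ev
  proof eventually_elim
    case (elim t)
    let ?x = "G (t *\<^sub>R w)"
    have x: "?x \<in> U'" "\<Phi> ?x = t *\<^sub>R w" using elim G(6) by (auto simp: homeomorphism_def)
    have xU: "q + ?x \<in> U" using x G(2) by (auto simp: V_def)
    have "\<rho> j (q + ?x) = 0" if j: "j < d" for j
    proof -
      interpret Lj: linear "L j" by (rule lin[OF j])
      \<comment> \<open>By duality \<open>L j\<close> extracts the single coefficient belonging to
        \<open>b j\<close>, so \<open>L j (\<Phi> x)\<close> equals
        \<open>\<rho> j (q + x)\<close>.\<close>
      have "L j (\<Phi> ?x) = L j ?x + (\<Sum>i<d. (\<rho> i (q + ?x) - L i ?x) * L j (b i))"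
        by (simp add: \<Phi>_def Lj.add Lj.sum Lj.scale)
      also have "(\<Sum>i<d. (\<rho> i (q + ?x) - L i ?x) * L j (b i)) = (\<Sum>i<d. if i = j then \<rho> j (q + ?x) - L j ?x else 0)"
        by (rule sum.cong) (auto simp: b[OF _ j])
      finally have "L j (\<Phi> ?x) = \<rho> j (q + ?x)" using j by simp
      then show ?thesis unfolding x(2) Lj.scale using w[OF j] by (simp add: L_def)
    qed
    then show ?case using local_definingD(4)[OF ld xU] by (simp add: \<gamma>_def)
  qed
  show ?thesis by (rule that[OF _ 1 2]) (simp add: \<gamma>_def G0)
qed

text \<open>The two arguments of \<open>dder\<close> are the real and imaginary parts of the
  complexified vector \<open>X\<close>. For a real function, \<open>X\<close> annihilates it exactly
  when both parts do.\<close>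

lemma vact_cplx:
  assumes "f differentiable (at Z)"
  shows "vact X (cplx f) Z = of_real (dder f (\<chi> k. (fst X $ k + cnj (snd X $ k)) / 2) Z)
    + \<i> * of_real (dder f (\<chi> k. (fst X $ k - cnj (snd X $ k)) / (2 * \<i>)) Z)"
proof -
  have d: "cplx f differentiable (at Z)"
    using dder_bounded_linear[OF bounded_linear_of_real assms] by (auto simp: differentiable_def)
  have *: "of_real (dder f v Z) = (\<Sum>k\<in>UNIV. dZ k (cplx f) Z * v $ k + dZbar k (cplx f) Z * cnj (v $ k))" for v
    using derivative_wirtinger[OF d, of v] sum.Plus[of UNIV UNIV "\<lambda>u. wirtinger u (cplx f) Z * cc v u"]
    by (simp add: dder_cplx[OF assms] sum.distrib)
  show ?thesis
    unfolding * vact_def sum_distrib_left sum.distrib[symmetric]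
    by (rule sum.cong) (auto simp: field_simps)
qed

text \<open>\<open>CT\<close> asks for some defining function, possibly different at each point.
  Real tangent vectors of one defining function are velocities of curves in \<open>M\<close>, along
  which every other defining function is constant.\<close>

lemma CT_annihilates:
  fixes M :: "(complex^'N::finite) set"
  assumes ld: "local_defining d M p U \<rho>" and Z: "Z \<in> U" "Z \<in> M" and X: "X \<in> CT d M Z" and j: "j < d"
  shows "vact X (cplx (\<rho> j)) Z = 0"
proof -
  obtain U' \<rho>' where ld': "local_defining d M Z U' \<rho>'" and X': "\<And>i. i < d \<Longrightarrow> vact X (cplx (\<rho>' i)) Z = 0"
    using X by (auto simp: CT_def)
  have ZU': "Z \<in> U'" by (rule local_definingD(2)[OF ld'])
  have diff': "\<rho>' i differentiable (at Z)" if "i < d" for i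
    by (rule smooth_on_differentiable[OF local_definingD(3)[OF ld' that] ZU'])
  have diff: "\<rho> j differentiable (at Z)"
    by (rule smooth_on_differentiable[OF local_definingD(3)[OF ld j] Z(1)])
  have key: "dder (\<rho> j) v Z = 0" if v: "\<And>i. i < d \<Longrightarrow> dder (\<rho>' i) v Z = 0" for v
  proof -
    obtain \<gamma> where \<gamma>: "\<gamma> 0 = 0" "(\<gamma> has_vector_derivative v) (at 0)" "\<forall>\<^sub>F t in nhds (0::real). Z + \<gamma> t \<in> M"
      using tangent_curve[OF ld' Z(2) v] by metis
    have "isCont \<gamma> 0" using \<gamma>(2) has_vector_derivative_continuous by blast
    then have "(\<gamma> \<longlongrightarrow> 0) (nhds 0)" using \<gamma>(1) tendsto_at_iff_tendsto_nhds[of \<gamma> 0] by (simp add: continuous_at)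
    then have "((\<lambda>t. Z + \<gamma> t) \<longlongrightarrow> Z + 0) (nhds 0)" by (intro tendsto_add tendsto_const)
    then have "filterlim (\<lambda>t. Z + \<gamma> t) (nhds Z) (nhds 0)" by simp
    from eventually_compose_filterlim[OF eventually_nhds_in_open[OF local_definingD(1)[OF ld] Z(1)] this]
    have "\<forall>\<^sub>F t in nhds 0. Z + \<gamma> t \<in> U" .
    then have ev: "\<forall>\<^sub>F t in nhds 0. \<rho> j (Z + \<gamma> t) = 0"
      using \<gamma>(3) by eventually_elim (use local_definingD(4)[OF ld] j in blast)
    have "((\<lambda>t. Z + \<gamma> t) has_derivative (\<lambda>t. t *\<^sub>R v)) (at 0)"
      using has_derivative_add[OF has_derivative_const \<gamma>(2)[unfolded has_vector_derivative_def]] by simp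
    from has_derivative_compose[OF this, of "\<rho> j"] diff \<gamma>(1)
    have "((\<lambda>t. \<rho> j (Z + \<gamma> t)) has_derivative (\<lambda>t. dder (\<rho> j) (t *\<^sub>R v) Z)) (at 0)"
      by (simp add: frechet_derivative_works)
    note D1 = this
    obtain S where S: "open S" "0 \<in> S" "\<And>t. t \<in> S \<Longrightarrow> \<rho> j (Z + \<gamma> t) = 0"
      using ev by (auto simp: eventually_nhds)
    have "((\<lambda>t::real. 0::real) has_derivative (\<lambda>t. dder (\<rho> j) (t *\<^sub>R v) Z)) (at 0)"
      by (rule has_derivative_transform_within_open[OF D1 S(1,2)]) (rule S(3))
    then have "(\<lambda>t. dder (\<rho> j) (t *\<^sub>R v) Z) = (\<lambda>t::real. 0)"
      by (rule has_derivative_unique[OF _ has_derivative_const])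
    from fun_cong[OF this, of 1] show ?thesis by simp
  qed
  have "dder (\<rho>' i) (\<chi> k. (fst X $ k + cnj (snd X $ k)) / 2) Z = 0"
    "dder (\<rho>' i) (\<chi> k. (fst X $ k - cnj (snd X $ k)) / (2 * \<i>)) Z = 0" if "i < d" for i
    using X'[OF that] unfolding vact_cplx[OF diff'[OF that]] by (simp_all add: complex_eq_iff)
  then show ?thesis unfolding vact_cplx[OF diff] using key by simp
qed

lemma mcoeff_taylor_single: "open U \<Longrightarrow> p \<in> U \<Longrightarrow> smooth_on U f \<Longrightarrow> mcoeff (taylor p f) {#u#} = wirtinger u f p"
  using mcoeff_taylor[of U p f "[u]"] by simp

locale defining_function =
  formal_normal_coordinates d "\<lambda>j. taylor p (cplx (\<rho> j))" \<phi> D Q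
  for d :: nat and p :: "complex^'N::finite" and \<rho> \<phi> D Q +
  fixes M U
  assumes ld: "local_defining d M p U \<rho>" and pM: "p \<in> M"
begin

lemmas U = local_definingD(1)[OF ld] and pU = local_definingD(2)[OF ld]

lemma smooth_rho: "j < d \<Longrightarrow> smooth_on U (cplx (\<rho> j))"
  by (rule smooth_on_cplx[OF U local_definingD(3)[OF ld]])

lemma has_exp_rho: "j < d \<Longrightarrow> has_exp (cplx (\<rho> j)) p (taylor p (cplx (\<rho> j)))"
  by (rule has_exp_taylor[OF U pU smooth_rho])

text \<open>The formal counterpart of dividing by the defining functions, and the passage from
  geometry on \<open>M\<close> to algebra modulo \<open>II\<close>. Otherwise some representative
  \<open>g\<close> modulo \<open>II\<close> has a leading form that is nonzero at a real tangent
  vector; a curve in \<open>M\<close> with that velocity contradicts the estimates along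
  \<open>M\<close>.\<close>

lemma expansion_in_II:
  assumes f: "has_exp f p F" and van: "\<forall>\<^sub>F Z in nhds p. Z \<in> M \<longrightarrow> f Z = 0"
  shows "F \<in> II"
proof (rule ccontr)
  assume "F \<notin> II"
  then obtain k g y where g: "F - g \<in> II" "g \<in> mpow k" "tangent y" "\<And>i. y (Inr i) = cnj (y (Inl i))"
    "lform k g (dpol y) \<noteq> 0"
    using leading_form_not_in_II by metis
  define w where "w = (\<chi> k. dpol y (Inl k))"
  have lin: "mcoeff (lift_hol A) {#Inl i#} = mcoeff A {#i#}" "mcoeff (lift_hol A) {#Inr i#} = 0"
    "mcoeff (lift_anti A) {#Inr i#} = mcoeff A {#i#}" "mcoeff (lift_anti A) {#Inl i#} = 0" for A :: "'N mfps" and i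
    unfolding lift_hol_def lift_anti_def mcoeff_msubst_single[OF hol_mpow] mcoeff_msubst_single[OF anti_mpow]
    by (simp_all add: if_distrib[of "\<lambda>x. _ * x"] cong: if_cong)
  have sumP: "(\<Sum>v\<in>UNIV. h v) = (\<Sum>i\<in>UNIV. h (Inl i)) + (\<Sum>i\<in>UNIV. h (Inr i))" for h :: "'N + 'N \<Rightarrow> complex"
    using sum.Plus[of UNIV UNIV h] by simp
  \<comment> \<open>The reality condition on \<open>y\<close> says that its image under
    \<open>dpol\<close> is the coordinate vector of an actual vector \<open>w\<close>.\<close>
  have "cc w u = dpol y u" for u
    by (cases u) (simp_all add: w_def dpol_def polarized_simps sumP lin g(4))
  then have cw: "cc w = dpol y" by blast
  have "dder (\<rho> j) w p = 0" if j: "j < d" for j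
  proof -
    have d: "\<rho> j differentiable (at p)" by (rule smooth_on_differentiable[OF local_definingD(3)[OF ld j] pU])
    have "complex_of_real (dder (\<rho> j) w p) = (\<Sum>u\<in>UNIV. wirtinger u (cplx (\<rho> j)) p * cc w u)"
      using derivative_wirtinger[OF smooth_on_differentiable[OF smooth_rho[OF j] pU], of w] by (simp add: dder_cplx[OF d])
    also have "\<dots> = (\<Sum>u\<in>UNIV. mcoeff (taylor p (cplx (\<rho> j))) {#u#} * dpol y u)"
      by (simp add: cw mcoeff_taylor_single[OF U pU smooth_rho[OF j]])
    also have "\<dots> = 0"
      by (rule II_linear[OF _ g(3)], unfold II_def, rule subsetD[OF ideal_gen_superset]) (use j in blast)
    finally show ?thesis by simp
  qed
  then obtain \<gamma> where \<gamma>: "\<gamma> 0 = 0" "(\<gamma> has_vector_derivative w) (at 0)" "\<forall>\<^sub>F t in nhds (0::real). p + \<gamma> t \<in> M"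
    using tangent_curve[OF ld pM] by metis
  \<comment> \<open>The indicator of \<open>M\<close>, flat of order 0: multiplying by it confines
    all estimates to \<open>M\<close>, where \<open>f\<close> and the \<open>\<rho> j\<close>
    vanish.\<close>
  define ch where "ch v = (if p + v \<in> M then 1 else (0 :: complex))" for v
  have ch: "flat 0 ch" by (auto simp: flat_def ch_def intro!: exI[of _ 1])
  have ch_mult: "flat n (\<lambda>v. ch v * h v)" if "flat n h" for n h
    using flat_mult[OF ch that] by simp
  have F1: "flat n (\<lambda>v. ch v * pev n F v)" for n
  proof (rule flat_cong)
    show "flat n (\<lambda>v. - (ch v * (f (p + v) - pev n F v)))"
      by (intro flat_uminus ch_mult has_expD[OF f])
    show "\<forall>\<^sub>F v in nhds 0. ch v * pev n F v = - (ch v * (f (p + v) - pev n F v))"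
      using eventually_nhds_0_shift[OF van] by eventually_elim (simp add: ch_def)
  qed
  have R1: "flat n (\<lambda>v. ch v * pev n (taylor p (cplx (\<rho> j))) v)" if j: "j < d" for n j
  proof (rule flat_cong)
    show "flat n (\<lambda>v. - (ch v * (cplx (\<rho> j) (p + v) - pev n (taylor p (cplx (\<rho> j))) v)))"
      by (intro flat_uminus ch_mult has_expD[OF has_exp_rho[OF j]])
    show "\<forall>\<^sub>F v in nhds 0. ch v * pev n (taylor p (cplx (\<rho> j))) v
        = - (ch v * (cplx (\<rho> j) (p + v) - pev n (taylor p (cplx (\<rho> j))) v))"
      using eventually_nhds_0_shift[OF eventually_nhds_in_open[OF U pU]]
      by eventually_elim (use local_definingD(4)[OF ld] j in \<open>auto simp: ch_def\<close>)
  qed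
  have "F - g \<in> ideal_gen UNIV {taylor p (cplx (\<rho> j)) | j. j \<in> {..<d}}" using g(1) by (simp add: II_def)
  then obtain c where c: "F - g = (\<Sum>j\<in>{..<d}. c j * taylor p (cplx (\<rho> j)))"
    unfolding ideal_gen_indexed[OF finite_lessThan] by blast
  have psum: "pev n (sum h S) v = (\<Sum>l\<in>S. pev n (h l) v)" for n and h :: "nat \<Rightarrow> ('N + 'N) mfps" and S v
    by (induction S rule: infinite_finite_induct) (auto simp: pev_add, auto simp: pev_def)
  have "flat n (\<lambda>v. ch v * pev n (c j * taylor p (cplx (\<rho> j))) v)" if j: "j < d" for n j
  proof -
    have a: "flat n (\<lambda>v. pev n (c j) v * (ch v * pev n (taylor p (cplx (\<rho> j))) v))"
      using flat_mult[OF flat_pev[of _ 0] R1[OF j]] by simp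
    have b: "flat n (\<lambda>v. ch v * (pev n (c j) v * pev n (taylor p (cplx (\<rho> j))) v - pev n (c j * taylor p (cplx (\<rho> j))) v))"
      by (rule ch_mult[OF pev_mult])
    show ?thesis using flat_diff[OF a b] by (simp add: algebra_simps)
  qed
  then have G1: "flat n (\<lambda>v. ch v * pev n (F - g) v)" for n
    unfolding c psum sum_distrib_left by (intro flat_sum) auto
  have "flat (Suc k) (\<lambda>v. ch v * pev (Suc k) g v)"
    using flat_diff[OF F1 G1, of "Suc k"] by (simp add: pev_diff algebra_simps)
  then obtain C where "\<forall>\<^sub>F v in nhds 0. norm (ch v * lform k g (cc v)) \<le> C * norm v ^ Suc k"
    unfolding pev_Suc_lform[OF g(2)] by (auto simp: flat_def)
  then have "\<forall>\<^sub>F v in nhds 0. v \<in> {v. p + v \<in> M} \<longrightarrow> norm (lform k g (cc v)) \<le> C * norm v ^ Suc k"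
    by eventually_elim (auto simp: ch_def)
  then have "lform k g (cc w) = 0"
    by (rule lform_eq_0_curve[OF _ \<gamma>(2,1)]) (use \<gamma>(3) in simp)
  then show False using g(5) cw by simp
qed

end

section \<open>Formal vector fields\<close>

definition smooth_at :: "'a::real_normed_vector \<Rightarrow> ('a \<Rightarrow> 'b::real_normed_vector) \<Rightarrow> bool" where
  "smooth_at p f \<longleftrightarrow> (\<exists>U. open U \<and> p \<in> U \<and> smooth_on U f)"

lemma smooth_atI: "open U \<Longrightarrow> p \<in> U \<Longrightarrow> smooth_on U f \<Longrightarrow> smooth_at p f"
  by (auto simp: smooth_at_def)

lemma smooth_at_common:
  assumes "smooth_at p f" "smooth_at p g"
  obtains U where "open U" "p \<in> U" "smooth_on U f" "smooth_on U g"
proof -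
  obtain U V where "open U" "p \<in> U" "smooth_on U f" "open V" "p \<in> V" "smooth_on V g"
    using assms by (auto simp: smooth_at_def)
  then show ?thesis using that[of "U \<inter> V"] by (auto intro: smooth_on_subset)
qed

lemma smooth_at_const: "smooth_at p (\<lambda>_. c :: complex)"
  by (rule smooth_atI[of UNIV]) (auto intro: smooth_on_const)

lemma smooth_at_add: "smooth_at p f \<Longrightarrow> smooth_at p g \<Longrightarrow> smooth_at p (\<lambda>x. f x + g x :: complex)"
  by (erule smooth_at_common, assumption) (auto intro!: smooth_atI smooth_on_add)

lemma smooth_at_mult: "smooth_at p f \<Longrightarrow> smooth_at p g \<Longrightarrow> smooth_at p (\<lambda>x. f x * g x :: complex)"
  by (erule smooth_at_common, assumption) (auto intro!: smooth_atI smooth_on_mult)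

lemma smooth_at_diff: "smooth_at p f \<Longrightarrow> smooth_at p g \<Longrightarrow> smooth_at p (\<lambda>x. f x - g x :: complex)"
  by (erule smooth_at_common, assumption) (auto intro!: smooth_atI smooth_on_diff)

lemma smooth_at_sum: "(\<And>i. i \<in> A \<Longrightarrow> smooth_at p (f i)) \<Longrightarrow> smooth_at p (\<lambda>x. \<Sum>i\<in>A. f i x :: complex)"
  by (induction A rule: infinite_finite_induct) (auto intro: smooth_at_const smooth_at_add)

lemma smooth_at_wirtinger: "smooth_at p f \<Longrightarrow> smooth_at p (wirtinger u f)"
  by (auto simp: smooth_at_def intro: smooth_on_wirtinger)

lemma smooth_at_has_exp: "smooth_at p f \<Longrightarrow> has_exp f p (taylor p f)"
  by (auto simp: smooth_at_def intro: has_exp_taylor)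

lemma taylor_unique: "smooth_at p f \<Longrightarrow> has_exp f p F \<Longrightarrow> taylor p f = F"
  by (rule has_exp_unique[OF smooth_at_has_exp])

lemma smooth_at_taylor_wirtinger: "smooth_at p f \<Longrightarrow> taylor p (wirtinger u f) = pder u (taylor p f)"
  by (auto simp: smooth_at_def intro: taylor_wirtinger)

definition xc :: "(complex^'N \<Rightarrow> 'N cvec) \<Rightarrow> 'N + 'N \<Rightarrow> complex^'N \<Rightarrow> complex" where
  "xc X u Z = (case u of Inl k \<Rightarrow> fst (X Z) $ k | Inr k \<Rightarrow> snd (X Z) $ k)"

lemma sum_over_sum_type: "(\<Sum>v\<in>UNIV. h v) = (\<Sum>i\<in>UNIV. h (Inl i)) + (\<Sum>i\<in>UNIV. h (Inr i))"
  for h :: "'a::finite + 'b::finite \<Rightarrow> 'c::comm_monoid_add"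
  using sum.Plus[of UNIV UNIV h] by simp

lemma vact_xc: "vact (X Z) f Z = (\<Sum>u\<in>UNIV. xc X u Z * wirtinger u f Z)"
  by (simp add: vact_def sum_over_sum_type sum.distrib xc_def)

lemma xc_lie_bracket: "xc (lie_bracket X Y) u Z = vact (X Z) (xc Y u) Z - vact (Y Z) (xc X u) Z"
  by (cases u) (simp_all add: xc_def[abs_def] lie_bracket_def)

text \<open>The formal vector field at \<open>p\<close>. Through it the action on functions and the
  brackets of fields are computed on Taylor series.\<close>

definition hat :: "complex^'N::finite \<Rightarrow> (complex^'N \<Rightarrow> 'N cvec) \<Rightarrow> ('N + 'N) mfps \<Rightarrow> ('N + 'N) mfps" where
  "hat p X f = (\<Sum>u\<in>UNIV. taylor p (xc X u) * pder u f)"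

lemma derivation_hat: "derivation (hat p X)"
  unfolding derivation_def
  by (auto simp: hat_def pder_add pder_mult ring_distribs sum.distrib
      sum_distrib_left sum_distrib_right mult_ac)

lemma hat_mconst [simp]: "hat p X (mconst c) = 0"
  by (simp add: hat_def)

lemma mcoeff_hat_mvar: "mcoeff (hat p X (mvar u)) {#} = xc X u p"
  by (simp add: hat_def pder_mvar if_distrib[of "\<lambda>x. _ * x"] cong: if_cong)

lemma vact_smooth:
  assumes X: "\<And>u. smooth_at p (xc X u)" and f: "smooth_at p f"
  shows "smooth_at p (\<lambda>Z. vact (X Z) f Z)" "taylor p (\<lambda>Z. vact (X Z) f Z) = hat p X (taylor p f)"
proof -
  show 1: "smooth_at p (\<lambda>Z. vact (X Z) f Z)"
    unfolding vact_xc by (intro smooth_at_sum smooth_at_mult smooth_at_wirtinger X f)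
  have "has_exp (\<lambda>Z. vact (X Z) f Z) p (\<Sum>u\<in>UNIV. taylor p (xc X u) * taylor p (wirtinger u f))"
    unfolding vact_xc by (intro has_exp_sum has_exp_mult smooth_at_has_exp smooth_at_wirtinger X f)
  from taylor_unique[OF 1 this]
  show "taylor p (\<lambda>Z. vact (X Z) f Z) = hat p X (taylor p f)"
    by (simp add: hat_def smooth_at_taylor_wirtinger[OF f])
qed

lemma xc_lie_bracket_abs: "xc (lie_bracket X Y) u = (\<lambda>Z. vact (X Z) (xc Y u) Z - vact (Y Z) (xc X u) Z)"
  by (rule ext) (rule xc_lie_bracket)

lemma hat_lie_bracket:
  assumes X: "\<And>u. smooth_at p (xc X u)" and Y: "\<And>u. smooth_at p (xc Y u)"
  shows "hat p (lie_bracket X Y) f = hat p X (hat p Y f) - hat p Y (hat p X f)"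
proof -
  let ?a = "\<lambda>u. taylor p (xc X u)" and ?b = "\<lambda>u. taylor p (xc Y u)"
  have t: "taylor p (xc (lie_bracket X Y) u) = hat p X (?b u) - hat p Y (?a u)" for u
  proof (rule taylor_unique)
    show "smooth_at p (xc (lie_bracket X Y) u)"
      unfolding xc_lie_bracket_abs by (intro smooth_at_diff vact_smooth X Y)
    show "has_exp (xc (lie_bracket X Y) u) p (hat p X (?b u) - hat p Y (?a u))"
      unfolding xc_lie_bracket_abs
      using has_exp_diff[OF smooth_at_has_exp[OF vact_smooth(1)[OF X Y[of u]]]
          smooth_at_has_exp[OF vact_smooth(1)[OF Y X[of u]]]]
      by (simp add: vact_smooth(2)[OF X Y] vact_smooth(2)[OF Y X])
  qed
  have comp: "hat p X (hat p Y f) = (\<Sum>u\<in>UNIV. hat p X (taylor p (xc Y u)) * pder u f)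
      + (\<Sum>u\<in>UNIV. \<Sum>v\<in>UNIV. taylor p (xc Y u) * taylor p (xc X v) * pder v (pder u f))" for X Y
    unfolding hat_def[of p Y f] derivation_sum[OF derivation_hat] derivation_mult[OF derivation_hat] sum.distrib
    by (simp add: hat_def sum_distrib_left mult.assoc)
  have "(\<Sum>u\<in>UNIV. \<Sum>v\<in>UNIV. ?b u * ?a v * pder v (pder u f)) = (\<Sum>u\<in>UNIV. \<Sum>v\<in>UNIV. ?a u * ?b v * pder v (pder u f))"
    by (subst sum.swap) (simp add: pder_commute mult_ac)
  then show ?thesis
    by (simp add: comp) (simp add: hat_def[of p "lie_bracket X Y"] t left_diff_distrib sum_subtractf)
qed

lemma CR_field_smooth:
  assumes "CR_field d M p L"
  shows "smooth_at p (\<lambda>Z. L Z $ k)" "smooth_at p (\<lambda>Z. cnj (L Z $ k))"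
proof -
  obtain V where V: "open V" "p \<in> V" "smooth_on V L" using assms by (auto simp: CR_field_def)
  have 1: "smooth_on V (\<lambda>Z. L Z $ k)" by (rule smooth_on_bounded_linear[OF V(1) bounded_linear_vec_nth V(3)])
  show "smooth_at p (\<lambda>Z. L Z $ k)" by (rule smooth_atI[OF V(1,2) 1])
  show "smooth_at p (\<lambda>Z. cnj (L Z $ k))"
    by (rule smooth_atI[OF V(1,2) smooth_on_bounded_linear[OF V(1) bounded_linear_cnj 1]])
qed

lemma CR_lie_algebra_smooth: "X \<in> CR_lie_algebra d M p \<Longrightarrow> smooth_at p (xc X u)"
proof (induction arbitrary: u rule: CR_lie_algebra.induct)
  case (CR L)
  then show ?case by (cases u) (simp_all add: xc_def[abs_def] smooth_at_const CR_field_smooth)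
next
  case (CR_conj L)
  then show ?case by (cases u) (simp_all add: xc_def[abs_def] smooth_at_const CR_field_smooth vcnj_def)
next
  case (add X Y)
  have "xc (\<lambda>Z. X Z + Y Z) u = (\<lambda>Z. xc X u Z + xc Y u Z)" by (cases u) (auto simp: xc_def)
  then show ?case using add by (simp add: smooth_at_add)
next
  case (scale X c)
  have "xc (\<lambda>Z. (c *s fst (X Z), c *s snd (X Z))) u = (\<lambda>Z. c * xc X u Z)" by (cases u) (auto simp: xc_def)
  then show ?case using scale by (simp add: smooth_at_mult smooth_at_const)
next
  case (bracket X Y)
  then show ?case unfolding xc_lie_bracket_abs by (intro smooth_at_diff vact_smooth)
qed

context defining_function
begin

section \<open>Formal fields tangent to \<open>M\<close>, and finite type\<close>

definition LL :: "(('N + 'N) mfps \<Rightarrow> ('N + 'N) mfps) set" where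
  "LL = {hat p (\<lambda>Z. (0, L Z)) | L. CR_field d M p L} \<union> {hat p (\<lambda>Z. (vcnj (L Z), 0)) | L. CR_field d M p L}"

lemma derivation_preserves_II:
  assumes X: "derivation X" and r: "\<And>j. j < d \<Longrightarrow> X (taylor p (cplx (\<rho> j))) \<in> II" and f: "f \<in> II"
  shows "X f \<in> II"
proof -
  have "f \<in> ideal_gen UNIV {taylor p (cplx (\<rho> j)) | j. j \<in> {..<d}}" using f by (simp add: II_def)
  then obtain c where c: "f = (\<Sum>j\<in>{..<d}. c j * taylor p (cplx (\<rho> j)))"
    unfolding ideal_gen_indexed[OF finite_lessThan] by blast
  have "taylor p (cplx (\<rho> j)) \<in> II" if "j < d" for j
    unfolding II_def by (rule subsetD[OF ideal_gen_superset]) (use that in blast)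
  then show ?thesis
    unfolding c derivation_sum[OF X] derivation_mult[OF X]
    using r by (intro isideal_sum[OF isideal_II] isideal_add[OF isideal_II] isideal_mult[OF isideal_II]) auto
qed

lemma hat_in_II_of_tangent:
  assumes X: "\<And>u. smooth_at p (xc X u)" and j: "j < d"
    and van: "\<forall>\<^sub>F Z in nhds p. Z \<in> M \<longrightarrow> vact (X Z) (cplx (\<rho> j)) Z = 0"
  shows "hat p X (taylor p (cplx (\<rho> j))) \<in> II"
proof (rule expansion_in_II[OF _ van])
  have "smooth_at p (cplx (\<rho> j))" by (rule smooth_atI[OF U pU smooth_rho[OF j]])
  from smooth_at_has_exp[OF vact_smooth(1)[OF X this]] vact_smooth(2)[OF X this]
  show "has_exp (\<lambda>Z. vact (X Z) (cplx (\<rho> j)) Z) p (hat p X (taylor p (cplx (\<rho> j))))" by simp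
qed

text \<open>A CR field is tangent only along \<open>M\<close>, so it maps \<open>\<rho> j\<close> to
  a function that vanishes on \<open>M\<close>; \<open>expansion_in_II\<close> turns this into
  membership. Conjugate fields follow because the \<open>\<rho> j\<close> are real.\<close>

lemma LL_preserves_II:
  assumes X: "X \<in> LL" and f: "f \<in> II" shows "X f \<in> II"
proof -
  have der: "derivation X" using X by (auto simp: LL_def derivation_hat)
  have van: "\<forall>\<^sub>F Z in nhds p. Z \<in> M \<longrightarrow> vact (0, L Z) (cplx (\<rho> j)) Z = 0" if L: "CR_field d M p L" and j: "j < d" for L j
  proof -
    obtain V where V: "open V" "p \<in> V" "\<forall>Z\<in>M \<inter> V. L Z \<in> T01 d M Z" using L by (auto simp: CR_field_def)
    have "\<forall>\<^sub>F Z in nhds p. Z \<in> U \<inter> V" using U pU V by (intro eventually_nhds_in_open) auto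
    then show ?thesis
      by eventually_elim (use V(3) CT_annihilates[OF ld _ _ _ j] in \<open>auto simp: T01_def\<close>)
  qed
  have real: "vact (vcnj b, 0) (cplx (\<rho> j)) Z = cnj (vact (0, b) (cplx (\<rho> j)) Z)" if "Z \<in> U" "j < d" for b j Z
  proof -
    have d: "\<rho> j differentiable (at Z)" by (rule smooth_on_differentiable[OF local_definingD(3)[OF ld that(2)] that(1)])
    have "dZ k (cplx (\<rho> j)) Z = cnj (dZbar k (cplx (\<rho> j)) Z)" for k
      by (simp add: dZ_def dZbar_def dder_cplx[OF d])
    then show ?thesis by (simp add: vact_def vcnj_def)
  qed
  show ?thesis
  proof (rule derivation_preserves_II[OF der _ f])
    fix j assume j: "j < d"
    from X consider L where "CR_field d M p L" "X = hat p (\<lambda>Z. (0, L Z))"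
      | L where "CR_field d M p L" "X = hat p (\<lambda>Z. (vcnj (L Z), 0))"
      by (auto simp: LL_def)
    then show "X (taylor p (cplx (\<rho> j))) \<in> II"
    proof cases
      case 1
      show ?thesis unfolding 1(2)
        by (rule hat_in_II_of_tangent[OF CR_lie_algebra_smooth[OF CR_lie_algebra.CR[OF 1(1)]] j van[OF 1(1) j]])
    next
      case 2
      have "\<forall>\<^sub>F Z in nhds p. Z \<in> U" using U pU by (rule eventually_nhds_in_open)
      then have "\<forall>\<^sub>F Z in nhds p. Z \<in> M \<longrightarrow> vact (vcnj (L Z), 0) (cplx (\<rho> j)) Z = 0"
        using van[OF 2(1) j] by eventually_elim (simp add: real[OF _ j])
      then show ?thesis unfolding 2(2)
        by (rule hat_in_II_of_tangent[OF CR_lie_algebra_smooth[OF CR_lie_algebra.CR_conj[OF 2(1)]] j])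
    qed
  qed
qed

text \<open>A bracket acts as a commutator, so closure under letters and complex linear combinations
  gives closure under the whole Lie algebra. The series \<open>f\<close> stays general because a
  commutator applies one field to the image under another.\<close>

lemma hat_CR_lie_algebra_induct:
  assumes X: "X \<in> CR_lie_algebra d M p"
    and letter: "\<And>Y f. Y \<in> LL \<Longrightarrow> f \<in> P \<Longrightarrow> Y f \<in> P"
    and add: "\<And>f g. f \<in> P \<Longrightarrow> g \<in> P \<Longrightarrow> f + g \<in> P"
    and scale: "\<And>c f. f \<in> P \<Longrightarrow> mconst c * f \<in> P"
  shows "f \<in> P \<Longrightarrow> hat p X f \<in> P"
  using X
proof (induction arbitrary: f rule: CR_lie_algebra.induct)
  case (CR L)
  then show ?case by (intro letter[of "hat p (\<lambda>Z. (0, L Z))" f]) (auto simp: LL_def)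
next
  case (CR_conj L)
  then show ?case by (intro letter[of "hat p (\<lambda>Z. (vcnj (L Z), 0))" f]) (auto simp: LL_def)
next
  case (add X Y)
  have "xc (\<lambda>Z. X Z + Y Z) u = (\<lambda>Z. xc X u Z + xc Y u Z)" for u by (cases u) (auto simp: xc_def)
  then have "taylor p (xc (\<lambda>Z. X Z + Y Z) u) = taylor p (xc X u) + taylor p (xc Y u)" for u
    using CR_lie_algebra_smooth[OF add.hyps(1), of u] CR_lie_algebra_smooth[OF add.hyps(2), of u]
    by (auto intro!: taylor_unique smooth_at_add has_exp_add smooth_at_has_exp)
  then have "hat p (\<lambda>Z. X Z + Y Z) f = hat p X f + hat p Y f"
    by (simp add: hat_def distrib_right sum.distrib)
  then show ?case using add assms(3) by simp
next
  case (scale X c)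
  have "xc (\<lambda>Z. (c *s fst (X Z), c *s snd (X Z))) u = (\<lambda>Z. c * xc X u Z)" for u by (cases u) (auto simp: xc_def)
  then have "taylor p (xc (\<lambda>Z. (c *s fst (X Z), c *s snd (X Z))) u) = mconst c * taylor p (xc X u)" for u
    using CR_lie_algebra_smooth[OF scale.hyps(1), of u]
    by (auto intro!: taylor_unique smooth_at_mult smooth_at_const has_exp_cmult smooth_at_has_exp)
  then have "hat p (\<lambda>Z. (c *s fst (X Z), c *s snd (X Z))) f = mconst c * hat p X f"
    by (simp add: hat_def sum_distrib_left mult.assoc)
  then show ?case using scale assms(4) by simp
next
  case (bracket X Y)
  have "hat p (lie_bracket X Y) f = hat p X (hat p Y f) + mconst (- 1) * hat p Y (hat p X f)"
    using hat_lie_bracket[OF CR_lie_algebra_smooth[OF bracket.hyps(1)] CR_lie_algebra_smooth[OF bracket.hyps(2)]]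
    by (simp add: mconst_uminus)
  then show ?case using bracket assms(3,4) by simp
qed

lemma hat_preserves_II:
  assumes "X \<in> CR_lie_algebra d M p" "f \<in> II" shows "hat p X f \<in> II"
proof (rule hat_CR_lie_algebra_induct[where P = II, OF assms(1) _ _ _ assms(2)])
  show "Y f \<in> II" if "Y \<in> LL" "f \<in> II" for Y f by (rule LL_preserves_II[OF that])
qed (auto intro: isideal_add[OF isideal_II] isideal_mult[OF isideal_II])

lemma mcoeff_taylor_rho_linear:
  "j < d \<Longrightarrow> mcoeff (taylor p (cplx (\<rho> j))) {#u#} = wirtinger u (cplx (\<rho> j)) p"
  by (rule mcoeff_taylor_single[OF U pU smooth_rho])

text \<open>The image under \<open>dpol\<close> of every vector tangent in normal coordinates lies
  in \<open>CT d M p\<close>, hence by finite type is the value at \<open>p\<close> of some field in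
  the Lie algebra, as \<open>words_separate\<close> requires.\<close>

lemma finite_type_separates:
  assumes ft: "finite_type d M p"
    and F: "\<And>X k. X \<in> CR_lie_algebra d M p \<Longrightarrow> mcoeff ((hat p X ^^ k) F) {#} = 0"
  shows "F \<in> II"
proof (rule words_separate[where \<G> = "hat p ` CR_lie_algebra d M p"])
  fix X f assume X: "X \<in> hat p ` CR_lie_algebra d M p" and f: "f \<in> II"
  then obtain Y where Y: "X = hat p Y" "Y \<in> CR_lie_algebra d M p" by blast
  show "X f \<in> II" unfolding Y(1)
    by (rule hat_preserves_II[OF Y(2) f])
next
  fix y assume y: "tangent y"
  define x :: "'N cvec" where "x = (\<chi> k. dpol y (Inl k), \<chi> k. dpol y (Inr k))"
  have "vact x (cplx (\<rho> j)) p = 0" if j: "j < d" for j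
  proof -
    have "vact x (cplx (\<rho> j)) p = (\<Sum>u\<in>UNIV. mcoeff (taylor p (cplx (\<rho> j))) {#u#} * dpol y u)"
      by (simp add: vact_def sum_over_sum_type sum.distrib x_def mcoeff_taylor_rho_linear[OF j] mult.commute)
    also have "\<dots> = 0"
      by (rule II_linear[OF _ y], unfold II_def, rule subsetD[OF ideal_gen_superset]) (use j in blast)
    finally show ?thesis .
  qed
  then have "x \<in> CT d M p" using ld by (auto simp: CT_def)
  then have "x \<in> {X p |X. X \<in> CR_lie_algebra d M p}"
    using ft unfolding finite_type_def by simp
  then obtain X where X: "X \<in> CR_lie_algebra d M p" "X p = x" by blast
  have "mcoeff (hat p X (mvar u)) {#} = dpol y u" for u
    unfolding mcoeff_hat_mvar by (cases u) (simp_all add: xc_def X(2) x_def)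
  then show "\<exists>X\<in>hat p ` CR_lie_algebra d M p. \<forall>u. mcoeff (X (mvar u)) {#} = dpol y u" using X(1) by blast
qed (use derivation_hat F II_mpow in auto)

text \<open>The series all of whose word derivatives vanish at \<open>p\<close> are mapped to such
  series by letters, since a word may be lengthened, and therefore by the Lie algebra and its
  iterates; the empty word gives the vanishing at \<open>p\<close>.\<close>

lemma finite_type_words:
  assumes ft: "finite_type d M p"
    and F: "\<And>ws. set ws \<subseteq> LL \<Longrightarrow> foldr (\<lambda>X. X) ws F \<in> mpow 1"
  shows "F \<in> II"
proof (rule finite_type_separates[OF ft])
  define P where "P = {f. \<forall>ws. set ws \<subseteq> LL \<longrightarrow> foldr (\<lambda>X. X) ws f \<in> mpow 1}"
  have der: "derivation X" and con: "X (mconst c) = 0" if "X \<in> LL" for X c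
    using that by (auto simp: LL_def derivation_hat)
  have wadd: "foldr (\<lambda>X. X) ws (f + g) = foldr (\<lambda>X. X) ws f + foldr (\<lambda>X. X) ws g" if "set ws \<subseteq> LL" for ws f g
    using that by (induction ws) (auto simp: derivation_add[OF der])
  have wscale: "foldr (\<lambda>X. X) ws (mconst c * f) = mconst c * foldr (\<lambda>X. X) ws f" if "set ws \<subseteq> LL" for ws c f
    using that by (induction ws) (auto simp: derivation_mult[OF der] con)
  have letter: "X f \<in> P" if "X \<in> LL" "f \<in> P" for X f
    unfolding P_def
  proof (intro CollectI allI impI)
    fix ws assume "set ws \<subseteq> LL"
    then have "set (ws @ [X]) \<subseteq> LL" using that by simp
    then have "foldr (\<lambda>X. X) (ws @ [X]) f \<in> mpow 1" using that unfolding P_def by blast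
    then show "foldr (\<lambda>X. X) ws (X f) \<in> mpow 1" by simp
  qed
  have PX: "hat p X f \<in> P" if "X \<in> CR_lie_algebra d M p" "f \<in> P" for X f
  proof (rule hat_CR_lie_algebra_induct[where P = P, OF that(1) _ _ _ that(2)])
    show "Y f \<in> P" if "Y \<in> LL" "f \<in> P" for Y f by (rule letter[OF that])
    show "f + g \<in> P" if "f \<in> P" "g \<in> P" for f g
      using that by (auto simp: P_def wadd intro!: mpow_add)
    show "mconst c * f \<in> P" if "f \<in> P" for c f
      using that by (auto simp: P_def wscale intro!: mpow_mult_left)
  qed
  fix X k assume X: "X \<in> CR_lie_algebra d M p"
  have "(hat p X ^^ k) F \<in> P" by (induction k) (use F PX[OF X] in \<open>auto simp: P_def\<close>)
  then have "foldr (\<lambda>X. X) [] ((hat p X ^^ k) F) \<in> mpow 1"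
    unfolding P_def by (metis (mono_tags, lifting) empty_subsetI list.set(1) mem_Collect_eq)
  then show "mcoeff ((hat p X ^^ k) F) {#} = 0" by (simp add: mpow_1_iff)
qed

lemma dpow_funpow: "J \<in> dpow \<D> P (Suc n) \<Longrightarrow> X \<in> \<D> \<Longrightarrow> (X ^^ n) J \<in> P"
proof (induction n arbitrary: J)
  case (Suc n)
  then have "X J \<in> dpow \<D> P (Suc n)" by auto
  from Suc.IH[OF this Suc.prems(2)] show ?case by (simp add: funpow_swap1)
qed auto

text \<open>The (0,1) fields annihilate the holomorphic \<open>J1\<close> and their conjugates the
  antiholomorphic \<open>J2\<close>, so each letter has its own annihilated multiple of
  \<open>A\<close>. If \<open>A\<close> were not a unit, every word would send it into the maximal
  ideal, so \<open>A\<close> and with it \<open>lift_hol J1\<close> would lie in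
  \<open>II\<close>.\<close>

lemma divisor_is_unit:
  assumes ft: "finite_type d M p"
    and A1: "A * B1 - u1 * lift_hol J1 \<in> II" "u1 \<notin> mpow 1" "J1 \<noteq> 0"
    and A2: "A * B2 - u2 * lift_anti J2 \<in> II" "u2 \<notin> mpow 1" "J2 \<noteq> 0"
  shows "A \<notin> mpow 1"
proof
  assume A: "A \<in> mpow 1"
  \<comment> \<open>Taking all derivations that preserve \<open>II\<close> makes closure under
    commutators immediate, and still includes every letter and every field of the Lie
    algebra.\<close>
  define \<D> where "\<D> = {X. derivation X \<and> (\<forall>f\<in>II. X f \<in> II)}"
  have m: "prime_ideal (mpow 1 :: ('N + 'N) mfps set)"
    by (auto simp: prime_ideal_def isideal_def mpow_1_iff)
  have nat: "of_nat (Suc n) \<notin> (mpow 1 :: ('N + 'N) mfps set)" for n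
    unfolding of_nat_mconst by (simp add: mpow_1_iff del: of_nat_Suc)
  have LD: "LL \<subseteq> \<D>"
    using LL_preserves_II by (auto simp: \<D>_def) (auto simp: LL_def derivation_hat)
  have hatD: "hat p X \<in> \<D>" if "X \<in> CR_lie_algebra d M p" for X
    using hat_preserves_II[OF that] by (auto simp: \<D>_def derivation_hat)
  \<comment> \<open>Infinite order along the maximal ideal would mean that all iterates of all
    fields in the Lie algebra vanish at \<open>p\<close>, which finite type allows only for elements
    of \<open>II\<close>.\<close>
  have inf: "\<exists>n. J \<notin> dpow \<D> (mpow 1) n" if "J \<notin> II" for J
  proof (rule ccontr)
    assume "\<not> ?thesis"
    then have "(hat p X ^^ k) J \<in> mpow 1" if "X \<in> CR_lie_algebra d M p" for X k
      using dpow_funpow[OF _ hatD[OF that]] by blast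
    then have "J \<in> II" by (intro finite_type_separates[OF ft]) (auto simp: mpow_1_iff)
    with that show False by contradiction
  qed
  have J: "lift_hol J1 \<notin> II" "lift_anti J2 \<notin> II"
    using A1(3) A2(3) lift_hol_in_II lift_anti_in_II by auto
  have taylor0: "taylor p (\<lambda>_. 0) = 0"
    by (rule taylor_unique[OF smooth_at_const]) (rule has_exp_const[of 0, simplified])
  have kill1: "hat p (\<lambda>Z. (0, L Z)) (lift_hol J1) = 0" for L
    by (simp add: hat_def sum_over_sum_type pder_lift_other xc_def[abs_def] taylor0)
  have kill2: "hat p (\<lambda>Z. (vcnj (L Z), 0)) (lift_anti J2) = 0" for L
    by (simp add: hat_def sum_over_sum_type pder_lift_other xc_def[abs_def] taylor0)
  have "foldr (\<lambda>X. X) ws A \<in> mpow 1" if ws: "set ws \<subseteq> LL" for ws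
  proof (rule divisor_in_word_kernel[of \<D> II, OF _ isideal_II _ _ m II_mpow nat A LD _ ws])
    fix X assume "X \<in> LL"
    then show "\<exists>B u J n. A * B - u * J \<in> II \<and> u \<notin> mpow 1 \<and> X J \<in> II \<and> J \<notin> dpow \<D> (mpow 1) n"
      using A1(1,2) A2(1,2) inf[OF J(1)] inf[OF J(2)] kill1 kill2 isideal_0[OF isideal_II]
      unfolding LL_def by fastforce
  next
    fix X Y assume "X \<in> \<D>" "Y \<in> \<D>"
    then show "(\<lambda>f. X (Y f) - Y (X f)) \<in> \<D>"
      by (auto simp: \<D>_def intro: derivation_commutator isideal_diff[OF isideal_II])
  qed (auto simp: \<D>_def)
  then have "A \<in> II" by (rule finite_type_words[OF ft])
  then have "u1 * lift_hol J1 \<in> II"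
    using isideal_diff[OF isideal_II isideal_mult_right[OF isideal_II, of A B1] A1(1)] by simp
  moreover obtain g where "u1 * g = 1" using mfps_unit[of u1] A1(2) by (auto simp: mpow_1_iff)
  ultimately have "lift_hol J1 \<in> II"
    using isideal_mult[OF isideal_II, of "u1 * lift_hol J1" g]
    by (metis mult.assoc mult.commute mult_1)
  then show False using J(1) by contradiction
qed

end

section \<open>Determinants\<close>

lemma ring_hom_det:
  fixes T :: "'a::comm_ring_1 \<Rightarrow> 'b::comm_ring_1" and A :: "'a^'n^'n"
  assumes add: "\<And>x y. T (x + y) = T x + T y" and mult: "\<And>x y. T (x * y) = T x * T y" and one: "T 1 = 1"
  shows "T (det A) = det (\<chi> i j. T (A $ i $ j))"
proof -
  interpret T: Modules.additive T by (rule additiveI) (rule add)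
  have prod: "T (prod f S) = (\<Prod>x\<in>S. T (f x))" for f :: "'n \<Rightarrow> 'a" and S
    by (induction S rule: infinite_finite_induct) (simp_all add: mult one)
  have sgn: "T (of_int (sign \<sigma>)) = of_int (sign \<sigma>)" for \<sigma> :: "'n \<Rightarrow> 'n"
    by (simp add: sign_def T.minus one)
  show ?thesis by (simp add: det_def T.sum mult prod sgn)
qed

lemma det_cong_ideal:
  fixes A B :: "'a::comm_ring_1^'n^'n"
  assumes J: "isideal J" and AB: "\<And>i j. A $ i $ j - B $ i $ j \<in> J"
  shows "det A - det B \<in> J"
proof -
  have prod: "(\<Prod>x\<in>S. f x) - (\<Prod>x\<in>S. g x) \<in> J" if "\<And>x. f x - g x \<in> J" for f g :: "'n \<Rightarrow> 'a" and S
  proof (induction S rule: infinite_finite_induct)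
    case (insert x S)
    have "prod f (insert x S) - prod g (insert x S)
        = (f x - g x) * prod f S + g x * (prod f S - prod g S)"
      using insert by (simp add: algebra_simps)
    then show ?case
      using isideal_add[OF J isideal_mult_right[OF J that] isideal_mult[OF J insert.IH]] by simp
  qed (auto simp: isideal_0[OF J])
  show ?thesis
    unfolding det_def sum_subtractf[symmetric] right_diff_distrib[symmetric]
    by (intro isideal_sum[OF J] isideal_mult[OF J] prod AB)
qed

lemma det_zero_kernel:
  fixes A :: "complex^'n^'n"
  assumes "det A = 0" obtains x where "x \<noteq> 0" "A *v x = 0"
proof -
  have "\<nexists>B. B ** A = mat 1"
  proof
    assume "\<exists>B. B ** A = mat 1"
    then obtain B where "B ** A = mat 1" ..
    then have "det B * det A = 1" by (metis det_mul det_I)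
    with assms show False by simp
  qed
  then show ?thesis using that unfolding matrix_left_invertible_ker by blast
qed

text \<open>The prescribed rows extend to a basis; a bijection from the complement of
  \<open>D\<close> to the added vectors places these in the free rows.\<close>

lemma complete_rows:
  fixes \<theta> :: "'n::finite \<Rightarrow> complex^'n"
  assumes indep: "\<And>c i. (\<Sum>i\<in>D. c i *s \<theta> i) = 0 \<Longrightarrow> i \<in> D \<Longrightarrow> c i = 0"
  obtains E where "det (\<chi> i. if i \<in> D then \<theta> i else E i) \<noteq> 0"
proof -
  have inj: "inj_on \<theta> D"
  proof (rule inj_onI, rule ccontr)
    fix i j assume ij: "i \<in> D" "j \<in> D" "\<theta> i = \<theta> j" "i \<noteq> j"
    define c :: "'n \<Rightarrow> complex" where "c k = (if k = i then 1 else if k = j then - 1 else 0)" for k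
    have "(\<Sum>k\<in>D. c k *s \<theta> k) = (\<Sum>k\<in>{i, j}. c k *s \<theta> k)"
      by (rule sum.mono_neutral_right) (use ij in \<open>auto simp: c_def\<close>)
    also have "\<dots> = 0" using ij by (simp add: c_def)
    finally have "c i = 0" using indep ij(1) by blast
    then show False by (simp add: c_def)
  qed
  have ind: "vec.independent (\<theta> ` D)"
  proof
    assume "vec.dependent (\<theta> ` D)"
    then obtain u v where uv: "v \<in> \<theta> ` D" "u v \<noteq> 0" "(\<Sum>v\<in>\<theta> ` D. u v *s v) = 0"
      unfolding vec.dependent_finite[OF finite_imageI[OF finite]] by blast
    then have "(\<Sum>i\<in>D. u (\<theta> i) *s \<theta> i) = 0" by (simp add: sum.reindex[OF inj])
    moreover obtain i where "v = \<theta> i" "i \<in> D" using uv(1) by blast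
    ultimately show False using indep[of "\<lambda>i. u (\<theta> i)" i] uv(2) by blast
  qed
  define B where "B = vec.extend_basis (\<theta> ` D)"
  have B: "\<theta> ` D \<subseteq> B" "vec.independent B" "vec.span B = UNIV"
    unfolding B_def using vec.extend_basis_superset[OF ind] vec.independent_extend_basis[OF ind]
      vec.span_extend_basis[OF ind] by auto
  have finB: "finite B" by (rule vec.finiteI_independent[OF B(2)])
  have cardB: "card B = CARD('n)"
    using vec.dim_span_eq_card_independent[OF B(2)] vec.dim_span_eq_card_independent[OF independent_cart_basis]
    by (simp add: B(3) card_cart_basis)
  have "card (B - \<theta> ` D) = card (- D)"
    using B(1) finB cardB inj by (simp add: card_Diff_subset card_image Compl_eq_Diff_UNIV)
  then obtain f where f: "bij_betw f (- D) (B - \<theta> ` D)"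
    using finite_same_card_bij[of "- D" "B - \<theta> ` D"] finB by auto
  define \<eta> where "\<eta> i = (if i \<in> D then \<theta> i else f i)" for i
  have inj\<eta>: "inj \<eta>"
  proof (rule injI)
    fix i j assume ij: "\<eta> i = \<eta> j"
    show "i = j"
    proof (cases "i \<in> D"; cases "j \<in> D")
      assume "i \<in> D" "j \<in> D" then show ?thesis using ij inj by (auto simp: \<eta>_def dest: inj_onD)
    next
      assume "i \<notin> D" "j \<notin> D" then show ?thesis using ij f by (auto simp: \<eta>_def bij_betw_def dest: inj_onD)
    next
      assume "i \<in> D" "j \<notin> D"
      moreover have "f j \<in> B - \<theta> ` D" using f \<open>j \<notin> D\<close> by (auto simp: bij_betw_def)
      ultimately show ?thesis using ij imageI[of i D \<theta>] by (auto simp: \<eta>_def)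
    next
      assume "i \<notin> D" "j \<in> D"
      moreover have "f i \<in> B - \<theta> ` D" using f \<open>i \<notin> D\<close> by (auto simp: bij_betw_def)
      ultimately show ?thesis using ij by (auto simp: \<eta>_def)
    qed
  qed
  have ran: "range \<eta> \<subseteq> B" using B(1) f by (auto simp: \<eta>_def bij_betw_def)
  have indr: "vec.independent (range \<eta>)" by (rule vec.independent_mono[OF B(2) ran])
  let ?A = "\<chi> i. \<eta> i"
  have "det ?A \<noteq> 0"
  proof
    assume "det ?A = 0"
    then have "det (transpose ?A) = 0" by (simp add: det_transpose)
    then obtain x where x: "x \<noteq> 0" "transpose ?A *v x = 0" by (rule det_zero_kernel)
    have "(\<Sum>i\<in>UNIV. x $ i *s \<eta> i) = transpose ?A *v x"
      by (simp add: vec_eq_iff matrix_vector_mult_def transpose_def mult.commute)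
    then have "(\<Sum>v\<in>range \<eta>. x $ (inv \<eta> v) *s v) = 0"
      using x(2) by (simp add: sum.reindex[OF inj\<eta>] inv_f_f[OF inj\<eta>])
    note sum0 = this
    have z: "\<forall>v\<in>range \<eta>. x $ (inv \<eta> v) = 0"
    proof (rule ccontr)
      assume "\<not> ?thesis"
      then have "\<exists>v\<in>range \<eta>. x $ (inv \<eta> v) \<noteq> 0" by blast
      then have "vec.dependent (range \<eta>)"
        unfolding vec.dependent_finite[OF finite_imageI[OF finite]]
        using sum0 by (intro exI[of _ "\<lambda>v. x $ (inv \<eta> v)"] conjI)
      with indr show False by contradiction
    qed
    have "x $ i = 0" for i
    proof -
      have "x $ (inv \<eta> (\<eta> i)) = 0" using z by blast
      then show ?thesis by (simp add: inv_f_f[OF inj\<eta>])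
    qed
    then show False using x(1) by (simp add: vec_eq_iff)
  qed
  then show ?thesis using that[of f] by (simp add: \<eta>_def[abs_def])
qed

section \<open>The mapping of formal power series\<close>

locale cr_map = defining_function d p \<rho> \<phi> D Q M U
  for d :: nat and p :: "complex^'N::finite" and \<rho> \<phi> D Q M U +
  fixes M' p' U' \<rho>' and H :: "complex^'N \<Rightarrow> complex^'N" and W
  assumes ld': "local_defining d M' p' U' \<rho>'" and pM': "p' \<in> M'"
    and W: "open W" "p \<in> W" "holomorphic_map_on W H" and Hp: "H p = p'"
    and HM: "\<forall>\<^sub>F Z in nhds p. Z \<in> M \<longrightarrow> H Z \<in> M'"
    and Jac: "\<not> (\<forall>\<^sub>F Z in nhds p. Jac H Z = 0)"
    and ft: "finite_type d M p"
begin

lemma cdiff_H: "cdiff_on W (\<lambda>Z. H Z $ k)"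
  using W(3) by (simp add: holomorphic_map_on_iff)

definition A0 :: "'N \<Rightarrow> 'N mfps" where
  "A0 k = (SOME A. has_exp (\<lambda>Z. H Z $ k) p (lift_hol A))"

lemma has_exp_A0: "has_exp (\<lambda>Z. H Z $ k) p (lift_hol (A0 k))"
  unfolding A0_def by (rule someI_ex) (use cdiff_on_has_exp[OF W(1,2) cdiff_H] in metis)

definition Ah :: "'N \<Rightarrow> 'N mfps" where
  "Ah k = A0 k - mconst (p' $ k)"

lemma has_exp_Ah: "has_exp (\<lambda>Z. H Z $ k - p' $ k) p (lift_hol (Ah k))"
  using has_exp_diff[OF has_exp_A0 has_exp_const[of "p' $ k"]]
  by (simp add: Ah_def lift_hol_def msubst_diff)

lemma Ah_mpow: "Ah k \<in> mpow 1"
  using has_exp_value[OF has_exp_Ah[of k]] by (simp add: mpow_1_iff lift_hol_def Hp)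

lemma pder_Ah: "pder j (Ah k) = pder j (A0 k)"
  by (simp add: Ah_def pder_diff)

definition HH :: "'N + 'N \<Rightarrow> ('N + 'N) mfps" where
  "HH u = (case u of Inl k \<Rightarrow> lift_hol (Ah k) | Inr k \<Rightarrow> lift_anti (mcnj (Ah k)))"

lemma HH_simps [simp]: "HH (Inl k) = lift_hol (Ah k)" "HH (Inr k) = lift_anti (mcnj (Ah k))"
  by (simp_all add: HH_def)

lemma HH_mpow: "HH u \<in> mpow 1"
  using Ah_mpow by (cases u) (auto simp: lift_hol_def lift_anti_def mpow_1_iff)

text \<open>The equations of \<open>M'\<close> are numbered by \<open>D\<close>, as the generators
  \<open>s\<close> are, so that the transition between the two families is a square matrix.\<close>

definition e :: "'N \<Rightarrow> nat" where
  "e = (SOME e. bij_betw e D {..<d})"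

lemma bij_e: "bij_betw e D {..<d}"
proof -
  have "\<exists>e. bij_betw e D {..<d}" using finite_same_card_bij[of D "{..<d}"] card_D by simp
  from someI_ex[OF this] show ?thesis by (simp only: e_def)
qed

lemma e_less: "i \<in> D \<Longrightarrow> e i < d"
  using bij_e by (auto simp: bij_betw_def)

definition F' :: "'N \<Rightarrow> ('N + 'N) mfps" where
  "F' i = taylor p' (cplx (\<rho>' (e i)))"

lemmas U' = local_definingD(1,2)[OF ld']

lemma smooth_rho': "i \<in> D \<Longrightarrow> smooth_on U' (cplx (\<rho>' (e i)))"
  by (rule smooth_on_cplx[OF U'(1) local_definingD(3)[OF ld' e_less]])

lemma F'_mpow: "i \<in> D \<Longrightarrow> F' i \<in> mpow 1"
  using local_definingD(4)[OF ld' U'(2)] pM' e_less by (auto simp: F'_def mpow_1_iff)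

text \<open>The Taylor series at \<open>p\<close> of the equations of \<open>M'\<close> composed
  with \<open>H\<close>, with the conjugate variables made independent.\<close>

definition T :: "'N \<Rightarrow> ('N + 'N) mfps" where
  "T i = msubst HH (F' i)"

lemma T_in_II: assumes i: "i \<in> D" shows "T i \<in> II"
proof (rule expansion_in_II)
  have "has_exp (\<lambda>x. cc (H x - H p) u) p (HH u)" for u
    using has_exp_Ah has_exp_cnj_hol[OF has_exp_Ah] by (cases u) (auto simp: Hp)
  moreover have "has_exp (cplx (\<rho>' (e i))) (H p) (F' i)"
    unfolding F'_def Hp by (rule has_exp_taylor[OF U' smooth_rho'[OF i]])
  ultimately show "has_exp (\<lambda>Z. cplx (\<rho>' (e i)) (H Z)) p (T i)"
    unfolding T_def by (intro has_exp_compose)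
  have "H differentiable (at p)" using W by (auto simp: holomorphic_map_on_def differentiable_def)
  then have "isCont H p" by (rule differentiable_imp_continuous_within)
  then have "(H \<longlongrightarrow> p') (nhds p)" using Hp tendsto_at_iff_tendsto_nhds[of H p] by (simp add: continuous_at)
  from eventually_compose_filterlim[OF eventually_nhds_in_open[OF U'] this]
  have "\<forall>\<^sub>F Z in nhds p. H Z \<in> U'" .
  then show "\<forall>\<^sub>F Z in nhds p. Z \<in> M \<longrightarrow> cplx (\<rho>' (e i)) (H Z) = 0"
    using HM by eventually_elim (use local_definingD(4)[OF ld'] e_less[OF i] in auto)
qed

section \<open>The transition matrix and transversality\<close>

definition a :: "'N \<Rightarrow> 'N \<Rightarrow> ('N + 'N) mfps" where
  "a i = (SOME a. T i = (\<Sum>j\<in>D. a j * s j))"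

lemma T_eq: "i \<in> D \<Longrightarrow> T i = (\<Sum>j\<in>D. a i j * s j)"
proof -
  assume "i \<in> D"
  then have "\<exists>a. T i = (\<Sum>j\<in>D. a j * s j)" using T_in_II II_iff_s by blast
  from someI_ex[OF this, folded a_def] show ?thesis .
qed

text \<open>The transition matrix \<open>a\<close> is padded with an identity block to an \<open>N \<times> N\<close> matrix.\<close>
definition AA :: "('N + 'N) mfps^'N^'N" where
  "AA = (\<chi> i j. if i \<in> D then (if j \<in> D then a i j else 0) else (if i = j then 1 else 0))"

lemma pder_T:
  "pder (Inl k) (T i) = (\<Sum>l\<in>UNIV. msubst HH (pder (Inl l) (F' i)) * lift_hol (pder k (Ah l)))"
  "pder (Inr k) (T i) = (\<Sum>l\<in>UNIV. msubst HH (pder (Inr l) (F' i)) * lift_anti (pder k (mcnj (Ah l))))"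
  unfolding T_def pder_msubst[OF HH_mpow]
  by (simp_all add: sum_over_sum_type pder_lift_hol pder_lift_anti pder_lift_other)

text \<open>
  Up to a unit the Jacobian factors through \<open>det AA\<close> modulo the ideal; \<open>v\<close> selects the holomorphic
  or the antiholomorphic variables, and \<open>h k l\<close> is the corresponding derivative of the mapping.
\<close>
lemma jacobian_factor:
  fixes v :: "'N \<Rightarrow> 'N + 'N" and h :: "'N \<Rightarrow> 'N \<Rightarrow> ('N + 'N) mfps"
  assumes pT: "\<And>i k. i \<in> D \<Longrightarrow> pder (v k) (T i) = (\<Sum>l\<in>UNIV. msubst HH (pder (v l) (F' i)) * h k l)"
    and unit: "det (\<chi> i l. if i \<in> D then mcoeff (pder (v l) (F' i)) {#} else E i $ l) \<noteq> 0"
  obtains B u where "det AA * B - u * det (\<chi> l k. h k l) \<in> II" "u \<notin> mpow 1"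
proof -
  define R :: "('N + 'N) mfps^'N^'N" where
    "R = (\<chi> i l. if i \<in> D then msubst HH (pder (v l) (F' i)) else mconst (E i $ l))"
  define Hm :: "('N + 'N) mfps^'N^'N" where "Hm = (\<chi> l k. h k l)"
  \<comment> \<open>Outside \<open>D\<close> the rows of \<open>K\<close> are taken from the product
    \<open>R ** Hm\<close>, so there the two matrix products agree exactly; inside \<open>D\<close>
    they differ by terms with a factor \<open>s j\<close>.\<close>
  define K :: "('N + 'N) mfps^'N^'N" where
    "K = (\<chi> i k. if i \<in> D then pder (v k) (s i) else (\<Sum>l\<in>UNIV. mconst (E i $ l) * h k l))"
  have "(AA ** K) $ i $ k - (R ** Hm) $ i $ k \<in> II" for i k
  proof (cases "i \<in> D")
    case True
    have "(AA ** K) $ i $ k = (\<Sum>j\<in>UNIV. if j \<in> D then a i j * pder (v k) (s j) else 0)"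
      using True unfolding matrix_matrix_mult_def by (auto simp: AA_def K_def intro!: sum.cong)
    then have 1: "(AA ** K) $ i $ k = (\<Sum>j\<in>D. a i j * pder (v k) (s j))"
      by (simp add: sum.If_cases)
    have "(R ** Hm) $ i $ k = pder (v k) (T i)"
      using True by (simp add: matrix_matrix_mult_def R_def Hm_def pT)
    also have "\<dots> = (\<Sum>j\<in>D. pder (v k) (a i j) * s j) + (AA ** K) $ i $ k"
      by (simp add: T_eq[OF True] pder_sum pder_mult sum.distrib 1)
    finally have "(AA ** K) $ i $ k - (R ** Hm) $ i $ k = - (\<Sum>j\<in>D. pder (v k) (a i j) * s j)" by simp
    moreover have "(\<Sum>j\<in>D. pder (v k) (a i j) * s j) \<in> II"
      by (intro isideal_sum[OF isideal_II] isideal_mult[OF isideal_II] s_in_II)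
    ultimately show ?thesis using isideal_uminus[OF isideal_II] by simp
  next
    case False
    have "(AA ** K) $ i $ k = K $ i $ k"
      using False by (simp add: matrix_matrix_mult_def AA_def if_distrib[of "\<lambda>x. x * _"] cong: if_cong)
    also have "\<dots> = (R ** Hm) $ i $ k"
      using False by (simp add: K_def R_def Hm_def matrix_matrix_mult_def)
    finally show ?thesis by (simp add: isideal_0[OF isideal_II])
  qed
  from det_cong_ideal[OF isideal_II this]
  have "det AA * det K - det R * det Hm \<in> II" by (simp add: det_mul)
  moreover have "mcoeff (det R) {#} \<noteq> 0"
  proof -
    have "mcoeff (det R) {#} = det (\<chi> i l. mcoeff (R $ i $ l) {#})"
      by (rule ring_hom_det[of "\<lambda>f. mcoeff f {#}"]) auto
    also have "(\<chi> i l. mcoeff (R $ i $ l) {#}) = (\<chi> i l. if i \<in> D then mcoeff (pder (v l) (F' i)) {#} else E i $ l)"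
      by (auto simp: vec_eq_iff R_def)
    finally show ?thesis using unit by simp
  qed
  ultimately show ?thesis using that unfolding Hm_def by (simp add: mpow_1_iff)
qed

definition J :: "'N mfps" where
  "J = det (\<chi> l k. pder k (Ah l))"

lemma has_exp_Jac: "has_exp (Jac H) p (lift_hol J)"
proof -
  have "has_exp (\<lambda>Z. det (\<chi> l k. dder (\<lambda>Z. H Z $ l) (axis k 1) Z)) p (det (\<chi> l k. lift_hol (pder k (A0 l))))"
    by (rule has_exp_det) (simp add: cdiff_on_has_exp_dder[OF W(1,2) cdiff_H has_exp_A0])
  moreover have "det (\<chi> l k. lift_hol (pder k (A0 l))) = lift_hol J"
    unfolding J_def by (subst ring_hom_det[of lift_hol])
      (simp_all add: lift_hol_mult pder_Ah, simp_all add: lift_hol_def msubst_add)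
  ultimately have "has_exp (\<lambda>Z. det (\<chi> l k. dder (\<lambda>Z. H Z $ l) (axis k 1) Z)) p (lift_hol J)" by simp
  then show ?thesis
    by (rule has_exp_cong) (rule eventually_mono[OF eventually_nhds_in_open[OF W(1,2)]], rule Jac_eq[OF W(3)])
qed

text \<open>\<open>J\<close> is the formal Jacobian, while the hypothesis concerns values near
  \<open>p\<close>; the identity theorem links the two.\<close>

lemma J_nonzero: "J \<noteq> 0"
proof
  assume "J = 0"
  have cd: "cdiff_on W (\<lambda>Z. det (\<chi> l k. dder (\<lambda>Z. H Z $ l) (axis k 1) Z))"
    by (rule cdiff_on_det[OF W(1)]) (simp add: cdiff_on_dder[OF W(1) cdiff_H])
  have ev: "\<forall>\<^sub>F Z in nhds p. Jac H Z = det (\<chi> l k. dder (\<lambda>Z. H Z $ l) (axis k 1) Z)"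
    by (rule eventually_mono[OF eventually_nhds_in_open[OF W(1,2)]], rule Jac_eq[OF W(3)])
  have "has_exp (Jac H) p 0" using has_exp_Jac \<open>J = 0\<close> by (simp add: lift_hol_def)
  then have "has_exp (\<lambda>Z. det (\<chi> l k. dder (\<lambda>Z. H Z $ l) (axis k 1) Z)) p 0"
    by (rule has_exp_cong) (use ev in \<open>auto elim: eventually_mono\<close>)
  from cdiff_on_identity[OF W(1,2) cd this] ev have "\<forall>\<^sub>F Z in nhds p. Jac H Z = 0"
    by eventually_elim simp
  with Jac show False by contradiction
qed

lemma pder_mcnj: "pder k (mcnj f) = mcnj (pder k f)"
  by (rule mfps_eqI) (simp add: mcoeff_pder)

text \<open>The (1,0) gradients of \<open>M'\<close> are independent at \<open>p'\<close>, so
  constant rows complete them to an invertible matrix; since the \<open>\<rho>'\<close> are real,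
  the conjugate rows serve the conjugate variables. Both factorizations through
  \<open>det AA\<close> are then available to \<open>divisor_is_unit\<close>.\<close>

lemma det_AA_unit: "det AA \<notin> mpow 1"
proof -
  have lin: "mcoeff (pder u (F' i)) {#} = wirtinger u (cplx (\<rho>' (e i))) p'" if "i \<in> D" for i u
    using mcoeff_taylor_single[OF U' smooth_rho'[OF that], of u] by (simp add: mcoeff_pder F'_def)
  define \<theta> where "\<theta> i = (\<chi> k. dZ k (cplx (\<rho>' (e i))) p')" for i
  obtain E where E: "det (\<chi> i. if i \<in> D then \<theta> i else E i) \<noteq> 0"
  proof (rule complete_rows[where D = D and \<theta> = \<theta>])
    fix c i assume c: "(\<Sum>i\<in>D. c i *s \<theta> i) = 0" and i: "i \<in> D"
    let ?g = "inv_into D e"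
    have "(\<Sum>j<d. c (?g j) * dZ k (cplx (\<rho>' j)) p') = 0" for k
    proof -
      have "(\<Sum>j<d. c (?g j) * dZ k (cplx (\<rho>' j)) p') = (\<Sum>i\<in>D. c (?g (e i)) * dZ k (cplx (\<rho>' (e i))) p')"
        by (rule sum.reindex_bij_betw[OF bij_e, symmetric])
      also have "\<dots> = (\<Sum>i\<in>D. c i *s \<theta> i) $ k"
        using bij_e by (simp add: \<theta>_def bij_betw_def inv_into_f_f)
      finally show ?thesis by (simp add: c)
    qed
    from local_defining_independent[OF ld' U'(2) this e_less[OF i]]
    show "c i = 0" using bij_e i by (simp add: bij_betw_def inv_into_f_f)
  qed
  have unit1: "det (\<chi> i l. if i \<in> D then mcoeff (pder (Inl l) (F' i)) {#} else E i $ l) \<noteq> 0"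
  proof -
    have "(\<chi> i l. if i \<in> D then mcoeff (pder (Inl l) (F' i)) {#} else E i $ l) = (\<chi> i. if i \<in> D then \<theta> i else E i)"
      by (auto simp: vec_eq_iff lin \<theta>_def)
    then show ?thesis using E by simp
  qed
  have conj: "mcoeff (pder (Inr l) (F' i)) {#} = cnj (mcoeff (pder (Inl l) (F' i)) {#})" if i: "i \<in> D" for i l
  proof -
    have "\<rho>' (e i) differentiable (at p')"
      by (rule smooth_on_differentiable[OF local_definingD(3)[OF ld' e_less[OF i]] U'(2)])
    then show ?thesis by (simp add: lin[OF i] dZ_def dZbar_def dder_cplx)
  qed
  have unit2: "det (\<chi> i l. if i \<in> D then mcoeff (pder (Inr l) (F' i)) {#} else (\<chi> l. cnj (E i $ l)) $ l) \<noteq> 0"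
  proof -
    have "(\<chi> i l. if i \<in> D then mcoeff (pder (Inr l) (F' i)) {#} else (\<chi> l. cnj (E i $ l)) $ l)
       = (\<chi> i l. cnj ((\<chi> i l. if i \<in> D then mcoeff (pder (Inl l) (F' i)) {#} else E i $ l) $ i $ l))"
      by (auto simp: vec_eq_iff conj)
    also have "det \<dots> = cnj (det (\<chi> i l. if i \<in> D then mcoeff (pder (Inl l) (F' i)) {#} else E i $ l))"
      by (rule ring_hom_det[symmetric]) auto
    finally show ?thesis using unit1 by simp
  qed
  obtain B1 u1 where 1: "det AA * B1 - u1 * det (\<chi> l k. lift_hol (pder k (Ah l))) \<in> II" "u1 \<notin> mpow 1"
    using jacobian_factor[of Inl "\<lambda>k l. lift_hol (pder k (Ah l))", OF pder_T(1) unit1] .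
  obtain B2 u2 where 2: "det AA * B2 - u2 * det (\<chi> l k. lift_anti (pder k (mcnj (Ah l)))) \<in> II" "u2 \<notin> mpow 1"
    using jacobian_factor[of Inr "\<lambda>k l. lift_anti (pder k (mcnj (Ah l)))" "\<lambda>i. \<chi> l. cnj (E i $ l)", OF pder_T(2) unit2] .
  have j1: "det (\<chi> l k. lift_hol (pder k (Ah l))) = lift_hol J"
    unfolding J_def by (subst ring_hom_det[of lift_hol])
      (simp_all add: lift_hol_mult, simp_all add: lift_hol_def msubst_add)
  have j2: "det (\<chi> l k. lift_anti (pder k (mcnj (Ah l)))) = lift_anti (mcnj J)"
    unfolding J_def
    by (subst ring_hom_det[of mcnj], simp_all add: mcnj_add mcnj_mult, subst ring_hom_det[of lift_anti])
      (simp_all add: lift_anti_mult pder_mcnj, simp_all add: lift_anti_def msubst_add)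
  have "mcnj J \<noteq> 0" using J_nonzero mcnj_mcnj mcnj_0 by metis
  then show ?thesis
    using divisor_is_unit[OF ft 1(1)[unfolded j1] 1(2) J_nonzero 2(1)[unfolded j2] 2(2)] by blast
qed

text \<open>Transversality in the form used afterwards: as \<open>det AA\<close> is a unit, Cramer's
  rule inverts the transition matrix and the pulled-back equations of \<open>M'\<close> generate the
  ideal of \<open>M\<close>.\<close>

lemma s_combination:
  obtains b where "\<And>j. j \<in> D \<Longrightarrow> s j = (\<Sum>i\<in>D. b j i * T i)"
proof -
  obtain g where g: "det AA * g = 1" using mfps_unit[of "det AA"] det_AA_unit by (auto simp: mpow_1_iff)
  obtain B where B: "B ** AA = mat (det AA)" using adjugate_exists[of AA] .
  have "s j = (\<Sum>i\<in>D. (g * B $ j $ i) * T i)" if j: "j \<in> D" for j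
  proof -
    have "(\<Sum>i\<in>D. B $ j $ i * T i) = (\<Sum>i\<in>D. \<Sum>k\<in>D. B $ j $ i * AA $ i $ k * s k)"
      by (simp add: T_eq AA_def sum_distrib_left mult.assoc)
    also have "\<dots> = (\<Sum>k\<in>D. \<Sum>i\<in>D. B $ j $ i * AA $ i $ k * s k)" by (rule sum.swap)
    also have "\<dots> = (\<Sum>k\<in>D. (B ** AA) $ j $ k * s k)"
    proof (rule sum.cong)
      fix k assume k: "k \<in> D"
      have "(B ** AA) $ j $ k = (\<Sum>i\<in>UNIV. B $ j $ i * AA $ i $ k)"
        by (simp add: matrix_matrix_mult_def)
      also have "\<dots> = (\<Sum>i\<in>D. B $ j $ i * AA $ i $ k)"
        by (rule sum.mono_neutral_right) (use k in \<open>auto simp: AA_def\<close>)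
      finally show "(\<Sum>i\<in>D. B $ j $ i * AA $ i $ k * s k) = (B ** AA) $ j $ k * s k"
        by (simp add: sum_distrib_right)
    qed simp
    also have "\<dots> = det AA * s j"
      using j by (simp add: B mat_def if_distrib[of "\<lambda>x. x * _"] cong: if_cong)
    finally have "g * (\<Sum>i\<in>D. B $ j $ i * T i) = s j"
      using g by (simp add: mult.assoc[symmetric] mult.commute[of g])
    then show ?thesis by (simp add: sum_distrib_left mult.assoc)
  qed
  then show ?thesis by (rule that)
qed

end

section \<open>Ideals of finite codimension\<close>

lemma linear_dependence:
  fixes c :: "'i \<Rightarrow> 'b \<Rightarrow> 'a::field"
  assumes "finite B"
  shows "finite I \<Longrightarrow> card B < card I \<Longrightarrow> \<exists>l. (\<exists>i\<in>I. l i \<noteq> 0) \<and> (\<forall>b\<in>B. (\<Sum>i\<in>I. l i * c i b) = 0)"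
  using assms
proof (induction B arbitrary: I c rule: finite_induct)
  case empty
  then have "I \<noteq> {}" by auto
  then show ?case by (intro exI[of _ "\<lambda>_. 1"]) auto
next
  case (insert b B)
  show ?case
  proof (cases "\<forall>i\<in>I. c i b = 0")
    case True
    obtain l where "\<exists>i\<in>I. l i \<noteq> 0" "\<forall>b\<in>B. (\<Sum>i\<in>I. l i * c i b) = 0"
      using insert.IH[of I c, OF insert.prems(1)] insert.prems(2) insert.hyps by auto
    with True show ?thesis by (intro exI[of _ l]) auto
  next
    case False
    then obtain i0 where i0: "i0 \<in> I" "c i0 b \<noteq> 0" by blast
    let ?I = "I - {i0}"
    \<comment> \<open>Elimination of the coordinate \<open>b\<close> with pivot \<open>i0\<close>;
      the coefficient of \<open>i0\<close> in \<open>l'\<close> is then chosen so that coordinate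
      \<open>b\<close> cancels.\<close>
    define c' where "c' i x = c i x - c i b / c i0 b * c i0 x" for i x
    have "finite ?I" "card B < card ?I" using insert.prems insert.hyps i0 by simp_all
    from insert.IH[OF this, of c'] obtain l
      where l: "\<exists>i\<in>?I. l i \<noteq> 0" "\<forall>x\<in>B. (\<Sum>i\<in>?I. l i * c' i x) = 0" by blast
    define l' where "l' = l(i0 := - (\<Sum>i\<in>?I. l i * c i b) / c i0 b)"
    have split: "(\<Sum>i\<in>I. l' i * c i x) = - (\<Sum>i\<in>?I. l i * c i b) / c i0 b * c i0 x + (\<Sum>i\<in>?I. l i * c i x)" for x
    proof -
      have "(\<Sum>i\<in>I. l' i * c i x) = l' i0 * c i0 x + (\<Sum>i\<in>?I. l' i * c i x)"
        using insert i0 by (intro sum.remove) auto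
      also have "(\<Sum>i\<in>?I. l' i * c i x) = (\<Sum>i\<in>?I. l i * c i x)"
        by (rule sum.cong) (auto simp: l'_def)
      finally show ?thesis by (simp add: l'_def)
    qed
    have "(\<Sum>i\<in>I. l' i * c i b) = 0" unfolding split using i0 by simp
    moreover have "(\<Sum>i\<in>I. l' i * c i x) = 0" if "x \<in> B" for x
    proof -
      have "(\<Sum>i\<in>?I. l i * c i x) - (\<Sum>i\<in>?I. l i * c i b) / c i0 b * c i0 x = (\<Sum>i\<in>?I. l i * c' i x)"
        by (simp add: c'_def right_diff_distrib sum_subtractf sum_divide_distrib sum_distrib_right mult.assoc)
      then show ?thesis using l(2) that unfolding split by simp
    qed
    moreover have "\<exists>i\<in>I. l' i \<noteq> 0" using l(1) by (auto simp: l'_def)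
    ultimately show ?thesis by (intro exI[of _ l']) auto
  qed
qed

lemma mvar_power: "mvar v ^ n = mon (replicate_mset n v)"
  by (induction n) (auto simp: mon_add_mset)

text \<open>The first \<open>card B + 1\<close> powers of the variable are dependent modulo
  \<open>I\<close>. Factoring out the lowest power that occurs leaves a series with nonzero constant
  term, a unit in the ring where \<open>K\<close> is an ideal.\<close>

lemma finite_codim_power:
  fixes K :: "'v mfps set"
  assumes fc: "finite_codim (series_in V) I" and IK: "I \<subseteq> K" and K: "isideal K" and v: "v \<in> V"
  shows "\<exists>n. mvar v ^ n \<in> K"
proof -
  obtain B where B: "finite B" "\<forall>f\<in>series_in V. \<exists>c. f - (\<Sum>b\<in>B. mconst (c b) * b) \<in> I"
    using fc by (auto simp: finite_codim_def)
  have "mvar v ^ n \<in> series_in V" for n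
    using v by (auto simp: mvar_power series_in_def split: if_splits)
  then have "\<exists>c. \<forall>n. mvar v ^ n - (\<Sum>b\<in>B. mconst (c n b) * b) \<in> I"
    using B(2) by (intro choice) blast
  then obtain c where c: "\<And>n. mvar v ^ n - (\<Sum>b\<in>B. mconst (c n b) * b) \<in> I" by blast
  let ?N = "{..card B}"
  obtain l where l: "\<exists>i\<in>?N. l i \<noteq> 0" "\<forall>b\<in>B. (\<Sum>i\<in>?N. l i * c i b) = 0"
    using linear_dependence[OF B(1), of ?N c] by auto
  have "(\<Sum>i\<in>?N. mconst (l i) * (\<Sum>b\<in>B. mconst (c i b) * b)) = (\<Sum>b\<in>B. mconst (\<Sum>i\<in>?N. l i * c i b) * b)"
    unfolding mconst_sum mconst_mult sum_distrib_left sum_distrib_right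
    by (subst sum.swap) (simp add: mult.assoc)
  also have "\<dots> = 0" using l(2) by simp
  finally have zero: "(\<Sum>i\<in>?N. mconst (l i) * (\<Sum>b\<in>B. mconst (c i b) * b)) = 0" .
  have "(\<Sum>i\<in>?N. mconst (l i) * (mvar v ^ i - (\<Sum>b\<in>B. mconst (c i b) * b))) \<in> K"
    using c IK by (intro isideal_sum[OF K] isideal_mult[OF K]) blast
  then have inK: "(\<Sum>i\<in>?N. mconst (l i) * mvar v ^ i) \<in> K"
    by (simp only: right_diff_distrib sum_subtractf zero diff_zero)
  define i0 where "i0 = (LEAST i. l i \<noteq> 0)"
  have i0: "l i0 \<noteq> 0" "i0 \<in> ?N" "\<And>i. i < i0 \<Longrightarrow> l i = 0"
  proof -
    obtain i where i: "i \<in> ?N" "l i \<noteq> 0" using l(1) by blast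
    show "l i0 \<noteq> 0" unfolding i0_def by (rule LeastI[of _ i]) (rule i)
    have "i0 \<le> i" unfolding i0_def by (rule Least_le) (rule i)
    then show "i0 \<in> ?N" using i by simp
    show "\<And>i. i < i0 \<Longrightarrow> l i = 0" unfolding i0_def using not_less_Least by blast
  qed
  define r where "r = (\<Sum>i\<in>?N - {..<i0}. mconst (l i) * mvar v ^ (i - i0))"
  have "(\<Sum>i\<in>?N. mconst (l i) * mvar v ^ i) = (\<Sum>i\<in>?N - {..<i0}. mconst (l i) * mvar v ^ i)"
    by (rule sum.mono_neutral_right) (use i0(3) in auto)
  also have "\<dots> = mvar v ^ i0 * r"
    unfolding r_def sum_distrib_left
    by (rule sum.cong) (auto simp: mult_ac simp flip: power_add)
  finally have fact: "mvar v ^ i0 * r \<in> K" using inK by simp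
  have "mcoeff r {#} = (\<Sum>i\<in>?N - {..<i0}. if i = i0 then l i0 else 0)"
    unfolding r_def mcoeff_sum
    by (rule sum.cong) (auto simp: mvar_power)
  also have "\<dots> = l i0" using i0(2) by simp
  finally have "mcoeff r {#} \<noteq> 0" using i0(1) by simp
  then obtain g where "r * g = 1" by (rule mfps_unit)
  then have "mvar v ^ i0 = mvar v ^ i0 * r * g" by (simp add: mult.assoc)
  then have "mvar v ^ i0 \<in> K" using isideal_mult_right[OF K fact, of g] by simp
  then show ?thesis ..
qed

lemma isideal_radical:
  assumes J: "isideal J" shows "isideal {f. \<exists>n. f ^ n \<in> J}"
proof (rule isidealI)
  show "0 \<in> {f. \<exists>n. f ^ n \<in> J}" using isideal_0[OF J] by (auto intro!: exI[of _ 1])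
next
  fix a b assume "a \<in> {f. \<exists>n. f ^ n \<in> J}" "b \<in> {f. \<exists>n. f ^ n \<in> J}"
  then obtain n m where nm: "a ^ n \<in> J" "b ^ m \<in> J" by auto
  have "of_nat (n + m choose k) * a ^ k * b ^ (n + m - k) \<in> J" if "k \<le> n + m" for k
  proof (cases "n \<le> k")
    case True
    then have "a ^ k = a ^ n * a ^ (k - n)" by (simp flip: power_add)
    then show ?thesis
      using isideal_mult[OF J nm(1), of "of_nat (n + m choose k) * a ^ (k - n) * b ^ (n + m - k)"]
      by (simp add: mult_ac)
  next
    case False
    then have "n + m - k = m + (n - k)" by simp
    then have "b ^ (n + m - k) = b ^ m * b ^ (n - k)" by (simp only: power_add)
    then show ?thesis
      using isideal_mult[OF J nm(2), of "of_nat (n + m choose k) * a ^ k * b ^ (n - k)"]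
      by (simp add: mult_ac)
  qed
  then have "(a + b) ^ (n + m) \<in> J"
    unfolding binomial_ring by (intro isideal_sum[OF J]) auto
  then show "a + b \<in> {f. \<exists>n. f ^ n \<in> J}" by blast
next
  fix c a assume "a \<in> {f. \<exists>n. f ^ n \<in> J}"
  then obtain n where "a ^ n \<in> J" by auto
  then have "(c * a) ^ n \<in> J" unfolding power_mult_distrib by (rule isideal_mult[OF J])
  then show "c * a \<in> {f. \<exists>n. f ^ n \<in> J}" by blast
qed

lemma msubst_in_ideal:
  fixes g :: "'v::finite \<Rightarrow> 'u mfps"
  assumes g: "\<And>v. g v \<in> mpow 1" and f: "f \<in> mpow 1" and J: "isideal J" and gJ: "\<And>v. g v \<in> J"
  shows "msubst g f \<in> J"
proof -
  obtain G where "f = (\<Sum>v\<in>UNIV. mvar v * G v)" using mpow_Suc_decompose[of f 0] f by auto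
  then have "msubst g f = (\<Sum>v\<in>UNIV. g v * msubst g (G v))"
    by (simp add: msubst_sum msubst_mult[OF g] msubst_mvar[OF g])
  then show ?thesis using gJ by (auto intro!: isideal_sum[OF J] isideal_mult_right[OF J])
qed

lemma msubst_zero: "f \<in> mpow 1 \<Longrightarrow> msubst (\<lambda>_. 0) (f :: 'v::finite mfps) = 0"
  using msubst_in_ideal[of "\<lambda>_. 0" f "{0}"] by (auto simp: isideal_def)

definition chi_coeff :: "'N multiset \<Rightarrow> ('N + 'N) mfps \<Rightarrow> 'N mfps" where
  "chi_coeff \<alpha> f = Mfps (\<lambda>\<beta>. mcoeff f (image_mset Inl \<alpha> + image_mset Inr \<beta>))"

text \<open>Extracting the coefficient of a holomorphic monomial is linear over antiholomorphic
  series. Membership in an ideal with antiholomorphic generators therefore passes to each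
  coefficient.\<close>

lemma chi_coeff_mult_lift_anti:
  fixes h :: "'N::finite mfps"
  shows "chi_coeff \<alpha> (c * lift_anti h) = chi_coeff \<alpha> c * h"
proof (rule mfps_eqI)
  fix \<beta>
  let ?A = "image_mset Inl \<alpha> :: ('N + 'N) multiset" and ?R = "image_mset Inr :: _ \<Rightarrow> ('N + 'N) multiset"
  have injR: "inj ?R" by (rule multiset.inj_map) simp
  have "mcoeff (lift_anti h * c) (?A + ?R \<beta>)
      = (\<Sum>\<gamma>\<in>?R ` {\<gamma>. \<gamma> \<subseteq># \<beta>}. mcoeff (lift_anti h) \<gamma> * mcoeff c (?A + ?R \<beta> - \<gamma>))"
    unfolding mcoeff_mult
  proof (rule sum.mono_neutral_right)
    show "?R ` {\<gamma>. \<gamma> \<subseteq># \<beta>} \<subseteq> {\<gamma>. \<gamma> \<subseteq># ?A + ?R \<beta>}"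
      by (auto intro: image_mset_subseteq_mono subset_mset.add_increasing)
    show "\<forall>\<gamma>\<in>{\<gamma>. \<gamma> \<subseteq># ?A + ?R \<beta>} - ?R ` {\<gamma>. \<gamma> \<subseteq># \<beta>}. mcoeff (lift_anti h) \<gamma> * mcoeff c (?A + ?R \<beta> - \<gamma>) = 0"
    proof
      fix \<gamma> assume g: "\<gamma> \<in> {\<gamma>. \<gamma> \<subseteq># ?A + ?R \<beta>} - ?R ` {\<gamma>. \<gamma> \<subseteq># \<beta>}"
      have "mcoeff (lift_anti h) \<gamma> = 0"
      proof (rule ccontr)
        assume "mcoeff (lift_anti h) \<gamma> \<noteq> 0"
        then obtain \<delta> where d: "\<gamma> = ?R \<delta>"
          using msubst_rename_coeff(2)[of Inr h \<gamma>] by (auto simp: lift_anti_def)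
        have "\<delta> \<subseteq># \<beta>"
          unfolding subseteq_mset_def
        proof
          fix x
          have "count (?R \<delta>) (Inr x) \<le> count (?A + ?R \<beta>) (Inr x)"
            using g d by (auto simp: subseteq_mset_def)
          moreover have "count (?R \<epsilon>) (Inr x) = count \<epsilon> x" for \<epsilon>
            by (induction \<epsilon>) auto
          moreover have "count ?A (Inr x) = 0" by (auto simp: count_eq_zero_iff)
          ultimately show "count \<delta> x \<le> count \<beta> x" by simp
        qed
        with g d show False by auto
      qed
      then show "mcoeff (lift_anti h) \<gamma> * mcoeff c (?A + ?R \<beta> - \<gamma>) = 0" by simp
    qed
  qed simp
  also have "\<dots> = (\<Sum>\<gamma> | \<gamma> \<subseteq># \<beta>. mcoeff h \<gamma> * mcoeff c (?A + ?R (\<beta> - \<gamma>)))"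
  proof (subst sum.reindex)
    show "inj_on ?R {\<gamma>. \<gamma> \<subseteq># \<beta>}" using injR by (rule inj_on_subset) simp
    show "sum ((\<lambda>\<gamma>. mcoeff (lift_anti h) \<gamma> * mcoeff c (?A + ?R \<beta> - \<gamma>)) \<circ> ?R) {\<gamma>. \<gamma> \<subseteq># \<beta>}
       = (\<Sum>\<gamma> | \<gamma> \<subseteq># \<beta>. mcoeff h \<gamma> * mcoeff c (?A + ?R (\<beta> - \<gamma>)))"
    proof (rule sum.cong)
      fix \<gamma> assume "\<gamma> \<in> {\<gamma>. \<gamma> \<subseteq># \<beta>}"
      then have "?A + ?R \<beta> - ?R \<gamma> = ?A + ?R (\<beta> - \<gamma>)"
        by (auto simp: subset_mset.le_iff_add)
      moreover have "mcoeff (lift_anti h) (?R \<gamma>) = mcoeff h \<gamma>"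
        unfolding lift_anti_def by (rule msubst_rename_coeff(1)) simp
      ultimately show "((\<lambda>\<gamma>. mcoeff (lift_anti h) \<gamma> * mcoeff c (?A + ?R \<beta> - \<gamma>)) \<circ> ?R) \<gamma>
          = mcoeff h \<gamma> * mcoeff c (?A + ?R (\<beta> - \<gamma>))"
        by simp
    qed simp
  qed
  also have "\<dots> = mcoeff (h * chi_coeff \<alpha> c) \<beta>"
    by (simp add: mcoeff_mult chi_coeff_def)
  finally show "mcoeff (chi_coeff \<alpha> (c * lift_anti h)) \<beta> = mcoeff (chi_coeff \<alpha> c * h) \<beta>"
    by (simp add: chi_coeff_def mult.commute)
qed

lemma chi_coeff_sum: "chi_coeff \<alpha> (sum f A) = (\<Sum>x\<in>A. chi_coeff \<alpha> (f x))"
  by (rule mfps_eqI) (simp add: chi_coeff_def)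

lemma msubst_set_zero:
  fixes f :: "'v::finite mfps" and g :: "'v \<Rightarrow> 'u::finite mfps"
  assumes g: "\<And>v. g v \<in> mpow 1" and z: "\<And>v. v \<in> S \<Longrightarrow> g v = 0"
  shows "msubst g (set_zero S f) = msubst g f"
proof -
  have m: "(if v \<in> S then 0 else mvar v :: 'v mfps) \<in> mpow 1" for v by simp
  have "(\<lambda>v. msubst g (if v \<in> S then 0 else mvar v)) = g"
    using z by (auto simp: msubst_mvar[OF g])
  then show ?thesis unfolding set_zero_def by (simp add: msubst_msubst[OF g m])
qed

section \<open>Finiteness and nondegeneracy\<close>

context cr_map
begin

section \<open>The ideal generated by the components of \<open>H\<close> in normal
  coordinates\<close>

definition Jphi :: "'N mfps set" where
  "Jphi = ideal_gen UNIV {msubst \<phi> (Ah l) | l. l \<in> UNIV}"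

lemma isideal_Jphi: "isideal Jphi"
  by (simp add: Jphi_def isideal_ideal_gen)

lemma Ah_phi_in_Jphi: "msubst \<phi> (Ah l) \<in> Jphi"
  unfolding Jphi_def by (rule subsetD[OF ideal_gen_superset]) blast

text \<open>Restriction to \<open>\<xi> = 0\<close>, where the ideal of \<open>M\<close> becomes that of \<open>w = 0\<close>.\<close>
lemma w_in_Jphi: assumes j: "j \<in> D" shows "mvar j \<in> Jphi"
proof -
  \<comment> \<open>The point \<open>Z = \<phi>(z, w)\<close>, \<open>\<xi> = 0\<close>; in normal
    coordinates it is \<open>?z\<close>, where the normalization makes \<open>Q\<close>
    vanish.\<close>
  let ?k = "\<lambda>v. case v of Inl i \<Rightarrow> \<phi> i | Inr i \<Rightarrow> 0"
  let ?z = "\<lambda>v. case v of Inl i \<Rightarrow> mvar i | Inr i \<Rightarrow> (0 :: 'N mfps)"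
  have k: "?k v \<in> mpow 1" for v using phi by (cases v) auto
  have z: "?z v \<in> mpow 1" for v by (cases v) auto
  have cpsi: "mcnj (\<psi> i) \<in> mpow 1" for i using psi(1) by simp
  have "msubst ?k (polarized \<psi> v) = ?z v" for v
    by (cases v) (simp_all add: polarized_simps msubst_lift_hol[OF k] msubst_lift_anti[OF k] psi(2) msubst_zero[OF cpsi])
  then have ki: "msubst ?k (ipol f) = msubst ?z f" for f
    unfolding ipol_def by (simp add: msubst_msubst[OF k ipol_mpow1])
  have Qz: "msubst ?z (Q i) = 0" if "i \<in> D" for i
  proof -
    have "msubst ?z (set_zero (Inr ` (- D)) (Q i)) = msubst ?z (Q i)"
      by (rule msubst_set_zero[OF z]) auto
    then show ?thesis by (simp add: Q_chi_zero that msubst_mvar[OF z])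
  qed
  have ks: "msubst ?k (s i) = mvar i" if "i \<in> D" for i
    unfolding s_def ki by (simp add: msubst_diff msubst_mvar[OF z] Qz that)
  have kT: "msubst ?k (T i) \<in> Jphi" if i: "i \<in> D" for i
  proof -
    have cA: "mcnj (Ah l) \<in> mpow 1" for l using Ah_mpow by simp
    have "msubst ?k (HH u) \<in> Jphi" for u
      by (cases u) (auto simp: msubst_lift_hol[OF k] msubst_lift_anti[OF k] msubst_zero[OF cA]
          Ah_phi_in_Jphi isideal_0[OF isideal_Jphi])
    then show ?thesis
      unfolding T_def msubst_msubst[OF k HH_mpow]
      by (intro msubst_in_ideal[OF msubst_in_mpow[OF HH_mpow k] F'_mpow[OF i] isideal_Jphi])
  qed
  obtain b where "\<And>j. j \<in> D \<Longrightarrow> s j = (\<Sum>i\<in>D. b j i * T i)" using s_combination by blast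
  then have "mvar j = (\<Sum>i\<in>D. msubst ?k (b j i) * msubst ?k (T i))"
    using ks[OF j] by (simp add: j msubst_sum msubst_mult[OF k])
  then show ?thesis
    using kT by (auto intro!: isideal_sum[OF isideal_Jphi] isideal_mult[OF isideal_Jphi])
qed

text \<open>The conjugate mapping in normal coordinates at \<tau> = 0, a series in \<chi>
  alone.\<close>

definition hb :: "'N \<Rightarrow> 'N mfps" where
  "hb k = set_zero D (msubst (\<lambda>i. mcnj (\<phi> i)) (mcnj (Ah k)))"

definition Kb :: "('N + 'N) mfps set" where
  "Kb = ideal_gen UNIV {lift_anti (hb k) | k. k \<in> UNIV}"

lemma isideal_Kb: "isideal Kb"
  by (simp add: Kb_def isideal_ideal_gen)

lemma zero_D_mpow: "(if v \<in> S then 0 else mvar v) \<in> mpow 1"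
  by simp

text \<open>
  The equations of \<open>M'\<close> at \<open>(Z, \<xi>)\<close> and at \<open>(Z, 0)\<close> differ by an element of the ideal of the
  conjugate mapping. On the points \<open>Z = \<phi>(z, Q(z, \<chi>, 0))\<close>, \<open>\<xi> = \<phi>bar(\<chi>, 0)\<close> of \<open>M\<close> the former
  vanish, while the latter generate the same ideal as \<open>Q(z, \<chi>, 0)\<close>.
\<close>
lemma Q_in_Kb: assumes j: "j \<in> D" shows "set_zero (Inr ` D) (Q j) \<in> Kb"
proof -
  let ?Z = "set_zero (Inr ` D) :: ('N + 'N) mfps \<Rightarrow> _"
  let ?zv = "\<lambda>v. if v \<in> Inr ` D then 0 else (mvar v :: ('N + 'N) mfps)"
  have zv: "?zv v \<in> mpow 1" for v by simp
  have Zm: "?Z f \<in> mpow 1" if "f \<in> mpow 1" for f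
    unfolding set_zero_def by (rule msubst_in_mpow[OF that zv])
  \<comment> \<open>The points of the complexified \<open>M\<close> with \<tau> = 0.\<close>
  define k1 where "k1 v = ?Z (msubst graph (polarized \<phi> v))" for v
  have k1: "k1 v \<in> mpow 1" for v
    unfolding k1_def by (intro Zm msubst_in_mpow[OF pol_mpow1 graph_mpow])
  have k1_eq: "msubst k1 f = ?Z (Psi f)" for f
  proof -
    have g: "msubst graph (polarized \<phi> v) \<in> mpow 1" for v by (rule msubst_in_mpow[OF pol_mpow1 graph_mpow])
    show ?thesis
      unfolding Psi_def pol_def msubst_msubst[OF graph_mpow pol_mpow1] k1_def set_zero_def
      by (rule msubst_msubst[OF zv g, symmetric])
  qed
  \<comment> \<open>The same \<open>Z\<close> as in \<open>k1\<close>, but with the conjugate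
    variables set to 0; this point need not lie on the complexified \<open>M\<close>.\<close>
  define k2 :: "'N + 'N \<Rightarrow> _" where "k2 v = (case v of Inl i \<Rightarrow> k1 (Inl i) | Inr i \<Rightarrow> 0)" for v
  have k2: "k2 v \<in> mpow 1" for v using k1 by (cases v) (auto simp: k2_def)
  have cphi: "mcnj (\<phi> i) \<in> mpow 1" and cA: "mcnj (Ah i) \<in> mpow 1" and cpsi: "mcnj (\<psi> i) \<in> mpow 1" for i
    using phi Ah_mpow psi(1) by simp_all
  have k1_anti: "k1 (Inr i) = lift_anti (set_zero D (mcnj (\<phi> i)))" for i
  proof -
    have "msubst graph (lift_anti (mcnj (\<phi> i))) = lift_anti (mcnj (\<phi> i))"
      unfolding msubst_lift_anti[OF graph_mpow] by (simp add: graph_def lift_anti_def)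
    then have "k1 (Inr i) = msubst (\<lambda>i. if i \<in> D then 0 else anti i) (mcnj (\<phi> i))"
      by (simp add: k1_def polarized_simps set_zero_def msubst_lift_anti[OF zv] inj_image_mem_iff)
    also have "\<dots> = lift_anti (set_zero D (mcnj (\<phi> i)))"
      unfolding lift_anti_def set_zero_def
      by (subst msubst_msubst[OF anti_mpow zero_D_mpow])
        (rule arg_cong[of _ _ "\<lambda>g. msubst g _"], auto simp: msubst_mvar[OF anti_mpow])
    finally show ?thesis .
  qed
  have HHa: "msubst k1 (HH (Inr k)) = lift_anti (hb k)" for k
  proof -
    have m1: "set_zero D (mcnj (\<phi> i)) \<in> mpow 1" for i
      unfolding set_zero_def by (rule msubst_in_mpow[OF cphi zero_D_mpow])
    have "msubst k1 (HH (Inr k)) = msubst (\<lambda>i. lift_anti (set_zero D (mcnj (\<phi> i)))) (mcnj (Ah k))"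
      by (simp add: msubst_lift_anti[OF k1] k1_anti)
    also have "\<dots> = lift_anti (msubst (\<lambda>i. set_zero D (mcnj (\<phi> i))) (mcnj (Ah k)))"
      unfolding lift_anti_def by (rule msubst_msubst[OF anti_mpow m1, symmetric])
    also have "msubst (\<lambda>i. set_zero D (mcnj (\<phi> i))) (mcnj (Ah k)) = hb k"
      unfolding hb_def set_zero_def by (rule msubst_msubst[OF zero_D_mpow cphi, symmetric])
    finally show ?thesis .
  qed
  have k2T: "msubst k2 (T i) \<in> Kb" if i: "i \<in> D" for i
  proof -
    have "msubst k1 (HH u) - msubst k2 (HH u) \<in> Kb" for u
    proof (cases u)
      case (Inl k)
      then show ?thesis
        by (simp add: msubst_lift_hol[OF k1] msubst_lift_hol[OF k2] k2_def isideal_0[OF isideal_Kb])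
    next
      case (Inr k)
      have "msubst k2 (HH (Inr k)) = 0"
        by (simp add: msubst_lift_anti[OF k2]) (simp add: k2_def msubst_zero[OF cA])
      then have "msubst k1 (HH u) - msubst k2 (HH u) = lift_anti (hb k)" unfolding Inr HHa by simp
      then show ?thesis unfolding Kb_def using ideal_gen_superset[of "{lift_anti (hb k) | k. k \<in> UNIV}"] by auto
    qed
    then have "msubst k1 (T i) - msubst k2 (T i) \<in> Kb"
      unfolding T_def msubst_msubst[OF k1 HH_mpow] msubst_msubst[OF k2 HH_mpow]
      by (intro msubst_diff_in_ideal[OF msubst_in_mpow[OF HH_mpow k1] msubst_in_mpow[OF HH_mpow k2] isideal_Kb])
    moreover have "msubst k1 (T i) = 0"
      unfolding k1_eq using T_in_II[OF i] by (simp add: II_iff_Psi set_zero_def)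
    ultimately show ?thesis using isideal_uminus[OF isideal_Kb] by fastforce
  qed
  \<comment> \<open>The point \<open>k2\<close> in normal coordinates: \<chi> = \<tau> = 0 makes
    \<open>Q\<close> vanish, so the equation \<open>w - Q\<close> takes there the value
    \<open>w\<close>, which is \<open>Q(z, \<chi>, 0)\<close>.\<close>
  define k3 :: "'N + 'N \<Rightarrow> _" where "k3 v = (case v of Inl i \<Rightarrow> ?Z (graph (Inl i)) | Inr i \<Rightarrow> 0)" for v
  have k3: "k3 v \<in> mpow 1" for v using Zm graph_mpow by (cases v) (auto simp: k3_def)
  have k2i: "msubst k2 (ipol f) = msubst k3 f" for f
  proof -
    have "msubst k2 (polarized \<psi> v) = k3 v" for v
    proof (cases v)
      case (Inl i)
      have m: "?Z (graph (Inl m)) \<in> mpow 1" for m by (rule Zm[OF graph_mpow])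
      have "k1 (Inl l) = msubst (\<lambda>m. ?Z (graph (Inl m))) (\<phi> l)" for l
        unfolding k1_def polarized_simps msubst_lift_hol[OF graph_mpow] set_zero_def
        by (rule msubst_msubst[OF zv graph_mpow])
      then have "msubst k2 (polarized \<psi> v) = msubst (\<lambda>l. msubst (\<lambda>m. ?Z (graph (Inl m))) (\<phi> l)) (\<psi> i)"
        by (simp add: Inl polarized_simps msubst_lift_hol[OF k2] k2_def)
      also have "\<dots> = msubst (\<lambda>m. ?Z (graph (Inl m))) (msubst \<phi> (\<psi> i))"
        by (rule msubst_msubst[OF m phi, symmetric])
      finally show ?thesis by (simp add: psi(2) msubst_mvar[OF m] k3_def Inl)
    next
      case (Inr i)
      show ?thesis
        by (simp add: Inr polarized_simps msubst_lift_anti[OF k2]) (simp add: k2_def k3_def msubst_zero[OF cpsi])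
    qed
    then show ?thesis unfolding ipol_def by (simp add: msubst_msubst[OF k2 ipol_mpow1])
  qed
  have "msubst k3 (Q j) = 0"
  proof -
    have "msubst k3 (set_zero (Inr ` (- D)) (Q j)) = msubst k3 (Q j)"
      by (rule msubst_set_zero[OF k3]) (auto simp: k3_def)
    then show ?thesis by (simp add: Q_chi_zero j msubst_mvar[OF k3]) (simp add: k3_def)
  qed
  then have k2s: "msubst k2 (s j) = ?Z (Q j)"
    unfolding s_def k2i using j by (simp add: msubst_diff msubst_mvar[OF k3]) (simp add: k3_def graph_def)
  obtain b where "\<And>j. j \<in> D \<Longrightarrow> s j = (\<Sum>i\<in>D. b j i * T i)" using s_combination by blast
  then have "?Z (Q j) = (\<Sum>i\<in>D. msubst k2 (b j i) * msubst k2 (T i))"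
    using k2s by (simp add: j msubst_sum msubst_mult[OF k2])
  then show ?thesis
    using k2T by (auto intro!: isideal_sum[OF isideal_Kb] isideal_mult[OF isideal_Kb])
qed

text \<open>The generators \<open>lift_anti (hb k)\<close> do not contain z, so the membership of
  \<open>Q(z, \<chi>, 0)\<close> can be read off separately at each power of z.\<close>

lemma q_coeff_in_ideal:
  assumes j: "j \<in> D" shows "q_coeff D (Q j) \<alpha> \<in> ideal_gen UNIV {hb k | k. k \<in> UNIV}"
proof -
  obtain c where c: "set_zero (Inr ` D) (Q j) = (\<Sum>k\<in>UNIV. c k * lift_anti (hb k))"
    using Q_in_Kb[OF j] unfolding Kb_def ideal_gen_indexed[OF finite] by blast
  have "q_coeff D (Q j) \<alpha> = chi_coeff \<alpha> (set_zero (Inr ` D) (Q j))"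
    by (simp add: q_coeff_def chi_coeff_def)
  also have "\<dots> = (\<Sum>k\<in>UNIV. chi_coeff \<alpha> (c k) * hb k)"
    unfolding c chi_coeff_sum chi_coeff_mult_lift_anti ..
  finally show ?thesis unfolding ideal_gen_indexed[OF finite]
    by (intro exI[of _ "\<lambda>k. chi_coeff \<alpha> (c k)"])
qed

text \<open>Essential finiteness gives a power of each \<chi> variable in the ideal of the
  \<open>hb k\<close>. Conjugating, and using that w already lies in \<open>Jphi\<close>, gives a
  power of every normal coordinate in \<open>Jphi\<close>, which is then carried back to the
  coordinates \<open>Z\<close>.\<close>

lemma finite_map:
  assumes fc: "finite_codim (series_in (- D))
    (ideal_gen (series_in (- D)) {q_coeff D (Q j) \<alpha> | j \<alpha>. j \<in> D \<and> set_mset \<alpha> \<subseteq> - D})"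
  shows "finite_map_at H p p'"
proof -
  let ?K = "ideal_gen UNIV {hb k | k. k \<in> UNIV}"
  have sub: "ideal_gen (series_in (- D)) {q_coeff D (Q j) \<alpha> | j \<alpha>. j \<in> D \<and> set_mset \<alpha> \<subseteq> - D} \<subseteq> ?K"
    by (rule ideal_gen_least[OF isideal_ideal_gen]) (use q_coeff_in_ideal in blast)
  have D_in: "f - set_zero D f \<in> Jphi" for f
  proof -
    have "msubst mvar f - msubst (\<lambda>v. if v \<in> D then 0 else mvar v) f \<in> Jphi"
      by (rule msubst_diff_in_ideal[OF _ zero_D_mpow isideal_Jphi])
        (auto simp: w_in_Jphi isideal_0[OF isideal_Jphi])
    then show ?thesis by (simp add: msubst_mvar_id set_zero_def)
  qed
  have hb_in: "mcnj (hb k) \<in> Jphi" for k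
  proof -
    have z: "(\<lambda>v. mcnj (if v \<in> D then 0 else mvar v)) = (\<lambda>v. if v \<in> D then 0 else mvar v :: 'N mfps)" by auto
    have "mcnj (hb k) = set_zero D (msubst \<phi> (Ah k))"
      unfolding hb_def set_zero_def mcnj_msubst z by simp
    then show ?thesis
      using isideal_diff[OF isideal_Jphi Ah_phi_in_Jphi[of k] D_in[of "msubst \<phi> (Ah k)"]] by simp
  qed
  have "\<exists>n. mvar v ^ n \<in> Jphi" for v
  proof (cases "v \<in> D")
    case True then show ?thesis using w_in_Jphi by (intro exI[of _ 1]) simp
  next
    case False
    obtain n where "mvar v ^ n \<in> ?K"
      using finite_codim_power[OF fc sub isideal_ideal_gen, of v] False by auto
    then obtain c where c: "mvar v ^ n = (\<Sum>k\<in>UNIV. c k * hb k)"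
      unfolding ideal_gen_indexed[OF finite] by blast
    have "mvar v ^ n = mcnj (mvar v ^ n)" by (simp add: mcnj_power)
    also have "\<dots> = (\<Sum>k\<in>UNIV. mcnj (c k) * mcnj (hb k))" unfolding c by (simp add: mcnj_sum mcnj_mult)
    finally have "mvar v ^ n \<in> Jphi"
      using hb_in by (auto intro!: isideal_sum[OF isideal_Jphi] isideal_mult[OF isideal_Jphi])
    then show ?thesis ..
  qed
  note nil = this
  let ?J = "ideal_gen UNIV {Ah l | l. l \<in> UNIV}"
  have J: "isideal ?J" by (rule isideal_ideal_gen)
  have psiJ: "msubst \<psi> f \<in> ?J" if f: "f \<in> Jphi" for f
  proof -
    have "isideal {f. msubst \<psi> f \<in> ?J}"
      by (rule isideal_vimage[OF J additive_msubst]) (rule msubst_mult[OF psi(1)])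
    moreover have "msubst \<psi> (msubst \<phi> (Ah l)) = Ah l" for l
      by (simp add: msubst_msubst[OF psi(1) phi] psi(3) msubst_mvar_id)
    ultimately have "Jphi \<subseteq> {f. msubst \<psi> f \<in> ?J}"
      unfolding Jphi_def using ideal_gen_superset[of "{Ah l | l. l \<in> UNIV}"]
      by (intro ideal_gen_least) auto
    then show ?thesis using f by blast
  qed
  \<comment> \<open>Each \<open>Z\<close> coordinate is a series without constant term in the normal
    coordinates, which have powers in the ideal; the radical absorbs this mixing of
    variables.\<close>
  let ?R = "{f. \<exists>n. f ^ n \<in> ?J}"
  have R: "isideal ?R" by (rule isideal_radical[OF J])
  have psiR: "\<psi> v \<in> ?R" for v
  proof -
    obtain n where "mvar v ^ n \<in> Jphi" using nil[of v] ..
    from psiJ[OF this] have "\<psi> v ^ n \<in> ?J" by (simp add: msubst_power[OF psi(1)] msubst_mvar[OF psi(1)])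
    then show ?thesis by blast
  qed
  have "mvar k \<in> ?R" for k
    using msubst_in_ideal[of \<psi>, OF psi(1) phi[of k] R psiR] by (simp only: psi(3))
  then have "\<exists>n. \<forall>k. mvar k ^ n k \<in> ?J" by (intro choice) blast
  then obtain n where n: "\<And>k. mvar k ^ n k \<in> ?J" by blast
  \<comment> \<open>\<open>common_zero_isolated\<close> takes one exponent for all variables; the
    sum of the individual ones is large enough.\<close>
  have "mvar k ^ (\<Sum>k\<in>UNIV. n k) \<in> ?J" for k
  proof -
    have "n k \<le> (\<Sum>k\<in>UNIV. n k)" by (rule member_le_sum) auto
    then have "mvar k ^ (\<Sum>k\<in>UNIV. n k) = mvar k ^ ((\<Sum>k\<in>UNIV. n k) - n k) * mvar k ^ n k"
      by (simp flip: power_add)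
    then show ?thesis using isideal_mult[OF J n[of k]] by simp
  qed
  from common_zero_isolated[OF has_exp_Ah this]
  have "\<forall>\<^sub>F Z in nhds p. (\<forall>l. H Z $ l - p' $ l = 0) \<longrightarrow> Z = p" .
  then show ?thesis
    unfolding finite_map_at_def by eventually_elim (auto simp: Hp)
qed

section \<open>Finite nondegeneracy and the invertibility of the derivative\<close>

definition hol_linear :: "(('N + 'N) mfps \<Rightarrow> ('N + 'N) mfps) \<Rightarrow> bool" where
  "hol_linear X \<longleftrightarrow> (\<forall>f g. X (f + g) = X f + X g) \<and> (\<forall>c g. X (c * lift_hol g) = X c * lift_hol g) \<and>
    (\<forall>f\<in>II. X f \<in> II)"

lemma hol_linear_funpow: "hol_linear X \<Longrightarrow> hol_linear (X ^^ n)"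
  by (induction n) (auto simp: hol_linear_def)

lemma hol_linear_foldr: "(\<And>i. i \<in> set xs \<Longrightarrow> hol_linear (X i)) \<Longrightarrow> hol_linear (foldr X xs)"
  by (induction xs) (auto simp: hol_linear_def)

text \<open>A (0,1) field kills holomorphic series, so the product rule makes it linear over them.
  Unlike the product rule, this linearity survives composition and so holds for all words in such
  fields.\<close>

lemma hol_linear_hat:
  assumes L: "CR_field d M p L" shows "hol_linear (hat p (\<lambda>Z. (0, L Z)))"
proof -
  have taylor0: "taylor p (\<lambda>_. 0) = 0"
    by (rule taylor_unique[OF smooth_at_const]) (rule has_exp_const[of 0, simplified])
  have "hat p (\<lambda>Z. (0, L Z)) (lift_hol g) = 0" for g
    by (simp add: hat_def sum_over_sum_type pder_lift_other xc_def[abs_def] taylor0)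
  moreover have "hat p (\<lambda>Z. (0, L Z)) \<in> LL" using L by (auto simp: LL_def)
  ultimately show ?thesis
    using LL_preserves_II by (simp add: hol_linear_def derivation_add[OF derivation_hat] derivation_mult[OF derivation_hat])
qed

lemma apply_CR_smooth:
  assumes "CR_field d M p L" "smooth_at p f"
  shows "smooth_at p (apply_CR L f)" "taylor p (apply_CR L f) = hat p (\<lambda>Z. (0, L Z)) (taylor p f)"
proof -
  have "apply_CR L f = (\<lambda>Z. vact (0, L Z) f Z)" by (rule ext) (simp add: apply_CR_def)
  then show "smooth_at p (apply_CR L f)" "taylor p (apply_CR L f) = hat p (\<lambda>Z. (0, L Z)) (taylor p f)"
    using vact_smooth[OF CR_lie_algebra_smooth[OF CR_lie_algebra.CR[OF assms(1)]] assms(2)] by simp_all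
qed

lemma CR_power_smooth:
  assumes L: "\<And>i. i \<in> set xs \<Longrightarrow> CR_field d M p (L i)" and f: "smooth_at p f"
  shows "smooth_at p (foldr (\<lambda>i. apply_CR (L i) ^^ \<alpha> i) xs f) \<and>
    taylor p (foldr (\<lambda>i. apply_CR (L i) ^^ \<alpha> i) xs f) = foldr (\<lambda>i. hat p (\<lambda>Z. (0, L i Z)) ^^ \<alpha> i) xs (taylor p f)"
  using L
proof (induction xs)
  case (Cons i xs)
  let ?g = "foldr (\<lambda>i. apply_CR (L i) ^^ \<alpha> i) xs f"
  have IH: "smooth_at p ?g" "taylor p ?g = foldr (\<lambda>i. hat p (\<lambda>Z. (0, L i Z)) ^^ \<alpha> i) xs (taylor p f)"
    using Cons by auto
  have Li: "CR_field d M p (L i)" using Cons by simp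
  have "smooth_at p ((apply_CR (L i) ^^ n) ?g) \<and> taylor p ((apply_CR (L i) ^^ n) ?g) = (hat p (\<lambda>Z. (0, L i Z)) ^^ n) (taylor p ?g)" for n
    by (induction n) (auto simp: IH(1) apply_CR_smooth[OF Li])
  then show ?case by (simp add: IH(2))
qed (simp add: f)

text \<open>If \<open>Jac H p\<close> vanished, a nonzero \<open>x\<close> in the kernel of the
  derivative would be annihilated by each of its rows, hence by all the vectors in question, which
  could not span.\<close>

lemma nondegenerate_imp_Jac:
  assumes fn: "finitely_nondegenerate d M p" shows "Jac H p \<noteq> 0"
proof
  assume J0: "Jac H p = 0"
  obtain V \<rho>2 L where ld2: "local_defining d M p V \<rho>2" and L: "CR_basis d M p L"
    and span: "vec.span {(\<chi> k. CR_power (CARD('N) - d) L \<alpha> (dZ k (cplx (\<rho>2 j))) p) | j \<alpha>. j < d} = UNIV"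
    using fn by (auto simp: finitely_nondegenerate_def)
  define DH :: "complex^'N^'N" where "DH = (\<chi> m k. mcoeff (pder k (Ah m)) {#})"
  have "Jac H p = mcoeff J {#}"
    using has_exp_value[OF has_exp_Jac] by (simp add: lift_hol_def)
  also have "\<dots> = det DH"
    unfolding J_def DH_def by (subst ring_hom_det[of "\<lambda>f. mcoeff f {#}"]) auto
  finally have "det DH = 0" using J0 by simp
  then obtain x where x: "x \<noteq> 0" "DH *v x = 0" by (rule det_zero_kernel)
  have rowx: "(\<Sum>k\<in>UNIV. DH $ m $ k * x $ k) = 0" for m
    using arg_cong[OF x(2), of "\<lambda>v. v $ m"] by (simp add: matrix_vector_mult_def)
  let ?S = "{v. (\<Sum>k\<in>UNIV. v $ k * x $ k) = 0}"
  have "vec.subspace ?S"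
    by (auto simp: vec.subspace_def distrib_right sum.distrib mult.assoc simp flip: sum_distrib_left)
  moreover have "(\<chi> k. CR_power (CARD('N) - d) L \<alpha> (dZ k (cplx (\<rho>2 j))) p) \<in> ?S" if j: "j < d" for j \<alpha>
  proof -
    let ?n = "CARD('N) - d"
    note V = local_definingD(1,2)[OF ld2]
    have sm: "smooth_on V (cplx (\<rho>2 j))" by (rule smooth_on_cplx[OF V(1) local_definingD(3)[OF ld2 j]])
    let ?r = "taylor p (cplx (\<rho>2 j))"
    \<comment> \<open>Nondegeneracy may be witnessed by a defining function other than \<rho>; its
      Taylor series still lies in \<open>II\<close>, hence is a combination of the
      \<open>T l\<close>.\<close>
    have "?r \<in> II"
    proof (rule expansion_in_II[OF has_exp_taylor[OF V sm]])
      show "\<forall>\<^sub>F Z in nhds p. Z \<in> M \<longrightarrow> cplx (\<rho>2 j) Z = 0"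
        using eventually_nhds_in_open[OF V]
        by eventually_elim (use local_definingD(4)[OF ld2] j in auto)
    qed
    then obtain c where c: "?r = (\<Sum>i\<in>D. c i * s i)" unfolding II_iff_s by blast
    obtain b where b: "\<And>j. j \<in> D \<Longrightarrow> s j = (\<Sum>i\<in>D. b j i * T i)" using s_combination by blast
    define c' where "c' l = (\<Sum>i\<in>D. c i * b i l)" for l
    have "?r = (\<Sum>l\<in>D. c' l * T l)"
      unfolding c c'_def sum_distrib_right by (simp add: b sum_distrib_left mult.assoc) (rule sum.swap)
    then have pr: "pder (Inl k) ?r = (\<Sum>l\<in>D. pder (Inl k) (c' l) * T l) + (\<Sum>l\<in>D. c' l * pder (Inl k) (T l))" for k
      by (simp add: pder_sum pder_mult sum.distrib)
    \<comment> \<open>Modulo \<open>II\<close> the gradient of \<open>\<rho>2 j\<close> is the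
      combination with coefficients \<open>C m\<close> of the rows of the derivative of
      \<open>H\<close>. These rows are holomorphic, so a word in the CR fields acts on
      \<open>C m\<close> alone.\<close>
    define C where "C m = (\<Sum>l\<in>D. c' l * msubst HH (pder (Inl m) (F' l)))" for m
    have "(\<Sum>l\<in>D. c' l * pder (Inl k) (T l)) = (\<Sum>m\<in>UNIV. C m * lift_hol (pder k (Ah m)))" for k
      unfolding pder_T(1) C_def sum_distrib_left sum_distrib_right by (subst sum.swap) (simp add: mult.assoc)
    then have pr': "pder (Inl k) ?r = (\<Sum>l\<in>D. pder (Inl k) (c' l) * T l) + (\<Sum>m\<in>UNIV. C m * lift_hol (pder k (Ah m)))" for k
      unfolding pr by simp
    have rem: "(\<Sum>l\<in>D. pder (Inl k) (c' l) * T l) \<in> II" for k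
      by (intro isideal_sum[OF isideal_II] isideal_mult[OF isideal_II] T_in_II)
    have Li: "CR_field d M p (L i)" if "i \<in> set [0..<?n]" for i using L that by (auto simp: CR_basis_def)
    define X where "X = foldr (\<lambda>i. hat p (\<lambda>Z. (0, L i Z)) ^^ \<alpha> i) [0..<?n]"
    have X: "hol_linear X"
      unfolding X_def by (rule hol_linear_foldr) (rule hol_linear_funpow[OF hol_linear_hat[OF Li]])
    then have "Modules.additive X" by (intro additiveI) (simp add: hol_linear_def)
    then interpret X: Modules.additive X .
    have "CR_power ?n L \<alpha> (dZ k (cplx (\<rho>2 j))) p = (\<Sum>m\<in>UNIV. mcoeff (X (C m)) {#} * DH $ m $ k)" for k
    proof -
      have smk: "smooth_at p (dZ k (cplx (\<rho>2 j)))"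
        using smooth_at_wirtinger[OF smooth_atI[OF V sm], of "Inl k"] by simp
      have tk: "taylor p (dZ k (cplx (\<rho>2 j))) = pder (Inl k) ?r"
        using smooth_at_taylor_wirtinger[OF smooth_atI[OF V sm], of "Inl k"] by simp
      have "CR_power ?n L \<alpha> (dZ k (cplx (\<rho>2 j))) p = mcoeff (taylor p (CR_power ?n L \<alpha> (dZ k (cplx (\<rho>2 j))))) {#}"
        by simp
      also have "taylor p (CR_power ?n L \<alpha> (dZ k (cplx (\<rho>2 j)))) = X (pder (Inl k) ?r)"
        unfolding CR_power_def X_def tk[symmetric] using CR_power_smooth[of "[0..<?n]" L, OF Li smk] by blast
      also have "\<dots> = X (\<Sum>l\<in>D. pder (Inl k) (c' l) * T l) + (\<Sum>m\<in>UNIV. X (C m) * lift_hol (pder k (Ah m)))"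
        unfolding pr' X.add X.sum using X by (simp add: hol_linear_def X.sum)
      finally have "CR_power ?n L \<alpha> (dZ k (cplx (\<rho>2 j))) p = mcoeff (X (\<Sum>l\<in>D. pder (Inl k) (c' l) * T l)) {#}
          + (\<Sum>m\<in>UNIV. mcoeff (X (C m)) {#} * DH $ m $ k)"
        by (simp add: DH_def lift_hol_def)
      moreover have "X (\<Sum>l\<in>D. pder (Inl k) (c' l) * T l) \<in> mpow 1"
        using X rem[of k] II_mpow unfolding hol_linear_def by blast
      ultimately show ?thesis by (simp add: mpow_1_iff)
    qed
    then have "(\<Sum>k\<in>UNIV. (\<chi> k. CR_power ?n L \<alpha> (dZ k (cplx (\<rho>2 j))) p) $ k * x $ k)
       = (\<Sum>m\<in>UNIV. mcoeff (X (C m)) {#} * (\<Sum>k\<in>UNIV. DH $ m $ k * x $ k))"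
      by (simp add: sum_distrib_left sum_distrib_right mult.assoc) (rule sum.swap)
    then show ?thesis by (simp add: rowx)
  qed
  then have "{(\<chi> k. CR_power (CARD('N) - d) L \<alpha> (dZ k (cplx (\<rho>2 j))) p) | j \<alpha>. j < d} \<subseteq> ?S" by blast
  ultimately have "vec.span {(\<chi> k. CR_power (CARD('N) - d) L \<alpha> (dZ k (cplx (\<rho>2 j))) p) | j \<alpha>. j < d} \<subseteq> ?S"
    by (rule vec.span_minimal[rotated])
  then have all: "v \<in> ?S" for v using span by blast
  have "x $ k = 0" for k
  proof -
    have "(\<Sum>l\<in>UNIV. axis k 1 $ l * x $ l) = 0" using all[of "axis k 1"] by blast
    then show ?thesis by (simp add: axis_def if_distrib[of "\<lambda>x. x * _"] cong: if_cong)
  qed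
  then show False using x(1) by (simp add: vec_eq_iff)
qed

end

theorem theorem1p4:
  fixes M M' :: "(complex^'N::finite) set"
    and p p' :: "complex^'N"
    and H :: "complex^'N \<Rightarrow> complex^'N"
    and d :: nat
  assumes "generic_submanifold d M" and "p \<in> M"
    and "generic_submanifold d M'" and "p' \<in> M'"
    and "holomorphic_germ H p p'"
    and "\<forall>\<^sub>F Z in nhds p. Z \<in> M \<longrightarrow> H Z \<in> M'"
    and "\<not> (\<forall>\<^sub>F Z in nhds p. Jac H Z = 0)"
    and "finite_type d M p"
    and "essentially_finite d M p"
  shows "finite_map_at H p p' \<and>
    (finitely_nondegenerate d M p \<longrightarrow> local_biholomorphism H p)"
proof -
  obtain U \<rho> \<phi> D Q where ef: "local_defining d M p U \<rho>"
    "normal_coordinates d (\<lambda>j. taylor p (cplx (\<rho> j))) \<phi> D Q"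
    "finite_codim (series_in (- D)) (ideal_gen (series_in (- D))
             {q_coeff D (Q j) \<alpha> | j \<alpha>. j \<in> D \<and> set_mset \<alpha> \<subseteq> - D})"
    using assms(9) by (auto simp: essentially_finite_def)
  obtain U' \<rho>' where ld': "local_defining d M' p' U' \<rho>'"
    using assms(3,4) by (auto simp: generic_submanifold_def)
  obtain W where W: "open W" "p \<in> W" "holomorphic_map_on W H" and Hp: "H p = p'"
    using assms(5) by (auto simp: holomorphic_germ_def)
  interpret cr_map d p \<rho> \<phi> D Q M U M' p' U' \<rho>' H W
    by unfold_locales (use ef assms ld' W Hp in auto)
  show ?thesis
    using finite_map[OF ef(3)] nondegenerate_imp_Jac local_biholomorphismI[OF W] by blast
qed

end
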